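(* Let $R$ be a commutative noetherian ring. The following assertions are equivalent. (1) $R_{\mathfrak{p}}$ is Gorenstein for any $\mathfrak{p}\in\operatorname{Spec} R$. (2) For any $\mathfrak{p}\in\operatorname{Spec} R$, $\operatorname{Tor}_i^R(k(\mathfrak{p}),E(R/\mathfrak{p}))=0$ for any $i$ sufficiently large. (3) For any $\mathfrak{m}\in\operatorname{Max} R$, $\operatorname{Tor}_i^R(k(\mathfrak{m}),E(R/\mathfrak{m}))=0$ for any $i$ sufficiently large. (4) For any $\mathfrak{p}\in\operatorname{Spec} R$, $\operatorname{Ext}^i_R(E(R/\mathfrak{p}),k(\mathfrak{p}))=0$ for any $i$ sufficiently large. (5) For any $\mathfrak{m}\in\operatorname{Max} R$, $\operatorname{Ext}^i_R(E(R/\mathfrak{m}),k(\mathfrak{m}))=0$ for any $i$ sufficiently large. Here "for any $i$ sufficiently large" means for all $i>n$ for some integer $n$ which may depend on the prime ideal under consideration.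
   Context: $\operatorname{Max} R$ is the set of maximal ideals of $R$; $k(\mathfrak{p}):=R_{\mathfrak{p}}/\mathfrak{p}R_{\mathfrak{p}}$ is the residue field at $\mathfrak{p}\in\operatorname{Spec} R$; $E(M)$ denotes the injective hull of an $R$-module $M$. *)

theory Defs
  imports "HOL-Algebra.Ring_Divisibility" "HOL-Algebra.Module" "HOL-Library.FSet"
begin

text \<open>
  Modules are the records of \<open>HOL-Algebra.Module\<close>. Such a record also has the ring fields
  \<open>mult\<close> and \<open>one\<close>; the locale \<open>module\<close> ignores them, and they are left
  \<open>undefined\<close> below.
\<close>

section \<open>Linear algebra over a commutative ring\<close>

definition mod_hom ::
    "('r, 'c) ring_scheme \<Rightarrow> ('r, 'm, 'd) module_scheme \<Rightarrow> ('r, 'n, 'e) module_scheme \<Rightarrow> ('m \<Rightarrow> 'n) set"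
  where "mod_hom R M N =
    {f \<in> carrier M \<rightarrow> carrier N.
       (\<forall>x\<in>carrier M. \<forall>y\<in>carrier M. f (x \<oplus>\<^bsub>M\<^esub> y) = f x \<oplus>\<^bsub>N\<^esub> f y) \<and>
       (\<forall>r\<in>carrier R. \<forall>x\<in>carrier M. f (r \<odot>\<^bsub>M\<^esub> x) = r \<odot>\<^bsub>N\<^esub> f x)}"

definition is_zero_module :: "('r, 'm, 'd) module_scheme \<Rightarrow> bool"
  where "is_zero_module M \<longleftrightarrow> carrier M = {\<zero>\<^bsub>M\<^esub>}"

text \<open>\<open>restrict_scalars S \<phi>\<close> is the ring \<open>S\<close> viewed as a module along a ring homomorphism
  \<open>\<phi>\<close> into \<open>S\<close>.\<close>

definition restrict_scalars :: "('s, 'c) ring_scheme \<Rightarrow> ('r \<Rightarrow> 's) \<Rightarrow> ('r, 's) module"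
  where "restrict_scalars S \<phi> =
    \<lparr>carrier = carrier S, monoid.mult = monoid.mult S, one = \<one>\<^bsub>S\<^esub>,
     zero = \<zero>\<^bsub>S\<^esub>, add = add S,
     smult = (\<lambda>r x. \<phi> r \<otimes>\<^bsub>S\<^esub> x)\<rparr>"

definition regular_module :: "('r, 'c) ring_scheme \<Rightarrow> ('r, 'r) module"
  where "regular_module R = restrict_scalars R (\<lambda>r. r)"

definition quotient_module :: "('r, 'm, 'd) module_scheme \<Rightarrow> 'm set \<Rightarrow> ('r, 'm set) module"
  where "quotient_module M H =
    \<lparr>carrier = a_rcosets\<^bsub>M\<^esub> H, monoid.mult = undefined, one = undefined, zero = H, add = set_add M,
     smult = (\<lambda>r X. \<Union>x\<in>X. H +>\<^bsub>M\<^esub> (r \<odot>\<^bsub>M\<^esub> x))\<rparr>"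

text \<open>The module \<open>ker g / im f\<close> for \<open>f : A \<rightarrow> B\<close> and \<open>g : B \<rightarrow> C\<close>.\<close>

definition homology ::
    "('r, 'm, 'd) module_scheme \<Rightarrow> ('m \<Rightarrow> 'n) \<Rightarrow> ('r, 'n, 'e) module_scheme \<Rightarrow> ('n \<Rightarrow> 'k) \<Rightarrow>
     ('r, 'k, 'f) module_scheme \<Rightarrow> ('r, 'n set) module"
  where "homology A f B g C =
    quotient_module (B\<lparr>carrier := a_kernel B C g\<rparr>) (f ` carrier A)"

definition hom_module ::
    "('r, 'c) ring_scheme \<Rightarrow> ('r, 'm, 'd) module_scheme \<Rightarrow> ('r, 'n, 'e) module_scheme \<Rightarrow> ('r, 'm \<Rightarrow> 'n) module"
  where "hom_module R M N =
    \<lparr>carrier = mod_hom R M N \<inter> extensional (carrier M), monoid.mult = undefined, one = undefined,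
     zero = (\<lambda>x\<in>carrier M. \<zero>\<^bsub>N\<^esub>),
     add = (\<lambda>f g. \<lambda>x\<in>carrier M. f x \<oplus>\<^bsub>N\<^esub> g x),
     smult = (\<lambda>r f. \<lambda>x\<in>carrier M. r \<odot>\<^bsub>N\<^esub> f x)\<rparr>"

text \<open>The free module on the set \<open>B\<close>, consisting of finitely supported functions.\<close>

definition free_module :: "('r, 'c) ring_scheme \<Rightarrow> 'x set \<Rightarrow> ('r, 'x \<Rightarrow> 'r) module"
  where "free_module R B =
    \<lparr>carrier = {f. range f \<subseteq> carrier R \<and> {b. f b \<noteq> \<zero>\<^bsub>R\<^esub>} \<subseteq> B \<and> finite {b. f b \<noteq> \<zero>\<^bsub>R\<^esub>}},
     monoid.mult = undefined, one = undefined,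
     zero = (\<lambda>b. \<zero>\<^bsub>R\<^esub>),
     add = (\<lambda>f g b. f b \<oplus>\<^bsub>R\<^esub> g b),
     smult = (\<lambda>r f b. r \<otimes>\<^bsub>R\<^esub> f b)\<rparr>"

definition basis_elt :: "('r, 'c) ring_scheme \<Rightarrow> 'x \<Rightarrow> 'x \<Rightarrow> 'r"
  where "basis_elt R b = (\<lambda>c. if c = b then \<one>\<^bsub>R\<^esub> else \<zero>\<^bsub>R\<^esub>)"

text \<open>The linear map from a free module to \<open>N\<close> taking each basis element \<open>b\<close> to \<open>\<phi> b\<close>.\<close>

definition lin_ext ::
    "('r, 'c) ring_scheme \<Rightarrow> ('r, 'n, 'e) module_scheme \<Rightarrow> ('x \<Rightarrow> 'n) \<Rightarrow> ('x \<Rightarrow> 'r) \<Rightarrow> 'n"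
  where "lin_ext R N \<phi> f = (\<Oplus>\<^bsub>N\<^esub>b\<in>{b. f b \<noteq> \<zero>\<^bsub>R\<^esub>}. f b \<odot>\<^bsub>N\<^esub> \<phi> b)"

section \<open>Tensor products\<close>

definition tensor_gens ::
    "('r, 'c) ring_scheme \<Rightarrow> ('r, 'm, 'd) module_scheme \<Rightarrow> ('r, 'n, 'e) module_scheme \<Rightarrow> ('r, 'm \<times> 'n \<Rightarrow> 'r) module"
  where "tensor_gens R M N = free_module R (carrier M \<times> carrier N)"

definition tensor_rels ::
    "('r, 'c) ring_scheme \<Rightarrow> ('r, 'm, 'd) module_scheme \<Rightarrow> ('r, 'n, 'e) module_scheme \<Rightarrow> ('m \<times> 'n \<Rightarrow> 'r) set"
  where "tensor_rels R M N =
    (let F = tensor_gens R M N; d = basis_elt R in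
      {d (x \<oplus>\<^bsub>M\<^esub> x', y) \<ominus>\<^bsub>F\<^esub> (d (x, y) \<oplus>\<^bsub>F\<^esub> d (x', y)) | x x' y.
         x \<in> carrier M \<and> x' \<in> carrier M \<and> y \<in> carrier N} \<union>
      {d (x, y \<oplus>\<^bsub>N\<^esub> y') \<ominus>\<^bsub>F\<^esub> (d (x, y) \<oplus>\<^bsub>F\<^esub> d (x, y')) | x y y'.
         x \<in> carrier M \<and> y \<in> carrier N \<and> y' \<in> carrier N} \<union>
      {d (r \<odot>\<^bsub>M\<^esub> x, y) \<ominus>\<^bsub>F\<^esub> (r \<odot>\<^bsub>F\<^esub> d (x, y)) | r x y.
         r \<in> carrier R \<and> x \<in> carrier M \<and> y \<in> carrier N} \<union>
      {d (x, r \<odot>\<^bsub>N\<^esub> y) \<ominus>\<^bsub>F\<^esub> (r \<odot>\<^bsub>F\<^esub> d (x, y)) | r x y.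
         r \<in> carrier R \<and> x \<in> carrier M \<and> y \<in> carrier N})"

definition tensor_kernel ::
    "('r, 'c) ring_scheme \<Rightarrow> ('r, 'm, 'd) module_scheme \<Rightarrow> ('r, 'n, 'e) module_scheme \<Rightarrow> ('m \<times> 'n \<Rightarrow> 'r) set"
  where "tensor_kernel R M N =
    \<Inter>{H. submodule H R (tensor_gens R M N) \<and> tensor_rels R M N \<subseteq> H}"

definition tensor ::
    "('r, 'c) ring_scheme \<Rightarrow> ('r, 'm, 'd) module_scheme \<Rightarrow> ('r, 'n, 'e) module_scheme \<Rightarrow>
     ('r, ('m \<times> 'n \<Rightarrow> 'r) set) module"
  where "tensor R M N = quotient_module (tensor_gens R M N) (tensor_kernel R M N)"

text \<open>The map \<open>f \<otimes> N : M \<otimes> N \<rightarrow> M' \<otimes> N\<close> induced by \<open>f : M \<rightarrow> M'\<close>.\<close>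

definition tensor_map ::
    "('r, 'c) ring_scheme \<Rightarrow> ('r, 'm, 'd) module_scheme \<Rightarrow> ('r, 'n, 'e) module_scheme \<Rightarrow>
     ('l \<Rightarrow> 'm) \<Rightarrow> ('l \<times> 'n \<Rightarrow> 'r) set \<Rightarrow> ('m \<times> 'n \<Rightarrow> 'r) set"
  where "tensor_map R M' N f X =
    (\<Union>h\<in>X. tensor_kernel R M' N +>\<^bsub>tensor_gens R M' N\<^esub>
        lin_ext R (tensor_gens R M' N) (\<lambda>(x, y). basis_elt R (f x, y)) h)"

section \<open>Free resolutions, Tor and Ext\<close>

text \<open>
  The standard free resolution \<open>\<dots> \<rightarrow> F\<^sub>1 \<rightarrow> F\<^sub>0 \<rightarrow> M \<rightarrow> 0\<close>: \<open>F\<^sub>0\<close> is free on the set of elements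
  of \<open>M\<close>, and \<open>F\<^sub>n\<^sub>+\<^sub>1\<close> is free on the set of elements of the kernel of the map out of \<open>F\<^sub>n\<close>.
  To keep all bases in one type, an element of \<open>F\<^sub>n\<close> that is used as a basis element
  of \<open>F\<^sub>n\<^sub>+\<^sub>1\<close> is stored as the finite graph of its restriction to its support.
\<close>

datatype ('r, 'm) cell = Elt 'm | Syz "(('r, 'm) cell \<times> 'r) fset"

definition to_cell :: "('r, 'c) ring_scheme \<Rightarrow> (('r, 'm) cell \<Rightarrow> 'r) \<Rightarrow> ('r, 'm) cell"
  where "to_cell R f = Syz (Abs_fset ((\<lambda>b. (b, f b)) ` {b. f b \<noteq> \<zero>\<^bsub>R\<^esub>}))"

fun of_cell :: "('r, 'c) ring_scheme \<Rightarrow> ('r, 'm) cell \<Rightarrow> ('r, 'm) cell \<Rightarrow> 'r"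
  where
    "of_cell R (Syz Z) = (\<lambda>b. if b \<in> fst ` fset Z then (THE r. (b, r) \<in> fset Z) else \<zero>\<^bsub>R\<^esub>)"
  | "of_cell R (Elt x) = (\<lambda>b. \<zero>\<^bsub>R\<^esub>)"

fun elt_of_cell :: "('r, 'm) cell \<Rightarrow> 'm"
  where
    "elt_of_cell (Elt x) = x"
  | "elt_of_cell (Syz Z) = undefined"

fun res_basis :: "('r, 'c) ring_scheme \<Rightarrow> ('r, 'm, 'd) module_scheme \<Rightarrow> nat \<Rightarrow> ('r, 'm) cell set"
  where
    "res_basis R M 0 = Elt ` carrier M"
  | "res_basis R M (Suc 0) =
       to_cell R ` a_kernel (free_module R (res_basis R M 0)) M (lin_ext R M elt_of_cell)"
  | "res_basis R M (Suc (Suc n)) =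
       to_cell R ` a_kernel (free_module R (res_basis R M (Suc n))) (free_module R (res_basis R M n))
                      (lin_ext R (free_module R (res_basis R M n)) (of_cell R))"

definition res :: "('r, 'c) ring_scheme \<Rightarrow> ('r, 'm, 'd) module_scheme \<Rightarrow> nat \<Rightarrow> ('r, ('r, 'm) cell \<Rightarrow> 'r) module"
  where "res R M n = free_module R (res_basis R M n)"

text \<open>The differential \<open>F\<^sub>n \<rightarrow> F\<^sub>n\<^sub>-\<^sub>1\<close>. In degree \<open>0\<close> it is the zero map \<open>F\<^sub>0 \<rightarrow> F\<^sub>0\<close>, in accordance
  with \<open>0 - 1 = 0\<close> on the natural numbers; the augmentation \<open>F\<^sub>0 \<rightarrow> M\<close> is not part of the complex.\<close>

fun res_diff ::
    "('r, 'c) ring_scheme \<Rightarrow> ('r, 'm, 'd) module_scheme \<Rightarrow> nat \<Rightarrow> (('r, 'm) cell \<Rightarrow> 'r) \<Rightarrow> ('r, 'm) cell \<Rightarrow> 'r"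
  where
    "res_diff R M 0 = (\<lambda>f. \<zero>\<^bsub>res R M 0\<^esub>)"
  | "res_diff R M (Suc n) = lin_ext R (res R M n) (of_cell R)"

text \<open>\<open>Tor R i M N\<close> is the \<open>i\<close>-th homology of \<open>F \<otimes> N\<close>, and \<open>Ext R i M N\<close> the \<open>i\<close>-th cohomology
  of \<open>Hom(F, N)\<close>, where \<open>F\<close> is the standard free resolution of \<open>M\<close>.\<close>

definition Tor ::
    "('r, 'c) ring_scheme \<Rightarrow> nat \<Rightarrow> ('r, 'm, 'd) module_scheme \<Rightarrow> ('r, 'n, 'e) module_scheme \<Rightarrow>
     ('r, ((('r, 'm) cell \<Rightarrow> 'r) \<times> 'n \<Rightarrow> 'r) set set) module"
  where "Tor R i M N =
    homology
      (tensor R (res R M (Suc i)) N) (tensor_map R (res R M i) N (res_diff R M (Suc i)))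
      (tensor R (res R M i) N) (tensor_map R (res R M (i - 1)) N (res_diff R M i))
      (tensor R (res R M (i - 1)) N)"

definition Ext ::
    "('r, 'c) ring_scheme \<Rightarrow> nat \<Rightarrow> ('r, 'm, 'd) module_scheme \<Rightarrow> ('r, 'n, 'e) module_scheme \<Rightarrow>
     ('r, ((('r, 'm) cell \<Rightarrow> 'r) \<Rightarrow> 'n) set) module"
  where "Ext R i M N =
    homology
      (hom_module R (res R M (i - 1)) N)
        (\<lambda>f. compose (carrier (res R M i)) f (res_diff R M i))
      (hom_module R (res R M i) N)
        (\<lambda>f. compose (carrier (res R M (Suc i))) f (res_diff R M (Suc i)))
      (hom_module R (res R M (Suc i)) N)"

section \<open>Injective modules, injective hulls, injective dimension\<close>

text \<open>The test modules \<open>A\<close>, \<open>B\<close> have to range over a fixed type. By Baer's criterion the ideals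
  of \<open>R\<close> suffice, so every type into which \<open>'r\<close> embeds yields the same notion.\<close>

definition injective_module :: "('r, 'c) ring_scheme \<Rightarrow> ('r, 'm, 'd) module_scheme \<Rightarrow> bool"
  where "injective_module R E \<longleftrightarrow>
    module R E \<and>
    (\<forall>(A :: ('r, 'r + 'm) module) (B :: ('r, 'r + 'm) module) i g.
       module R A \<and> module R B \<and> i \<in> mod_hom R A B \<and> inj_on i (carrier A) \<and> g \<in> mod_hom R A E \<longrightarrow>
       (\<exists>h\<in>mod_hom R B E. \<forall>x\<in>carrier A. h (i x) = g x))"

definition is_injective_hull ::
    "('r, 'c) ring_scheme \<Rightarrow> ('r, 'm, 'd) module_scheme \<Rightarrow> ('r, 'n, 'e) module_scheme \<Rightarrow> ('m \<Rightarrow> 'n) \<Rightarrow> bool"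
  where "is_injective_hull R M E \<iota> \<longleftrightarrow>
    injective_module R E \<and> \<iota> \<in> mod_hom R M E \<and> inj_on \<iota> (carrier M) \<and>
    (\<forall>H. submodule H R E \<and> H \<inter> \<iota> ` carrier M = {\<zero>\<^bsub>E\<^esub>} \<longrightarrow> H = {\<zero>\<^bsub>E\<^esub>})"

text \<open>
  A type large enough to carry injective hulls and injective resolutions of \<open>M\<close>: if \<open>\<kappa>\<close> is the
  maximum of \<open>|R|\<close>, \<open>|M|\<close> and \<open>\<aleph>\<^sub>0\<close>, then every \<open>R\<close>-module of cardinality at most \<open>2\<^sup>\<kappa>\<close> embeds
  into an injective \<open>R\<close>-module of cardinality at most \<open>2\<^sup>\<kappa>\<close>, and \<open>('r + 'm) list set\<close> has
  cardinality at least \<open>2\<^sup>\<kappa>\<close>.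
\<close>

type_synonym ('r, 'm) big = "('r + 'm) list set"

text \<open>The injective hull is unique up to isomorphism; one is chosen.\<close>

definition injective_hull ::
    "('r, 'c) ring_scheme \<Rightarrow> ('r, 'm, 'd) module_scheme \<Rightarrow> ('r, ('r, 'm) big) module"
  where "injective_hull R M = (SOME E. \<exists>\<iota>. is_injective_hull R M E \<iota>)"

definition injective_resolution ::
    "('r, 'c) ring_scheme \<Rightarrow> ('r, 'm, 'd) module_scheme \<Rightarrow> (nat \<Rightarrow> ('r, 'n) module) \<Rightarrow>
     ('m \<Rightarrow> 'n) \<Rightarrow> (nat \<Rightarrow> 'n \<Rightarrow> 'n) \<Rightarrow> bool"
  where "injective_resolution R M I \<eta> \<delta> \<longleftrightarrow>
    (\<forall>i. injective_module R (I i)) \<and>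
    \<eta> \<in> mod_hom R M (I 0) \<and> inj_on \<eta> (carrier M) \<and>
    (\<forall>i. \<delta> i \<in> mod_hom R (I i) (I (Suc i))) \<and>
    \<eta> ` carrier M = a_kernel (I 0) (I 1) (\<delta> 0) \<and>
    (\<forall>i. \<delta> i ` carrier (I i) = a_kernel (I (Suc i)) (I (Suc (Suc i))) (\<delta> (Suc i)))"

definition finite_injective_dimension :: "('r, 'c) ring_scheme \<Rightarrow> ('r, 'm, 'd) module_scheme \<Rightarrow> bool"
  where "finite_injective_dimension R M \<longleftrightarrow>
    (\<exists>n (I :: nat \<Rightarrow> ('r, ('r, 'm) big) module) \<eta> \<delta>.
       injective_resolution R M I \<eta> \<delta> \<and> (\<forall>i>n. is_zero_module (I i)))"

section \<open>Localization, residue fields, Gorenstein local rings\<close>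

definition fraction :: "('a, 'c) ring_scheme \<Rightarrow> 'a set \<Rightarrow> 'a \<Rightarrow> 'a \<Rightarrow> ('a \<times> 'a) set"
  where "fraction R S a s =
    {(b, t). b \<in> carrier R \<and> t \<in> S \<and> (\<exists>u\<in>S. u \<otimes>\<^bsub>R\<^esub> (t \<otimes>\<^bsub>R\<^esub> a \<ominus>\<^bsub>R\<^esub> s \<otimes>\<^bsub>R\<^esub> b) = \<zero>\<^bsub>R\<^esub>)}"

text \<open>\<open>localization R S\<close> is \<open>S\<^sup>-\<^sup>1R\<close> for a multiplicatively closed set \<open>S\<close> containing \<open>1\<close>.\<close>

definition localization :: "('a, 'c) ring_scheme \<Rightarrow> 'a set \<Rightarrow> ('a \<times> 'a) set ring"
  where "localization R S =
    \<lparr>carrier = {fraction R S a s | a s. a \<in> carrier R \<and> s \<in> S},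
     monoid.mult = (\<lambda>X Y. \<Union>(a, s)\<in>X. \<Union>(b, t)\<in>Y. fraction R S (a \<otimes>\<^bsub>R\<^esub> b) (s \<otimes>\<^bsub>R\<^esub> t)),
     one = fraction R S \<one>\<^bsub>R\<^esub> \<one>\<^bsub>R\<^esub>,
     zero = fraction R S \<zero>\<^bsub>R\<^esub> \<one>\<^bsub>R\<^esub>,
     add = (\<lambda>X Y. \<Union>(a, s)\<in>X. \<Union>(b, t)\<in>Y.
              fraction R S (t \<otimes>\<^bsub>R\<^esub> a \<oplus>\<^bsub>R\<^esub> s \<otimes>\<^bsub>R\<^esub> b) (s \<otimes>\<^bsub>R\<^esub> t))\<rparr>"

definition localization_at :: "('a, 'c) ring_scheme \<Rightarrow> 'a set \<Rightarrow> ('a \<times> 'a) set ring"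
  where "localization_at R P = localization R (carrier R - P)"

definition loc_map :: "('a, 'c) ring_scheme \<Rightarrow> 'a set \<Rightarrow> 'a \<Rightarrow> ('a \<times> 'a) set"
  where "loc_map R P r = fraction R (carrier R - P) r \<one>\<^bsub>R\<^esub>"

text \<open>The ideal \<open>P R\<^sub>P\<close>.\<close>

definition loc_ideal :: "('a, 'c) ring_scheme \<Rightarrow> 'a set \<Rightarrow> ('a \<times> 'a) set set"
  where "loc_ideal R P = Idl\<^bsub>localization_at R P\<^esub> (loc_map R P ` P)"

definition residue_field :: "('a, 'c) ring_scheme \<Rightarrow> 'a set \<Rightarrow> ('a \<times> 'a) set set ring"
  where "residue_field R P = localization_at R P Quot loc_ideal R P"

text \<open>\<open>k(P)\<close> and \<open>R/P\<close> as \<open>R\<close>-modules.\<close>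

definition residue_field_module :: "('a, 'c) ring_scheme \<Rightarrow> 'a set \<Rightarrow> ('a, ('a \<times> 'a) set set) module"
  where "residue_field_module R P =
    restrict_scalars (residue_field R P)
      (\<lambda>r. loc_ideal R P +>\<^bsub>localization_at R P\<^esub> loc_map R P r)"

definition quot_ring_module :: "('a, 'c) ring_scheme \<Rightarrow> 'a set \<Rightarrow> ('a, 'a set) module"
  where "quot_ring_module R P = restrict_scalars (R Quot P) (\<lambda>r. P +>\<^bsub>R\<^esub> r)"

definition gorenstein_local_ring :: "('r, 'c) ring_scheme \<Rightarrow> bool"
  where "gorenstein_local_ring S \<longleftrightarrow>
    cring S \<and> noetherian_ring S \<and> (\<exists>!\<mm>. maximalideal \<mm> S) \<and>
    finite_injective_dimension S (regular_module S)"

end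

theory Submission
  imports Defs "HOL-Algebra.IntRing" Complex_Main
begin

text \<open>
 Fix a prime \<open>P\<close> and a resolution \<open>G\<close> of \<open>R/P\<close> by finite free modules. The hull \<open>E = E(R/P)\<close> is
 \<open>P\<close>-local and \<open>k(P)\<close> is the localization of \<open>R/P\<close>, so \<open>Tor\<^sub>i(k(P), E)\<close> is the homology of \<open>E \<otimes> G\<close>.
 As \<open>E\<close> is injective and has an element with annihilator \<open>P\<close>, duality into \<open>E\<close> shows that it vanishes
 iff \<open>Ext\<^sup>i(R/P, R)\<^sub>P = 0\<close>; and over the field \<open>k(P)\<close>, \<open>Ext\<^sup>i(E, k(P))\<close> is dual to \<open>Tor\<^sub>i(k(P), E)\<close>.
 So (2) to (5) say that \<open>Ext\<^sup>i(k(P), R\<^sub>P) = 0\<close> for large \<open>i\<close>. Over the local ring \<open>R\<^sub>P\<close> this passes from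
 the residue field to all cyclic modules by noetherian induction and Nakayama's lemma, and then
 a cosyzygy of \<open>R\<^sub>P\<close> is injective by Baer's criterion. The vanishing for all cyclic modules
 localizes, which is why the maximal ideals suffice.
\<close>

\<comment> \<open>\<open>Tor\<close> and \<open>Ext\<close> are computed from one fixed resolution
  with enormous bases, whereas duality with R needs finite bases. The link is the balancing of Tor,
  used twice: Tor(k(P), E) is read off a resolution of E with coefficients k(P), the coefficients
  are changed to R/P, and a second balancing reaches the finite resolution of R/P. The resolution of
  E met on the way is the one that defines Ext(E, k(P)), which is why both kinds of conditions
  reduce to the same statement. All of this is done with matrices over R and exactness up to S = R -
  P. The noetherian induction keeps the bound on the degree: vanishing against the residue field in
  all degrees > n gives vanishing against every cyclic module in all degrees > n, with the same n.
  Without a uniform n no single cosyzygy would be injective. Cosyzygies call for embeddings into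
  injective modules again and again, while an induction in HOL runs inside one type. Injective
  modules must therefore be found in a type that is closed under this construction, and this forces
  the size argument.\<close>
text \<open>A structure subscript may be written without brackets, as in \<open>x \<oplus>\<^sub>M y\<close>, and \<open>x \<in> M\<close> refers
 to the carrier of \<open>M\<close>.\<close>

syntax "_index" :: "logic => index" ("\<^sub>_" [1000])

declare [[coercion carrier]]

abbreviation reg :: "('r, 'c) ring_scheme => ('r, 'r) module" where "reg R \<equiv> regular_module R"

abbreviation zf :: "('r, 'c) ring_scheme => 'x => 'r" where "zf N \<equiv> \<lambda>_. \<zero>\<^sub>N"

section \<open>Linear maps\<close>

lemma mod_homI:
 assumes "!!x. x \<in> carrier M ==> f x \<in> carrier N"
  and "!!x y. x \<in> carrier M ==> y \<in> carrier M ==> f (x \<oplus>\<^sub>M y) = f x \<oplus>\<^sub>N f y"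
  and "!!r x. r \<in> carrier R ==> x \<in> M ==> f (r \<odot>\<^sub>M x) = r \<odot>\<^sub>N f x"
 shows "f \<in> mod_hom R M N"
 using assms unfolding mod_hom_def by auto

lemma mod_homD:
 assumes "f \<in> mod_hom R M N"
 shows mod_hom_closed: "x \<in> carrier M ==> f x \<in> carrier N"
  and mod_hom_add: "x \<in> carrier M ==> y \<in> carrier M ==> f (x \<oplus>\<^sub>M y) = f x \<oplus>\<^sub>N f y"
  and mod_hom_smult: "r \<in> carrier R ==> x \<in> M ==> f (r \<odot>\<^sub>M x) = r \<odot>\<^sub>N f x"
 using assms unfolding mod_hom_def by auto

lemma mod_hom_zero:
 assumes "module R M" "module R N" "f \<in> mod_hom R M N"
 shows "f \<zero>\<^sub>M = \<zero>\<^sub>N"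
proof -
 interpret M: module R M by fact
 interpret N: module R N by fact
 have "f (\<zero>\<^sub>R \<odot>\<^sub>M \<zero>\<^sub>M) = \<zero>\<^sub>R \<odot>\<^sub>N f \<zero>\<^sub>M"
  by (rule mod_hom_smult[OF assms(3)]) auto
 then show ?thesis using mod_hom_closed[OF assms(3)] by simp
qed

lemma mod_hom_a_inv:
 assumes "module R M" "module R N" "f \<in> mod_hom R M N" "x \<in> M"
 shows "f (\<ominus>\<^sub>M x) = \<ominus>\<^sub>N f x"
proof -
 interpret M: module R M by fact
 interpret N: module R N by fact
 have "f (\<ominus>\<^sub>M x) \<oplus>\<^sub>N f x = f (\<ominus>\<^sub>M x \<oplus>\<^sub>M x)"
  using mod_hom_add[OF assms(3)] assms(4) by simp
 also have "\<dots> = \<zero>\<^sub>N" using mod_hom_zero[OF assms(1-3)] assms(4) M.l_neg by simp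
 finally show ?thesis using assms(4) mod_hom_closed[OF assms(3)] N.minus_equality by force
qed

lemma mod_hom_minus:
 assumes "module R M" "module R N" "f \<in> mod_hom R M N" "x \<in> M" "y \<in> M"
 shows "f (x \<ominus>\<^sub>M y) = f x \<ominus>\<^sub>N f y"
 using assms mod_hom_a_inv[OF assms(1-3)] mod_hom_add[OF assms(3)]
 by (simp add: a_minus_def abelian_group.a_inv_closed[OF module.axioms(2)])

lemma mod_hom_comp:
 assumes "f \<in> mod_hom R M N" "g \<in> mod_hom R N K"
 shows "(\<lambda>x. g (f x)) \<in> mod_hom R M K"
 by (rule mod_homI) (simp_all add: mod_homD[OF assms(1)] mod_homD[OF assms(2)])

lemma mod_hom_cong:
 assumes "f \<in> mod_hom R M N" "!!x. x \<in> carrier M ==> g x = f x" "module R M"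
 shows "g \<in> mod_hom R M N"
proof -
 interpret M: module R M by fact
 show ?thesis using assms(1,2) unfolding mod_hom_def by auto
qed

lemma mod_hom_id: "(\<lambda>x. x) \<in> mod_hom R M M"
 unfolding mod_hom_def by auto

lemma mod_hom_sum:
 assumes "module R N" "f \<in> mod_hom R M N" "g \<in> mod_hom R M N"
 shows "(\<lambda>x. f x \<oplus>\<^sub>N g x) \<in> mod_hom R M N"
proof -
 interpret N: module R N by fact
 show ?thesis
  using assms(2,3)
  by (intro mod_homI) (auto simp: mod_homD N.smult_r_distr N.a_ac)
qed

lemma mod_hom_scale:
 assumes "module R N" "f \<in> mod_hom R M N" "r \<in> carrier R"
 shows "(\<lambda>x. r \<odot>\<^sub>N f x) \<in> mod_hom R M N"
proof -
 interpret N: module R N by fact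
 show ?thesis
  using assms(2,3)
  by (intro mod_homI)
   (auto simp: mod_homD N.smult_r_distr N.smult_assoc1[symmetric] N.R.m_comm)
qed

lemma (in module) submodule_carrier:
 assumes "submodule H R M"
 shows "x \<in> H ==> x \<in> carrier M"
 using submoduleE(1)[OF assms] by auto

lemma submodule_zero:
 assumes "submodule H R M"
 shows "\<zero>\<^sub>M \<in> H"
 using subgroup.one_closed[OF submodule.axioms(1)[OF assms]] by simp

lemma (in module) submodule_minus:
 assumes "submodule H R M" "x \<in> H" "y \<in> H"
 shows "x \<ominus>\<^sub>M y \<in> H"
 using submoduleE[OF assms(1)] assms(2,3) by (simp add: a_minus_def)

lemma sub_module:
 "module R M ==> submodule H R M ==> module R (M\<lparr>carrier := H\<rparr>)"
 by (rule submodule.submodule_is_module)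

lemma mod_hom_restrict:
 "f \<in> mod_hom R M N ==> H \<subseteq> carrier M ==> f \<in> mod_hom R (M\<lparr>carrier := H\<rparr>) N"
 by (rule mod_homI) (auto simp: mod_homD subset_iff)

lemma mod_hom_into:
 assumes "f \<in> mod_hom R M N" "!!x. x \<in> carrier M ==> f x \<in> H"
 shows "f \<in> mod_hom R M (N\<lparr>carrier := H\<rparr>)"
 by (rule mod_homI) (auto simp: mod_homD[OF assms(1)] assms(2))

lemma mod_hom_from_sub:
 assumes "f \<in> mod_hom R M (N\<lparr>carrier := H\<rparr>)" "H \<subseteq> carrier N"
 shows "f \<in> mod_hom R M N"
 using mod_homD[OF assms(1)] assms(2) by (intro mod_homI) auto

lemma submodule_image:
 assumes "module R M" "module R N" "f \<in> mod_hom R M N" "submodule H R M"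
 shows "submodule (f ` H) R N"
proof -
 interpret M: module R M by fact
 interpret N: module R N by fact
 note H = M.submodule_carrier[OF assms(4)] M.submoduleE[OF assms(4)]
 show ?thesis
 proof (rule N.submoduleI)
  show "f ` H \<subseteq> N" using H(1) mod_hom_closed[OF assms(3)] by auto
  show "\<zero>\<^sub>N \<in> f ` H" using submodule_zero[OF assms(4)] mod_hom_zero[OF assms(1-3)] by force
 next
  fix a assume "a \<in> f ` H"
  then obtain x where "x \<in> H" "a = f x" by auto
  then show "\<ominus>\<^sub>N a \<in> f ` H" using mod_hom_a_inv[OF assms(1-3), of x, symmetric] H by simp
 next
  fix a b assume "a \<in> f ` H" "b \<in> f ` H"
  then obtain x y where "x \<in> H" "a = f x" "y \<in> H" "b = f y" by auto
  then show "a \<oplus>\<^sub>N b \<in> f ` H" using mod_hom_add[OF assms(3), of x y, symmetric] H by simp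
 next
  fix r a assume r: "r \<in> R" and "a \<in> f ` H"
  then obtain x where "x \<in> H" "a = f x" by auto
  then show "r \<odot>\<^sub>N a \<in> f ` H" using mod_hom_smult[OF assms(3), of r x, symmetric] H r by simp
 qed
qed

lemma submodule_range:
 assumes "module R M" "module R N" "f \<in> mod_hom R M N"
 shows "submodule (f ` carrier M) R N"
 using submodule_image[OF assms] module.carrier_is_submodule[OF assms(1)] by auto

lemma a_kernel_def'': "a_kernel M N f = {x \<in> carrier M. f x = \<zero>\<^sub>N}"
 by (auto simp: a_kernel_def kernel_def)

lemma submodule_kernel:
 assumes "module R M" "module R N" "f \<in> mod_hom R M N"
 shows "submodule (a_kernel M N f) R M"
proof -
 interpret M: module R M by fact
 interpret N: module R N by fact
 show ?thesis
  unfolding a_kernel_def''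
  using mod_hom_zero[OF assms] mod_hom_a_inv[OF assms] mod_homD[OF assms(3)]
  by (intro M.submoduleI) auto
qed

section \<open>Ideals and the regular module\<close>

lemma regular_module_simps [simp]:
 "carrier (reg R) = carrier R"
 "add (reg R) = add R"
 "zero (reg R) = zero R"
 "smult (reg R) = mult R"
 by (auto simp: regular_module_def restrict_scalars_def)

lemma regular_module_inv [simp]:
 "\<ominus>\<^bsub>reg R\<^esub> x = \<ominus>\<^sub>R x" "x \<ominus>\<^bsub>reg R\<^esub> y = x \<ominus>\<^sub>R y"
 by (auto simp: a_inv_def a_minus_def m_inv_def)

lemma regular_module_finsum [simp]: "finsum (reg R) f A = finsum R f A"
 by (auto simp: finsum_def finprod_def)

lemma reg_module:
 assumes "cring R"
 shows "module R (reg R)"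
proof -
 interpret cring R by fact
 show ?thesis
  by (intro moduleI abelian_groupI)
   (auto simp: a_ac m_assoc l_distr r_distr assms intro: l_neg dest: add.l_inv_ex)
qed

lemma ideal_submodule:
 assumes "cring R"
 shows "ideal I R \<longleftrightarrow> submodule I R (reg R)"
proof -
 interpret R: cring R by fact
 interpret M: module R "reg R" by (rule reg_module[OF assms])
 show ?thesis
 proof
  assume I: "ideal I R"
  interpret ideal I R by fact
  show "submodule I R (reg R)"
   by (rule M.submoduleI) (auto intro: a_subset a_Hcarr I_l_closed)
 next
  assume I: "submodule I R (reg R)"
  note E = M.submoduleE[OF I, simplified]
  show "ideal I R"
  proof (rule idealI)
   show "ring R" by (rule R.ring_axioms)
   show "subgroup I (add_monoid R)" using submodule.axioms(1)[OF I] by (auto simp: subgroup_def m_inv_def)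
   show "x \<otimes>\<^sub>R a \<in> I" if "a \<in> I" "x \<in> R" for a x using E(4) that by simp
   show "a \<otimes>\<^sub>R x \<in> I" if "a \<in> I" "x \<in> R" for a x
   proof -
    have "a \<in> R" using E(1) that by auto
    then show ?thesis using E(4)[of x a] that R.m_comm[of a x] by simp
   qed
  qed
 qed
qed

text \<open>The ideal quotient (L : y). With L = 0 it is the annihilator of y, with M = R the usual
  (I : x), and with L the domain of a partial map it is the ideal to which Baer's criterion is
  applied.\<close>

definition colon :: "('r, 'c) ring_scheme => ('r, 'm, 'd) module_scheme => 'm set => 'm => 'r set"
 where "colon R M L y = {r \<in> carrier R. r \<odot>\<^sub>M y \<in> L}"

lemma colon_ideal:
 assumes "module R M" "submodule L R M" "y \<in> M"
 shows "ideal (colon R M L y) R"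
proof -
 interpret M: module R M by fact
 interpret S: module R "reg R" by (rule reg_module) (rule M.is_cring)
 note L = M.submoduleE[OF assms(2)]
 show ?thesis
  unfolding ideal_submodule[OF M.is_cring] colon_def
  using assms(3) L
  by (intro S.submoduleI)
   (auto simp: M.smult_l_minus M.smult_l_distr M.smult_assoc1 submodule_zero[OF assms(2)])
qed

section \<open>Extension of linear maps\<close>

text \<open>The extension to L + Ry must send l + r y to f l + r z, and \<open>ok\<close> is the
  condition that makes this independent of the representation. The last clause is used where the sum
  L + Ry itself is wanted.\<close>

lemma mod_hom_extend_one:
 assumes B: "module R B" and E: "module R E" and L: "submodule L R B"
  and f: "f \<in> mod_hom R (B\<lparr>carrier := L\<rparr>) E" and y: "y \<in> B" and z: "z \<in> E"
  and ok: "!!r. r \<in> carrier R ==> r \<odot>\<^sub>B y \<in> L ==> f (r \<odot>\<^sub>B y) = r \<odot>\<^sub>E z"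
 obtains L' f' where "submodule L' R B" "L \<subseteq> L'" "y \<in> L'"
  "f' \<in> mod_hom R (B\<lparr>carrier := L'\<rparr>) E" "!!x. x \<in> L ==> f' x = f x" "f' y = z"
  "!!x. x \<in> L' ==> \<exists>l\<in>L. \<exists>r\<in>carrier R. x = l \<oplus>\<^sub>B r \<odot>\<^sub>B y \<and> f' x = f l \<oplus>\<^sub>E r \<odot>\<^sub>E z"
proof -
 interpret B: module R B by fact
 interpret E: module R E by fact
 note Lc = B.submodule_carrier[OF L] and LE = B.submoduleE[OF L] and L0 = submodule_zero[OF L]
 have fc: "f x \<in> E" if "x \<in> L" for x using mod_hom_closed[OF f] that by simp
 have fadd: "f (x \<oplus>\<^sub>B x') = f x \<oplus>\<^sub>E f x'" if "x \<in> L" "x' \<in> L" for x x'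
  using mod_hom_add[OF f] that by simp
 have fsm: "f (r \<odot>\<^sub>B x) = r \<odot>\<^sub>E f x" if "r \<in> R" "x \<in> L" for r x
  using mod_hom_smult[OF f] that by simp
 define g where "g l r = f l \<oplus>\<^sub>E r \<odot>\<^sub>E z" for l r
 define h where "h l r = l \<oplus>\<^sub>B r \<odot>\<^sub>B y" for l r
 have gc: "g l r \<in> E" if "l \<in> L" "r \<in> R" for l r using that fc z by (simp add: g_def)
 have hc: "h l r \<in> B" if "l \<in> L" "r \<in> R" for l r using that Lc y by (simp add: h_def)
 have hadd: "h l r \<oplus>\<^sub>B h l' r' = h (l \<oplus>\<^sub>B l') (r \<oplus>\<^sub>R r')"
  if "l \<in> L" "r \<in> R" "l' \<in> L" "r' \<in> R" for l r l' r'
  using that Lc y by (simp add: h_def B.smult_l_distr B.a_ac)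
 have gadd: "g l r \<oplus>\<^sub>E g l' r' = g (l \<oplus>\<^sub>B l') (r \<oplus>\<^sub>R r')"
  if "l \<in> L" "r \<in> R" "l' \<in> L" "r' \<in> R" for l r l' r'
  using that fc fadd z by (simp add: g_def E.smult_l_distr E.a_ac)
 have hsm: "t \<odot>\<^sub>B h l r = h (t \<odot>\<^sub>B l) (t \<otimes>\<^sub>R r)"
  if "l \<in> L" "r \<in> R" "t \<in> R" for l r t
  using that Lc y by (simp add: h_def B.smult_r_distr B.smult_assoc1)
 have gsm: "t \<odot>\<^sub>E g l r = g (t \<odot>\<^sub>B l) (t \<otimes>\<^sub>R r)"
  if "l \<in> L" "r \<in> R" "t \<in> R" for l r t
  using that fc fsm z by (simp add: g_def E.smult_r_distr E.smult_assoc1)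
 \<comment> \<open>A relation l + r y = 0 puts r y = -l into L, where \<open>ok\<close> applies;
   \<open>wd\<close> compares two representations of one element by subtracting them.\<close>
 have g0: "g l r = \<zero>\<^sub>E" if "l \<in> L" "r \<in> R" "h l r = \<zero>\<^sub>B" for l r
 proof -
  have "r \<odot>\<^sub>B y = \<ominus>\<^sub>B l"
   using that Lc[OF that(1)] y B.minus_equality[of "r \<odot>\<^sub>B y" l] B.a_comm by (simp add: h_def)
  then have in_L: "r \<odot>\<^sub>B y \<in> L" using LE(3) that(1) by simp
  have "g l r = f l \<oplus>\<^sub>E f (r \<odot>\<^sub>B y)" using ok[OF that(2) in_L] by (simp add: g_def)
  also have "\<dots> = f (h l r)" using fadd[OF that(1) in_L] by (simp add: h_def)
  also have "\<dots> = \<zero>\<^sub>E" using that(3) mod_hom_zero[OF sub_module[OF B L] E f] by simp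
  finally show ?thesis .
 qed
 have wd: "g l r = g l' r'"
  if "l \<in> L" "r \<in> R" "l' \<in> L" "r' \<in> R" "h l r = h l' r'" for l r l' r'
 proof -
  have m: "\<ominus>\<^sub>R \<one>\<^sub>R \<in> R" by simp
  let ?l = "\<ominus>\<^sub>R \<one>\<^sub>R \<odot>\<^sub>B l'" and ?r = "\<ominus>\<^sub>R \<one>\<^sub>R \<otimes>\<^sub>R r'"
  have l: "?l \<in> L" using LE(4)[OF m] that by blast
  have r: "?r \<in> R" using that by simp
  have "h (l \<oplus>\<^sub>B ?l) (r \<oplus>\<^sub>R ?r) = h l r \<oplus>\<^sub>B \<ominus>\<^sub>R \<one>\<^sub>R \<odot>\<^sub>B h l' r'"
   using hadd[OF that(1,2) l r] hsm[OF that(3,4) m] by simp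
  also have "\<dots> = \<zero>\<^sub>B"
   using hc[OF that(3,4)] that(5) by (simp add: B.smult_l_minus B.r_neg)
  finally have "g (l \<oplus>\<^sub>B ?l) (r \<oplus>\<^sub>R ?r) = \<zero>\<^sub>E" using g0 that l r LE(5) by simp
  then have "g l r \<oplus>\<^sub>E \<ominus>\<^sub>R \<one>\<^sub>R \<odot>\<^sub>E g l' r' = \<zero>\<^sub>E"
   using gadd[OF that(1,2) l r] gsm[OF that(3,4) m] by simp
  then have "g l r \<oplus>\<^sub>E \<ominus>\<^sub>E g l' r' = \<zero>\<^sub>E"
   using gc[OF that(3,4)] by (simp add: E.smult_l_minus)
  then show ?thesis
   using gc that by (metis E.add.inv_closed E.add.inv_equality E.add.inv_inv)
 qed
 define f' where "f' x = (THE e. \<exists>l\<in>L. \<exists>r\<in>R. x = h l r \<and> e = g l r)" for x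
 have f': "f' (h l r) = g l r" if "l \<in> L" "r \<in> R" for l r
  unfolding f'_def
 proof (rule the_equality)
  show "\<exists>l'\<in>L. \<exists>r'\<in>R. h l r = h l' r' \<and> g l r = g l' r'" using that by blast
  show "e = g l r" if e: "\<exists>l'\<in>L. \<exists>r'\<in>R. h l r = h l' r' \<and> e = g l' r'" for e
  proof -
   obtain l' r' where "l' \<in> L" "r' \<in> R" "h l r = h l' r'" "e = g l' r'" using e by blast
   then show ?thesis using wd[of l r l' r'] \<open>l \<in> L\<close> \<open>r \<in> R\<close> by simp
  qed
 qed
 define L' where "L' = {x. \<exists>l\<in>L. \<exists>r\<in>R. x = h l r}"
 have sub: "submodule L' R B"
 proof (rule B.submoduleI)
  show "L' \<subseteq> B" using hc by (auto simp: L'_def)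
  have "\<zero>\<^sub>B = h \<zero>\<^sub>B \<zero>\<^sub>R" using y by (simp add: h_def)
  then show "\<zero>\<^sub>B \<in> L'" using L0 unfolding L'_def by blast
  show "a \<oplus>\<^sub>B b \<in> L'" if ab: "a \<in> L'" "b \<in> L'" for a b
  proof -
   obtain l r l' r' where *: "l \<in> L" "r \<in> R" "a = h l r" "l' \<in> L" "r' \<in> R" "b = h l' r'"
    using ab unfolding L'_def by blast
   then show ?thesis using hadd[OF *(1,2,4,5)] LE(5) unfolding L'_def
    by (auto intro!: bexI[of _ "l \<oplus>\<^sub>B l'"] bexI[of _ "r \<oplus>\<^sub>R r'"])
  qed
  show sm: "r \<odot>\<^sub>B x \<in> L'" if that': "r \<in> R" "x \<in> L'" for r x
  proof -
   obtain l t where *: "l \<in> L" "t \<in> R" "x = h l t" using that'(2) unfolding L'_def by blast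
   have "r \<odot>\<^sub>B l \<in> L" "r \<otimes>\<^sub>R t \<in> R" using LE(4) * that'(1) by auto
   then show ?thesis using hsm[OF *(1,2) that'(1)] *(3) unfolding L'_def by blast
  qed
  show "\<ominus>\<^sub>B a \<in> L'" if "a \<in> L'" for a
  proof -
   have "a \<in> B" using that hc by (auto simp: L'_def)
   then have "\<ominus>\<^sub>B a = \<ominus>\<^sub>R \<one>\<^sub>R \<odot>\<^sub>B a" by (simp add: B.smult_l_minus)
   then show ?thesis using sm[OF _ that, of "\<ominus>\<^sub>R \<one>\<^sub>R"] by simp
  qed
 qed
 have hl: "h l \<zero>\<^sub>R = l" and gl: "g l \<zero>\<^sub>R = f l" if "l \<in> L" for l
  using that y z fc Lc by (simp_all add: h_def g_def)
 have hy: "h \<zero>\<^sub>B \<one>\<^sub>R = y" and gy: "g \<zero>\<^sub>B \<one>\<^sub>R = z"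
  using y z L0 mod_hom_zero[OF sub_module[OF B L] E f] by (simp_all add: h_def g_def)
 show ?thesis
 proof
  show "submodule L' R B" by fact
  show "L \<subseteq> L'" using hl unfolding L'_def by (force)
  show "y \<in> L'" using hy L0 unfolding L'_def by force
  show "f' x = f x" if "x \<in> L" for x using f'[OF that B.R.zero_closed] hl gl that by simp
  show "f' y = z" using f'[OF L0 B.R.one_closed] hy gy by simp
  show "\<exists>l\<in>L. \<exists>r\<in>R. x = l \<oplus>\<^sub>B r \<odot>\<^sub>B y \<and> f' x = f l \<oplus>\<^sub>E r \<odot>\<^sub>E z" if "x \<in> L'" for x
   using that f' unfolding L'_def g_def h_def by blast
  show "f' \<in> mod_hom R (B\<lparr>carrier := L'\<rparr>) E"
  proof (rule mod_homI; clarsimp simp: L'_def)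
   show "f' (h l r) \<in> E" if "l \<in> L" "r \<in> R" for l r using that f' gc by simp
   show "f' (h l r \<oplus>\<^sub>B h l' r') = f' (h l r) \<oplus>\<^sub>E f' (h l' r')"
    if "l \<in> L" "r \<in> R" "l' \<in> L" "r' \<in> R" for l r l' r'
    using that f' hadd gadd LE(5) by simp
   show "f' (t \<odot>\<^sub>B h l r) = t \<odot>\<^sub>E f' (h l r)"
    if "t \<in> R" "l \<in> L" "r \<in> R" for l r t
    using that f' hsm gsm LE(4) by simp
  qed
 qed
qed

text \<open>Partial maps are treated as their graphs, so that extension becomes inclusion and Zorn's
  lemma applies directly to sets.\<close>

lemma mod_hom_maximal_extension:
 assumes B: "module R B" and E: "module R E" and A: "submodule A R B"
  and g: "g \<in> mod_hom R (B\<lparr>carrier := A\<rparr>) E"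
 obtains L f where "submodule L R B" "A \<subseteq> L" "f \<in> mod_hom R (B\<lparr>carrier := L\<rparr>) E"
  "!!x. x \<in> A ==> f x = g x"
  "!!L' f'. submodule L' R B ==> L \<subseteq> L' ==> f' \<in> mod_hom R (B\<lparr>carrier := L'\<rparr>) E ==>
    (!!x. x \<in> L ==> f' x = f x) ==> L' = L"
proof -
 interpret B: module R B by fact
 interpret E: module R E by fact
 define ok where "ok G \<longleftrightarrow> G \<subseteq> carrier B \<times> carrier E \<and> single_valued G \<and>
   (\<forall>x e x' e'. (x, e) \<in> G --> (x', e') \<in> G --> (x \<oplus>\<^sub>B x', e \<oplus>\<^sub>E e') \<in> G) \<and>
   (\<forall>x e. \<forall>r\<in>R. (x, e) \<in> G --> (r \<odot>\<^sub>B x, r \<odot>\<^sub>E e) \<in> G)" for G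
 have graph_ok: "ok ((\<lambda>x. (x, f x)) ` L)"
  if "submodule L R B" "f \<in> mod_hom R (B\<lparr>carrier := L\<rparr>) E" for L f
  using mod_homD[OF that(2)] B.submoduleE[OF that(1)]
  unfolding ok_def single_valued_def by auto
 define G0 where "G0 = (\<lambda>x. (x, g x)) ` A"
 define AA where "AA = {G. ok G \<and> G0 \<subseteq> G}"
 have "\<exists>G\<in>AA. \<forall>X\<in>AA. G \<subseteq> X --> X = G"
 proof (rule subset_Zorn_nonempty)
  show "AA \<noteq> {}" using graph_ok[OF A g] unfolding AA_def G0_def by blast
 next
  fix C assume C: "C \<noteq> {}" "subset.chain AA C"
  have dir: "\<exists>Z\<in>C. X \<subseteq> Z \<and> Y \<subseteq> Z" if "X \<in> C" "Y \<in> C" for X Y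
  proof -
   have "X \<subseteq> Y \<or> Y \<subseteq> X" using that C(2) by (simp add: subset_chain_def)
   then show ?thesis using that by auto
  qed
  have CA: "X \<in> C ==> ok X \<and> G0 \<subseteq> X" for X using C(2) unfolding AA_def by (auto simp: subset_chain_def)
  have "ok (\<Union>C)"
   unfolding ok_def
  proof (intro conjI allI impI ballI)
   show "\<Union> C \<subseteq> carrier B \<times> carrier E" using CA unfolding ok_def by (meson Union_least)
   show "single_valued (\<Union> C)"
   proof (rule single_valuedI)
    fix x y z assume "(x, y) \<in> \<Union> C" "(x, z) \<in> \<Union> C"
    then obtain Z where "Z \<in> C" "(x, y) \<in> Z" "(x, z) \<in> Z" using dir by blast
    then show "y = z" using CA unfolding ok_def single_valued_def by blast
   qed
   show "(x \<oplus>\<^sub>B x', e \<oplus>\<^sub>E e') \<in> \<Union> C" if mem: "(x, e) \<in> \<Union> C" "(x', e') \<in> \<Union> C" for x e x' e'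
   proof -
    obtain Z where "Z \<in> C" "(x, e) \<in> Z" "(x', e') \<in> Z" using dir mem by blast
    then show ?thesis using CA unfolding ok_def by blast
   qed
   show "(r \<odot>\<^sub>B x, r \<odot>\<^sub>E e) \<in> \<Union> C" if "r \<in> R" "(x, e) \<in> \<Union> C" for r x e
    using that CA unfolding ok_def by blast
  qed
  then show "\<Union>C \<in> AA" using C(1) CA unfolding AA_def by blast
 qed
 then obtain G where GA: "G \<in> AA" and maxG: "\<forall>X\<in>AA. G \<subseteq> X --> X = G" by (elim bexE)
 then have G: "ok G" "G0 \<subseteq> G" by (simp_all add: AA_def)
 have max: "X = G" if "ok X" "G \<subseteq> X" for X
  using maxG that G(2) by (simp add: AA_def)
 have GU: "e = e'" if "(x, e) \<in> G" "(x, e') \<in> G" for x e e'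
  using G(1) that unfolding ok_def single_valued_def by metis
 define L where "L = Domain G"
 define f where "f x = (THE e. (x, e) \<in> G)" for x
 have fG: "f x = e" if "(x, e) \<in> G" for x e
  unfolding f_def using that GU[OF _ that] by (rule the_equality)
 have Gf: "(x, f x) \<in> G" if "x \<in> L" for x using that fG unfolding L_def by auto
 have Gadd: "(x \<oplus>\<^sub>B x', f x \<oplus>\<^sub>E f x') \<in> G" if "x \<in> L" "x' \<in> L" for x x'
  using Gf[OF that(1)] Gf[OF that(2)] G(1) by (simp add: ok_def)
 have Gsm: "(r \<odot>\<^sub>B x, r \<odot>\<^sub>E f x) \<in> G" if "r \<in> R" "x \<in> L" for r x
  using Gf[OF that(2)] that(1) G(1) by (simp add: ok_def)
 have AL: "A \<subseteq> L" using G(2) unfolding L_def G0_def by auto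
 have Lc: "L \<subseteq> B" using G(1) unfolding ok_def L_def by auto
 have L: "submodule L R B"
 proof (rule B.submoduleI)
  show "L \<subseteq> B" by fact
  show "\<zero>\<^sub>B \<in> L" using AL submodule_zero[OF A] by auto
  show "a \<oplus>\<^sub>B b \<in> L" if "a \<in> L" "b \<in> L" for a b using Gadd[OF that] unfolding L_def by auto
  show sm: "r \<odot>\<^sub>B x \<in> L" if "r \<in> R" "x \<in> L" for r x using Gsm[OF that] unfolding L_def by auto
  show "\<ominus>\<^sub>B a \<in> L" if "a \<in> L" for a
  proof -
   have "\<ominus>\<^sub>B a = \<ominus>\<^sub>R \<one>\<^sub>R \<odot>\<^sub>B a" using that Lc B.smult_l_minus[of "\<one>\<^sub>R" a] by auto
   then show ?thesis using sm[OF _ that, of "\<ominus>\<^sub>R \<one>\<^sub>R"] by simp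
  qed
 qed
 have f: "f \<in> mod_hom R (B\<lparr>carrier := L\<rparr>) E"
  using Gf Gadd Gsm fG G(1) unfolding ok_def by (intro mod_homI) auto
 have GL: "G = (\<lambda>x. (x, f x)) ` L" using Gf fG unfolding L_def by force
 show ?thesis
 proof (rule that[OF L AL f])
  show "f x = g x" if "x \<in> A" for x using that G(2) fG unfolding G0_def by auto
  show "L' = L" if "submodule L' R B" "L \<subseteq> L'" "f' \<in> mod_hom R (B\<lparr>carrier := L'\<rparr>) E"
   "!!x. x \<in> L ==> f' x = f x" for L' f'
  proof -
   have "G \<subseteq> (\<lambda>x. (x, f' x)) ` L'" unfolding GL using that(2,4) by force
   then have "(\<lambda>x. (x, f' x)) ` L' = G" using max graph_ok[OF that(1,3)] by blast
   then show ?thesis unfolding L_def Domain_fst by (auto simp: image_image)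
  qed
 qed
qed

text \<open>Baer's criterion as the working form of injectivity. Unlike
  \<open>injective_module\<close> it quantifies over no test modules, hence depends on no choice of
  their type.\<close>

definition baer :: "('r, 'c) ring_scheme => ('r, 'm, 'd) module_scheme => bool"
 where "baer R E \<longleftrightarrow> (\<forall>I \<phi>. ideal I R \<and> \<phi> \<in> mod_hom R ((reg R)\<lparr>carrier := I\<rparr>) E -->
   (\<exists>y\<in>carrier E. \<forall>r\<in>I. \<phi> r = r \<odot>\<^sub>E y))"

lemma baerD:
 assumes "baer R E" "ideal I R"
  and "!!r. r \<in> I ==> \<phi> r \<in> carrier E"
  and "!!r s. r \<in> I ==> s \<in> I ==> \<phi> (r \<oplus>\<^sub>R s) = \<phi> r \<oplus>\<^sub>E \<phi> s"
  and "!!r s. r \<in> R ==> s \<in> I ==> \<phi> (r \<otimes>\<^sub>R s) = r \<odot>\<^sub>E \<phi> s"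
 obtains y where "y \<in> E" "!!r. r \<in> I ==> \<phi> r = r \<odot>\<^sub>E y"
proof -
 have "\<phi> \<in> mod_hom R ((reg R)\<lparr>carrier := I\<rparr>) E"
  using assms(3-5) by (intro mod_homI) auto
 then show ?thesis using assms(1,2) that unfolding baer_def by blast
qed

text \<open>For any y and a maximal domain L, the map r -> f (r y) on (L : y) is multiplication by
  some z, and z is an admissible value at y. So y lies in L already, and a maximal extension is
  total.\<close>

lemma baer_extend:
 assumes B: "module R B" and E: "module R E" and bE: "baer R E" and A: "submodule A R B"
  and g: "g \<in> mod_hom R (B\<lparr>carrier := A\<rparr>) E"
 obtains h where "h \<in> mod_hom R B E" "!!x. x \<in> A ==> h x = g x"
proof -
 interpret B: module R B by fact
 interpret E: module R E by fact
 obtain L f where L: "submodule L R B" "A \<subseteq> L" and f: "f \<in> mod_hom R (B\<lparr>carrier := L\<rparr>) E"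
  and fg: "!!x. x \<in> A ==> f x = g x"
  and max: "!!L' f'. submodule L' R B ==> L \<subseteq> L' ==> f' \<in> mod_hom R (B\<lparr>carrier := L'\<rparr>) E ==>
    (!!x. x \<in> L ==> f' x = f x) ==> L' = L"
  using mod_hom_maximal_extension[OF B E A g] by blast
 have "y \<in> L" if y: "y \<in> B" for y
 proof -
  have "ideal (colon R B L y) R" using colon_ideal[OF B L(1) y] .
  moreover have "f (r \<odot>\<^sub>B y) \<in> E" if "r \<in> colon R B L y" for r
   using that mod_hom_closed[OF f] by (simp add: colon_def)
  moreover have "f ((r \<oplus>\<^sub>R s) \<odot>\<^sub>B y) = f (r \<odot>\<^sub>B y) \<oplus>\<^sub>E f (s \<odot>\<^sub>B y)"
   if "r \<in> colon R B L y" "s \<in> colon R B L y" for r s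
   using that mod_hom_add[OF f] y by (simp add: colon_def B.smult_l_distr)
  moreover have "f ((r \<otimes>\<^sub>R s) \<odot>\<^sub>B y) = r \<odot>\<^sub>E f (s \<odot>\<^sub>B y)"
   if "r \<in> R" "s \<in> colon R B L y" for r s
   using that mod_hom_smult[OF f] y by (simp add: colon_def B.smult_assoc1)
  ultimately obtain z where z: "z \<in> E"
   and *: "!!r. r \<in> colon R B L y ==> f (r \<odot>\<^sub>B y) = r \<odot>\<^sub>E z"
   using baerD[OF bE, of "colon R B L y" "\<lambda>r. f (r \<odot>\<^sub>B y)"] by blast
  then have ok: "f (r \<odot>\<^sub>B y) = r \<odot>\<^sub>E z" if "r \<in> R" "r \<odot>\<^sub>B y \<in> L" for r
   using that by (simp add: colon_def)
  obtain L' f' where "submodule L' R B" "L \<subseteq> L'" "y \<in> L'"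
   "f' \<in> mod_hom R (B\<lparr>carrier := L'\<rparr>) E" "!!x. x \<in> L ==> f' x = f x"
   using mod_hom_extend_one[OF B E L(1) f y z ok] by metis
  then show "y \<in> L" using max by blast
 qed
 then have "L = carrier B" using B.submoduleE(1)[OF L(1)] by auto
 then show ?thesis using f fg that by simp
qed

lemma baer_extend_inj:
 assumes A: "module R A" and B: "module R B" and E: "module R E" and bE: "baer R E"
  and i: "i \<in> mod_hom R A B" and inj: "inj_on i (carrier A)" and g: "g \<in> mod_hom R A E"
 obtains h where "h \<in> mod_hom R B E" "!!x. x \<in> A ==> h (i x) = g x"
proof -
 interpret A: module R A by fact
 interpret B: module R B by fact
 define j where "j = inv_into (carrier A) i"
 have ji: "j (i x) = x" if "x \<in> A" for x unfolding j_def using inj that by simp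
 have "j \<in> mod_hom R (B\<lparr>carrier := i ` A\<rparr>) A"
 proof (rule mod_homI; clarsimp simp: ji)
  show "j (i x \<oplus>\<^sub>B i x') = x \<oplus>\<^sub>A x'" if "x \<in> A" "x' \<in> A" for x x'
   using ji[of "x \<oplus>\<^sub>A x'"] mod_hom_add[OF i] that by simp
  show "j (r \<odot>\<^sub>B i x) = r \<odot>\<^sub>A x" if "r \<in> R" "x \<in> A" for r x
   using ji[of "r \<odot>\<^sub>A x"] mod_hom_smult[OF i] that by simp
 qed
 then have "(\<lambda>x. g (j x)) \<in> mod_hom R (B\<lparr>carrier := i ` A\<rparr>) E" using g by (rule mod_hom_comp)
 then obtain h where "h \<in> mod_hom R B E" "!!x. x \<in> i ` A ==> h x = g (j x)"
  using baer_extend[OF B E bE submodule_range[OF A B i]] by blast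
 then show ?thesis using that ji by simp
qed

section \<open>Transport of structure\<close>

text \<open>Relabels the elements of M along j, in order to move a module into a prescribed
  type.\<close>

definition transport :: "('m => 'n) => ('r, 'm, 'd) module_scheme => ('r, 'n) module"
 where "transport j M = (let k = inv_into (carrier M) j in
  \<lparr>carrier = j ` carrier M, monoid.mult = undefined, one = undefined, zero = j \<zero>\<^sub>M,
   add = (\<lambda>x y. j (k x \<oplus>\<^sub>M k y)), smult = (\<lambda>r x. j (r \<odot>\<^sub>M k x))\<rparr>)"

lemma transport_carrier [simp]: "carrier (transport j M) = j ` carrier M"
 by (simp add: transport_def Let_def)

text \<open>Here q may be a relabelling of the elements or a quotient map; both uses occur
  below.\<close>

lemma module_image:
 assumes M: "module R M"
  and carr: "carrier Q = q ` carrier M"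
  and add: "!!x y. x \<in> M ==> y \<in> M ==> q x \<oplus>\<^sub>Q q y = q (x \<oplus>\<^sub>M y)"
  and smult: "!!r x. r \<in> carrier R ==> x \<in> M ==> r \<odot>\<^sub>Q q x = q (r \<odot>\<^sub>M x)"
  and zero: "\<zero>\<^sub>Q = q \<zero>\<^sub>M"
 shows "module R Q" "q \<in> mod_hom R M Q"
proof -
 interpret M: module R M by fact
 show "module R Q"
 proof (rule moduleI)
  show "abelian_group Q"
  proof (rule abelian_groupI)
   show "\<exists>y\<in>Q. y \<oplus>\<^sub>Q x = \<zero>\<^sub>Q" if x: "x \<in> Q" for x
   proof -
    obtain u where "u \<in> M" "x = q u" using x carr by auto
    then show ?thesis by (intro bexI[of _ "q (\<ominus>\<^sub>M u)"]) (auto simp: add zero carr M.l_neg)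
   qed
  qed (auto simp: add zero carr M.a_ac)
 qed (auto simp: add smult carr M.is_cring M.smult_l_distr M.smult_r_distr M.smult_assoc1)
 show "q \<in> mod_hom R M Q" by (rule mod_homI) (auto simp: carr add smult)
qed

lemma mod_hom_inv:
 assumes M: "module R M" and h: "h \<in> mod_hom R M N" and inj: "inj_on h (carrier M)" and onto: "h ` carrier M = carrier N"
 shows "inv_into (carrier M) h \<in> mod_hom R N M"
proof -
 interpret module R M by fact
 have "x \<in> h ` M" if "x \<in> N" for x using onto that by simp
 then have k: "inv_into (carrier M) h x \<in> M" "h (inv_into (carrier M) h x) = x" if "x \<in> N" for x
  using inv_into_into[of x h "carrier M"] f_inv_into_f[of x h "carrier M"] that by blast+
 have e: "inv_into (carrier M) h (h y) = y" if "y \<in> M" for y by (rule inv_into_f_f[OF inj that])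
 show ?thesis
 proof (rule mod_homI)
  show "inv_into (carrier M) h (x \<oplus>\<^sub>N y) = inv_into (carrier M) h x \<oplus>\<^sub>M inv_into (carrier M) h y"
   if "x \<in> N" "y \<in> N" for x y
   using e[OF a_closed[OF k(1)[OF that(1)] k(1)[OF that(2)]]] mod_hom_add[OF h k(1)[OF that(1)] k(1)[OF that(2)]]
    k(2)[OF that(1)] k(2)[OF that(2)] by simp
  show "inv_into (carrier M) h (r \<odot>\<^sub>N x) = r \<odot>\<^sub>M inv_into (carrier M) h x"
   if "r \<in> R" "x \<in> N" for r x
   using e[OF smult_closed[OF that(1) k(1)[OF that(2)]]] mod_hom_smult[OF h that(1) k(1)[OF that(2)]] k(2)[OF that(2)] by simp
 qed (rule k(1))
qed

lemma transport_module:
 assumes M: "module R M" and inj: "inj_on j (carrier M)"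
 shows "module R (transport j M)"
  and "j \<in> mod_hom R M (transport j M)"
  and "inv_into (carrier M) j \<in> mod_hom R (transport j M) M"
proof -
 interpret M: module R M by fact
 have m: "module R (transport j M)" "j \<in> mod_hom R M (transport j M)"
  by (rule module_image[OF M]; use inj in \<open>auto simp: transport_def Let_def\<close>)+
 show "module R (transport j M)" "j \<in> mod_hom R M (transport j M)" by (rule m)+
 show "inv_into (carrier M) j \<in> mod_hom R (transport j M) M" by (rule mod_hom_inv[OF M m(2) inj]) simp
qed

lemma baer_iso:
 assumes M: "module R M" and f: "f \<in> mod_hom R M N" and g: "g \<in> mod_hom R N M"
  and fg: "!!y. y \<in> carrier N ==> f (g y) = y" and bM: "baer R M"
 shows "baer R N"
 unfolding baer_def
proof (intro allI impI; elim conjE)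
 fix I \<phi> assume I: "ideal I R" and \<phi>: "\<phi> \<in> mod_hom R ((reg R)\<lparr>carrier := I\<rparr>) N"
 obtain y where y: "y \<in> M" "!!r. r \<in> I ==> g (\<phi> r) = r \<odot>\<^sub>M y"
  using bM I mod_hom_comp[OF \<phi> g] unfolding baer_def by blast
 have "\<phi> r = r \<odot>\<^sub>N f y" if "r \<in> I" for r
  using fg[of "\<phi> r"] mod_hom_closed[OF \<phi>] that y mod_hom_smult[OF f, of r y]
   ideal.Icarr[OF I] by force
 then show "\<exists>y\<in>N. \<forall>r\<in>I. \<phi> r = r \<odot>\<^sub>N y" using mod_hom_closed[OF f y(1)] by blast
qed

text \<open>The test modules in \<open>injective_module\<close> live in the type
  \<open>'r + 'm\<close>, so an ideal and R enter through \<open>Inl\<close>. The element required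
  by Baer's criterion is the image of 1 under the extended map.\<close>

lemma injective_module_iff_baer:
 fixes R :: "('r, 'c) ring_scheme" and E :: "('r, 'm, 'd) module_scheme"
 assumes E: "module R E"
 shows "injective_module R E \<longleftrightarrow> baer R E"
proof
 assume "baer R E"
 then show "injective_module R E"
  unfolding injective_module_def using E baer_extend_inj[of R _ _ E] by metis
next
 assume inj: "injective_module R E"
 interpret E: module R E by fact
 let ?S = "reg R"
 have S: "module R ?S" by (rule reg_module[OF E.is_cring])
 show "baer R E"
  unfolding baer_def
 proof (intro allI impI; elim conjE)
  fix I \<phi> assume I: "ideal I R" and \<phi>: "\<phi> \<in> mod_hom R (?S\<lparr>carrier := I\<rparr>) E"
  let ?I = "?S\<lparr>carrier := I\<rparr>"
  have mI: "module R ?I" by (rule sub_module[OF S I[unfolded ideal_submodule[OF E.is_cring]]])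
  have IS: "(\<lambda>x. x) \<in> mod_hom R ?I ?S" using ideal.Icarr[OF I] by (intro mod_homI) auto
  let ?j = "Inl :: 'r => 'r + 'm"
  note tI = transport_module[OF mI, of ?j, simplified] and tS = transport_module[OF S, of ?j, simplified]
  define i where "i x = ?j (inv_into I ?j x)" for x
  have i: "i \<in> mod_hom R (transport ?j ?I) (transport ?j ?S)"
   unfolding i_def using mod_hom_comp[OF mod_hom_comp[OF tI(3) IS] tS(2)] by simp
  have iv: "i (?j x) = ?j x" if "x \<in> I" for x using that by (simp add: i_def)
  have "inj_on i (carrier (transport ?j ?I))" using iv by (auto simp: inj_on_def)
  moreover have "(\<lambda>x. \<phi> (inv_into I ?j x)) \<in> mod_hom R (transport ?j ?I) E"
   using mod_hom_comp[OF tI(3) \<phi>] by simp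
  ultimately obtain h where h: "h \<in> mod_hom R (transport ?j ?S) E"
   and hi: "\<forall>x\<in>transport ?j ?I. h (i x) = \<phi> (inv_into I ?j x)"
   using inj i tI(1) tS(1) unfolding injective_module_def by blast
  define h' where "h' x = h (?j x)" for x
  have h': "h' \<in> mod_hom R ?S E" unfolding h'_def using mod_hom_comp[OF tS(2) h] .
  have "\<phi> r = r \<odot>\<^sub>E h' \<one>\<^sub>R" if r: "r \<in> I" for r
  proof -
   have "\<phi> r = h' r" using hi[rule_format, of "?j r"] r iv unfolding h'_def by simp
   also have "\<dots> = h' (r \<otimes>\<^sub>R \<one>\<^sub>R)" using ideal.Icarr[OF I r] by simp
   also have "\<dots> = r \<odot>\<^sub>E h' \<one>\<^sub>R" using mod_hom_smult[OF h', of r "\<one>\<^sub>R"] ideal.Icarr[OF I r] by simp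
   finally show ?thesis .
  qed
  then show "\<exists>y\<in>E. \<forall>r\<in>I. \<phi> r = r \<odot>\<^sub>E y" using mod_hom_closed[OF h', of "\<one>\<^sub>R"] by auto
 qed
qed

section \<open>Direct sums and matrices\<close>

definition dsum :: "('r, 'm, 'd) module_scheme => 'b set => ('r, 'b => 'm) module"
 where "dsum M B =
  \<lparr>carrier = {f. range f \<subseteq> carrier M \<and> {b. f b \<noteq> \<zero>\<^sub>M} \<subseteq> B \<and> finite {b. f b \<noteq> \<zero>\<^sub>M}},
   monoid.mult = undefined, one = undefined,
   zero = zf M,
   add = (\<lambda>f g b. f b \<oplus>\<^sub>M g b),
   smult = (\<lambda>r f b. r \<odot>\<^sub>M f b)\<rparr>"

abbreviation fmod :: "('r, 'c) ring_scheme => 'b set => ('r, 'b => 'r) module" where "fmod R B \<equiv> dsum (reg R) B"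

lemma free_eq_dsum: "free_module R B = fmod R B"
 by (simp add: free_module_def dsum_def)

lemma dsum_simps [simp]:
 "zero (dsum M B) = zf M"
 "add (dsum M B) = (\<lambda>f g b. f b \<oplus>\<^sub>M g b)"
 "smult (dsum M B) = (\<lambda>r f b. r \<odot>\<^sub>M f b)"
 by (auto simp: dsum_def)

lemma dsumI:
 assumes "!!b. f b \<in> carrier M" "!!b. b \<notin> B ==> f b = \<zero>\<^sub>M" "finite {b. f b \<noteq> \<zero>\<^sub>M}"
 shows "f \<in> dsum M B"
 using assms by (auto simp: dsum_def)

lemma dsumI_superset:
 assumes "!!b. f b \<in> carrier M" "!!b. b \<notin> X ==> f b = \<zero>\<^sub>M" "finite X" "X \<subseteq> B"
 shows "f \<in> dsum M B"
 by (rule dsumI) (use assms in \<open>auto intro: finite_subset[OF _ assms(3)]\<close>)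

lemma dsumD:
 assumes "f \<in> dsum M B"
 shows dsum_val: "f b \<in> carrier M"
  and dsum_out: "b \<notin> B ==> f b = \<zero>\<^sub>M"
  and dsum_fin: "finite {b. f b \<noteq> \<zero>\<^sub>M}"
  and dsum_supp: "{b. f b \<noteq> \<zero>\<^sub>M} \<subseteq> B"
 using assms by (auto simp: dsum_def)

lemma dsum_module:
 fixes M :: "('r, 'm, 'd) module_scheme" and B :: "'b set"
 assumes "module R M"
 shows "module R (dsum M B)"
proof -
 interpret M: module R M by fact
 have sub: "finite {b. f b \<noteq> \<zero>\<^sub>M}" if "finite X" "!!b. b \<notin> X ==> f b = \<zero>\<^sub>M"
  for f :: "'b => 'm" and X
  using that(1) by (rule finite_subset[rotated]) (use that(2) in auto)
 have add: "(\<lambda>b. f b \<oplus>\<^sub>M g b) \<in> dsum M B"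
  if "f \<in> dsum M B" "g \<in> dsum M B" for f g
  by (rule dsumI; (rule sub[of "{b. f b \<noteq> \<zero>\<^sub>M} \<union> {b. g b \<noteq> \<zero>\<^sub>M}"])?)
   (use dsumD[OF that(1)] dsumD[OF that(2)] in auto)
 have smul: "(\<lambda>b. r \<odot>\<^sub>M f b) \<in> dsum M B"
  if "r \<in> R" "f \<in> dsum M B" for r f
  by (rule dsumI; (rule sub[of "{b. f b \<noteq> \<zero>\<^sub>M}"])?)
   (use dsumD[OF that(2)] that(1) in auto)
 note v = dsum_val[of _ M B]
 show ?thesis
 proof (rule moduleI)
  show "abelian_group (dsum M B)"
  proof (rule abelian_groupI)
   show "\<exists>g\<in>dsum M B. g \<oplus>\<^bsub>dsum M B\<^esub> f = \<zero>\<^bsub>dsum M B\<^esub>" if "f \<in> dsum M B" for f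
   proof (rule bexI)
    show "(\<lambda>b. \<ominus>\<^sub>R \<one>\<^sub>R \<odot>\<^sub>M f b) \<in> dsum M B" by (rule smul[OF _ that]) simp
    show "(\<lambda>b. \<ominus>\<^sub>R \<one>\<^sub>R \<odot>\<^sub>M f b) \<oplus>\<^bsub>dsum M B\<^esub> f = \<zero>\<^bsub>dsum M B\<^esub>"
     using v[OF that] by (simp add: M.smult_l_minus M.l_neg)
   qed
  qed (auto simp: add v M.a_ac intro: dsumI)
 qed (auto simp: smul v M.is_cring M.smult_l_distr M.smult_r_distr M.smult_assoc1)
qed

lemma dsum_inv:
 assumes "module R M" "f \<in> dsum M B"
 shows "\<ominus>\<^bsub>dsum M B\<^esub> f = (\<lambda>b. \<ominus>\<^sub>M f b)"
proof -
 interpret M: module R M by fact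
 interpret D: module R "dsum M B" by (rule dsum_module[OF assms(1)])
 have "\<ominus>\<^bsub>dsum M B\<^esub> f = \<ominus>\<^sub>R \<one>\<^sub>R \<odot>\<^bsub>dsum M B\<^esub> f" using assms(2) by (simp only: D.smult_l_minus M.R.one_closed D.smult_one)
 also have "\<dots> = (\<lambda>b. \<ominus>\<^sub>M f b)" using dsum_val[OF assms(2)] by (simp add: M.smult_l_minus)
 finally show ?thesis .
qed

lemma dsum_minus:
 assumes "module R M" "f \<in> dsum M B" "g \<in> dsum M B"
 shows "f \<ominus>\<^bsub>dsum M B\<^esub> g = (\<lambda>b. f b \<ominus>\<^sub>M g b)"
 using dsum_inv[OF assms(1,3)] by (simp add: a_minus_def)

definition sing :: "('r, 'm, 'd) module_scheme => 'b => 'm => 'b => 'm"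
 where "sing M b y = (\<lambda>c. if c = b then y else \<zero>\<^sub>M)"

lemma basis_elt_eq_sing: "basis_elt R b = sing (reg R) b \<one>\<^sub>R"
 by (simp add: basis_elt_def sing_def fun_eq_iff)

lemma sing_closed:
 assumes "module R M" "b \<in> B" "y \<in> M"
 shows "sing M b y \<in> dsum M B"
proof -
 interpret M: module R M by fact
 show ?thesis
  by (rule dsumI_superset[of _ _ "{b}"]) (use assms in \<open>auto simp: sing_def\<close>)
qed

text \<open>Induction on the support, one coordinate at a time; it takes the place of writing an
  element as a finite sum.\<close>

lemma dsum_induct [consumes 2, case_names zero add]:
 fixes M :: "('r, 'm, 'd) module_scheme" and B :: "'b set"
 assumes "module R M" "g \<in> dsum M B"
  and zero: "P (zf M)"
  and add: "!!b y f. b \<in> B ==> y \<in> M ==> f \<in> (dsum M B) ==> P f ==>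
   P (\<lambda>c. sing M b y c \<oplus>\<^sub>M f c)"
 shows "P g"
proof -
 interpret M: module R M by fact
 have "\<forall>g\<in>dsum M B. {b. g b \<noteq> \<zero>\<^sub>M} = X --> P g" if "finite X" for X :: "'b set"
  using that
 proof (induction X rule: finite_induct)
  case empty
  show ?case
  proof (intro ballI impI)
   fix g :: "'b => 'm" assume "{b. g b \<noteq> \<zero>\<^sub>M} = {}"
   then have "g = zf M" by auto
   then show "P g" using zero by simp
  qed
 next
  case (insert x X)
  show ?case
  proof (intro ballI impI)
   fix g assume g: "g \<in> dsum M B" and s: "{b. g b \<noteq> \<zero>\<^sub>M} = insert x X"
   define f where "f = g(x := \<zero>\<^sub>M)"
   have fs: "{b. f b \<noteq> \<zero>\<^sub>M} = X" using s insert(2) by (auto simp: f_def)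
   have f: "f \<in> dsum M B"
    by (rule dsumI) (use dsumD[OF g] insert(1) fs in \<open>auto simp: f_def\<close>)
   have "P f" using insert f fs by blast
   moreover have "x \<in> B" using s dsum_supp[OF g] by auto
   ultimately have "P (\<lambda>c. sing M x (g x) c \<oplus>\<^sub>M f c)" using add f dsum_val[OF g] by blast
   moreover have "(\<lambda>c. sing M x (g x) c \<oplus>\<^sub>M f c) = g"
    using dsum_val[OF g] by (auto simp: sing_def f_def)
   ultimately show "P g" by simp
  qed
 qed
 from this[OF dsum_fin[OF assms(2)]] show ?thesis using assms(2) by blast
qed

lemma dsum_hom_eq:
 assumes "module R M" "module R N" "f \<in> mod_hom R (dsum M B) N" "g \<in> mod_hom R (dsum M B) N"
  and eq: "!!b y. b \<in> B ==> y \<in> M ==> f (sing M b y) = g (sing M b y)"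
  and x: "x \<in> dsum M B"
 shows "f x = g x"
 using assms(1) x
proof (induction x rule: dsum_induct)
 case zero
 show ?case
  using mod_hom_zero[OF dsum_module[OF assms(1)] assms(2) assms(3)]
   mod_hom_zero[OF dsum_module[OF assms(1)] assms(2) assms(4)] by simp
next
 case (add b y h)
 note * = sing_closed[OF assms(1) add(1,2)]
 show ?case using mod_hom_add[OF assms(3) * add(3)] mod_hom_add[OF assms(4) * add(3)] eq[OF add(1,2)] add(4)
  by simp
qed

definition lext :: "('r, 'm, 'd) module_scheme => ('r, 'n, 'e) module_scheme => ('b => 'm => 'n) =>
  ('b => 'm) => 'n"
 where "lext M N \<phi> f = (\<Oplus>\<^sub>N b\<in>{b. f b \<noteq> \<zero>\<^sub>M}. \<phi> b (f b))"

lemma lin_ext_eq_lext: "lin_ext R N \<mu> = lext (reg R) N (\<lambda>b r. r \<odot>\<^sub>N \<mu> b)"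
 by (simp add: lin_ext_def lext_def fun_eq_iff)

text \<open>Sums over the supports of f, g and f + g become comparable once all are taken over one
  finite set.\<close>

lemma lext_superset:
 assumes "module R M" "module R N" "f \<in> dsum M B"
  and "!!b. b \<in> B ==> \<phi> b \<in> mod_hom R M N" "finite X" "{b. f b \<noteq> \<zero>\<^sub>M} \<subseteq> X" "X \<subseteq> B"
 shows "lext M N \<phi> f = (\<Oplus>\<^sub>N b\<in>X. \<phi> b (f b))"
proof -
 interpret N: module R N by fact
 show ?thesis
  unfolding lext_def
  using assms(5-7) mod_hom_zero[OF assms(1,2) assms(4)] mod_hom_closed[OF assms(4)] dsum_val[OF assms(3)]
  by (intro N.add.finprod_mono_neutral_cong_left) (auto simp: subset_iff)
qed

lemma lext_hom:
 assumes "module R M" "module R N" and \<phi>: "!!b. b \<in> B ==> \<phi> b \<in> mod_hom R M N"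
 shows "lext M N \<phi> \<in> mod_hom R (dsum M B) N"
proof -
 interpret M: module R M by fact
 interpret N: module R N by fact
 interpret D: module R "dsum M B" by (rule dsum_module[OF assms(1)])
 show ?thesis
 proof (rule mod_homI)
  fix f assume f: "f \<in> dsum M B"
  show "lext M N \<phi> f \<in> N"
   unfolding lext_def using dsumD[OF f] mod_hom_closed[OF \<phi>] by (intro N.finsum_closed) auto
  fix g assume g: "g \<in> dsum M B"
  let ?X = "{b. f b \<noteq> \<zero>\<^sub>M} \<union> {b. g b \<noteq> \<zero>\<^sub>M}"
  have X: "finite ?X" "?X \<subseteq> B" using dsumD[OF f] dsumD[OF g] by auto
  have fg: "f \<oplus>\<^bsub>dsum M B\<^esub> g \<in> dsum M B" using f g by (rule D.a_closed)
  have "lext M N \<phi> (f \<oplus>\<^bsub>dsum M B\<^esub> g) = (\<Oplus>\<^sub>N b\<in>?X. \<phi> b ((f \<oplus>\<^bsub>dsum M B\<^esub> g) b))"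
   by (rule lext_superset[OF assms(1,2) fg \<phi> X(1) _ X(2)]) auto
  also have "\<dots> = (\<Oplus>\<^sub>N b\<in>?X. \<phi> b (f b) \<oplus>\<^sub>N \<phi> b (g b))"
   using X dsum_val[OF f] dsum_val[OF g] mod_hom_closed[OF \<phi>] mod_hom_add[OF \<phi>]
   by (intro N.finsum_cong') auto
  also have "\<dots> = (\<Oplus>\<^sub>N b\<in>?X. \<phi> b (f b)) \<oplus>\<^sub>N (\<Oplus>\<^sub>N b\<in>?X. \<phi> b (g b))"
   using X dsum_val[OF f] dsum_val[OF g] mod_hom_closed[OF \<phi>]
   by (intro N.finsum_addf) auto
  also have "(\<Oplus>\<^sub>N b\<in>?X. \<phi> b (f b)) = lext M N \<phi> f"
   by (rule lext_superset[OF assms(1,2) f \<phi> X(1) _ X(2), symmetric]) auto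
  also have "(\<Oplus>\<^sub>N b\<in>?X. \<phi> b (g b)) = lext M N \<phi> g"
   by (rule lext_superset[OF assms(1,2) g \<phi> X(1) _ X(2), symmetric]) auto
  finally show "lext M N \<phi> (f \<oplus>\<^bsub>dsum M B\<^esub> g) = lext M N \<phi> f \<oplus>\<^sub>N lext M N \<phi> g" .
 next
  fix r f assume r: "r \<in> R" and f: "f \<in> dsum M B"
  let ?X = "{b. f b \<noteq> \<zero>\<^sub>M}"
  have X: "finite ?X" "?X \<subseteq> B" using dsumD[OF f] by auto
  have rf: "r \<odot>\<^bsub>dsum M B\<^esub> f \<in> dsum M B" using r f by (rule D.smult_closed)
  have "lext M N \<phi> (r \<odot>\<^bsub>dsum M B\<^esub> f) = (\<Oplus>\<^sub>N b\<in>?X. \<phi> b ((r \<odot>\<^bsub>dsum M B\<^esub> f) b))"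
   by (rule lext_superset[OF assms(1,2) rf \<phi> X(1) _ X(2)]) (use r in auto)
  also have "\<dots> = (\<Oplus>\<^sub>N b\<in>?X. r \<odot>\<^sub>N \<phi> b (f b))"
   using X r dsum_val[OF f] mod_hom_closed[OF \<phi>] mod_hom_smult[OF \<phi>]
   by (intro N.finsum_cong') auto
  also have "\<dots> = r \<odot>\<^sub>N lext M N \<phi> f"
   unfolding lext_def using X r dsum_val[OF f] mod_hom_closed[OF \<phi>]
   by (intro N.finsum_smult_ldistr[symmetric]) auto
  finally show "lext M N \<phi> (r \<odot>\<^bsub>dsum M B\<^esub> f) = r \<odot>\<^sub>N lext M N \<phi> f" .
 qed
qed

lemma lext_sing:
 assumes "module R M" "module R N" and \<phi>: "\<phi> b \<in> mod_hom R M N" and y: "y \<in> M"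
 shows "lext M N \<phi> (sing M b y) = \<phi> b y"
proof -
 interpret N: module R N by fact
 have "lext M N \<phi> (sing M b y) = (\<Oplus>\<^sub>N c\<in>{b}. \<phi> c (sing M b y c))"
  by (rule lext_superset[OF assms(1,2) sing_closed[OF assms(1) _ y, of b "{b}"]])
   (use \<phi> in \<open>auto simp: sing_def\<close>)
 then show ?thesis using mod_hom_closed[OF \<phi> y] by (simp add: sing_def)
qed

lemma lext_comp:
 assumes "module R M" "module R N" "module R K" and \<phi>: "!!b. b \<in> B ==> \<phi> b \<in> mod_hom R M N"
  and h: "h \<in> mod_hom R N K" and f: "f \<in> dsum M B"
 shows "h (lext M N \<phi> f) = lext M K (\<lambda>b y. h (\<phi> b y)) f"
proof (rule dsum_hom_eq[OF assms(1,3) mod_hom_comp[OF lext_hom[OF assms(1,2) \<phi>] h] _ _ f])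
 note h\<phi> = mod_hom_comp[OF \<phi> h]
 show "lext M K (\<lambda>b y. h (\<phi> b y)) \<in> mod_hom R (dsum M B) K" by (rule lext_hom[OF assms(1,3) h\<phi>])
 show "h (lext M N \<phi> (sing M b y)) = lext M K (\<lambda>b y. h (\<phi> b y)) (sing M b y)"
  if "b \<in> B" "y \<in> M" for b y
  using lext_sing[where \<phi> = \<phi>, OF assms(1,2) \<phi>] lext_sing[where \<phi> = "\<lambda>b y. h (\<phi> b y)", OF assms(1,3) h\<phi>] that by simp
qed auto

lemma dsum_eval_hom:
 assumes "module R M"
 shows "(\<lambda>f. f b) \<in> mod_hom R (dsum M B) M"
 by (rule mod_homI) (auto simp: dsum_val)

lemma dsum_map_hom:
 assumes "module R M" "module R N" "h \<in> mod_hom R M N"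
 shows "(\<lambda>f b. h (f b)) \<in> mod_hom R (dsum M B) (dsum N B)"
proof (rule mod_homI)
 fix f assume f: "f \<in> dsum M B"
 show "(\<lambda>b. h (f b)) \<in> dsum N B"
  by (rule dsumI_superset[of _ _ "{b. f b \<noteq> \<zero>\<^sub>M}"])
   (use dsumD[OF f] mod_hom_closed[OF assms(3)] mod_hom_zero[OF assms] in auto)
qed (auto simp: dsum_val mod_homD[OF assms(3)])

lemma dsum_map_lift:
 assumes "module R M" "module R N" "h \<in> mod_hom R M N"
  and g: "g \<in> dsum N B" and "!!b. b \<in> B ==> g b \<in> h ` carrier M"
 obtains f where "f \<in> dsum M B" "!!b. h (f b) = g b"
proof -
 interpret M: module R M by fact
 define f where "f b = (if g b = \<zero>\<^sub>N then \<zero>\<^sub>M else SOME x. x \<in> M \<and> h x = g b)" for b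
 have *: "f b \<in> M \<and> h (f b) = g b" for b
 proof (cases "g b = \<zero>\<^sub>N")
  case True
  then show ?thesis using mod_hom_zero[OF assms(1-3)] by (simp add: f_def)
 next
  case False
  then have "\<exists>x. x \<in> M \<and> h x = g b" using assms(5)[of b] dsum_out[OF g] by force
  from someI_ex[OF this] show ?thesis using False by (simp add: f_def)
 qed
 have "f \<in> dsum M B"
  by (rule dsumI_superset[of _ _ "{b. g b \<noteq> \<zero>\<^sub>N}"]) (use * dsumD[OF g] in \<open>auto simp: f_def\<close>)
 then show ?thesis using that * by blast
qed

section \<open>Matrices with finitely supported rows and the maps they induce\<close>

definition rmat :: "('r, 'c) ring_scheme => 'b set => 'x set => ('b => 'x => 'r) => bool"
 where "rmat R B C A \<longleftrightarrow> (\<forall>b\<in>B. A b \<in> free_module R C)"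

lemma rmat_row: "rmat R B C A ==> b \<in> B ==> A b \<in> free_module R C"
 by (simp add: rmat_def)

lemma rmat_entry:
 assumes "rmat R B C A" "b \<in> B"
 shows "A b c \<in> carrier R"
 using dsum_val[OF rmat_row[OF assms, unfolded free_eq_dsum]] by simp

text \<open>The map M^(B) -> M^(C) obtained by tensoring M with the map of free modules given by A,
  written so that no tensor product has to be formed.\<close>

definition push :: "('r, 'm, 'd) module_scheme => 'x set => ('b => 'x => 'r) => ('b => 'm) => 'x => 'm"
 where "push M C A = lext M (dsum M C) (\<lambda>b y c. A b c \<odot>\<^sub>M y)"

abbreviation bd where "bd N B A i \<equiv> push N (B i) (A i)"

lemma row_hom:
 assumes "module R M" "a \<in> free_module R C"
 shows "(\<lambda>y c. a c \<odot>\<^sub>M y) \<in> mod_hom R M (dsum M C)"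
proof -
 interpret M: module R M by fact
 note a = dsumD[OF assms(2)[unfolded free_eq_dsum], simplified]
 show ?thesis
 proof (rule mod_homI)
  show "(\<lambda>c. a c \<odot>\<^sub>M y) \<in> dsum M C" if "y \<in> M" for y
   by (rule dsumI_superset[of _ _ "{c. a c \<noteq> \<zero>\<^sub>R}"]) (use a that in auto)
 qed (auto simp: a M.smult_r_distr fun_eq_iff M.smult_assoc1[symmetric] M.R.m_comm)
qed

lemma push_hom:
 assumes "module R M" "rmat R B C A"
 shows "push M C A \<in> mod_hom R (dsum M B) (dsum M C)"
 unfolding push_def
 using assms by (intro lext_hom dsum_module row_hom) (auto simp: rmat_def)

lemma push_sing:
 assumes "module R M" "rmat R B C A" "b \<in> B" "y \<in> M"
 shows "push M C A (sing M b y) = (\<lambda>c. A b c \<odot>\<^sub>M y)"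
 unfolding push_def
 by (rule lext_sing[OF assms(1) dsum_module[OF assms(1)] _ assms(4)])
  (use assms in \<open>auto simp: rmat_def intro: row_hom\<close>)

lemma scale_hom:
 assumes "module R M" "a \<in> carrier R"
 shows "(\<lambda>y. a \<odot>\<^sub>M y) \<in> mod_hom R M M"
 using mod_hom_scale[OF assms(1) mod_hom_id assms(2)] .

lemma push_apply:
 assumes "module R M" "rmat R B C A" "f \<in> dsum M B"
 shows "push M C A f c = lext M M (\<lambda>b y. A b c \<odot>\<^sub>M y) f"
 unfolding push_def
 by (rule lext_comp[OF assms(1) dsum_module[OF assms(1)] assms(1) _ dsum_eval_hom[OF assms(1)] assms(3)])
  (use assms in \<open>auto simp: rmat_def intro: row_hom\<close>)

lemma lin_ext_hom:
 assumes "module R N" "!!b. b \<in> B ==> \<mu> b \<in> N"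
 shows "lin_ext R N \<mu> \<in> mod_hom R (free_module R B) N"
proof -
 interpret N: module R N by fact
 show ?thesis
  unfolding lin_ext_eq_lext free_eq_dsum
  by (rule lext_hom[OF reg_module[OF N.is_cring] assms(1)])
   (auto intro!: mod_homI simp: assms(2) N.smult_l_distr N.smult_assoc1)
qed

lemma lin_ext_sing:
 assumes "module R N" "\<mu> b \<in> N" "r \<in> carrier R"
 shows "lin_ext R N \<mu> (sing (reg R) b r) = r \<odot>\<^sub>N \<mu> b"
proof -
 interpret N: module R N by fact
 show ?thesis
  unfolding lin_ext_eq_lext
  by (rule lext_sing[OF reg_module[OF N.is_cring] assms(1)])
   (auto intro!: mod_homI simp: assms N.smult_l_distr N.smult_assoc1)
qed

lemma free_hom_eq:
 assumes "module R N" "f \<in> mod_hom R (free_module R B) N" "g \<in> mod_hom R (free_module R B) N"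
  and eq: "!!b. b \<in> B ==> f (basis_elt R b) = g (basis_elt R b)"
  and x: "x \<in> free_module R B"
 shows "f x = g x"
proof -
 interpret N: module R N by fact
 have S: "module R (reg R)" by (rule reg_module[OF N.is_cring])
 have *: "h (sing (reg R) b r) = r \<odot>\<^sub>N h (basis_elt R b)"
  if h: "h \<in> mod_hom R (free_module R B) N" and b: "b \<in> B" and r: "r \<in> R" for h b r
 proof -
  have "sing (reg R) b r = r \<odot>\<^bsub>free_module R B\<^esub> basis_elt R b"
   using r by (simp add: sing_def basis_elt_def free_eq_dsum fun_eq_iff)
  moreover have "basis_elt R b \<in> free_module R B"
   unfolding basis_elt_eq_sing free_eq_dsum using sing_closed[OF S b] by simp
  ultimately show ?thesis using mod_hom_smult[OF h r] by simp
 qed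
 show ?thesis
  by (rule dsum_hom_eq[OF S assms(1) assms(2,3)[unfolded free_eq_dsum] _ x[unfolded free_eq_dsum]])
   (simp_all add: *[OF assms(2)] *[OF assms(3)] eq)
qed

lemma basis_elt_closed:
 assumes "cring R" "b \<in> B"
 shows "basis_elt R b \<in> free_module R B"
 unfolding basis_elt_eq_sing free_eq_dsum
 using sing_closed[OF reg_module[OF assms(1)] assms(2)] cring.cring_simprules(6)[OF assms(1)] by simp

lemma lin_ext_basis:
 assumes "module R N" "\<mu> b \<in> N"
 shows "lin_ext R N \<mu> (basis_elt R b) = \<mu> b"
proof -
 interpret N: module R N by fact
 show ?thesis using lin_ext_sing[of R N \<mu> b "\<one>\<^sub>R"] assms by (simp add: basis_elt_eq_sing)
qed

lemma free_module_module: "cring R ==> module R (free_module R B)"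
 unfolding free_eq_dsum by (intro dsum_module reg_module)

text \<open>Connects the differentials of the definitions, which are linear extensions of rows, with
  \<open>push\<close> for M = R.\<close>

lemma lin_ext_free:
 assumes "cring R" "rmat R B C A" "f \<in> free_module R B"
 shows "lin_ext R (free_module R C) A f = push (reg R) C A f"
proof (rule free_hom_eq[OF free_module_module[OF assms(1)] _ _ _ assms(3)])
 have S: "module R (reg R)" by (rule reg_module[OF assms(1)])
 show "lin_ext R (free_module R C) A \<in> mod_hom R (free_module R B) (free_module R C)"
  using assms(2) by (intro lin_ext_hom free_module_module[OF assms(1)]) (auto simp: rmat_def)
 show "push (reg R) C A \<in> mod_hom R (free_module R B) (free_module R C)"
  unfolding free_eq_dsum by (rule push_hom[OF S assms(2)])
 interpret cring R by fact
 fix b assume b: "b \<in> B"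
 then have A: "A b \<in> free_module R C" using assms(2) by (simp add: rmat_def)
 show "lin_ext R (free_module R C) A (basis_elt R b) = push (reg R) C A (basis_elt R b)"
  using lin_ext_basis[where \<mu> = A and b = b, OF free_module_module[OF assms(1)] A] push_sing[OF S assms(2) b, of "\<one>\<^sub>R"]
   dsum_val[OF A[unfolded free_eq_dsum]]
  by (simp add: basis_elt_eq_sing)
qed

lemma lin_ext_comp:
 assumes "module R N" "rmat R B C A" "!!c. c \<in> C ==> e c \<in> N" "f \<in> free_module R B"
 shows "lin_ext R N e (lin_ext R (free_module R C) A f) = lin_ext R N (\<lambda>b. lin_ext R N e (A b)) f"
proof -
 interpret N: module R N by fact
 have F: "module R (free_module R C)" by (rule free_module_module[OF N.is_cring])
 have A: "!!b. b \<in> B ==> A b \<in> free_module R C" using assms(2) by (simp add: rmat_def)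
 have e: "lin_ext R N e \<in> mod_hom R (free_module R C) N" by (rule lin_ext_hom[OF assms(1,3)])
 show ?thesis
 proof (rule free_hom_eq[OF assms(1) mod_hom_comp[OF lin_ext_hom[OF F A] e] _ _ assms(4)])
  show "lin_ext R N (\<lambda>b. lin_ext R N e (A b)) \<in> mod_hom R (free_module R B) N"
   by (rule lin_ext_hom[OF assms(1)]) (rule mod_hom_closed[OF e A])
  fix b assume b: "b \<in> B"
  show "lin_ext R N e (lin_ext R (free_module R C) A (basis_elt R b)) =
    lin_ext R N (\<lambda>b. lin_ext R N e (A b)) (basis_elt R b)"
   using A[OF b] mod_hom_closed[OF e A[OF b]]
    lin_ext_basis[where \<mu> = A, OF F] lin_ext_basis[where \<mu> = "\<lambda>b. lin_ext R N e (A b)", OF assms(1)]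
   by simp
 qed (use A in auto)
qed

lemma lin_ext_superset:
 assumes "module R N" "f \<in> free_module R B" "!!b. b \<in> B ==> e b \<in> N"
  "finite X" "{b. f b \<noteq> \<zero>\<^sub>R} \<subseteq> X" "X \<subseteq> B"
 shows "lin_ext R N e f = (\<Oplus>\<^sub>N b\<in>X. f b \<odot>\<^sub>N e b)"
proof -
 interpret N: module R N by fact
 note f = dsumD[OF assms(2)[unfolded free_eq_dsum], simplified]
 show ?thesis
  unfolding lin_ext_def
  using assms(3-6) f by (intro N.add.finprod_mono_neutral_cong_left) (auto simp: subset_iff)
qed

lemma lin_ext_natural:
 assumes "module R M" "module R N" "h \<in> mod_hom R M N" "f \<in> free_module R B"
  "!!b. b \<in> B ==> e b \<in> M"
 shows "lin_ext R N (\<lambda>b. h (e b)) f = h (lin_ext R M e f)"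
proof -
 interpret M: module R M by fact
 interpret N: module R N by fact
 have he: "!!b. b \<in> B ==> h (e b) \<in> N" using mod_hom_closed[OF assms(3,5)] .
 show ?thesis
  by (rule free_hom_eq[OF assms(2) lin_ext_hom[OF assms(2) he] mod_hom_comp[OF lin_ext_hom[OF assms(1,5)] assms(3)] _ assms(4)])
   (auto simp: lin_ext_basis[OF assms(1)] lin_ext_basis[OF assms(2)] assms(5) he)
qed

lemma lin_ext_sum_right:
 assumes "module R N" "f \<in> free_module R B"
  "!!b. b \<in> B ==> e b \<in> N" "!!b. b \<in> B ==> e' b \<in> N"
 shows "lin_ext R N (\<lambda>b. e b \<oplus>\<^sub>N e' b) f = lin_ext R N e f \<oplus>\<^sub>N lin_ext R N e' f"
proof -
 interpret N: module R N by fact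
 have s: "!!b. b \<in> B ==> e b \<oplus>\<^sub>N e' b \<in> N" using assms(3,4) by simp
 show ?thesis
  by (rule free_hom_eq[OF assms(1) lin_ext_hom[OF assms(1) s]
     mod_hom_sum[OF assms(1) lin_ext_hom[OF assms(1,3)] lin_ext_hom[OF assms(1,4)]] _ assms(2)])
   (auto simp: lin_ext_basis[OF assms(1)] assms(3,4))
qed

lemma lin_ext_cong:
 assumes "f \<in> free_module R B" "module R N" "!!b. b \<in> B ==> e b = e' b"
  "!!b. b \<in> B ==> e' b \<in> N"
 shows "lin_ext R N e f = lin_ext R N e' f"
proof -
 interpret N: module R N by fact
 note f = dsumD[OF assms(1)[unfolded free_eq_dsum], simplified]
 show ?thesis unfolding lin_ext_def using f assms(3,4) by (intro N.finsum_cong') (auto simp: subset_iff)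
qed

text \<open>Used with h = (r -> r y) to reduce identities over M to identities over R, with h a
  coordinate projection to work one coordinate at a time, and with the maps of a resolution to
  obtain the commuting squares of a double complex.\<close>

lemma push_natural:
 assumes "module R M" "module R N" "h \<in> mod_hom R M N" "rmat R B C A" "f \<in> dsum M B"
 shows "push N C A (\<lambda>b. h (f b)) = (\<lambda>c. h (push M C A f c))"
proof -
 interpret M: module R M by fact
 interpret N: module R N by fact
 have A: "!!b c. b \<in> B ==> A b c \<in> R" using rmat_entry[OF assms(4)] by blast
 note m = dsum_map_hom[OF assms(1-3)]
 have "push N C A (\<lambda>b. h (f b)) = (\<lambda>f c. h (f c)) (push M C A f)"
 proof (rule dsum_hom_eq[OF assms(1) dsum_module[OF assms(2)] mod_hom_comp[OF m push_hom[OF assms(2,4)]]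
    mod_hom_comp[OF push_hom[OF assms(1,4)] m] _ assms(5)])
  fix b y assume b: "b \<in> B" and y: "y \<in> M"
  have "(\<lambda>c. h (sing M b y c)) = sing N b (h y)"
   using mod_hom_zero[OF assms(1-3)] by (auto simp: sing_def)
  then show "push N C A (\<lambda>c. h (sing M b y c)) = (\<lambda>c. h (push M C A (sing M b y) c))"
   using push_sing[OF assms(1,4) b y] push_sing[OF assms(2,4) b mod_hom_closed[OF assms(3) y]] y A[OF b]
    mod_hom_smult[OF assms(3)] by simp
 qed
 then show ?thesis .
qed

text \<open>Being a complex is a condition on the rows over R, and the maps r -> r y carry it to any
  coefficient module.\<close>

lemma push_comp_zero:
 assumes M: "module R M" and A: "rmat R B C A" and A': "rmat R C D A'"
  and z: "!!b. b \<in> B ==> push (reg R) D A' (A b) = zf R"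
  and f: "f \<in> dsum M B"
 shows "push M D A' (push M C A f) = zf M"
proof -
 interpret M: module R M by fact
 have S: "module R (reg R)" by (rule reg_module[OF M.is_cring])
 have DM: "module R (dsum M D)" by (rule dsum_module[OF M])
 interpret D: module R "dsum M D" by (rule DM)
 have zero: "(\<lambda>f d. \<zero>\<^sub>M) \<in> mod_hom R (dsum M B) (dsum M D)"
  by (rule mod_homI) (auto intro: dsumI)
 show ?thesis
 proof (rule dsum_hom_eq[OF M DM mod_hom_comp[OF push_hom[OF M A] push_hom[OF M A']] zero _ f])
  fix b y assume b: "b \<in> B" and y: "y \<in> M"
  have Ab: "A b \<in> fmod R C" using A b by (simp add: rmat_def free_eq_dsum)
  have h: "(\<lambda>r. r \<odot>\<^sub>M y) \<in> mod_hom R (reg R) M"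
   using y by (intro mod_homI) (auto simp: M.smult_l_distr M.smult_assoc1)
  have "push M D A' (\<lambda>c. A b c \<odot>\<^sub>M y) = zf M"
   using push_natural[OF S M h A' Ab] z[OF b] y by simp
  then show "push M D A' (push M C A (sing M b y)) = zf M" using push_sing[OF M A b y] by simp
 qed
qed

section \<open>Arbitrary families and the dual action of matrices\<close>

definition dprod :: "('r, 'm, 'd) module_scheme => 'b set => ('b => 'm) set"
 where "dprod M B = {f. range f \<subseteq> carrier M \<and> {b. f b \<noteq> \<zero>\<^sub>M} \<subseteq> B}"

text \<open>This is Hom(A, M) from M^C to M^B. Rows are finitely supported, so it is defined on
  arbitrary families even when C is infinite.\<close>

definition pull :: "('r, 'c) ring_scheme => ('r, 'm, 'd) module_scheme => 'b set => ('b => 'x => 'r) =>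
  ('x => 'm) => 'b => 'm"
 where "pull R M B A e = (\<lambda>b. if b \<in> B then lin_ext R M e (A b) else \<zero>\<^sub>M)"

abbreviation cobd where "cobd R N B A i \<equiv> pull R N (B (Suc i)) (A i)"

lemma dprodI:
 "(!!b. f b \<in> carrier M) ==> (!!b. b \<notin> B ==> f b = \<zero>\<^sub>M) ==> f \<in> dprod M B"
 by (auto simp: dprod_def)

lemma dprodD:
 assumes "f \<in> dprod M B"
 shows dprod_val: "f b \<in> carrier M" and dprod_out: "b \<notin> B ==> f b = \<zero>\<^sub>M"
 using assms by (auto simp: dprod_def)

lemma dsum_finite: "finite B ==> carrier (dsum M B) = dprod M B"
 by (auto simp: dsum_def dprod_def intro: finite_subset)

lemma pull_closed:
 assumes "module R M" "rmat R B C A" "e \<in> dprod M C"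
 shows "pull R M B A e \<in> dprod M B"
proof -
 interpret M: module R M by fact
 show ?thesis
  using mod_hom_closed[OF lin_ext_hom[OF assms(1)], of C e] assms(2) dprod_val[OF assms(3)]
  by (intro dprodI) (auto simp: pull_def rmat_def)
qed

lemma pull_natural:
 assumes "module R M" "module R N" "h \<in> mod_hom R M N" "rmat R B C A" "!!c. e c \<in> M"
 shows "pull R N B A (\<lambda>c. h (e c)) = (\<lambda>b. h (pull R M B A e b))"
proof
 fix b
 show "pull R N B A (\<lambda>c. h (e c)) b = h (pull R M B A e b)"
  using lin_ext_natural[OF assms(1-3) rmat_row[OF assms(4)], of b e] assms(5) mod_hom_zero[OF assms(1-3)]
  by (simp add: pull_def)
qed

lemma pull_add:
 assumes "module R M" "rmat R B C A" "!!c. e c \<in> M" "!!c. e' c \<in> M"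
 shows "pull R M B A (\<lambda>c. e c \<oplus>\<^sub>M e' c) = (\<lambda>b. pull R M B A e b \<oplus>\<^sub>M pull R M B A e' b)"
proof -
 interpret M: module R M by fact
 show ?thesis
 proof
  fix b
  show "pull R M B A (\<lambda>c. e c \<oplus>\<^sub>M e' c) b = pull R M B A e b \<oplus>\<^sub>M pull R M B A e' b"
   using lin_ext_sum_right[OF assms(1) rmat_row[OF assms(2)], of b e e'] assms(3,4) by (simp add: pull_def)
 qed
qed

lemma pull_scale:
 assumes "module R M" "rmat R B C A" "!!c. e c \<in> M" "r \<in> carrier R"
 shows "pull R M B A (\<lambda>c. r \<odot>\<^sub>M e c) = (\<lambda>b. r \<odot>\<^sub>M pull R M B A e b)"
 using pull_natural[OF assms(1,1) scale_hom[OF assms(1,4)] assms(2,3)] .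

lemma pull_minus:
 assumes "module R M" "rmat R B C A" "!!c. e c \<in> M" "!!c. e' c \<in> M"
 shows "pull R M B A (\<lambda>c. e c \<ominus>\<^sub>M e' c) = (\<lambda>b. pull R M B A e b \<ominus>\<^sub>M pull R M B A e' b)"
proof -
 interpret M: module R M by fact
 have n: "(\<lambda>x. \<ominus>\<^sub>M x) \<in> mod_hom R M M"
  by (rule mod_homI) (auto simp: M.minus_add M.a_ac M.smult_r_minus)
 show ?thesis
  unfolding a_minus_def
  using pull_add[OF assms(1,2,3), of "\<lambda>c. \<ominus>\<^sub>M e' c"] pull_natural[OF assms(1,1) n assms(2,4)] assms(4) by simp
qed

lemma pull_comp_zero:
 assumes M: "module R M" and A: "rmat R B C A" and A': "rmat R C D A'"
  and z: "!!b. b \<in> B ==> lin_ext R (free_module R D) A' (A b) = zf R"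
  and e: "!!d. e d \<in> M"
 shows "pull R M B A (pull R M C A' e) = zf M"
proof
 interpret M: module R M by fact
 fix b
 show "pull R M B A (pull R M C A' e) b = \<zero>\<^sub>M"
 proof (cases "b \<in> B")
  case True
  then have Ab: "A b \<in> free_module R C" using A by (simp add: rmat_def)
  have F: "module R (free_module R D)" by (rule free_module_module[OF M.is_cring])
  have cl: "lin_ext R M e (A' c) \<in> M" if "c \<in> C" for c
   using mod_hom_closed[OF lin_ext_hom[OF M, of D e]] A' that e by (simp add: rmat_def)
  have "lin_ext R M (pull R M C A' e) (A b) = lin_ext R M (\<lambda>c. lin_ext R M e (A' c)) (A b)"
   by (rule lin_ext_cong[OF Ab M]) (auto simp: pull_def cl)
  also have "\<dots> = lin_ext R M e (zf R)"
   using lin_ext_comp[OF M A' e Ab, symmetric] z[OF True] by simp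
  also have "\<dots> = \<zero>\<^sub>M" by (simp add: lin_ext_def)
  finally show ?thesis using True by (simp add: pull_def)
 qed (simp add: pull_def)
qed

lemma pull_hom:
 assumes N: "module R N" and A: "rmat R B C A" and fin: "finite B" "finite C"
 shows "pull R N B A \<in> mod_hom R (dsum N C) (dsum N B)"
proof (rule mod_homI)
 note d = dsum_finite[OF fin(1)] dsum_finite[OF fin(2)]
 show "pull R N B A e \<in> dsum N B" if "e \<in> dsum N C" for e
  using pull_closed[OF N A] that unfolding d by blast
qed (auto simp: pull_add[OF N A] pull_scale[OF N A] dsum_val)

text \<open>Between finite bases sum and product coincide, and \<open>push\<close> is
  \<open>pull\<close> along the transposed matrix. The test b \<in> B masks the values A b for b
  outside B, on which \<open>rmat\<close> is silent.\<close>

lemma push_eq_pull: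
 assumes M: "module R M" and A: "rmat R B C A" and fin: "finite B" "finite C" and f: "f \<in> dsum M B"
 shows "push M C A f = pull R M C (\<lambda>c b. if b \<in> B then A b c else \<zero>\<^sub>R) f"
proof
 interpret M: module R M by fact
 fix c
 have Ac: "A b c \<in> R" "c \<notin> C ==> A b c = \<zero>\<^sub>R" if "b \<in> B" for b
  using rmat_entry[OF A that] dsum_out[OF rmat_row[OF A that, unfolded free_eq_dsum]] by simp_all
 have "push M C A f c = lext M M (\<lambda>b y. A b c \<odot>\<^sub>M y) f" by (rule push_apply[OF M A f])
 also have "\<dots> = (\<Oplus>\<^sub>M b\<in>B. A b c \<odot>\<^sub>M f b)"
  by (rule lext_superset[OF M M f scale_hom[OF M Ac(1)] fin(1) dsum_supp[OF f]]) auto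
 also have "\<dots> = pull R M C (\<lambda>c b. if b \<in> B then A b c else \<zero>\<^sub>R) f c"
 proof (cases "c \<in> C")
  case True
  have row: "(\<lambda>b. if b \<in> B then A b c else \<zero>\<^sub>R) \<in> free_module R B"
   unfolding free_eq_dsum by (rule dsumI_superset[OF _ _ fin(1)]) (use Ac in auto)
  have "lin_ext R M f (\<lambda>b. if b \<in> B then A b c else \<zero>\<^sub>R) =
    (\<Oplus>\<^sub>M b\<in>B. (if b \<in> B then A b c else \<zero>\<^sub>R) \<odot>\<^sub>M f b)"
   by (rule lin_ext_superset[OF M row _ fin(1)]) (use dsum_val[OF f] in auto)
  also have "\<dots> = (\<Oplus>\<^sub>M b\<in>B. A b c \<odot>\<^sub>M f b)"
   using Ac dsum_val[OF f] by (intro M.finsum_cong') auto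
  finally show ?thesis using True by (simp add: pull_def)
 next
  case False
  then have "(\<Oplus>\<^sub>M b\<in>B. A b c \<odot>\<^sub>M f b) = \<zero>\<^sub>M"
   using Ac dsum_val[OF f] by (intro M.add.finprod_one_eqI) simp
  then show ?thesis using False by (simp add: pull_def)
 qed
 finally show "push M C A f c = pull R M C (\<lambda>c b. if b \<in> B then A b c else \<zero>\<^sub>R) f c" .
qed

section \<open>Quotient modules and homology\<close>

lemma (in abelian_group) a_inv_zero [simp]: "\<ominus> \<zero> = \<zero>"
 by (simp add: a_inv_def)

lemma (in abelian_group) a_minus_zero [simp]: "x \<in> carrier G ==> x \<ominus> \<zero> = x"
 by (simp add: a_minus_def)

lemma (in abelian_group) a_minus_self [simp]: "x \<in> carrier G ==> x \<ominus> x = \<zero>"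
 by (simp add: a_minus_def r_neg)

lemma (in module) submodule_abelian_subgroup:
 assumes "submodule H R M"
 shows "abelian_subgroup H M"
 by (rule abelian_subgroupI3[OF _ M.abelian_group_axioms])
  (rule additive_subgroup.intro, rule submodule.axioms(1)[OF assms])

lemma coset_eq_iff:
 assumes "module R M" "submodule H R M" "x \<in> M" "y \<in> M"
 shows "H +>\<^sub>M x = H +>\<^sub>M y \<longleftrightarrow> x \<ominus>\<^sub>M y \<in> H"
proof -
 interpret M: module R M by fact
 interpret H: abelian_subgroup H M by (rule M.submodule_abelian_subgroup[OF assms(2)])
 show ?thesis
  using H.a_rcos_module[OF assms(4,3)] H.a_repr_independence'[of x y] H.a_rcos_self[OF assms(3)] assms(3,4)
  unfolding a_minus_def by metis
qed

lemma coset_zero_iff: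
 assumes "module R M" "submodule H R M" "x \<in> M"
 shows "H +>\<^sub>M x = H \<longleftrightarrow> x \<in> H"
proof -
 interpret M: module R M by fact
 interpret H: abelian_subgroup H M by (rule M.submodule_abelian_subgroup[OF assms(2)])
 have "H +>\<^sub>M \<zero>\<^sub>M = H" using M.a_coset_add_zero H.a_subset by blast
 then show ?thesis
  using coset_eq_iff[OF assms(1-3), of "\<zero>\<^sub>M"] assms(3) by simp
qed

lemma coset_self:
 assumes "module R M" "submodule H R M" "x \<in> M"
 shows "x \<in> H +>\<^sub>M x"
proof -
 interpret M: module R M by fact
 interpret H: abelian_subgroup H M by (rule M.submodule_abelian_subgroup[OF assms(2)])
 show ?thesis by (rule H.a_rcos_self[OF assms(3)])
qed

lemma coset_memD:
 assumes "module R M" "submodule H R M" "x \<in> M" "y \<in> H +>\<^sub>M x"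
 shows "y \<in> M" "H +>\<^sub>M y = H +>\<^sub>M x"
proof -
 interpret M: module R M by fact
 interpret H: abelian_subgroup H M by (rule M.submodule_abelian_subgroup[OF assms(2)])
 show "y \<in> M" using H.a_elemrcos_carrier[OF assms(3,4)] .
 show "H +>\<^sub>M y = H +>\<^sub>M x" using H.a_repr_independence'[OF assms(4,3)] by simp
qed

lemma UN_eq_const: "x \<in> X ==> (!!y. y \<in> X ==> f y = c) ==> (\<Union>y\<in>X. f y) = c"
 by auto

lemma quotient_module_carrier:
 "carrier (quotient_module M H) = (\<lambda>x. H +>\<^sub>M x) ` carrier M"
 by (auto simp: quotient_module_def A_RCOSETS_def')

lemma quotient_module_zero: "\<zero>\<^bsub>quotient_module M H\<^esub> = H"
 by (simp add: quotient_module_def)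

lemma quotient_module:
 assumes M: "module R M" and H: "submodule H R M"
 shows quotient_module_module: "module R (quotient_module M H)"
  and quotient_map_hom: "(\<lambda>x. H +>\<^sub>M x) \<in> mod_hom R M (quotient_module M H)"
proof -
 interpret M: module R M by fact
 interpret H: abelian_subgroup H M by (rule M.submodule_abelian_subgroup[OF H])
 have add: "(H +>\<^sub>M x) \<oplus>\<^bsub>quotient_module M H\<^esub> (H +>\<^sub>M y) = H +>\<^sub>M (x \<oplus>\<^sub>M y)"
  if "x \<in> M" "y \<in> M" for x y
  using H.a_rcos_sum[OF that] by (simp add: quotient_module_def)
 have smult: "r \<odot>\<^bsub>quotient_module M H\<^esub> (H +>\<^sub>M x) = H +>\<^sub>M (r \<odot>\<^sub>M x)"
  if r: "r \<in> R" and x: "x \<in> M" for r x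
 proof -
  have "H +>\<^sub>M (r \<odot>\<^sub>M y) = H +>\<^sub>M (r \<odot>\<^sub>M x)" if y: "y \<in> H +>\<^sub>M x" for y
  proof -
   note y' = coset_memD[OF M H x y]
   have "r \<odot>\<^sub>M (y \<ominus>\<^sub>M x) \<in> H"
    using M.submoduleE(4)[OF H r] y' coset_eq_iff[OF M H y'(1) x] by blast
   then show ?thesis
    using coset_eq_iff[OF M H] y'(1) r x by (simp add: a_minus_def M.smult_r_distr M.smult_r_minus)
  qed
  then have "(\<Union>y\<in>H +>\<^sub>M x. H +>\<^sub>M (r \<odot>\<^sub>M y)) = H +>\<^sub>M (r \<odot>\<^sub>M x)"
   by (rule UN_eq_const[OF coset_self[OF M H x]])
  then show ?thesis by (simp add: quotient_module_def)
 qed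
 have zero: "\<zero>\<^bsub>quotient_module M H\<^esub> = H +>\<^sub>M \<zero>\<^sub>M"
  using M.a_coset_add_zero H.a_subset by (simp add: quotient_module_def)
 show "module R (quotient_module M H)"
  by (rule module_image(1)[OF M quotient_module_carrier add smult zero])
 show "(\<lambda>x. H +>\<^sub>M x) \<in> mod_hom R M (quotient_module M H)"
  by (rule module_image(2)[OF M quotient_module_carrier add smult zero])
qed

lemma is_zero_quotient:
 assumes M: "module R M" and H: "submodule H R M"
 shows "is_zero_module (quotient_module M H) \<longleftrightarrow> carrier M \<subseteq> H"
proof -
 interpret M: module R M by fact
 show ?thesis
  unfolding is_zero_module_def quotient_module_carrier quotient_module_zero
  using coset_zero_iff[OF M H] M.zero_closed by (auto simp: image_iff)
qed

text \<open>The union over all representatives is the form in which \<open>tensor_map\<close> is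
  defined; it collapses because all representatives give the same coset.\<close>

lemma quotient_map_induced:
 assumes M: "module R M" and H: "submodule H R M" and M': "module R M'" and H': "submodule H' R M'"
  and L: "L \<in> mod_hom R M M'" and LH: "!!x. x \<in> H ==> L x \<in> H'"
 shows "x \<in> M ==> (\<Union>h\<in>H +>\<^sub>M x. H' +>\<^sub>M' L h) = H' +>\<^sub>M' L x"
  and "(\<lambda>X. \<Union>h\<in>X. H' +>\<^sub>M' L h) \<in> mod_hom R (quotient_module M H) (quotient_module M' H')"
proof -
 interpret M: module R M by fact
 interpret M': module R M' by fact
 show *: "(\<Union>h\<in>H +>\<^sub>M x. H' +>\<^sub>M' L h) = H' +>\<^sub>M' L x" if x: "x \<in> M" for x
 proof -
  have "H' +>\<^sub>M' L y = H' +>\<^sub>M' L x" if y: "y \<in> H +>\<^sub>M x" for y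
  proof -
   note y' = coset_memD[OF M H x y]
   have "L (y \<ominus>\<^sub>M x) \<in> H'" using LH coset_eq_iff[OF M H y'(1) x] y'(2) by blast
   then show ?thesis
    using coset_eq_iff[OF M' H'] mod_hom_closed[OF L] y'(1) x mod_hom_minus[OF M M' L] by simp
  qed
  then show ?thesis by (rule UN_eq_const[OF coset_self[OF M H x]])
 qed
 note q = quotient_map_hom[OF M H] and q' = quotient_map_hom[OF M' H']
 show "(\<lambda>X. \<Union>h\<in>X. H' +>\<^sub>M' L h) \<in> mod_hom R (quotient_module M H) (quotient_module M' H')"
 proof (rule mod_homI; unfold quotient_module_carrier; clarsimp simp: *)
  show "H' +>\<^sub>M' L x \<in> (+>\<^sub>M') H' ` M'" if "x \<in> M" for x
   using mod_hom_closed[OF L that] by blast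
  show "(\<Union>h\<in>(H +>\<^sub>M x) \<oplus>\<^bsub>quotient_module M H\<^esub> (H +>\<^sub>M y). H' +>\<^sub>M' L h) =
    (H' +>\<^sub>M' L x) \<oplus>\<^bsub>quotient_module M' H'\<^esub> (H' +>\<^sub>M' L y)"
   if "x \<in> M" "y \<in> M" for x y
   using that *[of "x \<oplus>\<^sub>M y"] mod_hom_add[OF q that] mod_hom_add[OF L that]
    mod_hom_add[OF q' mod_hom_closed[OF L that(1)] mod_hom_closed[OF L that(2)]] by simp
  show "(\<Union>h\<in>r \<odot>\<^bsub>quotient_module M H\<^esub> (H +>\<^sub>M x). H' +>\<^sub>M' L h) =
    r \<odot>\<^bsub>quotient_module M' H'\<^esub> (H' +>\<^sub>M' L x)"
   if "r \<in> R" "x \<in> M" for r x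
   using that *[of "r \<odot>\<^sub>M x"] mod_hom_smult[OF q that] mod_hom_smult[OF L that]
    mod_hom_smult[OF q' that(1) mod_hom_closed[OF L that(2)]] by simp
 qed
qed

text \<open>\<open>homology\<close> divides the kernel of g by the image of f. By \<open>gf\<close>
  this image is a submodule of the kernel, so vanishing means that the two agree.\<close>

lemma is_zero_homology:
 assumes A: "module R A" and B: "module R B" and C: "module R C"
  and f: "f \<in> mod_hom R A B" and g: "g \<in> mod_hom R B C"
  and gf: "!!x. x \<in> A ==> g (f x) = \<zero>\<^sub>C"
 shows "is_zero_module (homology A f B g C) \<longleftrightarrow>
  (\<forall>x\<in>B. g x = \<zero>\<^sub>C --> x \<in> f ` carrier A)"
proof -
 let ?K = "a_kernel B C g"
 have K: "submodule ?K R B" by (rule submodule_kernel[OF B C g])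
 have BK: "module R (B\<lparr>carrier := ?K\<rparr>)" by (rule sub_module[OF B K])
 have f': "f \<in> mod_hom R A (B\<lparr>carrier := ?K\<rparr>)"
  using mod_hom_into[OF f] gf mod_hom_closed[OF f] by (simp add: a_kernel_def'')
 show ?thesis
  unfolding homology_def is_zero_quotient[OF BK submodule_range[OF A BK f']]
  by (auto simp: a_kernel_def'')
qed

section \<open>The standard free resolution\<close>

text \<open>A cell stores the graph of f over its support, and \<open>Abs_fset\<close> is faithful
  on finite sets only.\<close>

lemma of_cell_to_cell:
 assumes "finite {b. f b \<noteq> \<zero>\<^sub>R}"
 shows "of_cell R (to_cell R f) = f"
proof -
 have "fset (Abs_fset ((\<lambda>b. (b, f b)) ` {b. f b \<noteq> \<zero>\<^sub>R})) = (\<lambda>b. (b, f b)) ` {b. f b \<noteq> \<zero>\<^sub>R}"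
  using assms by (simp add: Abs_fset_inverse)
 then show ?thesis
  by (auto simp: to_cell_def fun_eq_iff image_iff)
qed

text \<open>Formulated for bases of any type, so that it covers the standard resolution as well as
  resolutions with finite bases.\<close>

definition free_resolution :: "('r, 'c) ring_scheme => ('r, 'm, 'd) module_scheme => (nat => 'b set) =>
  (nat => 'b => 'b => 'r) => ('b => 'm) => bool"
 where "free_resolution R M B A \<mu> \<longleftrightarrow>
  (\<forall>i. rmat R (B (Suc i)) (B i) (A i)) \<and> (\<forall>b\<in>B 0. \<mu> b \<in> carrier M) \<and>
  lin_ext R M \<mu> ` carrier (free_module R (B 0)) = carrier M \<and>
  (\<forall>f\<in>free_module R (B 0). lin_ext R M \<mu> f = \<zero>\<^sub>M \<longleftrightarrow>
    f \<in> lin_ext R (free_module R (B 0)) (A 0) ` carrier (free_module R (B 1))) \<and>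
  (\<forall>i. \<forall>f\<in>free_module R (B (Suc i)). lin_ext R (free_module R (B i)) (A i) f = \<zero>\<^bsub>free_module R (B i)\<^esub> \<longleftrightarrow>
    f \<in> lin_ext R (free_module R (B (Suc i))) (A (Suc i)) ` carrier (free_module R (B (Suc (Suc i)))))"

text \<open>One step of the standard resolution, where N is either M or the free module one degree
  lower. Each element of the kernel is stored as a basis element of B', so basis elements alone
  already hit the whole kernel.\<close>

lemma syzygy_basis:
 assumes N: "module R N" and \<mu>: "!!b. b \<in> B ==> \<mu> b \<in> N"
  and B': "B' = to_cell R ` a_kernel (free_module R B) N (lin_ext R N \<mu>)"
 shows "rmat R B' B (of_cell R)"
  and "f \<in> (free_module R B) ==> lin_ext R N \<mu> f = \<zero>\<^sub>N \<longleftrightarrow>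
    f \<in> lin_ext R (free_module R B) (of_cell R) ` carrier (free_module R B')"
proof -
 interpret N: module R N by fact
 have F: "module R (free_module R B)" by (rule free_module_module[OF N.is_cring])
 interpret F: module R "free_module R B" by (rule F)
 have oc: "of_cell R (to_cell R f) = f" if "f \<in> free_module R B" for f
  using that by (intro of_cell_to_cell) (auto simp: free_module_def)
 let ?K = "a_kernel (free_module R B) N (lin_ext R N \<mu>)"
 have Kc: "f \<in> ?K \<longleftrightarrow> f \<in> free_module R B \<and> lin_ext R N \<mu> f = \<zero>\<^sub>N" for f
  by (auto simp: a_kernel_def'')
 have ocB: "of_cell R b \<in> ?K" if "b \<in> B'" for b using that oc Kc unfolding B' by auto
 then show rm: "rmat R B' B (of_cell R)" using Kc by (auto simp: rmat_def)
 have \<mu>h: "lin_ext R N \<mu> \<in> mod_hom R (free_module R B) N" by (rule lin_ext_hom[OF N \<mu>])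
 have oh: "lin_ext R (free_module R B) (of_cell R) \<in> mod_hom R (free_module R B') (free_module R B)"
  using rmat_row[OF rm] by (rule lin_ext_hom[OF F])
 have zh: "(\<lambda>f. \<zero>\<^sub>N) \<in> mod_hom R (free_module R B') N" by (rule mod_homI) auto
 show "lin_ext R N \<mu> f = \<zero>\<^sub>N \<longleftrightarrow> f \<in> lin_ext R (free_module R B) (of_cell R) ` free_module R B'"
  if f: "f \<in> free_module R B" for f
 proof
  assume "lin_ext R N \<mu> f = \<zero>\<^sub>N"
  then have b: "to_cell R f \<in> B'" using f Kc unfolding B' by auto
  have "lin_ext R (free_module R B) (of_cell R) (basis_elt R (to_cell R f)) = f"
   using lin_ext_basis[OF F, of "of_cell R" "to_cell R f"] oc[OF f] f by simp
  then show "f \<in> lin_ext R (free_module R B) (of_cell R) ` free_module R B'"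
   using basis_elt_closed[OF N.is_cring b] by (metis imageI)
 next
  assume "f \<in> lin_ext R (free_module R B) (of_cell R) ` free_module R B'"
  then obtain g where g: "g \<in> free_module R B'" "f = lin_ext R (free_module R B) (of_cell R) g" by auto
  have "lin_ext R N \<mu> (lin_ext R (free_module R B) (of_cell R) g) = \<zero>\<^sub>N"
  proof (rule free_hom_eq[OF N mod_hom_comp[OF oh \<mu>h] zh _ g(1)])
   fix b assume b: "b \<in> B'"
   show "lin_ext R N \<mu> (lin_ext R (free_module R B) (of_cell R) (basis_elt R b)) = \<zero>\<^sub>N"
    using lin_ext_basis[OF F, of "of_cell R" b] ocB[OF b] Kc by simp
  qed
  then show "lin_ext R N \<mu> f = \<zero>\<^sub>N" using g(2) by simp
 qed
qed

lemma standard_resolution_rmat: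
 assumes "module R M"
 shows "rmat R (res_basis R M (Suc i)) (res_basis R M i) (of_cell R)"
proof (induction i)
 case 0
 have e: "!!b. b \<in> res_basis R M 0 ==> elt_of_cell b \<in> M" by auto
 show ?case by (rule syzygy_basis(1)[OF assms e]) simp_all
next
 case (Suc i)
 have F: "module R (free_module R (res_basis R M i))"
  using assms by (intro free_module_module) (simp add: module_def)
 show ?case by (rule syzygy_basis(1)[OF F rmat_row[OF Suc]]) simp_all
qed

lemma standard_resolution:
 assumes M: "module R M"
 shows "free_resolution R M (res_basis R M) (\<lambda>_. of_cell R) elt_of_cell"
proof -
 interpret M: module R M by fact
 have e: "elt_of_cell b \<in> M" if "b \<in> res_basis R M 0" for b using that by auto
 note rm = standard_resolution_rmat[OF M]
 have F: "module R (free_module R B)" for B :: "('a, 'c) cell set" by (rule free_module_module[OF M.is_cring])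
 have "lin_ext R M elt_of_cell ` free_module R (res_basis R M 0) = carrier M"
 proof
  show "lin_ext R M elt_of_cell ` (free_module R (res_basis R M 0)) \<subseteq> M"
   using mod_hom_closed[OF lin_ext_hom[OF M e]] by auto
  show "carrier M \<subseteq> lin_ext R M elt_of_cell ` free_module R (res_basis R M 0)"
  proof
   fix x assume x: "x \<in> M"
   then have "Elt x \<in> res_basis R M 0" by simp
   then have "basis_elt R (Elt x) \<in> free_module R (res_basis R M 0)"
    by (rule basis_elt_closed[OF M.is_cring])
   moreover have "lin_ext R M elt_of_cell (basis_elt R (Elt x)) = x"
    using lin_ext_basis[OF M, of elt_of_cell "Elt x"] x by simp
   ultimately show "x \<in> lin_ext R M elt_of_cell ` free_module R (res_basis R M 0)"
    by (metis imageI)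
  qed
 qed
 moreover have "lin_ext R M elt_of_cell f = \<zero>\<^sub>M \<longleftrightarrow>
    f \<in> lin_ext R (free_module R (res_basis R M 0)) (of_cell R) ` free_module R (res_basis R M 1)"
  if "f \<in> free_module R (res_basis R M 0)" for f
  by (rule syzygy_basis(2)[OF M e _ that]) simp_all
 moreover have "lin_ext R (free_module R (res_basis R M i)) (of_cell R) f = \<zero>\<^bsub>free_module R (res_basis R M i)\<^esub> \<longleftrightarrow>
    f \<in> lin_ext R (free_module R (res_basis R M (Suc i))) (of_cell R) ` free_module R (res_basis R M (Suc (Suc i)))"
  if "f \<in> free_module R (res_basis R M (Suc i))" for f i
  by (rule syzygy_basis(2)[OF F rmat_row[OF rm] _ that]) simp_all
 ultimately show ?thesis unfolding free_resolution_def by (intro conjI allI ballI rm e) simp_all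
qed

section \<open>Tor and Ext through matrices\<close>

text \<open>A complex of free modules is given by bases \<open>B i\<close> and matrices \<open>A i\<close>, the row \<open>A i b\<close> being the
 image of the basis element \<open>b\<close> of \<open>B (Suc i)\<close>. Instead of localizing at \<open>S\<close>, the homology at
 \<open>B (Suc i)\<close> is required to be \<open>S\<close>-torsion; ordinary exactness is the case \<open>S = {1}\<close>.\<close>

definition tor_exact :: "'r set => ('r, 'm, 'd) module_scheme => (nat => 'b set) =>
  (nat => 'b => 'b => 'r) => nat => bool"
 where "tor_exact S N B A i \<longleftrightarrow>
  (\<forall>z\<in>dsum N (B (Suc i)). bd N B A i z = zf N -->
    (\<exists>s\<in>S. \<exists>w\<in>dsum N (B (Suc (Suc i))). (\<lambda>b. s \<odot>\<^sub>N z b) = bd N B A (Suc i) w))"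

text \<open>Maps out of a free module on an infinite basis are arbitrary families, hence
  \<open>dprod\<close> in place of \<open>dsum\<close>. The index i refers to degree i + 1.\<close>

definition ext_exact :: "('r, 'c) ring_scheme => ('r, 'm, 'd) module_scheme => (nat => 'b set) =>
  (nat => 'b => 'b => 'r) => nat => bool"
 where "ext_exact R N B A i \<longleftrightarrow>
  (\<forall>e\<in>dprod N (B (Suc i)). cobd R N B A (Suc i) e = zf N -->
    (\<exists>e'\<in>dprod N (B i). e = cobd R N B A i e'))"

section \<open>Tensor products with free modules\<close>

lemma tensor_kernel_submodule:
 assumes R: "cring R" and M: "module R M" and N: "module R N"
 shows "submodule (tensor_kernel R M N) R (tensor_gens R M N)"
  and "tensor_rels R M N \<subseteq> tensor_kernel R M N"
proof -
 interpret M: module R M by fact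
 interpret N: module R N by fact
 let ?T = "tensor_gens R M N"
 have T: "module R ?T" unfolding tensor_gens_def by (rule free_module_module[OF R])
 interpret T: module R ?T by (rule T)
 have d: "basis_elt R (x, y) \<in> ?T" if "x \<in> M" "y \<in> N" for x y
  unfolding tensor_gens_def using that by (intro basis_elt_closed[OF R]) auto
 have "tensor_rels R M N \<subseteq> ?T"
  unfolding tensor_rels_def Let_def using d
  by (auto intro!: T.minus_closed T.a_closed T.smult_closed)
 then have c: "submodule (carrier ?T) R ?T \<and> tensor_rels R M N \<subseteq> ?T"
  using T.carrier_is_submodule by simp
 show "tensor_rels R M N \<subseteq> tensor_kernel R M N" by (auto simp: tensor_kernel_def)
 show "submodule (tensor_kernel R M N) R ?T"
  unfolding tensor_kernel_def
 proof (rule T.submoduleI)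
  let ?F = "{H. submodule H R ?T \<and> tensor_rels R M N \<subseteq> H}"
  show "\<Inter>?F \<subseteq> ?T" using c by blast
  show "\<zero>\<^sub>?T \<in> \<Inter>?F" using submodule_zero by auto
  show "\<ominus>\<^sub>?T a \<in> \<Inter>?F" if "a \<in> \<Inter>?F" for a using that T.submoduleE(3) by blast
  show "a \<oplus>\<^sub>?T b \<in> \<Inter>?F" if "a \<in> \<Inter>?F" "b \<in> \<Inter>?F" for a b
   using that T.submoduleE(5) by blast
  show "r \<odot>\<^sub>?T a \<in> \<Inter>?F" if "r \<in> R" "a \<in> \<Inter>?F" for r a
   using that T.submoduleE(4) by blast
 qed
qed

text \<open>Sends the generator (f, y) to the family of the f b y. It induces the isomorphism from
  the tensor product of R^(B) and N to N^(B).\<close>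

definition tensor_eval :: "('r, 'c) ring_scheme => ('r, 'n, 'e) module_scheme => 'b set =>
  (('b => 'r) \<times> 'n => 'r) => 'b => 'n"
 where "tensor_eval R N B = lin_ext R (dsum N B) (\<lambda>(f, y) b. f b \<odot>\<^sub>N y)"

lemma tensor_eval_gen_closed:
 assumes "module R N" "f \<in> free_module R B" "y \<in> N"
 shows "(\<lambda>b. f b \<odot>\<^sub>N y) \<in> dsum N B"
 using mod_hom_closed[OF row_hom[OF assms(1,2)] assms(3)] .

text \<open>The defining relations of the tensor product go to zero, hence so does
  \<open>tensor_kernel\<close>. Conversely an inverse is built on N^(B), which shows that nothing
  else is killed.\<close>

lemma tensor_eval:
 assumes N: "module R N"
 shows tensor_eval_hom: "tensor_eval R N B \<in> mod_hom R (tensor_gens R (free_module R B) N) (dsum N B)"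
  and tensor_eval_basis: "f \<in> (free_module R B) ==> y \<in> N ==>
   tensor_eval R N B (basis_elt R (f, y)) = (\<lambda>b. f b \<odot>\<^sub>N y)"
  and tensor_eval_surj: "z \<in> (dsum N B) ==>
   z \<in> tensor_eval R N B ` carrier (tensor_gens R (free_module R B) N)"
  and tensor_eval_kernel: "h \<in> (tensor_gens R (free_module R B) N) ==>
   tensor_eval R N B h = zf N \<longleftrightarrow> h \<in> tensor_kernel R (free_module R B) N"
proof -
 interpret N: module R N by fact
 let ?F = "free_module R B" and ?ev = "tensor_eval R N B"
 let ?T = "tensor_gens R ?F N" and ?K = "tensor_kernel R ?F N"
 have F: "module R ?F" by (rule free_module_module[OF N.is_cring])
 interpret F: module R ?F by (rule F)
 have D: "module R (dsum N B)" by (rule dsum_module[OF N])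
 interpret D: module R "dsum N B" by (rule D)
 have T: "module R ?T" unfolding tensor_gens_def by (rule free_module_module[OF N.is_cring])
 interpret T: module R ?T by (rule T)
 note K = tensor_kernel_submodule[OF N.is_cring F N]
 have gc: "(case p of (f, y) => \<lambda>b. f b \<odot>\<^sub>N y) \<in> dsum N B" if "p \<in> carrier ?F \<times> carrier N" for p
  using that tensor_eval_gen_closed[OF N] by auto
 show ev: "?ev \<in> mod_hom R ?T (dsum N B)"
  unfolding tensor_eval_def tensor_gens_def by (rule lin_ext_hom[OF D gc])
 show evb: "?ev (basis_elt R (f, y)) = (\<lambda>b. f b \<odot>\<^sub>N y)" if "f \<in> ?F" "y \<in> N" for f y
  unfolding tensor_eval_def using lin_ext_basis[OF D, of "\<lambda>(f, y) b. f b \<odot>\<^sub>N y" "(f, y)"] gc[of "(f, y)"] that by simp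
 have d: "basis_elt R (x, y) \<in> ?T" if "x \<in> ?F" "y \<in> N" for x y
  unfolding tensor_gens_def using that by (intro basis_elt_closed[OF N.is_cring]) auto
 have be: "basis_elt R b \<in> ?F" if "b \<in> B" for b by (rule basis_elt_closed[OF N.is_cring that])
 note img = submodule_range[OF T D ev]
 show "z \<in> ?ev ` ?T" if "z \<in> dsum N B" for z
  using N that
 proof (induction z rule: dsum_induct)
  case zero
  show ?case using submodule_zero[OF img] by simp
 next
  case (add b y f)
  have "(\<lambda>c. basis_elt R b c \<odot>\<^sub>N y) = sing N b y" using add(2) by (auto simp: basis_elt_def sing_def)
  then have "sing N b y \<in> ?ev ` ?T"
   using evb[OF be[OF add(1)] add(2)] d[OF be[OF add(1)] add(2)] by (metis imageI)
  then show ?case using D.submoduleE(5)[OF img _ add(4)] by simp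
 qed
 have Fv: "f b \<in> R" if "f \<in> ?F" for f b using that by (auto simp: free_module_def)
 have rels: "tensor_rels R ?F N \<subseteq> a_kernel ?T (dsum N B) ?ev"
 proof
  fix t assume t: "t \<in> tensor_rels R ?F N"
  note m = mod_hom_minus[OF T D ev] and a = mod_hom_add[OF ev] and s = mod_hom_smult[OF ev]
  note Da = D.a_closed[simplified] and Ds = D.smult_closed[simplified]
  have eqz: "x \<ominus>\<^bsub>dsum N B\<^esub> y = \<zero>\<^bsub>dsum N B\<^esub>" if "x = y" "x \<in> dsum N B" for x y
   using that D.r_neg by (simp add: a_minus_def)
  show "t \<in> a_kernel ?T (dsum N B) ?ev"
   using t unfolding tensor_rels_def Let_def a_kernel_def''
  proof (elim UnE CollectE exE conjE; intro CollectI conjI; hypsubst)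
   fix x x' y assume x: "x \<in> ?F" "x' \<in> ?F" and y: "y \<in> N"
   note cl = d[OF F.a_closed[OF x] y] d[OF x(1) y] d[OF x(2) y]
   show "basis_elt R (x \<oplus>\<^sub>?F x', y) \<ominus>\<^sub>?T (basis_elt R (x, y) \<oplus>\<^sub>?T basis_elt R (x', y)) \<in> ?T"
    using cl by (intro T.minus_closed T.a_closed)
   have "?ev (basis_elt R (x \<oplus>\<^sub>?F x', y)) = ?ev (basis_elt R (x, y) \<oplus>\<^sub>?T basis_elt R (x', y))"
    unfolding a[OF cl(2,3)] evb[OF F.a_closed[OF x] y] evb[OF x(1) y] evb[OF x(2) y]
    using Fv[OF x(1)] Fv[OF x(2)] y by (simp add: free_eq_dsum N.smult_l_distr)
   then show "?ev (basis_elt R (x \<oplus>\<^sub>?F x', y) \<ominus>\<^sub>?T (basis_elt R (x, y) \<oplus>\<^sub>?T basis_elt R (x', y))) = \<zero>\<^bsub>dsum N B\<^esub>"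
    unfolding m[OF cl(1) T.a_closed[OF cl(2,3)]] by (rule eqz) (rule mod_hom_closed[OF ev cl(1)])
  next
   fix x y y' assume x: "x \<in> ?F" and y: "y \<in> N" "y' \<in> N"
   note cl = d[OF x N.a_closed[OF y]] d[OF x y(1)] d[OF x y(2)]
   show "basis_elt R (x, y \<oplus>\<^sub>N y') \<ominus>\<^sub>?T (basis_elt R (x, y) \<oplus>\<^sub>?T basis_elt R (x, y')) \<in> ?T"
    using cl by (intro T.minus_closed T.a_closed)
   have "?ev (basis_elt R (x, y \<oplus>\<^sub>N y')) = ?ev (basis_elt R (x, y) \<oplus>\<^sub>?T basis_elt R (x, y'))"
    unfolding a[OF cl(2,3)] evb[OF x N.a_closed[OF y]] evb[OF x y(1)] evb[OF x y(2)]
    using Fv[OF x] y by (simp add: N.smult_r_distr)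
   then show "?ev (basis_elt R (x, y \<oplus>\<^sub>N y') \<ominus>\<^sub>?T (basis_elt R (x, y) \<oplus>\<^sub>?T basis_elt R (x, y'))) = \<zero>\<^bsub>dsum N B\<^esub>"
    unfolding m[OF cl(1) T.a_closed[OF cl(2,3)]] by (rule eqz) (rule mod_hom_closed[OF ev cl(1)])
  next
   fix r x y assume r: "r \<in> R" and x: "x \<in> ?F" and y: "y \<in> N"
   note cl = d[OF F.smult_closed[OF r x] y] d[OF x y]
   show "basis_elt R (r \<odot>\<^sub>?F x, y) \<ominus>\<^sub>?T r \<odot>\<^sub>?T basis_elt R (x, y) \<in> ?T"
    using cl r by (intro T.minus_closed T.smult_closed)
   have "?ev (basis_elt R (r \<odot>\<^sub>?F x, y)) = ?ev (r \<odot>\<^sub>?T basis_elt R (x, y))"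
    unfolding s[OF r cl(2)] evb[OF F.smult_closed[OF r x] y] evb[OF x y]
    using Fv[OF x] r y by (simp add: free_eq_dsum N.smult_assoc1)
   then show "?ev (basis_elt R (r \<odot>\<^sub>?F x, y) \<ominus>\<^sub>?T r \<odot>\<^sub>?T basis_elt R (x, y)) = \<zero>\<^bsub>dsum N B\<^esub>"
    unfolding m[OF cl(1) T.smult_closed[OF r cl(2)]] by (rule eqz) (rule mod_hom_closed[OF ev cl(1)])
  next
   fix r x y assume r: "r \<in> R" and x: "x \<in> ?F" and y: "y \<in> N"
   note cl = d[OF x N.smult_closed[OF r y]] d[OF x y]
   show "basis_elt R (x, r \<odot>\<^sub>N y) \<ominus>\<^sub>?T r \<odot>\<^sub>?T basis_elt R (x, y) \<in> ?T"
    using cl r by (intro T.minus_closed T.smult_closed)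
   have "?ev (basis_elt R (x, r \<odot>\<^sub>N y)) = ?ev (r \<odot>\<^sub>?T basis_elt R (x, y))"
    unfolding s[OF r cl(2)] evb[OF x N.smult_closed[OF r y]] evb[OF x y]
    using Fv[OF x] r y by (simp add: N.smult_assoc1[symmetric] N.R.m_comm)
   then show "?ev (basis_elt R (x, r \<odot>\<^sub>N y) \<ominus>\<^sub>?T r \<odot>\<^sub>?T basis_elt R (x, y)) = \<zero>\<^bsub>dsum N B\<^esub>"
    unfolding m[OF cl(1) T.smult_closed[OF r cl(2)]] by (rule eqz) (rule mod_hom_closed[OF ev cl(1)])
  qed
 qed
 let ?Q = "quotient_module ?T ?K"
 have Q: "module R ?Q" by (rule quotient_module_module[OF T K(1)])
 interpret Q: module R ?Q by (rule Q)
 define q where "q = (\<lambda>x. ?K +>\<^sub>?T x)"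
 have q: "q \<in> mod_hom R ?T ?Q" unfolding q_def by (rule quotient_map_hom[OF T K(1)])
 have qeq: "q x = q y" if "x \<ominus>\<^sub>?T y \<in> tensor_rels R ?F N" "x \<in> ?T" "y \<in> ?T" for x y
  unfolding q_def using coset_eq_iff[OF T K(1) that(2,3)] that(1) K(2) by blast
 \<comment> \<open>The pure tensor of f and y; the relations make it linear in each
   argument.\<close>
 define t where "t f y = q (basis_elt R (f, y))" for f y
 have t1: "(\<lambda>f. t f y) \<in> mod_hom R ?F ?Q" if y: "y \<in> N" for y
 proof (rule mod_homI)
  show "t f y \<in> ?Q" if "f \<in> ?F" for f unfolding t_def by (rule mod_hom_closed[OF q d[OF that y]])
  show "t (f \<oplus>\<^sub>?F g) y = t f y \<oplus>\<^sub>?Q t g y" if fg: "f \<in> ?F" "g \<in> ?F" for f g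
   unfolding t_def mod_hom_add[OF q d[OF fg(1) y] d[OF fg(2) y], symmetric]
   by (rule qeq) (use fg y in \<open>auto simp: tensor_rels_def Let_def intro!: d T.a_closed F.a_closed\<close>)
  show "t (r \<odot>\<^sub>?F f) y = r \<odot>\<^sub>?Q t f y" if rf: "r \<in> R" "f \<in> ?F" for r f
   unfolding t_def mod_hom_smult[OF q rf(1) d[OF rf(2) y], symmetric]
   by (rule qeq) (use rf y in \<open>auto simp: tensor_rels_def Let_def intro!: d T.smult_closed F.smult_closed\<close>)
 qed
 have t2: "(\<lambda>y. t f y) \<in> mod_hom R N ?Q" if f: "f \<in> ?F" for f
 proof (rule mod_homI)
  show "t f y \<in> ?Q" if "y \<in> N" for y unfolding t_def by (rule mod_hom_closed[OF q d[OF f that]])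
  show "t f (y \<oplus>\<^sub>N y') = t f y \<oplus>\<^sub>?Q t f y'" if yy: "y \<in> N" "y' \<in> N" for y y'
   unfolding t_def mod_hom_add[OF q d[OF f yy(1)] d[OF f yy(2)], symmetric]
   by (rule qeq) (use f yy in \<open>auto simp: tensor_rels_def Let_def intro!: d T.a_closed\<close>)
  show "t f (r \<odot>\<^sub>N y) = r \<odot>\<^sub>?Q t f y" if ry: "r \<in> R" "y \<in> N" for r y
   unfolding t_def mod_hom_smult[OF q ry(1) d[OF f ry(2)], symmetric]
   by (rule qeq) (use f ry in \<open>auto simp: tensor_rels_def Let_def intro!: d T.smult_closed\<close>)
 qed
 \<comment> \<open>The inverse map: y in coordinate b goes to the tensor of the basis element b and
   y. Composed with evaluation it agrees with the quotient map \<open>q\<close> on generators, hence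
   everywhere.\<close>
 define \<sigma> where "\<sigma> = lext N ?Q (\<lambda>b y. t (basis_elt R b) y)"
 have \<sigma>: "\<sigma> \<in> mod_hom R (dsum N B) ?Q"
  unfolding \<sigma>_def by (rule lext_hom[OF N Q t2[OF be]])
 have \<sigma>g: "\<sigma> (\<lambda>b. f b \<odot>\<^sub>N y) = t f y" if f: "f \<in> ?F" and y: "y \<in> N" for f y
 proof (rule free_hom_eq[OF Q _ t1[OF y] _ f])
  have g: "(\<lambda>r. r \<odot>\<^sub>N y) \<in> mod_hom R (reg R) N"
   using y by (intro mod_homI) (auto simp: N.smult_l_distr N.smult_assoc1)
  note dm = dsum_map_hom[OF reg_module[OF N.is_cring] N g]
  show "(\<lambda>f. \<sigma> (\<lambda>b. f b \<odot>\<^sub>N y)) \<in> mod_hom R ?F ?Q"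
   using mod_hom_comp[OF dm \<sigma>] by (simp only: free_eq_dsum)
  fix b assume b: "b \<in> B"
  have "(\<lambda>c. basis_elt R b c \<odot>\<^sub>N y) = sing N b y" using y by (auto simp: basis_elt_def sing_def)
  then show "\<sigma> (\<lambda>c. basis_elt R b c \<odot>\<^sub>N y) = t (basis_elt R b) y"
   unfolding \<sigma>_def using lext_sing[where \<phi> = "\<lambda>b y. t (basis_elt R b) y", OF N Q t2[OF be[OF b]] y] by simp
 qed
 show "?ev h = zf N \<longleftrightarrow> h \<in> ?K" if h: "h \<in> ?T" for h
 proof
  assume "h \<in> ?K"
  moreover have "?K \<subseteq> a_kernel ?T (dsum N B) ?ev"
   unfolding tensor_kernel_def using submodule_kernel[OF T D ev] rels by blast
  ultimately show "?ev h = zf N" by (auto simp: a_kernel_def'')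
 next
  assume e: "?ev h = zf N"
  have "\<sigma> (?ev h) = q h"
  proof (rule free_hom_eq[OF Q _ _ _ h[unfolded tensor_gens_def]])
   show "(\<lambda>h. \<sigma> (?ev h)) \<in> mod_hom R (free_module R (carrier ?F \<times> carrier N)) ?Q"
    using mod_hom_comp[OF ev \<sigma>] by (simp add: tensor_gens_def)
   show "q \<in> mod_hom R (free_module R (carrier ?F \<times> carrier N)) ?Q" using q by (simp add: tensor_gens_def)
   show "\<sigma> (?ev (basis_elt R p)) = q (basis_elt R p)" if "p \<in> carrier ?F \<times> carrier N" for p
    using that evb \<sigma>g by (auto simp: t_def)
  qed
  then have "q h = \<zero>\<^sub>?Q" using e mod_hom_zero[OF D Q \<sigma>] by simp
  then show "h \<in> ?K" using coset_zero_iff[OF T K(1) h] by (simp add: q_def quotient_module_zero)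
 qed
qed

declare res_basis.simps [simp del]

lemma (in abelian_group) a_minus_eq_zero_iff:
 assumes "x \<in> carrier G" "y \<in> carrier G"
 shows "x \<ominus> y = \<zero> \<longleftrightarrow> x = y"
 using assms minus_equality[of x "\<ominus> y"] by (auto simp: a_minus_def r_neg)

text \<open>Both sides of \<open>tensor_map_eval\<close> are linear on the free module of
  generators. On a single generator (x, y) the claim is naturality of \<open>push\<close> along r ->
  r y.\<close>

lemma tensor_map:
 assumes N: "module R N" and A: "rmat R B' B A"
 defines "d \<equiv> lin_ext R (free_module R B) A"
 defines "L \<equiv> lin_ext R (tensor_gens R (free_module R B) N) (\<lambda>(x, y). basis_elt R (d x, y))"
 shows tensor_map_lift_hom: "L \<in> mod_hom R (tensor_gens R (free_module R B') N) (tensor_gens R (free_module R B) N)"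
  and tensor_map_eval: "h \<in> (tensor_gens R (free_module R B') N) ==>
   tensor_eval R N B (L h) = push N B A (tensor_eval R N B' h)"
  and tensor_map_hom: "tensor_map R (free_module R B) N d \<in>
   mod_hom R (tensor R (free_module R B') N) (tensor R (free_module R B) N)"
  and tensor_map_coset: "h \<in> (tensor_gens R (free_module R B') N) ==>
   tensor_map R (free_module R B) N d
    (tensor_kernel R (free_module R B') N +>\<^bsub>tensor_gens R (free_module R B') N\<^esub> h) =
   tensor_kernel R (free_module R B) N +>\<^bsub>tensor_gens R (free_module R B) N\<^esub> L h"
proof -
 interpret N: module R N by fact
 let ?F = "free_module R B" and ?F' = "free_module R B'"
 let ?T = "tensor_gens R ?F N" and ?T' = "tensor_gens R ?F' N"
 have F: "module R ?F" and F': "module R ?F'" by (rule free_module_module[OF N.is_cring])+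
 have T: "module R ?T" and T': "module R ?T'"
  unfolding tensor_gens_def by (rule free_module_module[OF N.is_cring])+
 have D: "module R (dsum N B)" by (rule dsum_module[OF N])
 have d: "d \<in> mod_hom R ?F' ?F" unfolding d_def by (rule lin_ext_hom[OF F rmat_row[OF A]])
 have bc: "(case p of (x, y) => basis_elt R (d x, y)) \<in> ?T" if "p \<in> carrier ?F' \<times> carrier N" for p
  using that mod_hom_closed[OF d] unfolding tensor_gens_def
  by (auto intro!: basis_elt_closed[OF N.is_cring])
 show L: "L \<in> mod_hom R ?T' ?T"
  unfolding L_def tensor_gens_def[of R ?F']
  by (rule lin_ext_hom[OF T bc])
 note ev = tensor_eval_hom[OF N, of B] and ev' = tensor_eval_hom[OF N, of B']
 show Lev: "tensor_eval R N B (L h) = push N B A (tensor_eval R N B' h)" if h: "h \<in> ?T'" for h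
 proof (rule free_hom_eq[OF D _ _ _ h[unfolded tensor_gens_def]])
  show "(\<lambda>h. tensor_eval R N B (L h)) \<in> mod_hom R (free_module R (carrier ?F' \<times> carrier N)) (dsum N B)"
   using mod_hom_comp[OF L ev] by (simp add: tensor_gens_def)
  show "(\<lambda>h. push N B A (tensor_eval R N B' h)) \<in> mod_hom R (free_module R (carrier ?F' \<times> carrier N)) (dsum N B)"
   using mod_hom_comp[OF ev' push_hom[OF N A]] by (simp add: tensor_gens_def)
  fix p assume p: "p \<in> carrier ?F' \<times> carrier N"
  obtain x y where xy: "p = (x, y)" "x \<in> ?F'" "y \<in> N" using p by auto
  have "L (basis_elt R p) = basis_elt R (d x, y)"
   unfolding L_def using lin_ext_basis[OF T, of "\<lambda>(x, y). basis_elt R (d x, y)" p] bc[OF p] xy by simp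
  then have "tensor_eval R N B (L (basis_elt R p)) = (\<lambda>b. d x b \<odot>\<^sub>N y)"
   using tensor_eval_basis[OF N mod_hom_closed[OF d xy(2)] xy(3)] by simp
  also have "d x = push (reg R) B A x"
   unfolding d_def by (rule lin_ext_free[OF N.is_cring A xy(2)])
  also have "(\<lambda>b. push (reg R) B A x b \<odot>\<^sub>N y) = push N B A (\<lambda>b. x b \<odot>\<^sub>N y)"
  proof (rule push_natural[OF reg_module[OF N.is_cring] N _ A, symmetric])
   show "(\<lambda>r. r \<odot>\<^sub>N y) \<in> mod_hom R (reg R) N"
    using xy by (intro mod_homI) (auto simp: N.smult_l_distr N.smult_assoc1)
   show "x \<in> fmod R B'" using xy(2) by (simp add: free_eq_dsum)
  qed
  also have "(\<lambda>b. x b \<odot>\<^sub>N y) = tensor_eval R N B' (basis_elt R p)"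
   using tensor_eval_basis[OF N xy(2,3)] xy(1) by simp
  finally show "tensor_eval R N B (L (basis_elt R p)) = push N B A (tensor_eval R N B' (basis_elt R p))" .
 qed
 note K = tensor_kernel_submodule(1)[OF N.is_cring F N] and K' = tensor_kernel_submodule(1)[OF N.is_cring F' N]
 have LK: "L x \<in> tensor_kernel R ?F N" if x: "x \<in> tensor_kernel R ?F' N" for x
 proof -
  have xc: "x \<in> ?T'" using module.submodule_carrier[OF T' K' x] .
  then have "tensor_eval R N B' x = \<zero>\<^bsub>dsum N B'\<^esub>" using tensor_eval_kernel[OF N xc] x by simp
  then have "tensor_eval R N B (L x) = \<zero>\<^bsub>dsum N B\<^esub>"
   using Lev[OF xc] mod_hom_zero[OF dsum_module[OF N] dsum_module[OF N] push_hom[OF N A]] by simp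
  then show ?thesis using tensor_eval_kernel[OF N mod_hom_closed[OF L xc]] by simp
 qed
 show "tensor_map R ?F N d \<in> mod_hom R (tensor R ?F' N) (tensor R ?F N)"
  unfolding tensor_map_def tensor_def L_def[symmetric] by (rule quotient_map_induced(2)[OF T' K' T K L]) (rule LK)
 show "tensor_map R ?F N d (tensor_kernel R ?F' N +>\<^sub>?T' h) = tensor_kernel R ?F N +>\<^sub>?T L h"
  if "h \<in> ?T'" for h
  unfolding tensor_map_def L_def[symmetric] by (rule quotient_map_induced(1)[OF T' K' T K L _ that]) (rule LK)
qed

text \<open>Evaluation is injective modulo \<open>tensor_kernel\<close> and onto N^(B), so cycles
  and boundaries of the tensored complex can be read in direct sums. Degree 0, where
  \<open>res_diff\<close> is a mere convention, is left out because only large degrees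
  matter.\<close>

lemma is_zero_Tor:
 assumes M: "module R M" and N: "module R N"
 shows "is_zero_module (Tor R (Suc i) M N) \<longleftrightarrow> tor_exact {\<one>\<^sub>R} N (res_basis R M) (\<lambda>_. of_cell R) i"
proof -
 interpret N: module R N by fact
 let ?B = "res_basis R M"
 let ?F = "\<lambda>n. free_module R (?B n)"
 let ?T = "\<lambda>n. tensor_gens R (?F n) N" and ?K = "\<lambda>n. tensor_kernel R (?F n) N"
 note A = standard_resolution_rmat[OF M]
 let ?d = "\<lambda>n. lin_ext R (?F n) (of_cell R)"
 let ?L = "\<lambda>n. lin_ext R (?T n) (\<lambda>(x, y). basis_elt R (?d n x, y))"
 let ?t = "\<lambda>n. tensor_map R (?F n) N (?d n)"
 let ?ev = "\<lambda>n. tensor_eval R N (?B n)"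
 let ?q = "\<lambda>n h. ?K n +>\<^bsub>?T n\<^esub> h"
 have F: "module R (?F n)" and T: "module R (?T n)" for n
  unfolding tensor_gens_def by (rule free_module_module[OF N.is_cring])+
 note K = tensor_kernel_submodule(1)[OF N.is_cring F N]
 have X: "module R (tensor R (?F n) N)" for n
  unfolding tensor_def by (rule quotient_module_module[OF T K])
 note t = tensor_map_hom[OF N A] and tc = tensor_map_coset[OF N A] and L = tensor_map_lift_hom[OF N A]
  and Lev = tensor_map_eval[OF N A] and evk = tensor_eval_kernel[OF N]
  and evh = tensor_eval_hom[OF N]
 have carr: "carrier (tensor R (?F n) N) = ?q n ` ?T n" for n
  unfolding tensor_def quotient_module_carrier ..
 have zero: "?q n h = \<zero>\<^bsub>tensor R (?F n) N\<^esub> \<longleftrightarrow> ?ev n h = zf N" if "h \<in> ?T n" for n h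
  unfolding tensor_def quotient_module_zero coset_zero_iff[OF T K that] evk[OF that] ..
 have eq: "?q n h = ?q n h' \<longleftrightarrow> ?ev n h = ?ev n h'" if h: "h \<in> ?T n" "h' \<in> ?T n" for n h h'
 proof -
  have D: "module R (dsum N (?B n))" by (rule dsum_module[OF N])
  interpret T: module R "?T n" by (rule T)
  interpret D: module R "dsum N (?B n)" by (rule D)
  have "?q n h = ?q n h' \<longleftrightarrow> ?ev n (h \<ominus>\<^bsub>?T n\<^esub> h') = zf N"
   unfolding coset_eq_iff[OF T K h] by (rule evk[symmetric]) (use h in auto)
  also have "\<dots> \<longleftrightarrow> ?ev n h \<ominus>\<^bsub>dsum N (?B n)\<^esub> ?ev n h' = \<zero>\<^bsub>dsum N (?B n)\<^esub>"
   unfolding mod_hom_minus[OF T D evh h] by simp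
  also have "\<dots> \<longleftrightarrow> ?ev n h = ?ev n h'"
   using mod_hom_closed[OF evh h(1)] mod_hom_closed[OF evh h(2)] D.a_minus_eq_zero_iff by auto
  finally show ?thesis .
 qed
 have dd: "push N (?B n) (of_cell R) (push N (?B (Suc n)) (of_cell R) w) = zf N"
  if "w \<in> dsum N (?B (Suc (Suc n)))" for n w
 proof (rule push_comp_zero[OF N A A _ that])
  fix b assume b: "b \<in> ?B (Suc (Suc n))"
  have "lin_ext R (?F (Suc n)) (of_cell R) (basis_elt R b) = of_cell R b"
   using lin_ext_basis[OF F, of "of_cell R" b "Suc n"] rmat_row[OF A b] by simp
  then have "of_cell R b \<in> lin_ext R (?F (Suc n)) (of_cell R) ` ?F (Suc (Suc n))"
   using basis_elt_closed[OF N.is_cring b] by (metis imageI)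
  then have "lin_ext R (?F n) (of_cell R) (of_cell R b) = \<zero>\<^bsub>?F n\<^esub>"
   using standard_resolution[OF M] rmat_row[OF A b] unfolding free_resolution_def by blast
  then show "push (reg R) (?B n) (of_cell R) (of_cell R b) = zf R"
   using lin_ext_free[OF N.is_cring A rmat_row[OF A b]] by (simp add: free_eq_dsum)
 qed
 have tt: "?t n (?t (Suc n) x) = \<zero>\<^bsub>tensor R (?F n) N\<^esub>" if x: "x \<in> tensor R (?F (Suc (Suc n))) N" for n x
 proof -
  obtain h where h: "h \<in> ?T (Suc (Suc n))" "x = ?q (Suc (Suc n)) h" using x unfolding carr by auto
  note Lh = mod_hom_closed[OF L h(1)]
  have "?t n (?t (Suc n) x) = ?q n (?L n (?L (Suc n) h))" using h tc[OF h(1)] tc[OF Lh] by simp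
  moreover have "?ev n (?L n (?L (Suc n) h)) = zf N"
   using Lev[OF Lh] Lev[OF h(1)] dd mod_hom_closed[OF evh h(1)] by simp
  ultimately show ?thesis using zero[OF mod_hom_closed[OF L Lh]] by simp
 qed
 have evimg: "?ev n ` ?T n = carrier (dsum N (?B n))" for n
  using tensor_eval_surj[OF N, of _ "?B n"] mod_hom_closed[OF evh, of _ "?B n"] by blast
 have "is_zero_module (Tor R (Suc i) M N) \<longleftrightarrow>
   (\<forall>x\<in>tensor R (?F (Suc i)) N. ?t i x = \<zero>\<^bsub>tensor R (?F i) N\<^esub> -->
    x \<in> ?t (Suc i) ` tensor R (?F (Suc (Suc i))) N)"
  unfolding Tor_def res_def res_diff.simps diff_Suc_1
  by (rule is_zero_homology[OF X X X t t tt])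
 also have "\<dots> \<longleftrightarrow> (\<forall>h\<in>?T (Suc i). ?ev i (?L i h) = zf N -->
    (\<exists>h'\<in>?T (Suc (Suc i)). ?ev (Suc i) h = ?ev (Suc i) (?L (Suc i) h')))"
 proof -
  have "?t i (?q (Suc i) h) = \<zero>\<^bsub>tensor R (?F i) N\<^esub> \<longleftrightarrow> ?ev i (?L i h) = zf N"
   if "h \<in> ?T (Suc i)" for h
   unfolding tc[OF that] by (rule zero[OF mod_hom_closed[OF L that]])
  moreover have "?q (Suc i) h \<in> ?t (Suc i) ` (tensor R (?F (Suc (Suc i))) N) \<longleftrightarrow>
   (\<exists>h'\<in>?T (Suc (Suc i)). ?ev (Suc i) h = ?ev (Suc i) (?L (Suc i) h'))"
   if h: "h \<in> ?T (Suc i)" for h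
  proof -
   have "?q (Suc i) h \<in> ?t (Suc i) ` (tensor R (?F (Suc (Suc i))) N) \<longleftrightarrow>
    (\<exists>h'\<in>?T (Suc (Suc i)). ?q (Suc i) h = ?t (Suc i) (?q (Suc (Suc i)) h'))"
    unfolding carr by blast
   also have "\<dots> \<longleftrightarrow> (\<exists>h'\<in>?T (Suc (Suc i)). ?q (Suc i) h = ?q (Suc i) (?L (Suc i) h'))"
    using tc by (intro bex_cong) auto
   also have "\<dots> \<longleftrightarrow> (\<exists>h'\<in>?T (Suc (Suc i)). ?ev (Suc i) h = ?ev (Suc i) (?L (Suc i) h'))"
    using eq[OF h mod_hom_closed[OF L]] by (intro bex_cong) auto
   finally show ?thesis .
  qed
  ultimately show ?thesis unfolding carr by auto
 qed
 also have "\<dots> \<longleftrightarrow> (\<forall>h\<in>?T (Suc i). push N (?B i) (of_cell R) (?ev (Suc i) h) = zf N -->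
    (\<exists>h'\<in>?T (Suc (Suc i)). ?ev (Suc i) h = push N (?B (Suc i)) (of_cell R) (?ev (Suc (Suc i)) h')))"
  using Lev by (intro ball_cong bex_cong imp_cong) auto
 also have "\<dots> \<longleftrightarrow> (\<forall>z\<in>?ev (Suc i) ` ?T (Suc i). push N (?B i) (of_cell R) z = zf N -->
    (\<exists>w\<in>?ev (Suc (Suc i)) ` ?T (Suc (Suc i)). z = push N (?B (Suc i)) (of_cell R) w))"
  by simp
 finally have *: "is_zero_module (Tor R (Suc i) M N) \<longleftrightarrow>
  (\<forall>z\<in>dsum N (?B (Suc i)). push N (?B i) (of_cell R) z = zf N -->
    (\<exists>w\<in>dsum N (?B (Suc (Suc i))). z = push N (?B (Suc i)) (of_cell R) w))"
  unfolding evimg .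
 have one': "(\<lambda>b. \<one>\<^sub>R \<odot>\<^sub>N z b) = z" if "z \<in> dsum N (?B n)" for z n
  using dsum_val[OF that] by simp
 show ?thesis unfolding * tor_exact_def using one'
  by (intro ball_cong imp_cong refl) (auto simp: one')
qed

section \<open>Modules of homomorphisms\<close>

lemma hom_module_simps [simp]:
 "carrier (hom_module R M N) = mod_hom R M N \<inter> extensional (carrier M)"
 "zero (hom_module R M N) = (\<lambda>x\<in>carrier M. \<zero>\<^sub>N)"
 "add (hom_module R M N) = (\<lambda>f g. \<lambda>x\<in>carrier M. f x \<oplus>\<^sub>N g x)"
 "smult (hom_module R M N) = (\<lambda>r f. \<lambda>x\<in>carrier M. r \<odot>\<^sub>N f x)"
 by (auto simp: hom_module_def)

lemma hom_module_restrict: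
 assumes "module R M" "f \<in> mod_hom R M N"
 shows "restrict f (carrier M) \<in> hom_module R M N"
 using mod_hom_cong[OF assms(2) _ assms(1)] by auto

lemma hom_module_module:
 assumes M: "module R M" and N: "module R N"
 shows "module R (hom_module R M N)"
proof -
 interpret M: module R M by fact
 interpret N: module R N by fact
 have ext: "f = g" if "f \<in> extensional (carrier M)" "g \<in> extensional (carrier M)"
  "!!x. x \<in> M ==> f x = g x" for f g :: "'c => 'e"
  using that by (rule extensionalityI)
 have add: "f \<oplus>\<^bsub>hom_module R M N\<^esub> g \<in> hom_module R M N"
  if "f \<in> hom_module R M N" "g \<in> hom_module R M N" for f g
  using hom_module_restrict[OF M mod_hom_sum[OF N]] that by simp
 have smul: "r \<odot>\<^bsub>hom_module R M N\<^esub> f \<in> hom_module R M N"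
  if "r \<in> R" "f \<in> hom_module R M N" for r f
  using hom_module_restrict[OF M mod_hom_scale[OF N]] that by simp
 have zero: "\<zero>\<^bsub>hom_module R M N\<^esub> \<in> hom_module R M N"
  unfolding hom_module_simps(2) by (rule hom_module_restrict[OF M]) (auto intro: mod_homI)
 have cl: "f x \<in> N" if "f \<in> hom_module R M N" "x \<in> M" for f x
  using that mod_hom_closed by auto
 have ex: "f \<in> extensional (carrier M)" if "f \<in> hom_module R M N" for f using that by simp
 show ?thesis
 proof (rule moduleI)
  show "abelian_group (hom_module R M N)"
  proof (rule abelian_groupI)
   fix f assume f: "f \<in> hom_module R M N"
   show "\<zero>\<^bsub>hom_module R M N\<^esub> \<oplus>\<^bsub>hom_module R M N\<^esub> f = f"
    by (rule ext) (use ex[OF f] cl[OF f] in auto)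
   show "\<exists>g\<in>hom_module R M N. g \<oplus>\<^bsub>hom_module R M N\<^esub> f = \<zero>\<^bsub>hom_module R M N\<^esub>"
   proof (rule bexI)
    have m: "\<ominus>\<^sub>R \<one>\<^sub>R \<in> R" by simp
    show "\<ominus>\<^sub>R \<one>\<^sub>R \<odot>\<^bsub>hom_module R M N\<^esub> f \<in> hom_module R M N" by (rule smul[OF m f])
    show "\<ominus>\<^sub>R \<one>\<^sub>R \<odot>\<^bsub>hom_module R M N\<^esub> f \<oplus>\<^bsub>hom_module R M N\<^esub> f = \<zero>\<^bsub>hom_module R M N\<^esub>"
     by (rule ext) (use cl[OF f] in \<open>auto simp: N.smult_l_minus N.l_neg\<close>)
   qed
  next
   fix f g h assume "f \<in> hom_module R M N" "g \<in> hom_module R M N" "h \<in> hom_module R M N"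
   then show "f \<oplus>\<^bsub>hom_module R M N\<^esub> g \<oplus>\<^bsub>hom_module R M N\<^esub> h = f \<oplus>\<^bsub>hom_module R M N\<^esub> (g \<oplus>\<^bsub>hom_module R M N\<^esub> h)"
    by (intro ext) (auto simp: N.a_ac mod_hom_closed)
  next
   fix f g assume "f \<in> hom_module R M N" "g \<in> hom_module R M N"
   then show "f \<oplus>\<^bsub>hom_module R M N\<^esub> g = g \<oplus>\<^bsub>hom_module R M N\<^esub> f"
    by (intro ext) (auto simp: N.a_ac mod_hom_closed)
  qed (use add zero in auto)
 next
  fix r s f assume "r \<in> R" "s \<in> R" "f \<in> hom_module R M N"
  then show "(r \<oplus>\<^sub>R s) \<odot>\<^bsub>hom_module R M N\<^esub> f = r \<odot>\<^bsub>hom_module R M N\<^esub> f \<oplus>\<^bsub>hom_module R M N\<^esub> s \<odot>\<^bsub>hom_module R M N\<^esub> f"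
   "(r \<otimes>\<^sub>R s) \<odot>\<^bsub>hom_module R M N\<^esub> f = r \<odot>\<^bsub>hom_module R M N\<^esub> (s \<odot>\<^bsub>hom_module R M N\<^esub> f)"
   by (intro ext; auto simp: N.smult_l_distr N.smult_assoc1 mod_hom_closed)+
 next
  fix r f g assume "r \<in> R" "f \<in> hom_module R M N" "g \<in> hom_module R M N"
  then show "r \<odot>\<^bsub>hom_module R M N\<^esub> (f \<oplus>\<^bsub>hom_module R M N\<^esub> g) = r \<odot>\<^bsub>hom_module R M N\<^esub> f \<oplus>\<^bsub>hom_module R M N\<^esub> r \<odot>\<^bsub>hom_module R M N\<^esub> g"
   by (intro ext) (auto simp: N.smult_r_distr mod_hom_closed)
 next
  fix f assume f: "f \<in> hom_module R M N"
  show "\<one>\<^sub>R \<odot>\<^bsub>hom_module R M N\<^esub> f = f" by (rule ext) (use ex[OF f] cl[OF f] in auto)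
 qed (use smul M.is_cring in auto)
qed

lemma hom_module_precompose:
 assumes M: "module R M" and M': "module R M'" and d: "d \<in> mod_hom R M' M"
 shows "(\<lambda>f. compose (carrier M') f d) \<in> mod_hom R (hom_module R M N) (hom_module R M' N)"
proof (rule mod_homI)
 show "compose (carrier M') f d \<in> hom_module R M' N" if "f \<in> hom_module R M N" for f
  unfolding compose_def using that by (intro hom_module_restrict[OF M'] mod_hom_comp[OF d]) auto
qed (auto simp: compose_def mod_hom_closed[OF d] restrict_def)

text \<open>A map out of a free module is the family of its values on the basis. The functions
  \<open>to\<close> and \<open>of'\<close> are the two directions of this identification, under
  which composition with the differential becomes \<open>pull\<close>.\<close>

lemma is_zero_Ext:
 assumes M: "module R M" and N: "module R N"
 shows "is_zero_module (Ext R (Suc i) M N) \<longleftrightarrow> ext_exact R N (res_basis R M) (\<lambda>_. of_cell R) i"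
proof -
 interpret N: module R N by fact
 let ?B = "res_basis R M"
 let ?F = "\<lambda>n. free_module R (?B n)"
 let ?d = "\<lambda>n. lin_ext R (?F n) (of_cell R)"
 let ?H = "\<lambda>n. hom_module R (?F n) N"
 let ?c = "\<lambda>n f. compose (carrier (?F (Suc n))) f (?d n)"
 note A = standard_resolution_rmat[OF M]
 have F: "module R (?F n)" for n by (rule free_module_module[OF N.is_cring])
 have H: "module R (?H n)" for n by (rule hom_module_module[OF F N])
 have d: "?d n \<in> mod_hom R (?F (Suc n)) (?F n)" for n by (rule lin_ext_hom[OF F rmat_row[OF A]])
 have dd: "?d n (?d (Suc n) f) = \<zero>\<^bsub>?F n\<^esub>" if "f \<in> ?F (Suc (Suc n))" for n f
  using standard_resolution[OF M] mod_hom_closed[OF d that] that unfolding free_resolution_def by blast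
 have c: "?c n \<in> mod_hom R (?H n) (?H (Suc n))" for n by (rule hom_module_precompose[OF F F d])
 have cc: "?c (Suc n) (?c n f) = \<zero>\<^bsub>?H (Suc (Suc n))\<^esub>" if "f \<in> ?H n" for n f
  using that mod_hom_closed[OF d] dd mod_hom_zero[OF F N, of f n] by (auto simp: compose_def restrict_def)
 define to where "to n e = restrict (lin_ext R N e) (carrier (?F n))" for n and e :: "('a, 'c) cell => 'e"
 define of' where "of' n f = (\<lambda>b. if b \<in> ?B n then f (basis_elt R b) else \<zero>\<^sub>N)" for n and f :: "(('a, 'c) cell => 'a) => 'e"
 have to: "to n e \<in> ?H n" if "e \<in> dprod N (?B n)" for n e
  unfolding to_def by (rule hom_module_restrict[OF F lin_ext_hom[OF N dprod_val[OF that]]])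
 have of: "of' n f \<in> dprod N (?B n)" if "f \<in> ?H n" for n f
  using that basis_elt_closed[OF N.is_cring, of _ "?B n"] mod_hom_closed[of f R "?F n" N]
  by (intro dprodI) (auto simp: of'_def)
 have ofto: "of' n (to n e) = e" if e: "e \<in> dprod N (?B n)" for n e
  using basis_elt_closed[OF N.is_cring, of _ "?B n"] lin_ext_basis[OF N, of e] dprodD[OF e]
  by (auto simp: of'_def to_def)
 have toof: "to n (of' n f) = f" if f: "f \<in> ?H n" for n f
 proof (rule extensionalityI[of _ "carrier (?F n)"])
  fix x assume x: "x \<in> ?F n"
  have v: "of' n f b \<in> N" for b using dprod_val[OF of[OF f]] .
  have "lin_ext R N (of' n f) x = f x"
  proof (rule free_hom_eq[OF N lin_ext_hom[OF N v] _ _ x])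
   show "f \<in> mod_hom R (?F n) N" using f by simp
   show "lin_ext R N (of' n f) (basis_elt R b) = f (basis_elt R b)" if "b \<in> ?B n" for b
    using lin_ext_basis[where \<mu> = "of' n f" and b = b, OF N v] that by (simp add: of'_def)
  qed
  then show "to n (of' n f) x = f x" using x by (simp add: to_def)
 qed (use f in \<open>auto simp: to_def\<close>)
 have cto: "?c n (to n e) = to (Suc n) (pull R N (?B (Suc n)) (of_cell R) e)" if e: "e \<in> dprod N (?B n)" for n e
 proof (rule extensionalityI[of _ "carrier (?F (Suc n))"])
  fix x assume x: "x \<in> ?F (Suc n)"
  note ev = dprod_val[OF e]
  have "lin_ext R N e (?d n x) = lin_ext R N (\<lambda>b. lin_ext R N e (of_cell R b)) x"
   by (rule lin_ext_comp[OF N A ev x])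
  also have "\<dots> = lin_ext R N (pull R N (?B (Suc n)) (of_cell R) e) x"
   by (rule lin_ext_cong[OF x N])
    (use mod_hom_closed[OF lin_ext_hom[OF N ev] rmat_row[OF A]] in \<open>auto simp: pull_def\<close>)
  finally show "?c n (to n e) x = to (Suc n) (pull R N (?B (Suc n)) (of_cell R) e) x"
   using x mod_hom_closed[OF d x] by (simp add: compose_def to_def)
 qed (auto simp: to_def)
 have toz: "to n e = \<zero>\<^bsub>?H n\<^esub> \<longleftrightarrow> e = zf N" if e: "e \<in> dprod N (?B n)" for n e
 proof -
  have "(zf N) \<in> dprod N (?B n)" by (rule dprodI) auto
  moreover have "to n (zf N) = \<zero>\<^bsub>?H n\<^esub>"
  proof (rule extensionalityI[of _ "carrier (?F n)"])
   fix x assume x: "x \<in> ?F n"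
   have "(\<lambda>f. \<zero>\<^sub>N) \<in> mod_hom R (?F n) N" by (rule mod_homI) auto
   then have "lin_ext R N (zf N) x = \<zero>\<^sub>N"
    by (intro free_hom_eq[OF N lin_ext_hom[OF N] _ _ x]) (auto simp: lin_ext_basis[OF N])
   then show "to n (zf N) x = \<zero>\<^bsub>?H n\<^esub> x" using x by (simp add: to_def)
  qed (auto simp: to_def)
  ultimately show ?thesis using ofto[OF e] ofto[of "\<lambda>_. \<zero>\<^sub>N" n] by metis
 qed
 have img: "to n ` dprod N (?B n) = carrier (?H n)" for n using to toof of by force
 have inj: "to n e = to n e' \<longleftrightarrow> e = e'" if "e \<in> dprod N (?B n)" "e' \<in> dprod N (?B n)" for n e e'
  using ofto that by metis
 have "is_zero_module (Ext R (Suc i) M N) \<longleftrightarrow>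
   (\<forall>x\<in>?H (Suc i). ?c (Suc i) x = \<zero>\<^bsub>?H (Suc (Suc i))\<^esub> --> x \<in> ?c i ` ?H i)"
  unfolding Ext_def res_def res_diff.simps diff_Suc_1
  by (rule is_zero_homology[OF H H H]) (rule c, rule c, rule cc)
 also have "\<dots> \<longleftrightarrow> (\<forall>e\<in>dprod N (?B (Suc i)). ?c (Suc i) (to (Suc i) e) = \<zero>\<^bsub>?H (Suc (Suc i))\<^esub> -->
    (\<exists>e'\<in>dprod N (?B i). to (Suc i) e = ?c i (to i e')))"
  unfolding img[symmetric] by auto
 also have "\<dots> \<longleftrightarrow> ext_exact R N ?B (\<lambda>_. of_cell R) i"
  unfolding ext_exact_def
  using cto toz[OF pull_closed[OF N A]] inj[OF _ pull_closed[OF N A]]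
  by (intro ball_cong imp_cong bex_cong refl) auto
 finally show ?thesis .
qed

section \<open>Balancing Tor\<close>

lemma free_resolutionD:
 assumes R: "cring R" and res: "free_resolution R M B A \<mu>"
 shows res_rmat: "rmat R (B (Suc i)) (B i) (A i)"
  and res_gen: "b \<in> B 0 ==> \<mu> b \<in> carrier M"
  and res_surj: "m \<in> carrier M ==> \<exists>f\<in>fmod R (B 0). lin_ext R M \<mu> f = m"
  and res_exact0: "f \<in> (fmod R (B 0)) ==> lin_ext R M \<mu> f = \<zero>\<^sub>M ==>
   \<exists>g\<in>fmod R (B (Suc 0)). bd (reg R) B A 0 g = f"
  and res_exact: "f \<in> (fmod R (B (Suc i))) ==> bd (reg R) B A i f = zf R ==>
   \<exists>g\<in>fmod R (B (Suc (Suc i))). bd (reg R) B A (Suc i) g = f"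
  and res_comp0: "g \<in> (fmod R (B (Suc 0))) ==> lin_ext R M \<mu> (bd (reg R) B A 0 g) = \<zero>\<^sub>M"
  and res_comp: "g \<in> (fmod R (B (Suc (Suc i)))) ==>
   bd (reg R) B A i (bd (reg R) B A (Suc i) g) = zf R"
proof -
 note F = free_eq_dsum
 have rm: "rmat R (B (Suc i)) (B i) (A i)" for i using res by (simp add: free_resolution_def)
 then show "rmat R (B (Suc i)) (B i) (A i)" .
 have p: "lin_ext R (fmod R (B i)) (A i) f = bd (reg R) B A i f"
  if "f \<in> fmod R (B (Suc i))" for i f
  using lin_ext_free[OF R rm, of f i] that by (simp add: F)
 have pi: "bd (reg R) B A i f \<in> lin_ext R (fmod R (B i)) (A i) ` fmod R (B (Suc i))"
  if "f \<in> fmod R (B (Suc i))" for i f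
  by (subst p[OF that, symmetric]) (rule imageI[OF that])
 have pc: "bd (reg R) B A i f \<in> fmod R (B i)"
  if "f \<in> fmod R (B (Suc i))" for i f
  by (rule mod_hom_closed[OF push_hom[OF reg_module[OF R] rm] that])
 show "b \<in> B 0 ==> \<mu> b \<in> M" using res by (simp add: free_resolution_def)
 show "m \<in> M ==> \<exists>f\<in>fmod R (B 0). lin_ext R M \<mu> f = m"
  using res unfolding free_resolution_def F by (metis imageE)
 have e0: "lin_ext R M \<mu> f = \<zero>\<^sub>M \<longleftrightarrow> f \<in> lin_ext R (fmod R (B 0)) (A 0) ` fmod R (B (Suc 0))"
  if "f \<in> fmod R (B 0)" for f
  using res that unfolding free_resolution_def F One_nat_def by blast
 have ei: "lin_ext R (fmod R (B i)) (A i) f = zf R \<longleftrightarrow>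
   f \<in> lin_ext R (fmod R (B (Suc i))) (A (Suc i)) ` fmod R (B (Suc (Suc i)))"
  if "f \<in> fmod R (B (Suc i))" for f i
  using res that unfolding free_resolution_def F dsum_simps regular_module_simps by blast
 show "f \<in> (fmod R (B 0)) ==> lin_ext R M \<mu> f = \<zero>\<^sub>M ==>
   \<exists>g\<in>fmod R (B (Suc 0)). bd (reg R) B A 0 g = f"
  using e0 p[of _ 0] by auto
 show "f \<in> (fmod R (B (Suc i))) ==> bd (reg R) B A i f = zf R ==>
   \<exists>g\<in>fmod R (B (Suc (Suc i))). bd (reg R) B A (Suc i) g = f"
  using ei[of f i] p[of _ i] p[of _ "Suc i"] by auto
 show "g \<in> (fmod R (B (Suc 0))) ==> lin_ext R M \<mu> (bd (reg R) B A 0 g) = \<zero>\<^sub>M"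
  using e0[OF pc, of g] pi[of g 0] by blast
 show "g \<in> (fmod R (B (Suc (Suc i)))) ==>
   bd (reg R) B A i (bd (reg R) B A (Suc i) g) = zf R"
  using ei[OF pc, of g i] p[OF pc, of g i] pi[of g "Suc i"] by simp
qed

section \<open>Families in two indices, treated one coordinate at a time\<close>

lemma slice_closed:
 assumes "module R G" "z \<in> dsum (dsum G C) B"
 shows "(\<lambda>b. z b c) \<in> dsum G B"
 using mod_hom_closed[OF dsum_map_hom[OF dsum_module[OF assms(1)] assms(1) dsum_eval_hom[OF assms(1)]] assms(2)] .

lemma push_slice:
 assumes "module R G" "rmat R B' B A" "z \<in> dsum (dsum G C) B'"
 shows "push G B A (\<lambda>b. z b c) = (\<lambda>b. push (dsum G C) B A z b c)"
 using push_natural[OF dsum_module[OF assms(1)] assms(1) dsum_eval_hom[OF assms(1)] assms(2,3)] .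

lemma assemble_slices:
 assumes M: "module R M" and C: "finite C0" "C0 \<subseteq> C"
  and w: "!!c. c \<in> C0 ==> w c \<in> dsum M B" "!!c. c \<notin> C0 ==> w c = zf M"
 shows "(\<lambda>b c. w c b) \<in> dsum (dsum M C) B"
proof -
 interpret M: module R M by fact
 have v: "w c b \<in> M" for c b using dsum_val[OF w(1)] w(2) by (cases "c \<in> C0") auto
 let ?X = "\<Union>c\<in>C0. {b. w c b \<noteq> \<zero>\<^sub>M}"
 show ?thesis
 proof (rule dsumI_superset[of _ _ ?X])
  show "(\<lambda>c. w c b) \<in> dsum M C" for b
   by (rule dsumI_superset[OF v _ C]) (simp add: w(2))
  show "(\<lambda>c. w c b) = \<zero>\<^bsub>dsum M C\<^esub>" if "b \<notin> ?X" for b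
   using that w(2) by (auto simp: fun_eq_iff)
  show "finite ?X" using C(1) dsum_fin[OF w(1)] by auto
  show "?X \<subseteq> B" using dsum_supp[OF w(1)] by blast
 qed
qed

lemma slice_support:
 assumes "module R M" "z \<in> dsum (dsum M C) B"
 obtains C0 where "finite C0" "C0 \<subseteq> C" "!!c b. c \<notin> C0 ==> z b c = \<zero>\<^sub>M"
proof
 let ?C = "\<Union>b\<in>{b. z b \<noteq> \<zero>\<^bsub>dsum M C\<^esub>}. {c. z b c \<noteq> \<zero>\<^sub>M}"
 show "finite ?C" using dsum_fin[OF assms(2)] dsum_fin[OF dsum_val[OF assms(2)]] by auto
 show "?C \<subseteq> C" using dsum_supp[OF dsum_val[OF assms(2)]] by blast
 show "z b c = \<zero>\<^sub>M" if "c \<notin> ?C" for b c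
  using that by (cases "z b = \<zero>\<^bsub>dsum M C\<^esub>") auto
qed

text \<open>The matrix acts on each coordinate c separately, so preimages can be chosen for each c;
  only finitely many coordinates occur, which keeps the assembled family finitely supported.\<close>

lemma push_slice_lift:
 assumes M: "module R M" and A: "rmat R B' B A" and z: "z \<in> dsum (dsum M C) B"
  and ex: "!!c. c \<in> C ==> \<exists>w\<in>dsum M B'. push M B A w = (\<lambda>b. z b c)"
 obtains w where "w \<in> dsum (dsum M C) B'" "push (dsum M C) B A w = z"
proof -
 obtain C0 where C0: "finite C0" "C0 \<subseteq> C" "!!c b. c \<notin> C0 ==> z b c = \<zero>\<^sub>M"
  using slice_support[OF M z] by blast
 define w where "w c = (if c \<in> C0 then SOME v. v \<in> dsum M B' \<and> push M B A v = (\<lambda>b. z b c)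
   else (zf M))" for c
 have w: "w c \<in> dsum M B' \<and> push M B A (w c) = (\<lambda>b. z b c)" if "c \<in> C0" for c
 proof -
  have "\<exists>v. v \<in> dsum M B' \<and> push M B A v = (\<lambda>b. z b c)" using ex that C0(2) by blast
  from someI_ex[OF this] show ?thesis using that by (simp add: w_def)
 qed
 have w0: "w c = zf M" if "c \<notin> C0" for c using that by (simp add: w_def)
 have W: "(\<lambda>b c. w c b) \<in> dsum (dsum M C) B'"
  by (rule assemble_slices[OF M C0(1,2)]) (use w w0 in auto)
 have "push (dsum M C) B A (\<lambda>b c. w c b) b c = z b c" for b c
 proof -
  have "push (dsum M C) B A (\<lambda>b c. w c b) b c = push M B A (w c) b"
   using push_slice[OF M A W, of c] by (simp add: fun_eq_iff)
  also have "\<dots> = z b c"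
  proof (cases "c \<in> C0")
   case False
   then show ?thesis using w0 C0(3) mod_hom_zero[OF dsum_module[OF M] dsum_module[OF M] push_hom[OF M A]] by simp
  qed (use w in simp)
  finally show ?thesis .
 qed
 then show ?thesis using that W by blast
qed

text \<open>Flatness of free modules: the preimage is found in each coordinate of R^(C).\<close>

lemma free_coefficients_exact:
 assumes R: "cring R" and res: "free_resolution R M B A \<mu>"
  and z: "z \<in> dsum (fmod R C) (B (Suc i))"
  and cyc: "bd (fmod R C) B A i z = (\<lambda>_ _. \<zero>\<^sub>R)"
 obtains w where "w \<in> dsum (fmod R C) (B (Suc (Suc i)))"
  "bd (fmod R C) B A (Suc i) w = z"
proof (rule push_slice_lift[OF reg_module[OF R] res_rmat[OF R res] z])
 fix c
 show "\<exists>w\<in>fmod R (B (Suc (Suc i))). bd (reg R) B A (Suc i) w = (\<lambda>b. z b c)"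
  using res_exact[OF R res slice_closed[OF reg_module[OF R] z]]
   push_slice[OF reg_module[OF R] res_rmat[OF R res] z] cyc by simp
qed (use that in blast)

text \<open>The augmentation of a resolution of M tensored with a free module on c-coordinates, as a
  map from double families to families in M. It is the end map of the double complex in one of its
  two directions.\<close>

definition aug :: "('r, 'c) ring_scheme => ('r, 'm, 'd) module_scheme => ('b => 'm) => ('b => 'x => 'r) => 'x => 'm"
 where "aug R M \<mu> z = (\<lambda>c. lin_ext R M \<mu> (\<lambda>b. z b c))"

context
 fixes R :: "('r, 'c) ring_scheme" and M :: "('r, 'm, 'd) module_scheme"
  and B :: "nat => 'b set" and A \<mu>
 assumes M: "module R M" and res: "free_resolution R M B A \<mu>"
begin

interpretation M: module R M by (rule M)

lemma R_cring: "cring R" by (rule M.is_cring)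

lemma aug_hom: "aug R M \<mu> \<in> mod_hom R (dsum (fmod R C) (B 0)) (dsum M C)"
proof -
 note S = reg_module[OF R_cring]
 note lh = lin_ext_hom[OF M res_gen[OF R_cring res], unfolded free_eq_dsum]
 have lh: "lin_ext R M \<mu> \<in> mod_hom R (fmod R (B 0)) M"
  using lin_ext_hom[OF M res_gen[OF R_cring res]] by (simp add: free_eq_dsum)
 show ?thesis
 proof (rule mod_homI)
  fix z assume z: "z \<in> dsum (fmod R C) (B 0)"
  obtain C0 where C0: "finite C0" "C0 \<subseteq> C" "!!c b. c \<notin> C0 ==> z b c = \<zero>\<^bsub>reg R\<^esub>"
   using slice_support[OF S z] by blast
  have z0: "lin_ext R M \<mu> (zf R) = \<zero>\<^sub>M" by (simp add: lin_ext_def)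
  show "aug R M \<mu> z \<in> dsum M C"
   unfolding aug_def
   by (rule dsumI_superset[OF _ _ C0(1,2)])
    (use mod_hom_closed[OF lh slice_closed[OF S z]] C0(3) z0 in auto)
  fix z' assume z': "z' \<in> dsum (fmod R C) (B 0)"
  show "aug R M \<mu> (z \<oplus>\<^bsub>dsum (fmod R C) (B 0)\<^esub> z') = aug R M \<mu> z \<oplus>\<^bsub>dsum M C\<^esub> aug R M \<mu> z'"
   using mod_hom_add[OF lh slice_closed[OF S z] slice_closed[OF S z']] by (simp add: aug_def)
 next
  fix r z assume r: "r \<in> R" and z: "z \<in> dsum (fmod R C) (B 0)"
  show "aug R M \<mu> (r \<odot>\<^bsub>dsum (fmod R C) (B 0)\<^esub> z) = r \<odot>\<^bsub>dsum M C\<^esub> aug R M \<mu> z"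
   using mod_hom_smult[OF lh r slice_closed[OF S z]] by (simp add: aug_def)
 qed
qed

lemma aug_push_zero:
 assumes z: "z \<in> dsum (fmod R C) (B (Suc 0))"
 shows "aug R M \<mu> (bd (fmod R C) B A 0 z) = zf M"
 unfolding aug_def
 using res_comp0[OF R_cring res slice_closed[OF reg_module[OF R_cring] z]]
  push_slice[OF reg_module[OF R_cring] res_rmat[OF R_cring res] z]
 by simp

lemma aug_kernel:
 assumes z: "z \<in> dsum (fmod R C) (B 0)" and k: "aug R M \<mu> z = zf M"
 obtains w where "w \<in> dsum (fmod R C) (B (Suc 0))" "bd (fmod R C) B A 0 w = z"
proof (rule push_slice_lift[OF reg_module[OF R_cring] res_rmat[OF R_cring res] z])
 fix c
 show "\<exists>w\<in>fmod R (B (Suc 0)). bd (reg R) B A 0 w = (\<lambda>b. z b c)"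
  using res_exact0[OF R_cring res slice_closed[OF reg_module[OF R_cring] z]] k
  by (simp add: aug_def fun_eq_iff)
qed (use that in blast)

lemma aug_surj:
 assumes m: "m \<in> dsum M C"
 obtains z where "z \<in> dsum (fmod R C) (B 0)" "aug R M \<mu> z = m"
proof -
 note S = reg_module[OF R_cring]
 let ?C0 = "{c. m c \<noteq> \<zero>\<^sub>M}"
 define w where "w c = (if c \<in> ?C0 then SOME f. f \<in> fmod R (B 0) \<and> lin_ext R M \<mu> f = m c
   else (zf (reg R)))" for c
 have w: "w c \<in> fmod R (B 0) \<and> lin_ext R M \<mu> (w c) = m c" if "c \<in> ?C0" for c
 proof -
  have "\<exists>f. f \<in> fmod R (B 0) \<and> lin_ext R M \<mu> f = m c"
   using res_surj[OF R_cring res dsum_val[OF m]] by blast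
  from someI_ex[OF this] show ?thesis using that by (simp add: w_def)
 qed
 have w0: "w c = zf (reg R)" if "c \<notin> ?C0" for c using that by (simp add: w_def)
 have "(\<lambda>b c. w c b) \<in> dsum (fmod R C) (B 0)"
  by (rule assemble_slices[OF S dsum_fin[OF m] dsum_supp[OF m]]) (use w w0 in auto)
 moreover have "aug R M \<mu> (\<lambda>b c. w c b) = m"
  unfolding aug_def
 proof
  fix c
  show "lin_ext R M \<mu> (\<lambda>b. w c b) = m c"
  proof (cases "c \<in> ?C0")
   case False
   then show ?thesis using w0 by (simp add: lin_ext_def)
  qed (use w in simp)
 qed
 ultimately show ?thesis using that by blast
qed

lemma aug_sing:
 assumes b: "b \<in> B 0" and g: "g \<in> fmod R X"
 shows "aug R M \<mu> (sing (fmod R X) b g) = (\<lambda>c. g c \<odot>\<^sub>M \<mu> b)"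
proof
  fix c
  have "(\<lambda>b'. sing (fmod R X) b g b' c) = sing (reg R) b (g c)" by (auto simp: sing_def)
  then show "aug R M \<mu> (sing (fmod R X) b g) c = g c \<odot>\<^sub>M \<mu> b"
   using lin_ext_sing[where \<mu> = \<mu> and b = b and r = "g c", OF M res_gen[OF R_cring res b]] dsum_val[OF g]
   by (simp add: aug_def)
qed

lemma aug_natural:
 assumes A': "rmat R C' C A'" and z: "z \<in> dsum (fmod R C') (B 0)"
 shows "aug R M \<mu> (\<lambda>b. push (reg R) C A' (z b)) = push M C A' (aug R M \<mu> z)"
proof -
 note S = reg_module[OF R_cring]
 note p = push_hom[OF S A']
 show ?thesis
 proof (rule dsum_hom_eq[OF dsum_module[OF S] dsum_module[OF M]
    mod_hom_comp[OF dsum_map_hom[OF dsum_module[OF S] dsum_module[OF S] p] aug_hom]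
    mod_hom_comp[OF aug_hom push_hom[OF M A']] _ z])
  fix b g assume b: "b \<in> B 0" and g: "g \<in> fmod R C'"
  have \<mu>: "(\<lambda>r. r \<odot>\<^sub>M \<mu> b) \<in> mod_hom R (reg R) M"
   using res_gen[OF R_cring res b] by (intro mod_homI) (auto simp: M.smult_l_distr M.smult_assoc1)
  have "(\<lambda>b'. push (reg R) C A' (sing (fmod R C') b g b')) = sing (fmod R C) b (push (reg R) C A' g)"
   using mod_hom_zero[OF dsum_module[OF S] dsum_module[OF S] p] by (auto simp: sing_def)
  then show "aug R M \<mu> (\<lambda>b'. push (reg R) C A' (sing (fmod R C') b g b')) =
    push M C A' (aug R M \<mu> (sing (fmod R C') b g))"
   using aug_sing[OF b g] aug_sing[OF b mod_hom_closed[OF p g]] push_natural[OF S M \<mu> A' g] by simp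
 qed
qed

end

text \<open>A diagram chase in the double complex of two resolutions, from a 1-cycle over M to a
  1-cycle over N and back. The element s of S is the one that the hypothesis supplies for the cycle
  over N.\<close>

lemma tor_balanced_1:
 assumes M: "module R M" and N: "module R N" and resM: "free_resolution R M B A \<mu>"
  and resN: "free_resolution R N C A' \<nu>" and S: "S \<subseteq> carrier R" and ex: "tor_exact S N B A 0"
 shows "tor_exact S M C A' 0"
 unfolding tor_exact_def
proof (intro ballI impI)
 interpret M: module R M by fact
 interpret N: module R N by fact
 note R = M.is_cring
 note Rg = reg_module[OF R]
 define G where "G j = fmod R (C j)" for j
 \<comment> \<open>D i j is the tensor product of the i-th module resolving M and the j-th module
   resolving N. The maps \<open>p\<close> and \<delta> are its two differentials, \<open>aug\<close>
   and \<epsilon> the augmentations at i = 0 and at j = 0.\<close>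
 define D where "D i j = dsum (G j) (B i)" for i j
 have G: "module R (G j)" for j unfolding G_def by (rule dsum_module[OF Rg])
 have D: "module R (D i j)" for i j unfolding D_def by (rule dsum_module[OF G])
 define \<delta> where "\<delta> j = bd (reg R) C A' j" for j
 define \<epsilon> where "\<epsilon> = lin_ext R N \<nu>"
 define p where "p i j = bd (G j) B A i" for i j
 have \<delta>: "\<delta> j \<in> mod_hom R (G (Suc j)) (G j)" for j
  unfolding \<delta>_def G_def by (rule push_hom[OF Rg res_rmat[OF R resN]])
 have \<epsilon>: "\<epsilon> \<in> mod_hom R (G 0) N"
  unfolding \<epsilon>_def G_def using lin_ext_hom[OF N res_gen[OF R resN]] by (simp add: free_eq_dsum)
 have p: "p i j \<in> mod_hom R (D (Suc i) j) (D i j)" for i j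
  unfolding p_def D_def by (rule push_hom[OF G res_rmat[OF R resM]])
 have \<delta>D: "(\<lambda>f b. \<delta> j (f b)) \<in> mod_hom R (D i (Suc j)) (D i j)" for i j
  unfolding D_def by (rule dsum_map_hom[OF G G \<delta>])
 have \<epsilon>D: "(\<lambda>f b. \<epsilon> (f b)) \<in> mod_hom R (D i 0) (dsum N (B i))" for i
  unfolding D_def by (rule dsum_map_hom[OF G N \<epsilon>])
 have pN: "bd N B A i \<in> mod_hom R (dsum N (B (Suc i))) (dsum N (B i))" for i
  by (rule push_hom[OF N res_rmat[OF R resM]])
 have nat\<delta>: "p i j (\<lambda>b. \<delta> j (f b)) = (\<lambda>b. \<delta> j (p i (Suc j) f b))" if "f \<in> D (Suc i) (Suc j)" for i j f
  unfolding p_def using push_natural[OF G G \<delta> res_rmat[OF R resM]] that by (simp add: D_def)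
 have nat\<epsilon>: "bd N B A i (\<lambda>b. \<epsilon> (f b)) = (\<lambda>b. \<epsilon> (p i 0 f b))" if "f \<in> D (Suc i) 0" for i f
  unfolding p_def using push_natural[OF G N \<epsilon> res_rmat[OF R resM]] that by (simp add: D_def)
 have \<alpha>: "aug R M \<mu> \<in> mod_hom R (D 0 j) (dsum M (C j))" for j
  unfolding D_def G_def by (rule aug_hom[OF M resM])
 have nat\<alpha>: "aug R M \<mu> (\<lambda>b. \<delta> j (f b)) = bd M C A' j (aug R M \<mu> f)" if "f \<in> D 0 (Suc j)" for j f
  unfolding \<delta>_def using aug_natural[OF M resM res_rmat[OF R resN]] that by (simp add: D_def G_def)
 fix w assume w: "w \<in> dsum M (C (Suc 0))" and wz: "bd M C A' 0 w = zf M"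
 obtain v where v: "v \<in> D 0 1" "aug R M \<mu> v = w"
  using aug_surj[OF M resM w] unfolding D_def G_def One_nat_def by blast
 \<comment> \<open>The boundary u of the lift v of w is killed by the augmentation, so it comes from
   some y, whose image over N is a 1-cycle.\<close>
 define u where "u = (\<lambda>b. \<delta> 0 (v b))"
 have u: "u \<in> D 0 0" unfolding u_def using mod_hom_closed[OF \<delta>D] v(1) by simp
 have "aug R M \<mu> u = zf M" unfolding u_def using nat\<alpha>[of v 0] v wz by simp
 then obtain y where y: "y \<in> D 1 0" "p 0 0 y = u"
  using aug_kernel[OF M resM] u unfolding D_def G_def p_def One_nat_def by metis
 have \<epsilon>\<delta>: "\<epsilon> (\<delta> 0 g) = \<zero>\<^sub>N" if "g \<in> G 1" for g
  unfolding \<epsilon>_def \<delta>_def using res_comp0[OF R resN] that by (simp add: G_def)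
 have ker\<epsilon>: "g \<in> \<delta> 0 ` G 1" if "g \<in> G 0" "\<epsilon> g = \<zero>\<^sub>N" for g
  using res_exact0[OF R resN, of g] that unfolding \<epsilon>_def \<delta>_def G_def One_nat_def by blast
 have ker\<delta>: "g \<in> \<delta> 1 ` G 2" if "g \<in> G 1" "\<delta> 0 g = zf R" for g
  using res_exact[OF R resN, of g 0] that unfolding \<delta>_def G_def One_nat_def numeral_2_eq_2 by blast
 have \<epsilon>y: "(\<lambda>b. \<epsilon> (y b)) \<in> dsum N (B (Suc 0))" using mod_hom_closed[OF \<epsilon>D y(1)] by simp
 have "bd N B A 0 (\<lambda>b. \<epsilon> (y b)) = zf N"
  using nat\<epsilon>[of y 0] y \<epsilon>\<delta> dsum_val[OF v(1)[unfolded D_def]] by (simp add: u_def)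
 then obtain s x where s: "s \<in> S" and x: "x \<in> dsum N (B (Suc (Suc 0)))"
  and sx: "(\<lambda>b. s \<odot>\<^sub>N \<epsilon> (y b)) = bd N B A (Suc 0) x"
  using ex \<epsilon>y unfolding tor_exact_def by blast
 have sR: "s \<in> R" using s S by auto
 have \<epsilon>surj: "n \<in> \<epsilon> ` G 0" if "n \<in> N" for n
  using res_surj[OF R resN that] unfolding \<epsilon>_def G_def by auto
 obtain x' where x': "x' \<in> D 2 0" "!!b. \<epsilon> (x' b) = x b"
  using dsum_map_lift[OF G N \<epsilon> x] \<epsilon>surj dsum_val[OF x] unfolding D_def numeral_2_eq_2 by blast
 interpret D10: module R "D 1 0" by (rule D)
 interpret D01: module R "D 0 1" by (rule D)
 interpret D00: module R "D 0 0" by (rule D)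
 interpret DM: module R "dsum M (C (Suc 0))" by (rule dsum_module[OF M])
 interpret DN: module R "dsum N (B (Suc 0))" by (rule dsum_module[OF N])
 \<comment> \<open>s y is corrected by a boundary so that \<epsilon> t = 0; hence t comes from some
   q in D 1 1.\<close>
 define t where "t = s \<odot>\<^bsub>D 1 0\<^esub> y \<ominus>\<^bsub>D 1 0\<^esub> p 1 0 x'"
 have px': "p 1 0 x' \<in> D 1 0" using mod_hom_closed[OF p[of 1 0]] x'(1) by (simp add: numeral_2_eq_2)
 have sy: "s \<odot>\<^bsub>D 1 0\<^esub> y \<in> D 1 0" by (rule D10.smult_closed[OF sR y(1)])
 have t: "t \<in> D 1 0" unfolding t_def by (rule D10.minus_closed[OF sy px'])
 have "(\<lambda>b. \<epsilon> (t b)) = \<zero>\<^bsub>dsum N (B 1)\<^esub>"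
 proof -
  have "(\<lambda>b. \<epsilon> (t b)) = (\<lambda>b. \<epsilon> ((s \<odot>\<^bsub>D 1 0\<^esub> y) b)) \<ominus>\<^bsub>dsum N (B 1)\<^esub> (\<lambda>b. \<epsilon> (p 1 0 x' b))"
   unfolding t_def using mod_hom_minus[OF D dsum_module[OF N] \<epsilon>D sy px'] .
  also have "(\<lambda>b. \<epsilon> ((s \<odot>\<^bsub>D 1 0\<^esub> y) b)) = s \<odot>\<^bsub>dsum N (B 1)\<^esub> (\<lambda>b. \<epsilon> (y b))"
   using mod_hom_smult[OF \<epsilon>D sR y(1)] .
  also have "\<dots> = (\<lambda>b. \<epsilon> (p 1 0 x' b))" using sx nat\<epsilon>[of x' 1] x' by (simp add: numeral_2_eq_2)
  finally show ?thesis using mod_hom_closed[OF \<epsilon>D px'] by simp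
 qed
 then have tk: "\<epsilon> (t b) = \<zero>\<^sub>N" for b by (auto dest: fun_cong)
 obtain q where q: "q \<in> D 1 1" "!!b. \<delta> 0 (q b) = t b"
  using dsum_map_lift[OF G G \<delta> t[unfolded D_def]] ker\<epsilon> tk dsum_val[OF t[unfolded D_def]] unfolding D_def One_nat_def by metis
 \<comment> \<open>The same correction one step further: s v and p q both have the boundary s u, so
   r comes from some c in D 0 2. As \<open>aug\<close> sends r to s w, the image of c is the
   preimage sought.\<close>
 define r where "r = s \<odot>\<^bsub>D 0 1\<^esub> v \<ominus>\<^bsub>D 0 1\<^esub> p 0 1 q"
 have pq: "p 0 1 q \<in> D 0 1" using mod_hom_closed[OF p[of 0 1]] q(1) by simp
 have sv: "s \<odot>\<^bsub>D 0 1\<^esub> v \<in> D 0 1" by (rule D01.smult_closed[OF sR v(1)])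
 have r: "r \<in> D 0 1" unfolding r_def by (rule D01.minus_closed[OF sv pq])
 have pt: "p 0 0 t = s \<odot>\<^bsub>D 0 0\<^esub> u"
 proof -
  have "p 0 0 t = p 0 0 (s \<odot>\<^bsub>D 1 0\<^esub> y) \<ominus>\<^bsub>D 0 0\<^esub> p 0 0 (p 1 0 x')"
   unfolding t_def using mod_hom_minus[OF D D p[of 0 0], of "s \<odot>\<^bsub>D 1 0\<^esub> y" "p 1 0 x'"] sy px' by simp
  also have "p 0 0 (p 1 0 x') = \<zero>\<^bsub>D 0 0\<^esub>"
  proof -
   have row: "bd (reg R) B A 0 (A 1 b) = zf R" if "b \<in> B (Suc 1)" for b
   proof -
    have "A 1 b = bd (reg R) B A 1 (sing (reg R) b \<one>\<^sub>R)"
     using push_sing[OF Rg res_rmat[OF R resM] that, of "\<one>\<^sub>R"] rmat_entry[OF res_rmat[OF R resM] that] by simp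
    then show ?thesis using res_comp[OF R resM, of "sing (reg R) b \<one>\<^sub>R" 0] sing_closed[OF Rg that] by simp
   qed
   have "x' \<in> dsum (G 0) (B (Suc 1))" using x'(1) by (simp add: D_def numeral_2_eq_2)
   then show ?thesis
    unfolding p_def D_def
    using push_comp_zero[OF G res_rmat[OF R resM, of 1] res_rmat[OF R resM, of 0, folded One_nat_def] row] by simp
  qed
  also have "p 0 0 (s \<odot>\<^bsub>D 1 0\<^esub> y) = s \<odot>\<^bsub>D 0 0\<^esub> u"
   using mod_hom_smult[OF p[of 0 0] sR, of y] y by simp
  finally show ?thesis using u sR by simp
 qed
 have "(\<lambda>b. \<delta> 0 (r b)) = \<zero>\<^bsub>D 0 0\<^esub>"
 proof -
  have "(\<lambda>b. \<delta> 0 (r b)) = (\<lambda>b. \<delta> 0 ((s \<odot>\<^bsub>D 0 1\<^esub> v) b)) \<ominus>\<^bsub>D 0 0\<^esub> (\<lambda>b. \<delta> 0 (p 0 1 q b))"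
   unfolding r_def using mod_hom_minus[OF D D \<delta>D[of 0 0], of "s \<odot>\<^bsub>D 0 1\<^esub> v" "p 0 1 q"] sv pq by simp
  also have "(\<lambda>b. \<delta> 0 ((s \<odot>\<^bsub>D 0 1\<^esub> v) b)) = s \<odot>\<^bsub>D 0 0\<^esub> u"
   unfolding u_def using mod_hom_smult[OF \<delta>D[of 0 0] sR, of v] v(1) by simp
  also have "(\<lambda>b. \<delta> 0 (p 0 1 q b)) = s \<odot>\<^bsub>D 0 0\<^esub> u"
   using nat\<delta>[of q 0 0] q pt by simp
  finally show ?thesis using u sR by simp
 qed
 then have rk: "\<delta> 0 (r b) = zf R" for b by (auto dest: fun_cong simp: D_def G_def)
 have \<delta>1: "\<delta> 1 \<in> mod_hom R (G 2) (G 1)" using \<delta>[of 1] by (simp add: numeral_2_eq_2)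
 obtain c where c: "c \<in> D 0 2" "!!b. \<delta> 1 (c b) = r b"
  using dsum_map_lift[OF G G \<delta>1 r[unfolded D_def]] ker\<delta> rk dsum_val[OF r[unfolded D_def]] unfolding D_def by blast
 have "(\<lambda>b. s \<odot>\<^sub>M w b) = aug R M \<mu> r"
 proof -
  have "aug R M \<mu> r = aug R M \<mu> (s \<odot>\<^bsub>D 0 1\<^esub> v) \<ominus>\<^bsub>dsum M (C 1)\<^esub> aug R M \<mu> (p 0 1 q)"
   unfolding r_def using mod_hom_minus[OF D dsum_module[OF M] \<alpha> sv pq] .
  also have "aug R M \<mu> (s \<odot>\<^bsub>D 0 1\<^esub> v) = s \<odot>\<^bsub>dsum M (C 1)\<^esub> w"
   using mod_hom_smult[OF \<alpha> sR v(1)] v(2) by simp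
  also have "aug R M \<mu> (p 0 1 q) = \<zero>\<^bsub>dsum M (C 1)\<^esub>"
   using aug_push_zero[OF M resM] q(1) by (simp add: p_def D_def G_def)
  finally show ?thesis using DM.a_minus_zero[OF DM.smult_closed[OF sR w]] by simp
 qed
 also have "\<dots> = bd M C A' 1 (aug R M \<mu> c)"
  using nat\<alpha>[of c 1] c by (simp add: numeral_2_eq_2)
 finally show "\<exists>s\<in>S. \<exists>x\<in>dsum M (C (Suc (Suc 0))). (\<lambda>b. s \<odot>\<^sub>M w b) = bd M C A' (Suc 0) x"
  using s mod_hom_closed[OF \<alpha> c(1)] by (auto simp: numeral_2_eq_2)
qed

section \<open>Syzygies in the second variable and balancing in all degrees\<close>

definition syzygy :: "('r, 'c) ring_scheme => ('r, 'n, 'e) module_scheme => 'x set => ('x => 'n) => ('r, 'x => 'r) module"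
 where "syzygy R N C \<nu> = (fmod R C)\<lparr>carrier := a_kernel (fmod R C) N (lin_ext R N \<nu>)\<rparr>"

context
 fixes R :: "('r, 'c) ring_scheme" and N :: "('r, 'n, 'e) module_scheme"
  and C :: "nat => 'x set" and A' \<nu>
 assumes N: "module R N" and resN: "free_resolution R N C A' \<nu>"
begin

interpretation N: module R N by (rule N)

lemma syzygy_module: "module R (syzygy R N (C 0) \<nu>)"
 and syzygy_incl: "(\<lambda>x. x) \<in> mod_hom R (syzygy R N (C 0) \<nu>) (fmod R (C 0))"
 and syzygy_carrier: "carrier (syzygy R N (C 0) \<nu>) = {f \<in> fmod R (C 0). lin_ext R N \<nu> f = \<zero>\<^sub>N}"
proof -
 note Rg = reg_module[OF N.is_cring]
 have h: "lin_ext R N \<nu> \<in> mod_hom R (fmod R (C 0)) N"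
  using lin_ext_hom[OF N res_gen[OF N.is_cring resN]] by (simp add: free_eq_dsum)
 show "module R (syzygy R N (C 0) \<nu>)"
  unfolding syzygy_def by (rule sub_module[OF dsum_module[OF Rg] submodule_kernel[OF dsum_module[OF Rg] N h]])
 show c: "carrier (syzygy R N (C 0) \<nu>) = {f \<in> fmod R (C 0). lin_ext R N \<nu> f = \<zero>\<^sub>N}"
  by (simp add: syzygy_def a_kernel_def'')
 show "(\<lambda>x. x) \<in> mod_hom R (syzygy R N (C 0) \<nu>) (fmod R (C 0))"
  by (rule mod_homI) (auto simp: syzygy_def a_kernel_def'')
qed

lemma syzygy_resolution:
 "free_resolution R (syzygy R N (C 0) \<nu>) (\<lambda>i. C (Suc i)) (\<lambda>i. A' (Suc i)) (A' 0)"
proof -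
 note R = N.is_cring
 note Rg = reg_module[OF R]
 let ?K = "syzygy R N (C 0) \<nu>"
 note rm = res_rmat[OF R resN]
 have lh: "lin_ext R (fmod R (C 0)) (A' 0) f = bd (reg R) C A' 0 f"
  if "f \<in> fmod R (C (Suc 0))" for f
  using lin_ext_free[OF R rm, of f 0] that by (simp add: free_eq_dsum)
 have gen: "A' 0 b \<in> ?K" if b: "b \<in> C (Suc 0)" for b
 proof -
  have "A' 0 b = bd (reg R) C A' 0 (sing (reg R) b \<one>\<^sub>R)"
   using push_sing[OF Rg rm b, of "\<one>\<^sub>R"] rmat_entry[OF rm b] by simp
  then show ?thesis
   using res_comp0[OF R resN, of "sing (reg R) b \<one>\<^sub>R"] sing_closed[OF Rg b] rmat_row[OF rm b]
   by (simp add: syzygy_carrier free_eq_dsum)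
 qed
 have lK: "lin_ext R ?K (A' 0) f = bd (reg R) C A' 0 f"
  if f: "f \<in> fmod R (C (Suc 0))" for f
  using lin_ext_natural[OF syzygy_module dsum_module[OF Rg] syzygy_incl _ gen, of f] f lh[OF f]
  by (simp add: free_eq_dsum)
 have zK: "\<zero>\<^sub>?K = zf R" by (simp add: syzygy_def)
 have pc: "bd (reg R) C A' i f \<in> fmod R (C i)" if "f \<in> fmod R (C (Suc i))" for f i
  by (rule mod_hom_closed[OF push_hom[OF Rg rm] that])
 have 1: "lin_ext R ?K (A' 0) ` free_module R (C (Suc 0)) = carrier ?K"
 proof
  show "lin_ext R ?K (A' 0) ` (free_module R (C (Suc 0))) \<subseteq> ?K"
   using lK pc res_comp0[OF R resN] by (auto simp: syzygy_carrier free_eq_dsum)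
  show "carrier ?K \<subseteq> lin_ext R ?K (A' 0) ` free_module R (C (Suc 0))"
  proof
   fix f assume "f \<in> ?K"
   then obtain g where "g \<in> fmod R (C (Suc 0))" "bd (reg R) C A' 0 g = f"
    using res_exact0[OF R resN, of f] by (auto simp: syzygy_carrier)
   then show "f \<in> lin_ext R ?K (A' 0) ` free_module R (C (Suc 0))"
    using lK[of g] unfolding free_eq_dsum by (metis imageI)
  qed
 qed
 have 2: "lin_ext R ?K (A' 0) f = \<zero>\<^sub>?K \<longleftrightarrow>
   f \<in> lin_ext R (free_module R (C (Suc 0))) (A' (Suc 0)) ` free_module R (C (Suc (Suc 0)))"
  if "f \<in> free_module R (C (Suc 0))" for f
 proof -
  have "lin_ext R ?K (A' 0) f = \<zero>\<^sub>?K \<longleftrightarrow> lin_ext R (free_module R (C 0)) (A' 0) f = \<zero>\<^bsub>free_module R (C 0)\<^esub>"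
   using lK[of f] lh[of f] that zK by (simp add: free_eq_dsum)
  then show ?thesis using resN that unfolding free_resolution_def by blast
 qed
 show ?thesis
  unfolding free_resolution_def One_nat_def
  using resN by (intro conjI allI ballI rm gen 1 2) (auto simp: free_resolution_def)
qed

text \<open>The connecting map of 0 -> K -> G -> N -> 0 with G free: a cycle z over K bounds some y
  over G, and the image of y over N is a cycle one degree higher.\<close>

lemma tor_exact_syzygy:
 fixes B :: "nat => 'b set"
 assumes M: "module R M" and resM: "free_resolution R M B A \<mu>" and S: "S \<subseteq> carrier R"
  and ex: "tor_exact S N B A (Suc i)"
 shows "tor_exact S (syzygy R N (C 0) \<nu>) B A i"
 unfolding tor_exact_def
proof (intro ballI impI)
 note R = N.is_cring
 note Rg = reg_module[OF R]
 let ?K = "syzygy R N (C 0) \<nu>" and ?G = "fmod R (C 0)"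
 note rm = res_rmat[OF R resM]
 have G: "module R ?G" by (rule dsum_module[OF Rg])
 note K = syzygy_module
 have zK: "\<zero>\<^sub>?K = zf R" "smult ?K = smult ?G" by (simp_all add: syzygy_def)
 have \<epsilon>: "lin_ext R N \<nu> \<in> mod_hom R ?G N"
  using lin_ext_hom[OF N res_gen[OF R resN]] by (simp add: free_eq_dsum)
 let ?\<epsilon> = "lin_ext R N \<nu>"
 have \<epsilon>D: "(\<lambda>f b. ?\<epsilon> (f b)) \<in> mod_hom R (dsum ?G (B i)) (dsum N (B i))" for i by (rule dsum_map_hom[OF G N \<epsilon>])
 have KG: "f \<in> dsum ?G X" if "f \<in> dsum ?K X" for f :: "'z => _" and X
  using mod_hom_closed[OF dsum_map_hom[OF K G syzygy_incl] that] .
 have pK: "push ?G X A0 f = push ?K X A0 f" if "rmat R Y X A0" "f \<in> dsum ?K Y" for f A0 and Y :: "'b set" and X :: "'b set"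
  using push_natural[OF K G syzygy_incl that] .
 fix z assume z: "z \<in> dsum ?K (B (Suc i))" and zz: "bd ?K B A i z = zf ?K"
 obtain y where y: "y \<in> dsum ?G (B (Suc (Suc i)))" "bd ?G B A (Suc i) y = z"
  using free_coefficients_exact[OF R resM KG[OF z]] pK[OF rm z] zz zK by metis
 have "bd N B A (Suc i) (\<lambda>b. ?\<epsilon> (y b)) = (\<lambda>b. ?\<epsilon> (z b))"
  using push_natural[OF G N \<epsilon> rm y(1)] y(2) by simp
 also have "\<dots> = zf N" using dsum_val[OF z] by (simp add: syzygy_carrier)
 finally obtain s x where s: "s \<in> S" and x: "x \<in> dsum N (B (Suc (Suc (Suc i))))"
  and sx: "(\<lambda>b. s \<odot>\<^sub>N ?\<epsilon> (y b)) = bd N B A (Suc (Suc i)) x"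
  using ex mod_hom_closed[OF \<epsilon>D y(1)] unfolding tor_exact_def by blast
 have sR: "s \<in> R" using s S by auto
 have \<epsilon>surj: "n \<in> ?\<epsilon> ` ?G" if "n \<in> N" for n
  using res_surj[OF R resN that] by auto
 obtain x' where x': "x' \<in> dsum ?G (B (Suc (Suc (Suc i))))" "!!b. ?\<epsilon> (x' b) = x b"
  using dsum_map_lift[OF G N \<epsilon> x] \<epsilon>surj dsum_val[OF x] by blast
 let ?D = "dsum ?G (B (Suc (Suc i)))"
 have D: "module R ?D" by (rule dsum_module[OF G])
 interpret D: module R ?D by (rule D)
 interpret DN: module R "dsum N (B (Suc (Suc i)))" by (rule dsum_module[OF N])
 define px where "px = bd ?G B A (Suc (Suc i)) x'"
 have px: "px \<in> ?D" unfolding px_def by (rule mod_hom_closed[OF push_hom[OF G rm] x'(1)])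
 have sy: "s \<odot>\<^sub>?D y \<in> ?D" by (rule D.smult_closed[OF sR y(1)])
 \<comment> \<open>After this correction t is killed by \<epsilon>, hence has its values in K, and
   its boundary is s z because the added term is itself a boundary.\<close>
 define t where "t = (s \<odot>\<^sub>?D y) \<ominus>\<^sub>?D px"
 have t: "t \<in> ?D" unfolding t_def by (rule D.minus_closed[OF sy px])
 have "(\<lambda>b. ?\<epsilon> (t b)) = \<zero>\<^bsub>dsum N (B (Suc (Suc i)))\<^esub>"
 proof -
  have "(\<lambda>b. ?\<epsilon> (t b)) = (\<lambda>b. ?\<epsilon> ((s \<odot>\<^sub>?D y) b)) \<ominus>\<^bsub>dsum N (B (Suc (Suc i)))\<^esub> (\<lambda>b. ?\<epsilon> (px b))"
   unfolding t_def using mod_hom_minus[OF D dsum_module[OF N] \<epsilon>D sy px] .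
  also have "(\<lambda>b. ?\<epsilon> ((s \<odot>\<^sub>?D y) b)) = s \<odot>\<^bsub>dsum N (B (Suc (Suc i)))\<^esub> (\<lambda>b. ?\<epsilon> (y b))"
   using mod_hom_smult[OF \<epsilon>D sR y(1)] .
  also have "\<dots> = (\<lambda>b. ?\<epsilon> (px b))"
   using sx push_natural[OF G N \<epsilon> rm x'(1)] x' by (simp add: px_def)
  finally show ?thesis using mod_hom_closed[OF \<epsilon>D px] by simp
 qed
 then have tk: "?\<epsilon> (t b) = \<zero>\<^sub>N" for b by (auto dest: fun_cong)
 have tK: "t \<in> dsum ?K (B (Suc (Suc i)))"
  by (rule dsumI) (use dsumD[OF t] tk zK in \<open>auto simp: syzygy_carrier\<close>)
 have DG: "module R (dsum ?G (B (Suc i)))" by (rule dsum_module[OF G])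
 interpret DG: module R "dsum ?G (B (Suc i))" by (rule DG)
 note ph = push_hom[OF G rm[of "Suc i"]]
 have "bd ?G B A (Suc i) t = (\<lambda>b. s \<odot>\<^sub>?K z b)"
 proof -
  have "bd ?G B A (Suc i) t =
    bd ?G B A (Suc i) (s \<odot>\<^sub>?D y) \<ominus>\<^bsub>dsum ?G (B (Suc i))\<^esub> bd ?G B A (Suc i) px"
   unfolding t_def by (rule mod_hom_minus[OF D DG ph sy px])
  also have "bd ?G B A (Suc i) (s \<odot>\<^sub>?D y) = s \<odot>\<^bsub>dsum ?G (B (Suc i))\<^esub> z"
   using mod_hom_smult[OF ph sR y(1)] y(2) by simp
  also have "bd ?G B A (Suc i) px = \<zero>\<^bsub>dsum ?G (B (Suc i))\<^esub>"
  proof -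
   have row: "bd (reg R) B A (Suc i) (A (Suc (Suc i)) b) = zf R" if b: "b \<in> B (Suc (Suc (Suc i)))" for b
   proof -
    have "A (Suc (Suc i)) b = bd (reg R) B A (Suc (Suc i)) (sing (reg R) b \<one>\<^sub>R)"
     using push_sing[OF Rg rm b, of "\<one>\<^sub>R"] rmat_entry[OF rm b] by simp
    then show ?thesis using res_comp[OF R resM, of "sing (reg R) b \<one>\<^sub>R" "Suc i"] sing_closed[OF Rg b] by simp
   qed
   show ?thesis unfolding px_def using push_comp_zero[OF G rm rm row x'(1)] by simp
  qed
  finally show ?thesis using DG.a_minus_zero[OF DG.smult_closed[OF sR KG[OF z]]] by (simp add: zK)
 qed
 then show "\<exists>s\<in>S. \<exists>w\<in>dsum ?K (B (Suc (Suc i))). (\<lambda>b. s \<odot>\<^sub>?K z b) = bd ?K B A (Suc i) w"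
  using s tK pK[OF rm tK] by metis
qed

end

text \<open>The induction replaces N by its syzygy, so N must have a type that is preserved by this.
  A syzygy consists of functions \<open>'x => 'r\<close> whatever the type of N was, whence the type
  fixed here.\<close>

lemma tor_balanced_aux:
 fixes N :: "('r, 'x => 'r) module" and C :: "nat => 'x set"
 assumes M: "module R M" and N: "module R N" and resM: "free_resolution R M B A \<mu>"
  and resN: "free_resolution R N C A' \<nu>" and S: "S \<subseteq> carrier R" and ex: "tor_exact S N B A i"
 shows "tor_exact S M C A' i"
 using N resN ex
proof (induction i arbitrary: N C A' \<nu>)
 case 0
 then show ?case using tor_balanced_1[OF M _ resM _ S] by blast
next
 case (Suc i)
 have "tor_exact S M (\<lambda>i. C (Suc i)) (\<lambda>i. A' (Suc i)) i"
  by (rule Suc.IH[OF syzygy_module[OF Suc.prems(1,2)] syzygy_resolution[OF Suc.prems(1,2)]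
     tor_exact_syzygy[OF Suc.prems(1,2) M resM S Suc.prems(3)]])
 then show ?case by (simp add: tor_exact_def)
qed

text \<open>One syzygy step brings an N of arbitrary type into the type in which the induction
  runs.\<close>

lemma tor_balanced_imp:
 assumes M: "module R M" and N: "module R N" and resM: "free_resolution R M B A \<mu>"
  and resN: "free_resolution R N C A' \<nu>" and S: "S \<subseteq> carrier R" and ex: "tor_exact S N B A i"
 shows "tor_exact S M C A' i"
proof (cases i)
 case 0
 then show ?thesis using tor_balanced_1[OF M N resM resN S] ex by simp
next
 case (Suc k)
 have "tor_exact S M (\<lambda>i. C (Suc i)) (\<lambda>i. A' (Suc i)) k"
  by (rule tor_balanced_aux[OF M syzygy_module[OF N resN] resM syzygy_resolution[OF N resN] S
     tor_exact_syzygy[OF N resN M resM S ex[unfolded Suc]]])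
 then show ?thesis using Suc by (simp add: tor_exact_def)
qed

lemma tor_balanced:
 assumes "module R M" "module R N" "free_resolution R M B A \<mu>" "free_resolution R N C A' \<nu>" "S \<subseteq> carrier R"
 shows "tor_exact S N B A i \<longleftrightarrow> tor_exact S M C A' i"
 using tor_balanced_imp[OF assms(1-5)] tor_balanced_imp[OF assms(2,1,4,3,5)] by blast

section \<open>Duality with an injective module\<close>

text \<open>A cocycle e is a functional on R^(C) that kills the image of A. The kernel of A' lies in
  that image up to S, and S acts injectively on E, so the functional kills this kernel too. It
  therefore factors through the image of A' and extends to R^(D) by injectivity.\<close>

lemma pull_exact_of_push_exact:
 assumes E: "module R E" and bE: "baer R E" and A: "rmat R B C A" and A': "rmat R C D A'"
  and S: "S \<subseteq> carrier R" and tf: "!!s x. s \<in> S ==> x \<in> E ==> s \<odot>\<^sub>E x = \<zero>\<^sub>E ==> x = \<zero>\<^sub>E"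
  and ex: "!!f. f \<in> (fmod R C) ==> push (reg R) D A' f = zf R ==>
   \<exists>s\<in>S. \<exists>g\<in>fmod R B. (\<lambda>c. s \<otimes>\<^sub>R f c) = push (reg R) C A g"
  and e: "e \<in> dprod E C" and cyc: "pull R E B A e = zf E"
 obtains e' where "e' \<in> dprod E D" "e = pull R E C A' e'"
proof -
 interpret E: module R E by fact
 note R = E.is_cring
 note Rg = reg_module[OF R]
 have F: "module R (fmod R X)" for X by (rule dsum_module[OF Rg])
 interpret FC: module R "fmod R C" by (rule F)
 interpret FD: module R "fmod R D" by (rule F)
 define \<phi> where "\<phi> = lin_ext R E e"
 have \<phi>: "\<phi> \<in> mod_hom R (fmod R C) E"
  unfolding \<phi>_def using lin_ext_hom[OF E, of C e] dprod_val[OF e] by (simp add: free_eq_dsum)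
 have p: "push (reg R) C A \<in> mod_hom R (fmod R B) (fmod R C)"
  and p': "push (reg R) D A' \<in> mod_hom R (fmod R C) (fmod R D)"
  by (rule push_hom[OF Rg A], rule push_hom[OF Rg A'])
 have z: "(zf E) \<in> mod_hom R (fmod R B) E" by (rule mod_homI) auto
 have \<phi>A: "\<phi> (push (reg R) C A g) = \<zero>\<^sub>E" if g: "g \<in> fmod R B" for g
 proof -
  have g': "g \<in> free_module R B" using g by (simp add: free_eq_dsum)
  have "\<phi> (push (reg R) C A g) = lin_ext R E (\<lambda>b. lin_ext R E e (A b)) g"
   unfolding \<phi>_def lin_ext_free[OF R A g', symmetric] by (rule lin_ext_comp[OF E A dprod_val[OF e] g'])
  also have "\<dots> = lin_ext R E (zf E) g"
   by (rule lin_ext_cong[OF g' E]) (use cyc in \<open>auto simp: pull_def fun_eq_iff split: if_splits\<close>)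
  also have "\<dots> = \<zero>\<^sub>E"
   using dsum_val[OF g] unfolding lin_ext_def by (intro E.add.finprod_one_eqI) simp
  finally show ?thesis .
 qed
 have \<phi>k: "\<phi> f = \<zero>\<^sub>E" if f: "f \<in> fmod R C" and k: "push (reg R) D A' f = zf R" for f
 proof -
  obtain s g where s: "s \<in> S" and g: "g \<in> fmod R B"
   and sf: "(\<lambda>c. s \<otimes>\<^sub>R f c) = push (reg R) C A g" using ex[OF f k] by blast
  have "s \<odot>\<^sub>E \<phi> f = \<phi> (s \<odot>\<^bsub>fmod R C\<^esub> f)" using mod_hom_smult[OF \<phi> _ f, of s] s S by auto
  also have "\<dots> = \<zero>\<^sub>E" using \<phi>A[OF g] sf by simp
  finally show ?thesis using tf[OF s mod_hom_closed[OF \<phi> f]] by simp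
 qed
 let ?I = "push (reg R) D A' ` fmod R C"
 have I: "submodule ?I R (fmod R D)" by (rule submodule_range[OF F F p'])
 \<comment> \<open>Preimages are chosen arbitrarily; \<open>\<phi>eq\<close> makes the value of
   \<phi> independent of the choice.\<close>
 define k where "k y = (SOME f. f \<in> fmod R C \<and> push (reg R) D A' f = y)" for y
 have k: "k y \<in> fmod R C \<and> push (reg R) D A' (k y) = y" if "y \<in> ?I" for y
 proof -
  have "\<exists>f. f \<in> fmod R C \<and> push (reg R) D A' f = y" using that by blast
  from someI_ex[OF this] show ?thesis by (simp add: k_def)
 qed
 have \<phi>eq: "\<phi> f = \<phi> f'" if "f \<in> fmod R C" "f' \<in> fmod R C"
  "push (reg R) D A' f = push (reg R) D A' f'" for f f'
 proof -
  have "push (reg R) D A' (f \<ominus>\<^bsub>fmod R C\<^esub> f') = \<zero>\<^bsub>fmod R D\<^esub>"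
   using mod_hom_minus[OF F F p' that(1,2)] that(3) FD.a_minus_self[OF mod_hom_closed[OF p' that(2)]] by simp
  then have "\<phi> (f \<ominus>\<^bsub>fmod R C\<^esub> f') = \<zero>\<^sub>E" using \<phi>k FC.minus_closed[OF that(1,2)] by simp
  then show ?thesis
   using mod_hom_minus[OF F E \<phi> that(1,2)] mod_hom_closed[OF \<phi>] that(1,2) E.a_minus_eq_zero_iff by simp
 qed
 have "(\<lambda>y. \<phi> (k y)) \<in> mod_hom R ((fmod R D)\<lparr>carrier := ?I\<rparr>) E"
 proof (rule mod_homI)
  fix y assume "y \<in> ((fmod R D)\<lparr>carrier := ?I\<rparr>)"
  then have y: "y \<in> ?I" by simp
  then show "\<phi> (k y) \<in> E" using k mod_hom_closed[OF \<phi>] by blast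
  fix y' assume "y' \<in> ((fmod R D)\<lparr>carrier := ?I\<rparr>)"
  then have y': "y' \<in> ?I" by simp
  have s: "y \<oplus>\<^bsub>fmod R D\<^esub> y' \<in> ?I" using FD.submoduleE(5)[OF I y y'] .
  note ky = k[OF y] and ky' = k[OF y']
  have "\<phi> (k (y \<oplus>\<^bsub>fmod R D\<^esub> y')) = \<phi> (k y \<oplus>\<^bsub>fmod R C\<^esub> k y')"
   using k[OF s] ky ky' mod_hom_add[OF p', of "k y" "k y'"] FC.a_closed[of "k y" "k y'"] by (intro \<phi>eq) auto
  then show "\<phi> (k (y \<oplus>\<^bsub>(fmod R D)\<lparr>carrier := ?I\<rparr>\<^esub> y')) = \<phi> (k y) \<oplus>\<^sub>E \<phi> (k y')"
   using mod_hom_add[OF \<phi>, of "k y" "k y'"] ky ky' by simp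
 next
  fix r y assume r: "r \<in> R" and "y \<in> ((fmod R D)\<lparr>carrier := ?I\<rparr>)"
  then have y: "y \<in> ?I" by simp
  have s: "r \<odot>\<^bsub>fmod R D\<^esub> y \<in> ?I" using FD.submoduleE(4)[OF I r y] .
  note ky = k[OF y]
  have "\<phi> (k (r \<odot>\<^bsub>fmod R D\<^esub> y)) = \<phi> (r \<odot>\<^bsub>fmod R C\<^esub> k y)"
   using k[OF s] ky r mod_hom_smult[OF p' r, of "k y"] FC.smult_closed[OF r, of "k y"] by (intro \<phi>eq) auto
  then show "\<phi> (k (r \<odot>\<^bsub>(fmod R D)\<lparr>carrier := ?I\<rparr>\<^esub> y)) = r \<odot>\<^sub>E \<phi> (k y)"
   using mod_hom_smult[OF \<phi> r, of "k y"] ky by simp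
 qed
 then obtain \<psi> where \<psi>: "\<psi> \<in> mod_hom R (fmod R D) E" and \<psi>I: "!!y. y \<in> ?I ==> \<psi> y = \<phi> (k y)"
  using baer_extend[OF F E bE I] by blast
 have \<psi>': "\<psi> \<in> mod_hom R (free_module R D) E" using \<psi> by (simp add: free_eq_dsum)
 define e' where "e' d = (if d \<in> D then \<psi> (basis_elt R d) else \<zero>\<^sub>E)" for d
 have e': "e' \<in> dprod E D"
  using mod_hom_closed[OF \<psi>' basis_elt_closed[OF R]] by (intro dprodI) (auto simp: e'_def)
 have le': "lin_ext R E e' f = \<psi> f" if "f \<in> free_module R D" for f
  by (rule free_hom_eq[OF E lin_ext_hom[OF E dprod_val[OF e']] \<psi>' _ that])
   (simp add: lin_ext_basis[where \<mu> = e', OF E dprod_val[OF e']], simp add: e'_def)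
 have "pull R E C A' e' c = e c" for c
 proof (cases "c \<in> C")
  case True
  have bc: "basis_elt R c \<in> fmod R C"
   using basis_elt_closed[OF R True] by (simp add: free_eq_dsum)
  have Ac: "A' c = push (reg R) D A' (basis_elt R c)"
   using push_sing[OF Rg A' True, of "\<one>\<^sub>R"] rmat_entry[OF A' True] by (simp add: basis_elt_eq_sing)
  then have AI: "A' c \<in> ?I" using bc by blast
  have "pull R E C A' e' c = \<psi> (A' c)" using True le'[OF rmat_row[OF A' True]] by (simp add: pull_def)
  also have "\<dots> = \<phi> (basis_elt R c)" unfolding \<psi>I[OF AI] using k[OF AI] Ac bc by (intro \<phi>eq) auto
  also have "\<dots> = e c" unfolding \<phi>_def by (rule lin_ext_basis[where \<mu> = e, OF E dprod_val[OF e]])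
  finally show ?thesis .
 qed (use dprod_out[OF e] in \<open>simp add: pull_def\<close>)
 then show ?thesis using that[OF e'] by (simp add: fun_eq_iff)
qed

text \<open>If no multiple of f by an element of S is a boundary, then r e0 = 0 whenever r f is a
  boundary, so a map may send f to e0 and all boundaries to 0. Extended to R^(C) it is a cocycle,
  but no coboundary, because coboundaries vanish on the cycle f and e0 is nonzero.\<close>

lemma push_exact_of_pull_exact:
 assumes E: "module R E" and bE: "baer R E" and A: "rmat R B C A" and A': "rmat R C D A'"
  and e0: "e0 \<in> E" and ann: "!!r. r \<in> carrier R ==> r \<odot>\<^sub>E e0 = \<zero>\<^sub>E \<longleftrightarrow> r \<notin> S"
  and S: "S \<subseteq> carrier R" "\<one>\<^sub>R \<in> S"
  and ex: "!!e. e \<in> dprod E C ==> pull R E B A e = zf E ==> \<exists>e'\<in>dprod E D. e = pull R E C A' e'"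
  and f: "f \<in> fmod R C" and cyc: "push (reg R) D A' f = zf R"
 shows "\<exists>s\<in>S. \<exists>g\<in>fmod R B. (\<lambda>c. s \<otimes>\<^sub>R f c) = push (reg R) C A g"
proof (rule ccontr)
 assume no: "\<not> ?thesis"
 interpret E: module R E by fact
 note R = E.is_cring
 note Rg = reg_module[OF R]
 have F: "module R (fmod R X)" for X by (rule dsum_module[OF Rg])
 interpret FC: module R "fmod R C" by (rule F)
 let ?FC = "fmod R C"
 have p: "push (reg R) C A \<in> mod_hom R (fmod R B) ?FC" by (rule push_hom[OF Rg A])
 let ?L = "push (reg R) C A ` fmod R B"
 have L: "submodule ?L R ?FC" by (rule submodule_range[OF F F p])
 have z: "(zf E) \<in> mod_hom R (?FC\<lparr>carrier := ?L\<rparr>) E" by (rule mod_homI) auto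
 have ok: "\<zero>\<^sub>E = r \<odot>\<^sub>E e0" if r: "r \<in> R" "r \<odot>\<^sub>?FC f \<in> ?L" for r
 proof -
  have "r \<notin> S" using no r(2) by auto
  then show ?thesis using ann[OF r(1)] by simp
 qed
 obtain L' f' where L': "submodule L' R ?FC" "?L \<subseteq> L'" "f \<in> L'"
  and f': "f' \<in> mod_hom R (?FC\<lparr>carrier := L'\<rparr>) E" "!!x. x \<in> ?L ==> f' x = \<zero>\<^sub>E" "f' f = e0"
  using mod_hom_extend_one[OF F E L z f e0 ok] by metis
 obtain \<phi> where \<phi>: "\<phi> \<in> mod_hom R ?FC E" and \<phi>f': "!!x. x \<in> L' ==> \<phi> x = f' x"
  using baer_extend[OF F E bE L'(1) f'(1)] by blast
 have \<phi>F: "\<phi> \<in> mod_hom R (free_module R C) E" using \<phi> by (simp add: free_eq_dsum)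
 define e where "e c = (if c \<in> C then \<phi> (basis_elt R c) else \<zero>\<^sub>E)" for c
 have e: "e \<in> dprod E C"
  using mod_hom_closed[OF \<phi>F basis_elt_closed[OF R]] by (intro dprodI) (auto simp: e_def)
 have le: "lin_ext R E e g = \<phi> g" if "g \<in> free_module R C" for g
  by (rule free_hom_eq[OF E lin_ext_hom[OF E dprod_val[OF e]] \<phi>F _ that])
   (simp add: lin_ext_basis[where \<mu> = e, OF E dprod_val[OF e]], simp add: e_def)
 have "pull R E B A e b = \<zero>\<^sub>E" for b
 proof (cases "b \<in> B")
  case True
  have bb: "basis_elt R b \<in> fmod R B"
   using basis_elt_closed[OF R True] by (simp add: free_eq_dsum)
  have "A b = push (reg R) C A (basis_elt R b)"
   using push_sing[OF Rg A True, of "\<one>\<^sub>R"] rmat_entry[OF A True] by (simp add: basis_elt_eq_sing)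
  then have AL: "A b \<in> ?L" using bb by blast
  have "pull R E B A e b = \<phi> (A b)" using True le[OF rmat_row[OF A True]] by (simp add: pull_def)
  also have "\<dots> = \<zero>\<^sub>E" using AL \<phi>f' f'(2) L'(2) by auto
  finally show ?thesis .
 qed (simp add: pull_def)
 then obtain e' where e': "e' \<in> dprod E D" "e = pull R E C A' e'" using ex[OF e] by blast
 have fF: "f \<in> free_module R C" using f by (simp add: free_eq_dsum)
 have "\<phi> f = lin_ext R E (\<lambda>c. lin_ext R E e' (A' c)) f"
  unfolding le[OF fF, symmetric]
  by (rule lin_ext_cong[OF fF E])
   (use e'(2) mod_hom_closed[OF lin_ext_hom[OF E dprod_val[OF e'(1)]] rmat_row[OF A']] in \<open>auto simp: pull_def\<close>)
 also have "\<dots> = lin_ext R E e' (push (reg R) D A' f)"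
  unfolding lin_ext_free[OF R A' fF, symmetric] by (rule lin_ext_comp[OF E A' dprod_val[OF e'(1)] fF, symmetric])
 also have "\<dots> = \<zero>\<^sub>E" unfolding cyc by (simp add: lin_ext_def)
 finally have "e0 = \<zero>\<^sub>E" using \<phi>f'[OF L'(3)] f'(3) by simp
 then show False using ann[of "\<one>\<^sub>R"] S by simp
qed

text \<open>Cohomology in degree i + 1 is S-torsion; for finite bases and multiplicatively closed S
  this means that it vanishes after localization at S.\<close>

definition coh_exact :: "('r, 'c) ring_scheme => 'r set => ('r, 'm, 'd) module_scheme => (nat => 'b set) =>
  (nat => 'b => 'b => 'r) => nat => bool"
 where "coh_exact R S N B A i \<longleftrightarrow>
  (\<forall>e\<in>dprod N (B (Suc i)). cobd R N B A (Suc i) e = zf N -->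
    (\<exists>s\<in>S. \<exists>e'\<in>dprod N (B i). (\<lambda>b. s \<odot>\<^sub>N e b) = cobd R N B A i e'))"

lemma ext_exact_iff_coh_exact:
 assumes "module R N"
 shows "ext_exact R N B A i \<longleftrightarrow> coh_exact R {\<one>\<^sub>R} N B A i"
proof -
 interpret module R N by fact
 have one: "(\<lambda>b. \<one>\<^sub>R \<odot>\<^sub>N e b) = e" if "e \<in> dprod N (B (Suc i))" for e
  using dprod_val[OF that] by simp
 show ?thesis unfolding ext_exact_def coh_exact_def
  by (intro ball_cong imp_cong refl) (auto simp: one)
qed

lemma ext_exact_injective:
 assumes E: "module R E" and bE: "baer R E" and res: "free_resolution R M B A \<mu>"
 shows "ext_exact R E B A i"
 unfolding ext_exact_def
proof (intro ballI impI)
 interpret E: module R E by fact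
 note R = E.is_cring
 fix e assume e: "e \<in> dprod E (B (Suc i))" and z: "cobd R E B A (Suc i) e = zf E"
 have ex: "\<exists>s\<in>{\<one>\<^sub>R}. \<exists>g\<in>fmod R (B (Suc (Suc i))). (\<lambda>c. s \<otimes>\<^sub>R f c) = bd (reg R) B A (Suc i) g"
  if f: "f \<in> fmod R (B (Suc i))" "bd (reg R) B A i f = zf R" for f
 proof -
  have "(\<lambda>c. \<one>\<^sub>R \<otimes>\<^sub>R f c) = f" using dsum_val[OF f(1)] by simp
  then show ?thesis using res_exact[OF R res f] by force
 qed
 show "\<exists>e'\<in>dprod E (B i). e = cobd R E B A i e'"
  by (rule pull_exact_of_push_exact[OF E bE res_rmat[OF R res] res_rmat[OF R res], of "{\<one>\<^sub>R}", OF _ _ ex e z])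
   auto
qed

text \<open>A field is injective over itself and 1 has annihilator 0, so both halves of the duality
  apply with E = K: one with S = {1}, the other with S the set of nonzero elements, which are then
  divided out. Bases may be infinite.\<close>

lemma exact_field_dual:
 fixes K :: "('r, 'd) ring_scheme" and B :: "nat => 'b set"
 assumes K: "field K" and A: "!!i. rmat K (B (Suc i)) (B i) (A i)"
 shows "tor_exact {\<one>\<^sub>K} (reg K) B A i \<longleftrightarrow> ext_exact K (reg K) B A i"
proof -
 interpret K: field K by fact
 have Kg: "module K (reg K)" by (rule reg_module[OF K.is_cring])
 have bK: "baer K (reg K)"
  unfolding baer_def
 proof (intro allI impI; elim conjE)
  fix I \<phi> assume I: "ideal I K" and \<phi>: "\<phi> \<in> mod_hom K ((reg K)\<lparr>carrier := I\<rparr>) (reg K)"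
  have "I = {\<zero>\<^sub>K} \<or> I = carrier K" using K.all_ideals I by auto
  then show "\<exists>y\<in>reg K. \<forall>r\<in>I. \<phi> r = r \<odot>\<^bsub>reg K\<^esub> y"
  proof
   assume I0: "I = {\<zero>\<^sub>K}"
   have "\<phi> (\<zero>\<^sub>K \<otimes>\<^sub>K \<zero>\<^sub>K) = \<zero>\<^sub>K \<otimes>\<^sub>K \<phi> \<zero>\<^sub>K" using mod_hom_smult[OF \<phi>, of "\<zero>\<^sub>K" "\<zero>\<^sub>K"] I0 by simp
   then have "\<phi> \<zero>\<^sub>K = \<zero>\<^sub>K" using mod_hom_closed[OF \<phi>, of "\<zero>\<^sub>K"] I0 by simp
   then show ?thesis using I0 by (intro bexI[of _ "\<zero>\<^sub>K"]) auto
  next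
   assume I1: "I = carrier K"
   have "\<phi> r = r \<otimes>\<^sub>K \<phi> \<one>\<^sub>K" if "r \<in> K" for r
    using mod_hom_smult[OF \<phi>, of r "\<one>\<^sub>K"] I1 that by simp
   moreover have "\<phi> \<one>\<^sub>K \<in> reg K" using mod_hom_closed[OF \<phi>, of "\<one>\<^sub>K"] I1 by simp
   ultimately show ?thesis unfolding I1 regular_module_simps(4) by blast
  qed
 qed
 have tf: "s \<odot>\<^bsub>reg K\<^esub> x = \<zero>\<^bsub>reg K\<^esub> ==> x = \<zero>\<^bsub>reg K\<^esub>" if "s \<in> carrier K - {\<zero>\<^sub>K}" "x \<in> reg K" for s x
  using that K.integral_iff by auto
 have one: "(\<lambda>b. \<one>\<^sub>K \<otimes>\<^sub>K z b) = z" if "z \<in> fmod K X" for z :: "'b => 'r" and X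
  using dsum_val[OF that] by simp
 have te: "tor_exact {\<one>\<^sub>K} (reg K) B A i \<longleftrightarrow>
  (\<forall>f\<in>fmod K (B (Suc i)). bd (reg K) B A i f = zf K -->
   (\<exists>g\<in>fmod K (B (Suc (Suc i))). f = bd (reg K) B A (Suc i) g))"
  unfolding tor_exact_def by (intro ball_cong imp_cong refl) (auto simp: one[of _ "B (Suc i)"])
 show ?thesis
 proof
  assume t: "tor_exact {\<one>\<^sub>K} (reg K) B A i"
  show "ext_exact K (reg K) B A i"
   unfolding ext_exact_def
  proof (intro ballI impI)
   fix e assume e: "e \<in> dprod (reg K) (B (Suc i))"
    and z: "cobd K (reg K) B A (Suc i) e = zf (reg K)"
   have ex: "\<exists>s\<in>{\<one>\<^sub>K}. \<exists>g\<in>fmod K (B (Suc (Suc i))). (\<lambda>c. s \<otimes>\<^sub>K f c) = bd (reg K) B A (Suc i) g"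
    if f: "f \<in> fmod K (B (Suc i))" "bd (reg K) B A i f = zf K" for f
    using t f one[OF f(1)] unfolding te by simp
   show "\<exists>e'\<in>dprod (reg K) (B i). e = cobd K (reg K) B A i e'"
    by (rule pull_exact_of_push_exact[OF Kg bK A A, of "{\<one>\<^sub>K}", OF _ _ ex e z]) auto
  qed
 next
  assume t: "ext_exact K (reg K) B A i"
  show "tor_exact {\<one>\<^sub>K} (reg K) B A i"
   unfolding te
  proof (intro ballI impI)
   fix f assume f: "f \<in> fmod K (B (Suc i))" and z: "bd (reg K) B A i f = zf K"
   have "\<exists>s\<in>carrier K - {\<zero>\<^sub>K}. \<exists>g\<in>fmod K (B (Suc (Suc i))).
     (\<lambda>c. s \<otimes>\<^sub>K f c) = bd (reg K) B A (Suc i) g"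
    by (rule push_exact_of_pull_exact[OF Kg bK A A, of "\<one>\<^sub>K", OF _ _ _ _ _ f z])
     (use t in \<open>auto simp: ext_exact_def\<close>)
   then obtain s g where s: "s \<in> K" "s \<noteq> \<zero>\<^sub>K" and g: "g \<in> fmod K (B (Suc (Suc i)))"
    and sf: "(\<lambda>c. s \<otimes>\<^sub>K f c) = bd (reg K) B A (Suc i) g" by blast
   have u: "s \<in> Units K" using s K.field_Units by auto
   define t where "t = inv\<^bsub>K\<^esub> s"
   have t: "t \<in> K" "t \<otimes>\<^sub>K s = \<one>\<^sub>K" using u by (auto simp: t_def)
   interpret G: module K "fmod K (B (Suc (Suc i)))" by (rule dsum_module[OF Kg])
   have "bd (reg K) B A (Suc i) (t \<odot>\<^bsub>fmod K (B (Suc (Suc i)))\<^esub> g) = (\<lambda>c. t \<otimes>\<^sub>K (s \<otimes>\<^sub>K f c))"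
    using mod_hom_smult[OF push_hom[OF Kg A] t(1) g] sf[symmetric] by simp
   also have "\<dots> = f" using t s dsum_val[OF f] by (simp add: K.m_assoc[symmetric])
   finally show "\<exists>g\<in>fmod K (B (Suc (Suc i))). f = bd (reg K) B A (Suc i) g"
    using G.smult_closed[OF t(1) g] by metis
  qed
 qed
qed

section \<open>Transposition and duality for finite bases\<close>

lemma transpose_rmat:
 assumes "cring R" "rmat R B C A" "finite B"
 shows "rmat R C B (\<lambda>c b. if b \<in> B then A b c else \<zero>\<^sub>R)"
proof -
 interpret R: cring R by fact
 show ?thesis
  unfolding rmat_def free_eq_dsum
  by (intro ballI dsumI_superset[OF _ _ assms(3)]) (use rmat_entry[OF assms(2)] in auto)
qed

lemma pull_cong_mat:
 assumes "!!b. b \<in> B ==> A b = A' b"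
 shows "pull R M B A = pull R M B A'"
 by (intro ext) (simp add: pull_def assms)

lemma push_transpose:
 assumes M: "module R M" and A: "rmat R B C A" and fin: "finite B" "finite C" and f: "f \<in> dsum M C"
 shows "push M B (\<lambda>c b. if b \<in> B then A b c else \<zero>\<^sub>R) f = pull R M B A f"
proof -
 have R: "cring R" using M by (simp add: module_def)
 have "push M B (\<lambda>c b. if b \<in> B then A b c else \<zero>\<^sub>R) f =
  pull R M B (\<lambda>b c. if c \<in> C then (if b \<in> B then A b c else \<zero>\<^sub>R) else \<zero>\<^sub>R) f"
  by (rule push_eq_pull[OF M transpose_rmat[OF R A fin(1)] fin(2,1) f])
 also have "\<dots> = pull R M B A f"
  by (rule fun_cong[OF pull_cong_mat])
   (use dsum_out[OF rmat_row[OF A, unfolded free_eq_dsum]] in \<open>auto simp: fun_eq_iff\<close>)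
 finally show ?thesis .
qed

text \<open>With finite bases the tensor product of E and G is Hom(Hom(G, R), E), so the two
  conditions are the two sides of the duality for the transposed matrices \<open>T\<close>. The
  annihilator of e0 is the complement of S, which lets E detect exactly the classes that are not
  killed by S.\<close>

lemma tor_exact_dual:
 fixes E :: "('r, 'm, 'd) module_scheme" and B :: "nat => 'b set"
 assumes E: "module R E" and bE: "baer R E" and A: "!!i. rmat R (B (Suc i)) (B i) (A i)"
  and fin: "!!i. finite (B i)" and S: "S \<subseteq> carrier R" "\<one>\<^sub>R \<in> S"
  and tf: "!!s x. s \<in> S ==> x \<in> E ==> s \<odot>\<^sub>E x = \<zero>\<^sub>E ==> x = \<zero>\<^sub>E"
  and e0: "e0 \<in> E" and ann: "!!r. r \<in> R ==> r \<odot>\<^sub>E e0 = \<zero>\<^sub>E \<longleftrightarrow> r \<notin> S"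
 shows "tor_exact {\<one>\<^sub>R} E B A i \<longleftrightarrow> coh_exact R S (reg R) B A i"
proof -
 interpret E: module R E by fact
 note R = E.is_cring
 note Rg = reg_module[OF R]
 define T where "T j = (\<lambda>c b. if b \<in> B (Suc j) then A j b c else \<zero>\<^sub>R)" for j
 have T: "rmat R (B j) (B (Suc j)) (T j)" for j
  unfolding T_def by (rule transpose_rmat[OF R A fin])
 have pT: "push (reg R) (B (Suc j)) (T j) f = cobd R (reg R) B A j f" if "f \<in> dprod (reg R) (B j)" for f j
  unfolding T_def by (rule push_transpose[OF Rg A fin fin]) (use that dsum_finite[OF fin] in blast)
 have pE: "pull R E (B j) (T j) e = bd E B A j e" if "e \<in> dprod E (B (Suc j))" for e j
  unfolding T_def
  by (rule push_eq_pull[OF E A fin fin, symmetric]) (use that dsum_finite[OF fin] in blast)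
 have one: "(\<lambda>b. \<one>\<^sub>R \<odot>\<^sub>E z b) = z" if "z \<in> dprod E X" for z :: "'b => 'm" and X
  using dprod_val[OF that] by simp
 have te: "tor_exact {\<one>\<^sub>R} E B A i \<longleftrightarrow>
  (\<forall>e\<in>dprod E (B (Suc i)). pull R E (B i) (T i) e = zf E -->
   (\<exists>e'\<in>dprod E (B (Suc (Suc i))). e = pull R E (B (Suc i)) (T (Suc i)) e'))"
  unfolding tor_exact_def dsum_finite[OF fin] by (intro ball_cong imp_cong refl) (auto simp: pE one[of _ "B (Suc i)"])
 have ce: "coh_exact R S (reg R) B A i \<longleftrightarrow>
  (\<forall>f\<in>fmod R (B (Suc i)). push (reg R) (B (Suc (Suc i))) (T (Suc i)) f = zf R -->
   (\<exists>s\<in>S. \<exists>g\<in>fmod R (B i). (\<lambda>c. s \<otimes>\<^sub>R f c) = push (reg R) (B (Suc i)) (T i) g))"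
  unfolding coh_exact_def dsum_finite[OF fin] by (intro ball_cong imp_cong refl) (auto simp: pT)
 show ?thesis
 proof
  assume t: "tor_exact {\<one>\<^sub>R} E B A i"
  show "coh_exact R S (reg R) B A i"
   unfolding ce
  proof (intro ballI impI)
   fix f assume f: "f \<in> fmod R (B (Suc i))"
    and z: "push (reg R) (B (Suc (Suc i))) (T (Suc i)) f = zf R"
   show "\<exists>s\<in>S. \<exists>g\<in>fmod R (B i). (\<lambda>c. s \<otimes>\<^sub>R f c) = push (reg R) (B (Suc i)) (T i) g"
    by (rule push_exact_of_pull_exact[OF E bE T T e0 ann S _ f z]) (use t te in auto)
  qed
 next
  assume c: "coh_exact R S (reg R) B A i"
  show "tor_exact {\<one>\<^sub>R} E B A i"
   unfolding te
  proof (intro ballI impI)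
   fix e assume e: "e \<in> dprod E (B (Suc i))" and z: "pull R E (B i) (T i) e = zf E"
   show "\<exists>e'\<in>dprod E (B (Suc (Suc i))). e = pull R E (B (Suc i)) (T (Suc i)) e'"
    by (rule pull_exact_of_push_exact[OF E bE T T S(1) tf _ e z]) (use c ce in auto)
  qed
 qed
qed

section \<open>Exactness up to a multiplicative set\<close>

text \<open>The chase for an isomorphism of complexes, with every injectivity and surjectivity
  weakened by a factor from S. The factors met on the way are multiplied together.\<close>

lemma S_iso_exact:
 assumes mods: "module R X" "module R Y" "module R Z" "module R X'" "module R Y'" "module R Z'"
  and f: "f \<in> mod_hom R X Y" and g: "g \<in> mod_hom R Y Z" and f': "f' \<in> mod_hom R X' Y'" and g': "g' \<in> mod_hom R Y' Z'"
  and \<alpha>: "\<alpha> \<in> mod_hom R X X'" and \<beta>: "\<beta> \<in> mod_hom R Y Y'" and \<gamma>: "\<gamma> \<in> mod_hom R Z Z'"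
  and c1: "!!x. x \<in> X ==> \<beta> (f x) = f' (\<alpha> x)" and c2: "!!y. y \<in> Y ==> \<gamma> (g y) = g' (\<beta> y)"
  and S: "S \<subseteq> carrier R" "!!s t. s \<in> S ==> t \<in> S ==> s \<otimes>\<^sub>R t \<in> S"
  and \<alpha>s: "!!x'. x' \<in> X' ==> \<exists>s\<in>S. \<exists>x\<in>X. s \<odot>\<^sub>X' x' = \<alpha> x"
  and \<beta>s: "!!y'. y' \<in> Y' ==> \<exists>s\<in>S. \<exists>y\<in>Y. s \<odot>\<^sub>Y' y' = \<beta> y"
  and \<beta>i: "!!y. y \<in> Y ==> \<beta> y = \<zero>\<^sub>Y' ==> \<exists>s\<in>S. s \<odot>\<^sub>Y y = \<zero>\<^sub>Y"
  and \<gamma>i: "!!z. z \<in> Z ==> \<gamma> z = \<zero>\<^sub>Z' ==> \<exists>s\<in>S. s \<odot>\<^sub>Z z = \<zero>\<^sub>Z"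
 shows "(\<forall>y\<in>Y. g y = \<zero>\<^sub>Z --> (\<exists>s\<in>S. \<exists>x\<in>X. s \<odot>\<^sub>Y y = f x)) \<longleftrightarrow>
  (\<forall>y\<in>Y'. g' y = \<zero>\<^sub>Z' --> (\<exists>s\<in>S. \<exists>x\<in>X'. s \<odot>\<^sub>Y' y = f' x))" (is "?L \<longleftrightarrow> ?R")
proof
 interpret X: module R X by fact
 interpret Y: module R Y by fact
 interpret Z: module R Z by fact
 interpret X': module R X' by fact
 interpret Y': module R Y' by fact
 interpret Z': module R Z' by fact
 have SR: "s \<in> R" if "s \<in> S" for s using that S by auto
 {
  assume L: ?L
  show ?R
  proof (intro ballI impI)
   fix y' assume y': "y' \<in> Y'" and z: "g' y' = \<zero>\<^sub>Z'"
   obtain s y where s: "s \<in> S" and y: "y \<in> Y" and sy: "s \<odot>\<^sub>Y' y' = \<beta> y" using \<beta>s[OF y'] by blast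
   have "\<gamma> (g y) = \<zero>\<^sub>Z'"
    using c2[OF y] sy[symmetric] mod_hom_smult[OF g' SR[OF s] y'] z SR[OF s] by simp
   then obtain t where t: "t \<in> S" and tg: "t \<odot>\<^sub>Z g y = \<zero>\<^sub>Z" using \<gamma>i mod_hom_closed[OF g y] by blast
   have ty: "t \<odot>\<^sub>Y y \<in> Y" using y SR[OF t] by simp
   have "g (t \<odot>\<^sub>Y y) = \<zero>\<^sub>Z" using mod_hom_smult[OF g SR[OF t] y] tg by simp
   then obtain u x where u: "u \<in> S" and x: "x \<in> X" and ux: "u \<odot>\<^sub>Y (t \<odot>\<^sub>Y y) = f x"
    using L ty by blast
   have "(u \<otimes>\<^sub>R t \<otimes>\<^sub>R s) \<odot>\<^sub>Y' y' = u \<odot>\<^sub>Y' (t \<odot>\<^sub>Y' \<beta> y)"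
    using sy[symmetric] y' SR[OF s] SR[OF t] SR[OF u] by (simp add: Y'.smult_assoc1)
   also have "\<dots> = f' (\<alpha> x)"
    using mod_hom_smult[OF \<beta> SR[OF u] ty] mod_hom_smult[OF \<beta> SR[OF t] y] ux c1[OF x] by simp
   finally show "\<exists>s\<in>S. \<exists>x\<in>X'. s \<odot>\<^sub>Y' y' = f' x"
    using mod_hom_closed[OF \<alpha> x] S(2) s t u by blast
  qed
 next
  assume Rr: ?R
  show ?L
  proof (intro ballI impI)
   fix y assume y: "y \<in> Y" and z: "g y = \<zero>\<^sub>Z"
   have "g' (\<beta> y) = \<zero>\<^sub>Z'" using c2[OF y] z mod_hom_zero[OF mods(3,6) \<gamma>] by simp
   then obtain s x' where s: "s \<in> S" and x': "x' \<in> X'" and sx: "s \<odot>\<^sub>Y' \<beta> y = f' x'"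
    using Rr mod_hom_closed[OF \<beta> y] by blast
   obtain t x where t: "t \<in> S" and x: "x \<in> X" and tx: "t \<odot>\<^sub>X' x' = \<alpha> x" using \<alpha>s[OF x'] by blast
   let ?y = "t \<odot>\<^sub>Y (s \<odot>\<^sub>Y y)"
   have cy: "s \<odot>\<^sub>Y y \<in> Y" "?y \<in> Y" "f x \<in> Y"
    using y SR[OF s] SR[OF t] mod_hom_closed[OF f x] by simp_all
   have "\<beta> ?y = t \<odot>\<^sub>Y' f' x'"
    using mod_hom_smult[OF \<beta> SR[OF t] cy(1)] mod_hom_smult[OF \<beta> SR[OF s] y] sx by simp
   also have "\<dots> = \<beta> (f x)" using mod_hom_smult[OF f' SR[OF t] x'] tx c1[OF x] by simp
   finally have "\<beta> (?y \<ominus>\<^sub>Y f x) = \<zero>\<^sub>Y'"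
    using mod_hom_minus[OF mods(2,5) \<beta> cy(2,3)] mod_hom_closed[OF \<beta> cy(3)] by simp
   then obtain u where u: "u \<in> S" and uz: "u \<odot>\<^sub>Y (?y \<ominus>\<^sub>Y f x) = \<zero>\<^sub>Y" using \<beta>i Y.minus_closed[OF cy(2,3)] by blast
   have "u \<odot>\<^sub>Y ?y \<ominus>\<^sub>Y u \<odot>\<^sub>Y f x = \<zero>\<^sub>Y"
    using mod_hom_minus[OF mods(2,2) scale_hom[OF mods(2) SR[OF u]] cy(2,3)] uz by simp
   then have "u \<odot>\<^sub>Y ?y = u \<odot>\<^sub>Y f x" using cy SR[OF u] Y.a_minus_eq_zero_iff by simp
   then have "(u \<otimes>\<^sub>R t \<otimes>\<^sub>R s) \<odot>\<^sub>Y y = f (u \<odot>\<^sub>X x)"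
    using mod_hom_smult[OF f SR[OF u] x] y SR[OF s] SR[OF t] SR[OF u] by (simp add: Y.smult_assoc1)
   then show "\<exists>s\<in>S. \<exists>x\<in>X. s \<odot>\<^sub>Y y = f x"
    using X.smult_closed[OF SR[OF u] x] S(2) s t u by blast
  qed
 }
qed

context
 fixes R :: "('r, 'c) ring_scheme" and M :: "('r, 'm, 'd) module_scheme" and N :: "('r, 'n, 'e) module_scheme"
  and h S
 assumes M: "module R M" and N: "module R N" and h: "h \<in> mod_hom R M N"
  and S: "S \<subseteq> carrier R" "\<one>\<^sub>R \<in> S" "!!s t. s \<in> S ==> t \<in> S ==> s \<otimes>\<^sub>R t \<in> S"
  and hs: "!!y. y \<in> N ==> \<exists>s\<in>S. \<exists>x\<in>M. s \<odot>\<^sub>N y = h x"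
  and hi: "!!x. x \<in> M ==> h x = \<zero>\<^sub>N ==> \<exists>s\<in>S. s \<odot>\<^sub>M x = \<zero>\<^sub>M"
begin

interpretation M: module R M by (rule M)
interpretation N: module R N by (rule N)

lemma SR: "s \<in> S ==> s \<in> carrier R"
 using S by auto

text \<open>Finitely many coordinates have a common denominator; the induction step cross-multiplies
  the old one with that of the new coordinate.\<close>

lemma dsum_S_surj:
 assumes "z \<in> dsum N B"
 shows "\<exists>s\<in>S. \<exists>x\<in>dsum M B. s \<odot>\<^bsub>dsum N B\<^esub> z = (\<lambda>b. h (x b))"
 using N assms
proof (induction z rule: dsum_induct)
 case zero
 interpret D: module R "dsum M B" by (rule dsum_module[OF M])
 show ?case using S mod_hom_zero[OF M N h] D.zero_closed by (intro bexI[of _ "\<one>\<^sub>R"] bexI[of _ "\<zero>\<^bsub>dsum M B\<^esub>"]) auto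
next
 case (add b y f)
 interpret DM: module R "dsum M B" by (rule dsum_module[OF M])
 interpret DN: module R "dsum N B" by (rule dsum_module[OF N])
 note dh = dsum_map_hom[OF M N h, of B]
 obtain s x where s: "s \<in> S" and x: "x \<in> dsum M B" and sx: "s \<odot>\<^bsub>dsum N B\<^esub> f = (\<lambda>b. h (x b))"
  using add(4) by blast
 obtain t v where t: "t \<in> S" and v: "v \<in> M" and tv: "t \<odot>\<^sub>N y = h v" using hs[OF add(2)] by blast
 note sg = sing_closed[OF N add(1,2)] and sv = sing_closed[OF M add(1) v]
 have tsing: "t \<odot>\<^bsub>dsum N B\<^esub> sing N b y = (\<lambda>c. h (sing M b v c))"
  using tv SR[OF t] mod_hom_zero[OF M N h] by (auto simp: sing_def)
 have "(t \<otimes>\<^sub>R s) \<odot>\<^bsub>dsum N B\<^esub> (sing N b y \<oplus>\<^bsub>dsum N B\<^esub> f) =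
   s \<odot>\<^bsub>dsum N B\<^esub> (t \<odot>\<^bsub>dsum N B\<^esub> sing N b y) \<oplus>\<^bsub>dsum N B\<^esub> t \<odot>\<^bsub>dsum N B\<^esub> (s \<odot>\<^bsub>dsum N B\<^esub> f)"
  using DN.smult_r_distr[of "t \<otimes>\<^sub>R s", OF _ sg add(3)] DN.smult_assoc1[OF SR[OF s] SR[OF t] sg]
   DN.smult_assoc1[OF SR[OF t] SR[OF s] add(3)] SR[OF s] SR[OF t] M.R.m_comm[of s t] by (simp add: fun_eq_iff)
 also have "\<dots> = (\<lambda>c. h ((s \<odot>\<^bsub>dsum M B\<^esub> sing M b v \<oplus>\<^bsub>dsum M B\<^esub> t \<odot>\<^bsub>dsum M B\<^esub> x) c))"
  unfolding tsing sx
  using mod_hom_add[OF dh DM.smult_closed[OF SR[OF s] sv] DM.smult_closed[OF SR[OF t] x]]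
   mod_hom_smult[OF dh SR[OF s] sv] mod_hom_smult[OF dh SR[OF t] x] by (simp add: fun_eq_iff)
 finally have "(t \<otimes>\<^sub>R s) \<odot>\<^bsub>dsum N B\<^esub> (\<lambda>c. sing N b y c \<oplus>\<^sub>N f c) =
  (\<lambda>c. h ((s \<odot>\<^bsub>dsum M B\<^esub> sing M b v \<oplus>\<^bsub>dsum M B\<^esub> t \<odot>\<^bsub>dsum M B\<^esub> x) c))" by simp
 then show ?case
  using S(3)[OF t s] DM.a_closed[OF DM.smult_closed[OF SR[OF s] sv] DM.smult_closed[OF SR[OF t] x]] by blast
qed

lemma dsum_S_inj:
 assumes "x \<in> dsum M B" "(\<lambda>b. h (x b)) = \<zero>\<^bsub>dsum N B\<^esub>"
 shows "\<exists>s\<in>S. s \<odot>\<^bsub>dsum M B\<^esub> x = \<zero>\<^bsub>dsum M B\<^esub>"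
proof -
 have "\<exists>s\<in>S. \<forall>b\<in>X. s \<odot>\<^sub>M x b = \<zero>\<^sub>M" if "finite X" for X
  using that
 proof (induction X)
  case empty
  then show ?case using S(2) by auto
 next
  case (insert b X)
  then obtain s where s: "s \<in> S" "\<forall>b\<in>X. s \<odot>\<^sub>M x b = \<zero>\<^sub>M" by blast
  have "h (x b) = \<zero>\<^sub>N" using assms(2) by (simp add: fun_eq_iff)
  then obtain t where t: "t \<in> S" "t \<odot>\<^sub>M x b = \<zero>\<^sub>M" using hi dsum_val[OF assms(1)] by blast
  have "(s \<otimes>\<^sub>R t) \<odot>\<^sub>M x c = \<zero>\<^sub>M" if "c \<in> insert b X" for c
  proof (cases "c = b")
   case True
   then show ?thesis using t SR[OF s(1)] SR[OF t(1)] dsum_val[OF assms(1)] by (simp add: M.smult_assoc1)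
  next
   case False
   then have "s \<odot>\<^sub>M x c = \<zero>\<^sub>M" using that s by simp
   then show ?thesis using SR[OF s(1)] SR[OF t(1)] dsum_val[OF assms(1)]
    by (simp add: M.R.m_comm[of s t] M.smult_assoc1)
  qed
  then show ?case using S(3)[OF s(1) t(1)] by blast
 qed
 from this[OF dsum_fin[OF assms(1)]]
 obtain s where s: "s \<in> S" "!!b. x b \<noteq> \<zero>\<^sub>M ==> s \<odot>\<^sub>M x b = \<zero>\<^sub>M" by blast
 have "s \<odot>\<^sub>M x b = \<zero>\<^sub>M" for b using s SR[OF s(1)] by (cases "x b = \<zero>\<^sub>M") auto
 then show ?thesis using s(1) by auto
qed

lemma tor_exact_S_iso:
 assumes A: "!!i. rmat R (B (Suc i)) (B i) (A i)"
 shows "tor_exact S M B A i \<longleftrightarrow> tor_exact S N B A i"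
proof -
 note mm = dsum_module[OF M] and nn = dsum_module[OF N]
 have "(\<forall>y\<in>dsum M (B (Suc i)). bd M B A i y = \<zero>\<^bsub>dsum M (B i)\<^esub> -->
   (\<exists>s\<in>S. \<exists>x\<in>dsum M (B (Suc (Suc i))). s \<odot>\<^bsub>dsum M (B (Suc i))\<^esub> y = bd M B A (Suc i) x)) \<longleftrightarrow>
  (\<forall>y\<in>dsum N (B (Suc i)). bd N B A i y = \<zero>\<^bsub>dsum N (B i)\<^esub> -->
   (\<exists>s\<in>S. \<exists>x\<in>dsum N (B (Suc (Suc i))). s \<odot>\<^bsub>dsum N (B (Suc i))\<^esub> y = bd N B A (Suc i) x))"
  by (rule S_iso_exact[OF mm mm mm nn nn nn push_hom[OF M A] push_hom[OF M A] push_hom[OF N A] push_hom[OF N A]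
     dsum_map_hom[OF M N h] dsum_map_hom[OF M N h] dsum_map_hom[OF M N h]
     push_natural[OF M N h A, symmetric] push_natural[OF M N h A, symmetric]
     S(1,3) dsum_S_surj dsum_S_surj dsum_S_inj dsum_S_inj])
 then show ?thesis by (simp add: tor_exact_def)
qed

lemma coh_exact_S_iso:
 assumes A: "!!i. rmat R (B (Suc i)) (B i) (A i)" and fin: "!!i. finite (B i)"
 shows "coh_exact R S M B A i \<longleftrightarrow> coh_exact R S N B A i"
proof -
 note mm = dsum_module[OF M] and nn = dsum_module[OF N]
 have pullh: "cobd R Q B A j \<in> mod_hom R (dsum Q (B j)) (dsum Q (B (Suc j)))" if Q: "module R Q"
  for Q :: "('r, 'q, 'u) module_scheme" and j
  by (rule pull_hom[OF Q A fin fin])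
 have c: "(\<lambda>b. h (cobd R M B A j x b)) = cobd R N B A j (\<lambda>b. h (x b))"
  if "x \<in> dsum M (B j)" for x j
  using pull_natural[OF M N h A dsum_val[OF that]] by simp
 have "(\<forall>y\<in>dsum M (B (Suc i)). cobd R M B A (Suc i) y = \<zero>\<^bsub>dsum M (B (Suc (Suc i)))\<^esub> -->
   (\<exists>s\<in>S. \<exists>x\<in>dsum M (B i). s \<odot>\<^bsub>dsum M (B (Suc i))\<^esub> y = cobd R M B A i x)) \<longleftrightarrow>
  (\<forall>y\<in>dsum N (B (Suc i)). cobd R N B A (Suc i) y = \<zero>\<^bsub>dsum N (B (Suc (Suc i)))\<^esub> -->
   (\<exists>s\<in>S. \<exists>x\<in>dsum N (B i). s \<odot>\<^bsub>dsum N (B (Suc i))\<^esub> y = cobd R N B A i x))"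
  by (rule S_iso_exact[OF mm mm mm nn nn nn pullh[OF M] pullh[OF M] pullh[OF N] pullh[OF N]
     dsum_map_hom[OF M N h] dsum_map_hom[OF M N h] dsum_map_hom[OF M N h] c c
     S(1,3) dsum_S_surj dsum_S_surj dsum_S_inj dsum_S_inj])
 then show ?thesis by (simp add: coh_exact_def dsum_finite[OF fin])
qed

end

text \<open>When S acts bijectively on N, the preimage w of s z can be divided by s, and s can be
  cancelled in the resulting equation.\<close>

lemma tor_exact_S_local:
 assumes N: "module R N" and A: "!!i. rmat R (B (Suc i)) (B i) (A i)"
  and S: "S \<subseteq> carrier R" "\<one>\<^sub>R \<in> S"
  and inj: "!!s x. s \<in> S ==> x \<in> N ==> s \<odot>\<^sub>N x = \<zero>\<^sub>N ==> x = \<zero>\<^sub>N"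
  and surj: "!!s x. s \<in> S ==> x \<in> N ==> \<exists>y\<in>N. s \<odot>\<^sub>N y = x"
 shows "tor_exact S N B A i \<longleftrightarrow> tor_exact {\<one>\<^sub>R} N B A i"
proof
 assume "tor_exact {\<one>\<^sub>R} N B A i"
 then show "tor_exact S N B A i" using S(2) unfolding tor_exact_def by blast
next
 assume t: "tor_exact S N B A i"
 interpret N: module R N by fact
 show "tor_exact {\<one>\<^sub>R} N B A i"
  unfolding tor_exact_def
 proof (intro ballI impI)
  fix z assume z: "z \<in> dsum N (B (Suc i))" "bd N B A i z = zf N"
  obtain s w where s: "s \<in> S" and w: "w \<in> dsum N (B (Suc (Suc i)))"
   and sw: "(\<lambda>b. s \<odot>\<^sub>N z b) = bd N B A (Suc i) w" using t z unfolding tor_exact_def by blast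
  have sR: "s \<in> R" using s S by auto
  obtain v where v: "v \<in> dsum N (B (Suc (Suc i)))" "!!b. s \<odot>\<^sub>N v b = w b"
   using dsum_map_lift[OF N N scale_hom[OF N sR] w] surj[OF s dsum_val[OF w]] by (metis imageI)
  let ?p = "bd N B A (Suc i) v"
  have pv: "?p \<in> dsum N (B (Suc i))" by (rule mod_hom_closed[OF push_hom[OF N A] v(1)])
  have "(\<lambda>b. s \<odot>\<^sub>N ?p b) = (\<lambda>b. s \<odot>\<^sub>N z b)"
   using mod_hom_smult[OF push_hom[OF N A[of "Suc i"]] sR v(1)] v(2) sw by simp
  then have "s \<odot>\<^sub>N (?p b \<ominus>\<^sub>N z b) = \<zero>\<^sub>N" for b
   using mod_hom_minus[OF N N scale_hom[OF N sR] dsum_val[OF pv, of b] dsum_val[OF z(1), of b]] sR dsum_val[OF z(1)]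
   by (simp add: fun_eq_iff)
  then have d0: "?p b \<ominus>\<^sub>N z b = \<zero>\<^sub>N" for b
   using inj[OF s] dsum_val[OF pv, of b] dsum_val[OF z(1), of b] by simp
  have "?p b = z b" for b
   using d0[of b] N.a_minus_eq_zero_iff[OF dsum_val[OF pv, of b] dsum_val[OF z(1), of b]] by simp
  then have "(\<lambda>b. \<one>\<^sub>R \<odot>\<^sub>N z b) = ?p" using dsum_val[OF z(1)] by auto
  then show "\<exists>s\<in>{\<one>\<^sub>R}. \<exists>w\<in>dsum N (B (Suc (Suc i))). (\<lambda>b. s \<odot>\<^sub>N z b) = bd N B A (Suc i) w"
   using v(1) by auto
 qed
qed

section \<open>Resolutions by finite free modules\<close>

lemma noetherian_maximal_ideal:
 assumes "noetherian_ring R" "F \<subseteq> {I. ideal I R}" "F \<noteq> {}"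
 obtains I where "I \<in> F" "!!J. J \<in> F ==> I \<subseteq> J ==> J = I"
proof -
 interpret noetherian_ring R by fact
 have "\<exists>M\<in>F. \<forall>X\<in>F. M \<subseteq> X --> X = M"
 proof (rule subset_Zorn_nonempty[OF assms(3)])
  fix C assume C: "C \<noteq> {}" "subset.chain F C"
  then have "subset.chain {I. ideal I R} C" using assms(2) unfolding subset_chain_def by blast
  then have "\<Union>C \<in> C" using ideal_chain_is_trivial[OF C(1)] by blast
  then show "\<Union>C \<in> F" using C(2) unfolding subset_chain_def by blast
 qed
 then show ?thesis using that by blast
qed

text \<open>Generation is expressed by minimality among submodules, which avoids linear
  combinations.\<close>

definition fin_gen :: "('r, 'c) ring_scheme => ('r, 'm, 'd) module_scheme => 'm set => bool"
 where "fin_gen R F K \<longleftrightarrow> (\<exists>G\<subseteq>K. finite G \<and> (\<forall>H. submodule H R F --> G \<subseteq> H --> K \<subseteq> H))"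

lemma submodule_Int:
 assumes "module R M" "submodule H R M" "submodule K R M"
 shows "submodule (H \<inter> K) R M"
proof -
 interpret module R M by fact
 show ?thesis
  using submoduleE[OF assms(2)] submoduleE[OF assms(3)] submodule_zero[OF assms(2)] submodule_zero[OF assms(3)]
  by (intro submoduleI) auto
qed

lemma dsum_mono: "B \<subseteq> C ==> carrier (dsum M B) \<subseteq> carrier (dsum M C)"
 by (auto simp: dsum_def)

lemma submodule_dsum_subset:
 assumes M: "module R M" and BC: "B \<subseteq> C" and H: "submodule H R (dsum M C)"
 shows "submodule (H \<inter> carrier (dsum M B)) R (dsum M B)"
proof -
 interpret B: module R "dsum M B" by (rule dsum_module[OF M])
 interpret C: module R "dsum M C" by (rule dsum_module[OF M])
 note E = C.submoduleE[OF H]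
 show ?thesis
 proof (rule B.submoduleI)
  fix a assume a: "a \<in> H \<inter> carrier (dsum M B)"
  then have "\<ominus>\<^bsub>dsum M B\<^esub> a = \<ominus>\<^bsub>dsum M C\<^esub> a"
   using dsum_inv[OF M, of a B] dsum_inv[OF M subsetD[OF dsum_mono[OF BC]], of a] by auto
  then show "\<ominus>\<^bsub>dsum M B\<^esub> a \<in> H \<inter> carrier (dsum M B)" using a E(3)[of a] B.a_inv_closed[of a] by auto
 next
  fix a b assume "a \<in> H \<inter> carrier (dsum M B)" "b \<in> H \<inter> carrier (dsum M B)"
  then show "a \<oplus>\<^bsub>dsum M B\<^esub> b \<in> H \<inter> carrier (dsum M B)" using E(5)[of a b] B.a_closed[of a b] by simp
 next
  fix r a assume "r \<in> R" "a \<in> H \<inter> carrier (dsum M B)"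
  then show "r \<odot>\<^bsub>dsum M B\<^esub> a \<in> H \<inter> carrier (dsum M B)" using E(4)[of r a] B.smult_closed[of r a] by simp
 qed (use submodule_zero[OF H] B.zero_closed in auto)
qed

text \<open>Induction on the number of coordinates: the c-coordinates of K form an ideal, and the
  elements of K with c-coordinate 0 lie in the smaller free module. Lifts of generators of the
  former together with generators of the latter generate K.\<close>

lemma submodule_free_fin_gen:
 assumes R: "cring R" and noeth: "noetherian_ring R" and fin: "finite C" and K: "submodule K R (fmod R C)"
 shows "fin_gen R (fmod R C) K"
 using fin K
proof (induction C arbitrary: K)
 case empty
 interpret D: module R "dsum (reg R) {}" by (rule dsum_module[OF reg_module[OF R]])
 have "K \<subseteq> {\<zero>\<^bsub>dsum (reg R) {}\<^esub>}" using D.submoduleE(1)[OF empty] by (auto simp: dsum_def)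
 then show ?case unfolding fin_gen_def
  using submodule_zero by (intro exI[of _ "{}"]) blast
next
 case (insert c C)
 interpret R: noetherian_ring R by fact
 note Rg = reg_module[OF R]
 let ?D = "fmod R (insert c C)"
 have D: "module R ?D" by (rule dsum_module[OF Rg])
 interpret D: module R ?D by (rule D)
 have sub: "C \<subseteq> insert c C" by auto
 note KE = D.submoduleE[OF insert(4)]
 have ev: "(\<lambda>f. f c) \<in> mod_hom R ?D (reg R)" by (rule dsum_eval_hom[OF Rg])
 define I where "I = (\<lambda>f. f c) ` K"
 have "ideal I R" unfolding I_def ideal_submodule[OF R] by (rule submodule_image[OF D Rg ev insert(4)])
 then obtain GI where GI: "finite GI" "I = Idl\<^bsub>R\<^esub> GI" "GI \<subseteq> R" using R.finetely_gen by blast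
 have GII: "GI \<subseteq> I" using R.genideal_self[OF GI(3)] GI(2) by simp
 obtain G' where G': "G' \<subseteq> K \<inter> carrier (fmod R C)" "finite G'"
  "!!H. submodule H R (fmod R C) ==> G' \<subseteq> H ==> K \<inter> carrier (fmod R C) \<subseteq> H"
  using insert.IH[OF submodule_dsum_subset[OF Rg sub insert(4)]] unfolding fin_gen_def by blast
 obtain k where k: "!!r. r \<in> GI ==> k r \<in> K \<and> k r c = r"
 proof -
  have "\<forall>r\<in>GI. \<exists>f. f \<in> K \<and> f c = r" using GII unfolding I_def by auto
  from bchoice[OF this] show ?thesis using that by blast
 qed
 have "K \<subseteq> H" if H: "submodule H R ?D" "k ` GI \<union> G' \<subseteq> H" for H
 proof
  fix f assume f: "f \<in> K"
  note HE = D.submoduleE[OF H(1)]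
  \<comment> \<open>H is intersected with K so that the h found below lies in K and the induction
    hypothesis covers f - h.\<close>
  have HK: "submodule (H \<inter> K) R ?D" by (rule submodule_Int[OF D H(1) insert(4)])
  have J: "ideal ((\<lambda>f. f c) ` (H \<inter> K)) R"
   unfolding ideal_submodule[OF R] by (rule submodule_image[OF D Rg ev HK])
  have "GI \<subseteq> (\<lambda>f. f c) ` (H \<inter> K)"
  proof
   fix r assume r: "r \<in> GI"
   have "k r \<in> H \<inter> K" using k[OF r] r H(2) by blast
   then show "r \<in> (\<lambda>f. f c) ` (H \<inter> K)" using k[OF r] by (intro image_eqI[of _ _ "k r"]) simp_all
  qed
  then have "I \<subseteq> (\<lambda>f. f c) ` (H \<inter> K)" unfolding GI(2) by (rule R.genideal_minimal[OF J])
  then obtain h where h: "h \<in> H" "h \<in> K" "f c = h c" using f unfolding I_def by blast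
  have fh: "f \<ominus>\<^sub>?D h \<in> K" by (rule D.submodule_minus[OF insert(4) f h(2)])
  have fD: "f \<in> ?D" "h \<in> ?D" using f h KE(1) by auto
  have "(f \<ominus>\<^sub>?D h) c = \<zero>\<^sub>R"
   using dsum_minus[OF Rg fD] h(3) dsum_val[OF fD(2), of c] R.a_minus_self by simp
  then have "f \<ominus>\<^sub>?D h \<in> fmod R C"
   using dsumD[OF D.submodule_carrier[OF insert(4) fh]] by (intro dsumI) auto
  moreover have "K \<inter> carrier (fmod R C) \<subseteq> H \<inter> carrier (fmod R C)"
   using G'(1) H(2) by (intro G'(3) submodule_dsum_subset[OF Rg sub H(1)]) auto
  ultimately have "f \<ominus>\<^sub>?D h \<in> H" using fh by auto
  then have "(f \<ominus>\<^sub>?D h) \<oplus>\<^sub>?D h \<in> H" using HE(5) h(1) by blast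
  moreover have "(f \<ominus>\<^sub>?D h) \<oplus>\<^sub>?D h = f" using fD D.minus_closed by (simp only: a_minus_def D.a_assoc D.a_inv_closed D.l_neg D.r_zero)
  ultimately show "f \<in> H" by simp
 qed
 then show ?case unfolding fin_gen_def
  using k G' GI(1) by (intro exI[of _ "k ` GI \<union> G'"]) auto
qed

text \<open>Generators are numbered by {..<n}, so that all bases of a resolution can be sets of
  natural numbers.\<close>

lemma fin_gen_presentation:
 assumes R: "cring R" and K: "submodule K R (fmod R C)" and fg: "fin_gen R (fmod R C) K"
 obtains n :: nat and A where "rmat R {..<n} C A" "push (reg R) C A ` carrier (dsum (reg R) {..<n}) = K"
proof -
 note Rg = reg_module[OF R]
 let ?D = "fmod R C"
 have D: "module R ?D" by (rule dsum_module[OF Rg])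
 interpret D: module R ?D by (rule D)
 obtain G where G: "G \<subseteq> K" "finite G" "!!H. submodule H R ?D ==> G \<subseteq> H ==> K \<subseteq> H"
  using fg unfolding fin_gen_def by blast
 obtain A where A: "bij_betw A {..<card G} G" using ex_bij_betw_nat_finite[OF G(2)] by (auto simp: lessThan_atLeast0)
 have AK: "A b \<in> K" if "b \<in> {..<card G}" for b using A G(1) that by (auto simp: bij_betw_def)
 have rm: "rmat R {..<card G} C A"
  using AK D.submodule_carrier[OF K] by (auto simp: rmat_def free_eq_dsum)
 let ?B = "dsum (reg R) {..<card G}"
 have B: "module R ?B" by (rule dsum_module[OF Rg])
 note p = push_hom[OF Rg rm]
 have "K \<subseteq> push (reg R) C A ` ?B"
 proof (rule G(3)[OF submodule_range[OF B D p]])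
  show "G \<subseteq> push (reg R) C A ` ?B"
  proof
   fix g assume "g \<in> G"
   then obtain b where b: "b \<in> {..<card G}" "g = A b" using A by (auto simp: bij_betw_def)
   have "push (reg R) C A (sing (reg R) b \<one>\<^sub>R) = g"
    using push_sing[OF Rg rm b(1), of "\<one>\<^sub>R"] rmat_entry[OF rm b(1)] b(2) by simp
   moreover have "sing (reg R) b \<one>\<^sub>R \<in> ?B" using sing_closed[OF Rg b(1)] by simp
   ultimately show "g \<in> push (reg R) C A ` ?B" by blast
  qed
 qed
 moreover have "push (reg R) C A f \<in> K" if f: "f \<in> ?B" for f
 proof -
  have KM: "module R (?D\<lparr>carrier := K\<rparr>)" by (rule sub_module[OF D K])
  have i: "(\<lambda>x. x) \<in> mod_hom R (?D\<lparr>carrier := K\<rparr>) ?D" using D.submodule_carrier[OF K] by (intro mod_homI) auto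
  have fF: "f \<in> free_module R {..<card G}" using f by (simp add: free_eq_dsum)
  have "push (reg R) C A f = lin_ext R ?D A f" using lin_ext_free[OF R rm fF] by (simp add: free_eq_dsum)
  also have "\<dots> = lin_ext R (?D\<lparr>carrier := K\<rparr>) A f"
   using lin_ext_natural[OF KM D i fF, of A] AK by simp
  also have "\<dots> \<in> K" using mod_hom_closed[OF lin_ext_hom[OF KM] fF, of A] AK by simp
  finally show ?thesis .
 qed
 ultimately show ?thesis using that[OF rm] by blast
qed

text \<open>A resolution of R/I in which the quotient does not appear: the augmentation is
  coordinate 0 taken modulo I. In this form a resolution can be localized by mapping matrix
  entries.\<close>

definition ideal_resolution :: "('r, 'c) ring_scheme => 'r set => (nat => nat set) => (nat => nat => nat => 'r) => bool"
 where "ideal_resolution R I B A \<longleftrightarrow> B 0 = {0} \<and> (\<forall>i. finite (B i)) \<and> (\<forall>i. rmat R (B (Suc i)) (B i) (A i)) \<and>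
  bd (reg R) B A 0 ` carrier (fmod R (B (Suc 0))) = {f \<in> fmod R (B 0). f 0 \<in> I} \<and>
  (\<forall>i. bd (reg R) B A (Suc i) ` carrier (fmod R (B (Suc (Suc i)))) =
   {f \<in> fmod R (B (Suc i)). bd (reg R) B A i f = zf R})"

lemma ideal_resolutionD:
 assumes "ideal_resolution R a B A"
 shows ideal_res_rmat: "rmat R (B (Suc i)) (B i) (A i)" and ideal_res_finite: "finite (B i)"
 using assms unfolding ideal_resolution_def by blast+

lemma ideal_resolution_exists:
 assumes R: "cring R" and noeth: "noetherian_ring R" and I: "ideal I R"
 obtains B A where "ideal_resolution R I B A"
proof -
 note Rg = reg_module[OF R]
 have F: "module R (fmod R X)" for X :: "nat set" by (rule dsum_module[OF Rg])
 let ?im = "\<lambda>n n' A. push (reg R) {..<n} A ` dsum (reg R) {..<n'}"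
 \<comment> \<open>A state (n, n', A) is one differential from R^n' to R^n; \<open>Q\<close> says
   that the next one has the kernel of this one as its image.\<close>
 define P where "P i x \<longleftrightarrow> (case x of (n, n', A) => rmat R {..<n'} {..<n} A \<and>
   (i = 0 --> n = 1 \<and> ?im n n' A = {f \<in> dsum (reg R) {..<n}. f 0 \<in> I}))"
  for i :: nat and x :: "nat \<times> nat \<times> (nat => nat => 'a)"
 define Q where "Q x y \<longleftrightarrow> (case x of (n, n', A) => case y of (m, m', A') => m = n' \<and>
   ?im m m' A' = {f \<in> dsum (reg R) {..<m}. push (reg R) {..<n} A f = zf R})"
  for x y :: "nat \<times> nat \<times> (nat => nat => 'a)"
 have "\<exists>s. \<forall>i. P i (s i) \<and> Q (s i) (s (Suc i))"
 proof (rule dependent_nat_choice)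
  have sub: "submodule {f \<in> dsum (reg R) {..<1::nat}. f 0 \<in> I} R (dsum (reg R) {..<1})"
  proof -
   interpret D: module R "dsum (reg R) {..<1::nat}" by (rule F)
   interpret I: ideal I R by (rule I)
   show ?thesis
   proof (rule D.submoduleI)
    fix a :: "nat => 'a" assume a: "a \<in> {f \<in> dsum (reg R) {..<1::nat}. f 0 \<in> I}"
    then show "\<ominus>\<^bsub>dsum (reg R) {..<1}\<^esub> a \<in> {f \<in> dsum (reg R) {..<1}. f 0 \<in> I}"
     using D.a_inv_closed[of a] dsum_inv[OF Rg, of a "{..<1}"] by simp
   next
    fix a b :: "nat => 'a" assume "a \<in> {f \<in> dsum (reg R) {..<1::nat}. f 0 \<in> I}" "b \<in> {f \<in> dsum (reg R) {..<1}. f 0 \<in> I}"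
    then show "a \<oplus>\<^bsub>dsum (reg R) {..<1}\<^esub> b \<in> {f \<in> dsum (reg R) {..<1}. f 0 \<in> I}"
     using D.a_closed[of a b] by simp
   next
    fix r and a :: "nat => 'a" assume "r \<in> R" "a \<in> {f \<in> dsum (reg R) {..<1::nat}. f 0 \<in> I}"
    then show "r \<odot>\<^bsub>dsum (reg R) {..<1}\<^esub> a \<in> {f \<in> dsum (reg R) {..<1}. f 0 \<in> I}"
     using D.smult_closed[of r a] I.I_l_closed by simp
   qed (use D.zero_closed in auto)
  qed
  obtain n A where "rmat R {..<n::nat} {..<1::nat} A"
   "?im 1 n A = {f \<in> dsum (reg R) {..<1::nat}. f 0 \<in> I}"
   by (rule fin_gen_presentation[OF R sub submodule_free_fin_gen[OF R noeth finite_lessThan sub]])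
  then show "\<exists>x. P 0 x" unfolding P_def by (intro exI[of _ "(1, n, A)"]) simp
 next
  fix x i assume P: "P i x"
  obtain n n' A where x: "x = (n, n', A)" by (cases x)
  have rm: "rmat R {..<n'} {..<n} A" using P by (simp add: P_def x)
  have sub: "submodule (a_kernel (dsum (reg R) {..<n'}) (dsum (reg R) {..<n}) (push (reg R) {..<n} A)) R (dsum (reg R) {..<n'})"
   by (rule submodule_kernel[OF F F push_hom[OF Rg rm]])
  obtain m A' where "rmat R {..<m::nat} {..<n'} A'"
   "?im n' m A' = a_kernel (dsum (reg R) {..<n'}) (dsum (reg R) {..<n}) (push (reg R) {..<n} A)"
   by (rule fin_gen_presentation[OF R sub submodule_free_fin_gen[OF R noeth finite_lessThan sub]])
  then show "\<exists>y. P (Suc i) y \<and> Q x y"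
   unfolding P_def Q_def x a_kernel_def'' by (intro exI[of _ "(n', m, A')"]) simp
 qed
 then obtain s where s: "!!i. P i (s i)" "!!i. Q (s i) (s (Suc i))" by blast
 define B where "B i = {..<fst (s i)}" for i
 define A where "A i = snd (snd (s i))" for i
 have nx: "fst (snd (s i)) = fst (s (Suc i))" for i using s(2)[of i] by (auto simp: Q_def split: prod.splits)
 have "ideal_resolution R I B A"
  unfolding ideal_resolution_def
 proof (intro conjI allI)
  show "B 0 = {0}" using s(1)[of 0] by (auto simp: P_def B_def split: prod.splits)
  show "finite (B i)" for i by (simp add: B_def)
  show "rmat R (B (Suc i)) (B i) (A i)" for i
   using s(1)[of i] nx[of i] by (auto simp: P_def B_def A_def split: prod.splits)
  show "bd (reg R) B A 0 ` fmod R (B (Suc 0)) = {f \<in> fmod R (B 0). f 0 \<in> I}"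
   using s(1)[of 0] nx[of 0] by (auto simp: P_def B_def A_def split: prod.splits)
  show "bd (reg R) B A (Suc i) ` fmod R (B (Suc (Suc i))) =
   {f \<in> fmod R (B (Suc i)). bd (reg R) B A i f = zf R}" for i
   using s(2)[of i] unfolding Q_def case_prod_beta B_def A_def nx[symmetric] by blast
 qed
 then show ?thesis using that by blast
qed

text \<open>Any cyclic module with annihilator I serves as R/I, whatever its carrier. Both the
  quotient module and the factor ring viewed as a module are used below.\<close>

lemma ideal_resolution_free_resolution:
 assumes R: "cring R" and res: "ideal_resolution R I B A" and M: "module R M" and m: "m \<in> M"
  and gen: "!!x. x \<in> M ==> \<exists>r\<in>R. x = r \<odot>\<^sub>M m"
  and ann: "!!r. r \<in> R ==> r \<odot>\<^sub>M m = \<zero>\<^sub>M \<longleftrightarrow> r \<in> I"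
 shows "free_resolution R M B A (\<lambda>_. m)"
proof -
 note Rg = reg_module[OF R]
 interpret M: module R M by fact
 have B0: "B 0 = {0}" and rm: "!!i. rmat R (B (Suc i)) (B i) (A i)" using res by (auto simp: ideal_resolution_def)
 have im0: "bd (reg R) B A 0 ` fmod R (B (Suc 0)) = {f \<in> fmod R (B 0). f 0 \<in> I}"
  and imi: "!!i. bd (reg R) B A (Suc i) ` fmod R (B (Suc (Suc i))) =
   {f \<in> fmod R (B (Suc i)). bd (reg R) B A i f = zf R}"
  using res unfolding ideal_resolution_def by blast+
 have le: "lin_ext R M (\<lambda>_. m) f = f 0 \<odot>\<^sub>M m" if f: "f \<in> fmod R (B 0)" for f
 proof -
  have "sing (reg R) 0 (f 0) = f" using dsum_out[OF f] B0 by (auto simp: sing_def fun_eq_iff)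
  then show ?thesis using lin_ext_sing[where \<mu> = "\<lambda>_. m" and b = "0::nat", OF M m, of "f 0"] dsum_val[OF f, of 0] by simp
 qed
 have p: "lin_ext R (free_module R (B i)) (A i) f = bd (reg R) B A i f"
  if "f \<in> fmod R (B (Suc i))" for i f
  using lin_ext_free[OF R rm, of f i] that by (simp add: free_eq_dsum)
 have im: "lin_ext R (free_module R (B i)) (A i) ` free_module R (B (Suc i)) =
   bd (reg R) B A i ` fmod R (B (Suc i))" for i
  unfolding free_eq_dsum[of R "B (Suc i)"] by (rule image_cong[OF refl p])
 show ?thesis
  unfolding free_resolution_def One_nat_def im
 proof (intro conjI allI ballI)
  show "lin_ext R M (\<lambda>_. m) ` free_module R (B 0) = carrier M"
  proof
   show "lin_ext R M (\<lambda>_. m) ` (free_module R (B 0)) \<subseteq> M"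
    using mod_hom_closed[OF lin_ext_hom[OF M, of "B 0" "\<lambda>_. m"]] m by auto
   show "carrier M \<subseteq> lin_ext R M (\<lambda>_. m) ` free_module R (B 0)"
   proof
    fix x assume "x \<in> M"
    then obtain r where r: "r \<in> R" "x = r \<odot>\<^sub>M m" using gen by blast
    have s: "sing (reg R) 0 r \<in> fmod R (B 0)" using sing_closed[OF Rg, of 0 "B 0" r] B0 r by simp
    have "lin_ext R M (\<lambda>_. m) (sing (reg R) (0::nat) r) = x" using le[OF s] r(2) by (simp add: sing_def)
    then show "x \<in> lin_ext R M (\<lambda>_. m) ` free_module R (B 0)"
     using s unfolding free_eq_dsum by (metis imageI)
   qed
  qed
  fix f assume "f \<in> free_module R (B 0)"
  then have f: "f \<in> fmod R (B 0)" by (simp add: free_eq_dsum)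
  have "f 0 \<in> R" using dsum_val[OF f] by simp
  then have "lin_ext R M (\<lambda>_. m) f = \<zero>\<^sub>M \<longleftrightarrow> f \<in> {f \<in> fmod R (B 0). f 0 \<in> I}"
   using le[OF f] ann f by simp
  then show "lin_ext R M (\<lambda>_. m) f = \<zero>\<^sub>M \<longleftrightarrow> f \<in> bd (reg R) B A 0 ` fmod R (B (Suc 0))"
   unfolding im0 .
 next
  fix i f assume "f \<in> free_module R (B (Suc i))"
  then have f: "f \<in> fmod R (B (Suc i))" by (simp add: free_eq_dsum)
  have "lin_ext R (free_module R (B i)) (A i) f = \<zero>\<^bsub>free_module R (B i)\<^esub> \<longleftrightarrow>
   f \<in> {f \<in> fmod R (B (Suc i)). bd (reg R) B A i f = zf R}"
   using f p[OF f] by (simp add: free_eq_dsum)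
  then show "lin_ext R (free_module R (B i)) (A i) f = \<zero>\<^bsub>free_module R (B i)\<^esub> \<longleftrightarrow>
   f \<in> bd (reg R) B A (Suc i) ` fmod R (B (Suc (Suc i)))"
   unfolding imi .
 qed (simp_all add: rm m)
qed

section \<open>Characters of abelian groups\<close>

text \<open>The multiplicative group of nonzero complex numbers as a Z-module. It is divisible and
  has nontrivial d-th roots of unity for every d > 1, so it can play the role of Q/Z.\<close>

definition units_module :: "(int, complex) module"
 where "units_module = \<lparr>carrier = UNIV - {0}, monoid.mult = undefined, one = undefined, zero = 1,
  add = (*), smult = (\<lambda>n z. z powi n)\<rparr>"

lemma units_module_simps [simp]:
 "carrier units_module = UNIV - {0}" "zero units_module = 1" "add units_module = (*)"
 "smult units_module = (\<lambda>n z. z powi n)"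
 by (simp_all add: units_module_def)

lemma units_module_module: "module int_ring units_module"
proof (rule moduleI)
 show "(a \<otimes>\<^bsub>int_ring\<^esub> b) \<odot>\<^bsub>units_module\<^esub> x = a \<odot>\<^bsub>units_module\<^esub> (b \<odot>\<^bsub>units_module\<^esub> x)" for a b x
  using power_int_mult[of x b a] by (simp add: mult.commute)
 show "abelian_group units_module"
  by (rule abelian_groupI) (auto intro!: bexI[of _ "inverse _"])
qed (auto simp: int_is_cring power_int_add power_int_mult_distrib)

lemma int_ideal_principal:
 assumes "ideal I int_ring"
 obtains d :: nat where "!!n. n \<in> I \<longleftrightarrow> int d dvd n"
proof -
 interpret I: ideal I int_ring by fact
 have zero: "0 \<in> I" and add: "!!a b. a \<in> I ==> b \<in> I ==> a + b \<in> I" and mult: "!!a b. a \<in> I ==> b * a \<in> I"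
  using additive_subgroup.zero_closed[OF I.additive_subgroup_axioms]
   additive_subgroup.a_closed[OF I.additive_subgroup_axioms] ideal.I_l_closed[OF assms] by simp_all
 show ?thesis
 proof (cases "\<exists>n>0. int n \<in> I")
  case False
  have "n = 0" if "n \<in> I" for n
  proof (rule ccontr)
   assume "n \<noteq> 0"
   then have "0 < nat \<bar>n\<bar>" by simp
   moreover have "int (nat \<bar>n\<bar>) \<in> I"
    using mult[OF that, of 1] mult[OF that, of "-1"] by (cases "n \<ge> 0") simp_all
   ultimately show False using False by blast
  qed
  then show ?thesis using that[of 0] zero by auto
 next
  case True
  define d where "d = (LEAST n. 0 < n \<and> int n \<in> I)"
  have d: "0 < d" "int d \<in> I" and least: "!!n. 0 < n ==> int n \<in> I ==> d \<le> n"
   using LeastI_ex[of "\<lambda>n. 0 < n \<and> int n \<in> I"] True Least_le[of "\<lambda>n. 0 < n \<and> int n \<in> I"] unfolding d_def by auto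
  have "int d dvd n" if "n \<in> I" for n
  proof -
   have "n mod int d = n + (- (n div int d)) * int d" by (simp add: minus_div_mult_eq_mod[symmetric])
   then have "n mod int d \<in> I" using add[OF that mult[OF d(2)]] by metis
   then have "int (nat (n mod int d)) \<in> I" using d(1) by simp
   moreover have "nat (n mod int d) < d" using d(1) by (simp add: nat_less_iff)
   ultimately have "nat (n mod int d) = 0" using least[of "nat (n mod int d)"] by force
   moreover have "0 \<le> n mod int d" using d(1) by simp
   ultimately have "n mod int d = 0" by linarith
   then show ?thesis by auto
  qed
  moreover have "n \<in> I" if "int d dvd n" for n
   using that mult[OF d(2)] by (auto elim!: dvdE simp: mult.commute)
  ultimately show ?thesis using that by blast
 qed
qed

lemma complex_root_exists:
 assumes "0 < d"
 obtains y :: complex where "y ^ d = w"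
proof
 show "rcis (root d (cmod w)) (Arg w / real d) ^ d = w"
  using assms by (simp add: DeMoivre2 rcis_cmod_Arg)
qed

text \<open>An ideal of Z is dZ, and a map on it is determined by its value at d; a d-th root of
  that value is the element sought.\<close>

lemma baer_units_module: "baer int_ring units_module"
 unfolding baer_def
proof (intro allI impI; elim conjE)
 fix I \<phi> assume I: "ideal I int_ring" and \<phi>: "\<phi> \<in> mod_hom int_ring ((regular_module int_ring)\<lparr>carrier := I\<rparr>) units_module"
 obtain d :: nat where d: "!!n. n \<in> I \<longleftrightarrow> int d dvd n" using int_ideal_principal[OF I] by blast
 have dI: "int d \<in> I" using d by simp
 have w: "\<phi> (int d) \<noteq> 0" using mod_hom_closed[OF \<phi>, of "int d"] dI by simp
 have \<phi>d: "\<phi> (k * int d) = \<phi> (int d) powi k" for k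
  using mod_hom_smult[OF \<phi>, of k "int d"] dI by simp
 obtain y :: complex where y: "y \<noteq> 0" "y ^ d = \<phi> (int d)"
 proof (cases "d = 0")
  \<comment> \<open>The ideal is zero here, and the value at 0 is 1, so y = 1 serves.\<close>
  case True
  have "\<phi> (0 * int d) = 1" unfolding \<phi>d by simp
  then show ?thesis using that[of 1] True by simp
 next
  case False
  then obtain y :: complex where y: "y ^ d = \<phi> (int d)" using complex_root_exists[of d] by blast
  moreover have "y \<noteq> 0" using y w False by (auto simp: power_0_left)
  ultimately show ?thesis using that by blast
 qed
 have "\<phi> r = y powi r" if "r \<in> I" for r
 proof -
  have "int d dvd r" using that d by simp
  then obtain k where "r = int d * k" ..
  then have k: "r = k * int d" by simp
  have "\<phi> r = (y ^ d) powi k" unfolding k \<phi>d y(2) ..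
  also have "\<dots> = y powi r" unfolding k by (simp add: power_int_mult mult.commute[of k] power_int_of_nat[symmetric] del: power_int_of_nat)
  finally show ?thesis .
 qed
 then show "\<exists>y\<in>units_module. \<forall>r\<in>I. \<phi> r = r \<odot>\<^bsub>units_module\<^esub> y" using y(1) by auto
qed

definition int_module :: "('a, 'm) ring_scheme => (int, 'a) module"
 where "int_module M = \<lparr>carrier = carrier M, monoid.mult = undefined, one = undefined, zero = zero M,
  add = add M, smult = (\<lambda>n x. add_pow M n x)\<rparr>"

lemma int_module_simps [simp]:
 "carrier (int_module M) = carrier M" "zero (int_module M) = zero M" "add (int_module M) = add M"
 "smult (int_module M) = (\<lambda>n x. add_pow M n x)"
 by (simp_all add: int_module_def)

lemma add_pow_int_0: "add_pow M (0::int) x = \<zero>\<^sub>M"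
 by (simp add: add_pow_def)

lemma int_module_module:
 assumes "abelian_group M"
 shows "module int_ring (int_module M)"
proof -
 interpret M: abelian_group M by fact
 show ?thesis
 proof (rule moduleI)
  show "abelian_group (int_module M)"
   by (rule abelian_groupI) (auto simp: M.a_ac intro: M.l_neg dest: M.add.l_inv_ex)
  have "add_pow M n x \<in> M" if "x \<in> M" for x and n :: int
   using M.add.int_pow_closed[of x n] that by simp
  then show "!!a x. a \<in> int_ring ==> x \<in> (int_module M) ==> a \<odot>\<^bsub>int_module M\<^esub> x \<in> int_module M"
   by simp
 next
  fix a b x assume "x \<in> int_module M"
  then show "(a \<oplus>\<^bsub>int_ring\<^esub> b) \<odot>\<^bsub>int_module M\<^esub> x = a \<odot>\<^bsub>int_module M\<^esub> x \<oplus>\<^bsub>int_module M\<^esub> b \<odot>\<^bsub>int_module M\<^esub> x"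
   using M.add.int_pow_mult[of x a b] by simp
 next
  fix a x y assume "x \<in> int_module M" "y \<in> int_module M"
  then show "a \<odot>\<^bsub>int_module M\<^esub> (x \<oplus>\<^bsub>int_module M\<^esub> y) = a \<odot>\<^bsub>int_module M\<^esub> x \<oplus>\<^bsub>int_module M\<^esub> a \<odot>\<^bsub>int_module M\<^esub> y"
   using M.add.int_pow_mult_distrib[of x y a] M.a_comm by simp
 next
  fix a b x assume "x \<in> int_module M"
  then show "(a \<otimes>\<^bsub>int_ring\<^esub> b) \<odot>\<^bsub>int_module M\<^esub> x = a \<odot>\<^bsub>int_module M\<^esub> (b \<odot>\<^bsub>int_module M\<^esub> x)"
   using M.add.int_pow_pow[of x a b] by (simp add: mult.commute)
 next
  fix x assume "x \<in> int_module M"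
  then show "\<one>\<^bsub>int_ring\<^esub> \<odot>\<^bsub>int_module M\<^esub> x = x" using M.add.int_pow_1[of x] by simp
 qed (simp add: int_is_cring)
qed

text \<open>The value outside the carrier is fixed to 1, so that characters form a group under
  pointwise multiplication of functions.\<close>

definition chars :: "('a, 'm) ring_scheme => ('a => complex) set"
 where "chars M = {\<chi>. (\<forall>x\<in>carrier M. \<chi> x \<noteq> 0) \<and> (\<forall>x. x \<notin> carrier M --> \<chi> x = 1) \<and>
  (\<forall>x\<in>carrier M. \<forall>y\<in>carrier M. \<chi> (x \<oplus>\<^sub>M y) = \<chi> x * \<chi> y)}"

lemma charsD:
 assumes "\<chi> \<in> chars M"
 shows "\<chi> x \<noteq> 0" "x \<notin> carrier M ==> \<chi> x = 1"
  "x \<in> carrier M ==> y \<in> carrier M ==> \<chi> (x \<oplus>\<^sub>M y) = \<chi> x * \<chi> y"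
proof -
 show "\<chi> x \<noteq> 0" using assms by (cases "x \<in> M") (auto simp: chars_def)
qed (use assms in \<open>auto simp: chars_def\<close>)

lemma chars_of_hom:
 assumes "h \<in> mod_hom int_ring (int_module M) units_module" "abelian_group M"
 shows "(\<lambda>x. if x \<in> carrier M then h x else 1) \<in> chars M"
proof -
 interpret abelian_group M by fact
 show ?thesis using mod_homD[OF assms(1)] by (auto simp: chars_def)
qed

text \<open>A homomorphism of abelian groups is Z-linear; the computations with powers establish
  this, and then Baer's criterion over Z applies.\<close>

lemma character_extend:
 assumes M: "abelian_group M" and A: "subgroup A (add_monoid M)"
  and nz: "!!x. x \<in> A ==> \<chi> x \<noteq> 0" and add: "!!x y. x \<in> A ==> y \<in> A ==> \<chi> (x \<oplus>\<^sub>M y) = \<chi> x * \<chi> y"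
 obtains \<theta> where "\<theta> \<in> chars M" "!!x. x \<in> A ==> \<theta> x = \<chi> x"
proof -
 interpret M: abelian_group M by fact
 interpret A: subgroup A "add_monoid M" by fact
 have Z: "module int_ring (int_module M)" by (rule int_module_module[OF M])
 interpret Z: module int_ring "int_module M" by (rule Z)
 interpret U: module int_ring units_module by (rule units_module_module)
 have pow: "add_pow M n x \<in> A" if "x \<in> A" for x and n :: int
  using M.add.subgroup_int_pow_closed[OF A that] .
 have Ac: "x \<in> M" if "x \<in> A" for x using A.mem_carrier[OF that] by simp
 have inv: "\<ominus>\<^bsub>int_module M\<^esub> x = add_pow M (-1 :: int) x" if "x \<in> M" for x
  using Z.smult_l_minus[of 1 x] that M.add.int_pow_1[of x] by (simp add: a_inv_def m_inv_def)
 have sub: "submodule A int_ring (int_module M)"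
 proof (rule Z.submoduleI)
  show "A \<subseteq> int_module M" using Ac by auto
  show "\<zero>\<^bsub>int_module M\<^esub> \<in> A" using A.one_closed by simp
  show "\<ominus>\<^bsub>int_module M\<^esub> a \<in> A" if "a \<in> A" for a unfolding inv[OF Ac[OF that]] by (rule pow[OF that])
  show "a \<oplus>\<^bsub>int_module M\<^esub> b \<in> A" if "a \<in> A" "b \<in> A" for a b using A.m_closed[OF that] by simp
  show "n \<odot>\<^bsub>int_module M\<^esub> x \<in> A" if "x \<in> A" for n x using pow[OF that] by simp
 qed
 have one: "\<chi> \<zero>\<^sub>M = 1"
 proof -
  have z: "\<zero>\<^sub>M \<in> A" using A.one_closed by simp
  have "\<chi> \<zero>\<^sub>M * \<chi> \<zero>\<^sub>M = \<chi> \<zero>\<^sub>M" using add[OF z z] by simp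
  then show ?thesis using nz[OF z] by simp
 qed
 have nat_pow: "\<chi> (add_pow M (int n) x) = \<chi> x ^ n" if x: "x \<in> A" for x n
 proof (induction n)
  case (Suc n)
  have "add_pow M (int (Suc n)) x = add_pow M (int n) x \<oplus>\<^sub>M x"
   using M.add.int_pow_mult[of x "int n" 1] Ac[OF x] M.add.int_pow_1[of x] by (simp add: add.commute)
  then show ?case using add[OF pow[OF x, of "int n"] x] Suc by simp
 qed (simp add: one add_pow_def)
 have int_pow: "\<chi> (add_pow M n x) = \<chi> x powi n" if x: "x \<in> A" for x and n :: int
 proof (cases "n \<ge> 0")
  case True
  then show ?thesis using nat_pow[OF x, of "nat n"] by (simp add: power_int_def)
 next
  case False
  have "add_pow M n x \<oplus>\<^sub>M add_pow M (int (nat (- n))) x = \<zero>\<^sub>M"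
   using M.add.int_pow_mult[of x n "int (nat (- n))"] Ac[OF x] False add_pow_int_0[of M x] by simp
  then have "\<chi> (add_pow M n x) * \<chi> x ^ nat (- n) = 1"
   using add[OF pow[OF x, of n] pow[OF x, of "int (nat (- n))"]] one nat_pow[OF x, of "nat (- n)"] by simp
  then show ?thesis using False nz[OF x] by (simp add: power_int_def field_simps)
 qed
 have "\<chi> \<in> mod_hom int_ring ((int_module M)\<lparr>carrier := A\<rparr>) units_module"
  by (rule mod_homI) (auto simp: nz add int_pow)
 then obtain h where h: "h \<in> mod_hom int_ring (int_module M) units_module" "!!x. x \<in> A ==> h x = \<chi> x"
  using baer_extend[OF Z units_module_module baer_units_module sub] by blast
 show ?thesis
  by (rule that[OF chars_of_hom[OF h(1) M]]) (use h(2) Ac in auto)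
qed

lemma character_separates:
 assumes M: "abelian_group M" and x: "x \<in> carrier M" "x \<noteq> \<zero>\<^sub>M"
 obtains \<theta> where "\<theta> \<in> chars M" "\<theta> x \<noteq> 1"
proof -
 interpret M: abelian_group M by fact
 have Z: "module int_ring (int_module M)" by (rule int_module_module[OF M])
 interpret Z: module int_ring "int_module M" by (rule Z)
 interpret U: module int_ring units_module by (rule units_module_module)
 have sub0: "submodule {\<zero>\<^bsub>int_module M\<^esub>} int_ring (int_module M)"
  by (rule Z.submoduleI) (use Z.smult_r_null Z.a_inv_zero in auto)
 obtain d :: nat where d: "!!n. n \<in> colon int_ring (int_module M) {\<zero>\<^bsub>int_module M\<^esub>} x \<longleftrightarrow> int d dvd n"
  using int_ideal_principal[OF colon_ideal[OF Z sub0, of x]] x by auto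
 have "d \<noteq> 1"
 proof
  assume "d = 1"
  then have "add_pow M (1::int) x = \<zero>\<^sub>M" using d[of 1] by (simp add: colon_def)
  then show False using x M.add.int_pow_1[of x] by simp
 qed
 \<comment> \<open>The annihilator of x is generated by d. For d = 0 the element x has infinite
   order, and any value other than 0 and 1 may be prescribed; otherwise a d-th root of unity
   different from 1 exists because there are d > 1 of them.\<close>
 obtain w :: complex where w: "w \<noteq> 0" "w \<noteq> 1" "w ^ d = 1"
 proof (cases "d = 0")
  case True
  then show ?thesis using that[of 2] by simp
 next
  case False
  with \<open>d \<noteq> 1\<close> have d2: "1 < d" by simp
  have c: "card {z::complex. z ^ d = 1} = d" using card_roots_unity_eq[of d] d2 by simp
  have "\<not> {z::complex. z ^ d = 1} \<subseteq> {1}"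
   using card_mono[of "{1}" "{z::complex. z ^ d = 1}"] c d2 by auto
  then obtain w :: complex where w: "w ^ d = 1" "w \<noteq> 1" by auto
  moreover have "w \<noteq> 0" using w(1) False by (auto simp: power_0_left)
  ultimately show ?thesis using that by blast
 qed
 have wd: "w powi n = 1" if dn: "int d dvd n" for n
 proof -
  obtain k where "n = int d * k" using dn ..
  then show ?thesis using w(3) by (simp add: power_int_mult)
 qed
 have f0: "(\<lambda>_. 1) \<in> mod_hom int_ring ((int_module M)\<lparr>carrier := {\<zero>\<^bsub>int_module M\<^esub>}\<rparr>) units_module"
  by (rule mod_homI) auto
 have ok: "1 = n \<odot>\<^bsub>units_module\<^esub> w" if "n \<in> int_ring" "n \<odot>\<^bsub>int_module M\<^esub> x \<in> {\<zero>\<^bsub>int_module M\<^esub>}" for n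
 proof -
  have "int d dvd n" using that d[of n] by (simp add: colon_def)
  then show ?thesis using wd by simp
 qed
 have xZ: "x \<in> int_module M" and wU: "w \<in> units_module" using x w by simp_all
 obtain L f where L: "submodule L int_ring (int_module M)" "x \<in> L"
  and f: "f \<in> mod_hom int_ring ((int_module M)\<lparr>carrier := L\<rparr>) units_module" "f x = w"
  using mod_hom_extend_one[OF Z units_module_module sub0 f0 xZ wU ok] by metis
 obtain h where h: "h \<in> mod_hom int_ring (int_module M) units_module" "!!x. x \<in> L ==> h x = f x"
  using baer_extend[OF Z units_module_module baer_units_module L(1) f(1)] by blast
 show ?thesis
  by (rule that[OF chars_of_hom[OF h(1) M]]) (use h(2)[OF L(2)] f(2) w(2) x(1) in auto)
qed

section \<open>Enough injectives\<close>

text \<open>A power of the coinduced module Hom_Z(R, U), with U the nonzero complex numbers and one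
  factor for each element of the type \<open>'i\<close>. The scalar r acts by precomposition with
  multiplication by r.\<close>

definition char_module :: "('r, 'c) ring_scheme => ('r, 'i => 'r => complex) module"
 where "char_module R = \<lparr>carrier = {q. \<forall>x. q x \<in> chars R}, monoid.mult = undefined, one = undefined,
  zero = (\<lambda>_ _. 1), add = (\<lambda>q q' x r. q x r * q' x r),
  smult = (\<lambda>r q x s. if s \<in> carrier R then q x (s \<otimes>\<^sub>R r) else 1)\<rparr>"

lemma char_module_simps [simp]:
 "carrier (char_module R) = {q. \<forall>x. q x \<in> chars R}" "zero (char_module R) = (\<lambda>_ _. 1)"
 "add (char_module R) = (\<lambda>q q' x r. q x r * q' x r)"
 "smult (char_module R) = (\<lambda>r q x s. if s \<in> carrier R then q x (s \<otimes>\<^sub>R r) else 1)"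
 by (simp_all add: char_module_def)

lemma char_module_module:
 assumes "cring R"
 shows "module R (char_module R :: ('r, 'i => 'r => complex) module)"
proof -
 interpret R: cring R by fact
 let ?Q = "char_module R :: ('r, 'i => 'r => complex) module"
 have mul: "(\<lambda>r. \<chi> r * \<chi>' r) \<in> chars R" if "\<chi> \<in> chars R" "\<chi>' \<in> chars R" for \<chi> \<chi>'
  using that by (auto simp: chars_def)
 have inv: "(\<lambda>r. inverse (\<chi> r)) \<in> chars R" if "\<chi> \<in> chars R" for \<chi>
  using that by (auto simp: chars_def)
 have one: "(\<lambda>_. 1) \<in> chars R" by (auto simp: chars_def)
 have sm: "(\<lambda>s. if s \<in> R then \<chi> (s \<otimes>\<^sub>R r) else 1) \<in> chars R" if "\<chi> \<in> chars R" "r \<in> R" for \<chi> r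
  using that by (auto simp: chars_def R.l_distr)
 show ?thesis
 proof (rule moduleI)
  show "abelian_group ?Q"
  proof (rule abelian_groupI)
   fix q assume q: "q \<in> ?Q"
   then have "q x r \<noteq> 0" for x r using charsD(1)[of "q x" R r] by simp
   then show "\<exists>y\<in>?Q. y \<oplus>\<^sub>?Q q = \<zero>\<^sub>?Q"
    using inv q by (intro bexI[of _ "\<lambda>x r. inverse (q x r)"]) (auto simp: fun_eq_iff)
  qed (auto simp: mul one mult_ac)
  fix a b x assume "a \<in> R" "b \<in> R" "x \<in> ?Q"
  then show "(a \<oplus>\<^sub>R b) \<odot>\<^sub>?Q x = a \<odot>\<^sub>?Q x \<oplus>\<^sub>?Q b \<odot>\<^sub>?Q x"
   "(a \<otimes>\<^sub>R b) \<odot>\<^sub>?Q x = a \<odot>\<^sub>?Q (b \<odot>\<^sub>?Q x)"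
   by (auto simp: fun_eq_iff R.r_distr charsD(3) R.m_assoc)
 next
  fix x assume x: "x \<in> ?Q"
  then have "x i r = 1" if "r \<notin> carrier R" for i r using charsD(2)[of "x i" R r] that by simp
  then show "\<one>\<^sub>R \<odot>\<^sub>?Q x = x" by (auto simp: fun_eq_iff)
 qed (auto simp: assms sm fun_eq_iff)
qed

text \<open>Evaluation at 1 turns an R-linear map from an ideal to Hom_Z(R, U) into a character of
  the ideal. An extension of this character to R is the required element, factor by factor.\<close>

lemma char_module_baer:
 assumes R: "cring R"
 shows "baer R (char_module R :: ('r, 'i => 'r => complex) module)"
 unfolding baer_def
proof (intro allI impI; elim conjE)
 interpret R: cring R by fact
 let ?Q = "char_module R :: ('r, 'i => 'r => complex) module"
 fix I \<phi> assume I: "ideal I R" and \<phi>: "\<phi> \<in> mod_hom R ((reg R)\<lparr>carrier := I\<rparr>) ?Q"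
 interpret I: ideal I R by (rule I)
 have Ic: "r \<in> I ==> r \<in> R" for r by (rule I.Icarr)
 have \<phi>c: "\<phi> r x \<in> chars R" if "r \<in> I" for r x using mod_hom_closed[OF \<phi>] that by simp
 have "\<forall>x. \<exists>\<theta>. \<theta> \<in> chars R \<and> (\<forall>r\<in>I. \<theta> r = \<phi> r x \<one>\<^sub>R)"
 proof
  fix x
  show "\<exists>\<theta>. \<theta> \<in> chars R \<and> (\<forall>r\<in>I. \<theta> r = \<phi> r x \<one>\<^sub>R)"
  proof (rule character_extend[of R I "\<lambda>r. \<phi> r x \<one>\<^sub>R"])
   show "subgroup I (add_monoid R)" by (rule I.a_subgroup)
   show "\<phi> r x \<one>\<^sub>R \<noteq> 0" if "r \<in> I" for r by (rule charsD(1)[OF \<phi>c[OF that]])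
   show "\<phi> (r \<oplus>\<^sub>R s) x \<one>\<^sub>R = \<phi> r x \<one>\<^sub>R * \<phi> s x \<one>\<^sub>R" if "r \<in> I" "s \<in> I" for r s
    using mod_hom_add[OF \<phi>, of r s] that by simp
  qed (use R.is_abelian_group in blast)+
 qed
 then obtain q where q: "!!x. q x \<in> chars R" "!!x r. r \<in> I ==> q x r = \<phi> r x \<one>\<^sub>R" by metis
 have "\<phi> r = r \<odot>\<^sub>?Q q" if r: "r \<in> I" for r
 proof (intro ext)
  fix x s
  show "\<phi> r x s = (r \<odot>\<^sub>?Q q) x s"
  proof (cases "s \<in> R")
   case True
   have "q x (s \<otimes>\<^sub>R r) = \<phi> (s \<otimes>\<^sub>R r) x \<one>\<^sub>R" by (rule q(2)) (rule I.I_l_closed[OF r True])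
   also have "\<dots> = \<phi> r x s" using mod_hom_smult[OF \<phi> True, of r] r True by simp
   finally show ?thesis using True by simp
  qed (use charsD(2)[OF \<phi>c[OF r]] in simp)
 qed
 then show "\<exists>y\<in>?Q. \<forall>r\<in>I. \<phi> r = r \<odot>\<^sub>?Q y" using q(1) by (intro bexI[of _ q]) auto
qed

text \<open>The factors are indexed by the elements x of M, each with a character of M that is
  nontrivial at x unless x = 0; in factor x, the element y becomes the character r -> \<theta> x (r
  y).\<close>

lemma char_module_embed:
 assumes M: "module R M"
 obtains e :: "'m => 'm => 'r => complex" where "e \<in> mod_hom R M (char_module R)" "inj_on e (carrier M)"
proof -
 interpret M: module R M by fact
 have "\<forall>x. \<exists>\<theta>. \<theta> \<in> chars M \<and> (x \<in> M \<and> x \<noteq> \<zero>\<^sub>M --> \<theta> x \<noteq> 1)"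
 proof
  fix x
  have "(\<lambda>_. 1) \<in> chars M" by (auto simp: chars_def)
  then show "\<exists>\<theta>. \<theta> \<in> chars M \<and> (x \<in> M \<and> x \<noteq> \<zero>\<^sub>M --> \<theta> x \<noteq> 1)"
   using character_separates[OF M.abelian_group_axioms, of x] by metis
 qed
 then obtain \<theta> where \<theta>: "!!x. \<theta> x \<in> chars M" "!!x. x \<in> M ==> x \<noteq> \<zero>\<^sub>M ==> \<theta> x x \<noteq> 1" by metis
 note tadd = charsD(3)[OF \<theta>(1)] and tnz = charsD(1)[OF \<theta>(1)]
 define e where "e y x r = (if r \<in> R then \<theta> x (r \<odot>\<^sub>M y) else 1)" for y x r
 have "e \<in> mod_hom R M (char_module R)"
 proof (rule mod_homI)
  show "e y \<in> char_module R" if "y \<in> M" for y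
   using that by (auto simp: e_def chars_def tnz M.smult_l_distr tadd)
  show "e (y \<oplus>\<^sub>M z) = e y \<oplus>\<^bsub>char_module R\<^esub> e z" if "y \<in> M" "z \<in> M" for y z
   using that by (auto simp: e_def fun_eq_iff M.smult_r_distr tadd)
  show "e (r \<odot>\<^sub>M y) = r \<odot>\<^bsub>char_module R\<^esub> e y" if "r \<in> R" "y \<in> M" for r y
   using that by (auto simp: e_def fun_eq_iff M.smult_assoc1)
 qed
 moreover have "inj_on e (carrier M)"
 proof (rule inj_onI)
  fix y z assume y: "y \<in> M" and z: "z \<in> M" and eq: "e y = e z"
  have yz: "y \<ominus>\<^sub>M z \<in> M" using y z by simp
  show "y = z"
  proof (rule ccontr)
   assume "y \<noteq> z"
   then have "y \<ominus>\<^sub>M z \<noteq> \<zero>\<^sub>M" using M.a_minus_eq_zero_iff[OF y z] by simp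
   then have n1: "\<theta> (y \<ominus>\<^sub>M z) (y \<ominus>\<^sub>M z) \<noteq> 1" by (rule \<theta>(2)[OF yz])
   have "\<theta> (y \<ominus>\<^sub>M z) y = \<theta> (y \<ominus>\<^sub>M z) z"
    using fun_cong[OF fun_cong[OF eq], of "y \<ominus>\<^sub>M z" "\<one>\<^sub>R"] y z by (simp add: e_def)
   moreover have "\<theta> (y \<ominus>\<^sub>M z) y = \<theta> (y \<ominus>\<^sub>M z) (y \<ominus>\<^sub>M z) * \<theta> (y \<ominus>\<^sub>M z) z"
    using tadd[OF yz z, of "y \<ominus>\<^sub>M z"] y z by (simp add: a_minus_def M.a_assoc M.l_neg)
   ultimately show False using n1 tnz by simp
  qed
 qed
 ultimately show ?thesis using that by blast
qed

text \<open>Over a noetherian ring, a Loewenheim-Skolem argument inside an injective module produces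
 small injective modules: Baer's condition only asks for solutions of finite linear systems.
 A \<open>sol_term\<close> names an element of the closure; \<open>System\<close> lists the equations of a system.\<close>

datatype 't sol_term =
  Base 't
 | Plus "'t sol_term" "'t sol_term"
 | Scale 't "'t sol_term"
 | System 't "'t sol_term" "'t sol_term"
 | Solve "'t sol_term"

text \<open>Terms are coded by iterated pairing with a numerical tag for each constructor, so there
  are no more terms than elements of the infinite type.\<close>

lemma sol_term_inj:
 assumes "infinite (UNIV :: 't set)"
 obtains c :: "'t sol_term => 't" where "inj c"
proof -
 have "(card_of ((UNIV :: 't set) \<times> (UNIV :: 't set)), card_of (UNIV :: 't set)) \<in> ordIso"
  using card_of_Times_same_infinite[OF assms] .
 then obtain p0 :: "'t \<times> 't => 't" where "bij_betw p0 (UNIV \<times> UNIV) UNIV"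
  unfolding card_of_ordIso[symmetric] by blast
 then have p0: "inj p0" by (simp add: bij_betw_def)
 obtain k :: "nat => 't" where k: "inj k" using assms infinite_countable_subset by blast
 define p where "p n a b = p0 (k n, p0 (a, b))" for n a b
 have p: "p n a b = p m a' b' \<longleftrightarrow> n = m \<and> a = a' \<and> b = b'" for n a b m a' b'
  using inj_eq[OF p0] inj_eq[OF k] by (simp add: p_def)
 define c where "c = rec_sol_term (\<lambda>a. p 0 a a) (\<lambda>s t c d. p 1 c d) (\<lambda>a t c. p 2 a c)
   (\<lambda>a s t c d. p 3 a (p 0 c d)) (\<lambda>t c. p 4 c c)"
 have "s = t" if "c s = c t" for s t
  using that
 proof (induction s arbitrary: t)
  case (Base x)
  then show ?case by (cases t) (auto simp: c_def p)
 next
  case (Plus s1 s2)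
  then show ?case by (cases t) (auto simp: c_def p)
 next
  case (Scale x s)
  then show ?case by (cases t) (auto simp: c_def p)
 next
  case (System x s1 s2)
  then show ?case by (cases t) (auto simp: c_def p)
 next
  case (Solve s)
  then show ?case by (cases t) (auto simp: c_def p)
 qed
 then show ?thesis using that by (auto simp: inj_def)
qed

text \<open>The module Q of characters is injective but lives in a large type. The values of all
  terms form a submodule that contains M and is closed under solving solvable finite systems, which
  over a noetherian ring suffices for Baer's criterion; and there are no more values than
  terms.\<close>

lemma small_injective_module:
 fixes R :: "('r, 'c) ring_scheme" and M :: "('r, 'm, 'd) module_scheme"
 assumes R: "cring R" and noeth: "noetherian_ring R" and M: "module R M"
  and inf: "infinite (UNIV :: 't set)" and j: "inj (j :: 'r => 't)" and k: "inj_on (k :: 'm => 't) (carrier M)"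
 obtains E :: "('r, 't) module" and \<iota> where "module R E" "baer R E" "\<iota> \<in> mod_hom R M E" "inj_on \<iota> (carrier M)"
proof -
 interpret M: module R M by fact
 interpret N: noetherian_ring R by fact
 let ?Q = "char_module R :: ('r, 'm => 'r => complex) module"
 have Q: "module R ?Q" by (rule char_module_module[OF R])
 interpret Q: module R ?Q by (rule Q)
 have bQ: "baer R ?Q" by (rule char_module_baer[OF R])
 obtain e :: "'m => 'm => 'r => complex" where e: "e \<in> mod_hom R M ?Q" "inj_on e (carrier M)"
  using char_module_embed[OF M] by blast
 define base where "base a = (if a \<in> k ` M then e (inv_into (carrier M) k a) else \<zero>\<^sub>?Q)" for a
 define sc where "sc a = (if inv_into UNIV j a \<in> R then inv_into UNIV j a else \<zero>\<^sub>R)" for a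
 \<comment> \<open>Unsolvable systems receive the default 0, which keeps every term
   meaningful.\<close>
 define sol where "sol ps = (if \<exists>y\<in>?Q. \<forall>(r, v)\<in>set ps. v = r \<odot>\<^sub>?Q y
  then SOME y. y \<in> ?Q \<and> (\<forall>(r, v)\<in>set ps. v = r \<odot>\<^sub>?Q y) else \<zero>\<^sub>?Q)" for ps
 have sol: "sol ps \<in> ?Q" for ps
 proof (cases "\<exists>y\<in>?Q. \<forall>(r, v)\<in>set ps. v = r \<odot>\<^sub>?Q y")
  case True
  then have "\<exists>y. y \<in> ?Q \<and> (\<forall>(r, v)\<in>set ps. v = r \<odot>\<^sub>?Q y)" by blast
  from someI_ex[OF this] show ?thesis unfolding sol_def if_P[OF True] by (rule conjunct1)
 next
  case False
  show ?thesis unfolding sol_def if_not_P[OF False] by (rule Q.zero_closed)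
 qed
 have sol_eq: "v = r \<odot>\<^sub>?Q sol ps"
  if ex: "\<exists>y\<in>?Q. \<forall>(r, v)\<in>set ps. v = r \<odot>\<^sub>?Q y" and rv: "(r, v) \<in> set ps" for ps r v
 proof -
  have "\<exists>y. y \<in> ?Q \<and> (\<forall>(r, v)\<in>set ps. v = r \<odot>\<^sub>?Q y)" using ex by blast
  from someI_ex[OF this] have "\<forall>(r, v)\<in>set ps. v = r \<odot>\<^sub>?Q sol ps" unfolding sol_def if_P[OF ex] by (rule conjunct2)
  then show ?thesis using rv by blast
 qed
 \<comment> \<open>The first component is the value of a term, the second the list of equations it
   encodes: \<open>System\<close> prepends an equation, and \<open>Solve\<close> turns a list into a
   solution.\<close>
 define ev where "ev = rec_sol_term (\<lambda>a. (base a, []))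
  (\<lambda>s t u v. (fst u \<oplus>\<^sub>?Q fst v, []))
  (\<lambda>a t u. (sc a \<odot>\<^sub>?Q fst u, []))
  (\<lambda>a s t u v. (\<zero>\<^sub>?Q, (sc a, fst u) # snd v))
  (\<lambda>t u. (sol (snd u), []))"
 have ev: "ev (Base a) = (base a, [])" "ev (Plus s t) = (fst (ev s) \<oplus>\<^sub>?Q fst (ev t), [])"
  "ev (Scale a t) = (sc a \<odot>\<^sub>?Q fst (ev t), [])"
  "ev (System a s t) = (\<zero>\<^sub>?Q, (sc a, fst (ev s)) # snd (ev t))"
  "ev (Solve t) = (sol (snd (ev t)), [])" for a s t
  by (simp_all add: ev_def)
 have scc: "sc a \<in> R" for a by (simp add: sc_def)
 have scj: "sc (j r) = r" if "r \<in> R" for r using that j by (simp add: sc_def)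
 have basec: "base a \<in> ?Q" for a
  unfolding base_def using mod_hom_closed[OF e(1)] inv_into_into[of a k "carrier M"] Q.zero_closed by simp
 have basek: "base (k x) = e x" if "x \<in> M" for x using that k by (simp add: base_def)
 define N where "N = range (\<lambda>t. fst (ev t))"
 have evc: "fst (ev t) \<in> ?Q" for t
  by (induction t) (simp_all only: ev fst_conv basec Q.a_closed Q.smult_closed scc Q.zero_closed sol)
 have NI: "fst (ev t) \<in> N" for t by (simp add: N_def)
 have Nsc: "r \<odot>\<^sub>?Q x \<in> N" if r: "r \<in> R" and x: "x \<in> N" for r x
 proof -
  obtain t where "x = fst (ev t)" using x by (auto simp: N_def)
  then show ?thesis using NI[of "Scale (j r) t"] scj[OF r] unfolding ev by simp
 qed
 have N: "submodule N R ?Q"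
 proof (rule Q.submoduleI)
  show "N \<subseteq> ?Q" using evc by (auto simp: N_def simp del: char_module_simps)
  have "e \<zero>\<^sub>M \<in> N" using NI[of "Base (k \<zero>\<^sub>M)"] basek[of "\<zero>\<^sub>M"] unfolding ev by simp
  then show "\<zero>\<^sub>?Q \<in> N" using mod_hom_zero[OF M Q e(1)] by (simp del: char_module_simps)
  show "x \<oplus>\<^sub>?Q y \<in> N" if xy: "x \<in> N" "y \<in> N" for x y
  proof -
   obtain s t where "x = fst (ev s)" "y = fst (ev t)" using xy by (auto simp: N_def)
   then show ?thesis using NI[of "Plus s t"] unfolding ev fst_conv by (simp only:)
  qed
  show "r \<odot>\<^sub>?Q x \<in> N" if "r \<in> R" "x \<in> N" for r x by (rule Nsc[OF that])
  show "\<ominus>\<^sub>?Q x \<in> N" if x: "x \<in> N" for x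
  proof -
   have xQ: "x \<in> ?Q" using x evc by (auto simp: N_def simp del: char_module_simps)
   have "\<ominus>\<^sub>R \<one>\<^sub>R \<odot>\<^sub>?Q x = \<ominus>\<^sub>?Q x"
    using Q.smult_l_minus[OF M.R.one_closed xQ] Q.smult_one[OF xQ] by (simp only:)
   then show ?thesis using Nsc[OF M.R.a_inv_closed[OF M.R.one_closed] x] by (simp only:)
  qed
 qed
 let ?N = "?Q\<lparr>carrier := N\<rparr>"
 have NM: "module R ?N" by (rule sub_module[OF Q N])
 have terms: "\<exists>t. snd (ev t) = ps" if "\<forall>(r, v)\<in>set ps. r \<in> R \<and> v \<in> N" for ps
  using that
 proof (induction ps)
  case Nil
  show ?case using ev(1)[of undefined] by (metis snd_conv)
 next
  case (Cons a ps)
  obtain r v where a: "a = (r, v)" by (cases a)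
  obtain t where t: "snd (ev t) = ps" using Cons by auto
  obtain s where s: "v = fst (ev s)" using Cons(2) a by (auto simp: N_def)
  have "snd (ev (System (j r) s t)) = a # ps" unfolding ev a using Cons(2) a s t scj by simp
  then show ?case by blast
 qed
 have bN: "baer R ?N"
  unfolding baer_def
 proof (intro allI impI; elim conjE)
  fix I \<phi> assume I: "ideal I R" and \<phi>: "\<phi> \<in> mod_hom R ((reg R)\<lparr>carrier := I\<rparr>) ?N"
  have \<phi>N: "\<phi> r \<in> N" if "r \<in> I" for r using mod_hom_closed[OF \<phi>, of r] that by simp
  have NQ: "N \<subseteq> ?Q" by (rule Q.submoduleE(1)[OF N])
  have \<phi>Q: "\<phi> \<in> mod_hom R ((reg R)\<lparr>carrier := I\<rparr>) ?Q" by (rule mod_hom_from_sub[OF \<phi> NQ])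
  obtain y where y: "y \<in> ?Q" "!!r. r \<in> I ==> \<phi> r = r \<odot>\<^sub>?Q y"
   using bQ[unfolded baer_def, rule_format, OF conjI[OF I \<phi>Q]] by (elim bexE) blast
  obtain G where G: "G \<subseteq> R" "finite G" "I = Idl\<^bsub>R\<^esub> G" using N.finetely_gen[OF I] by blast
  have GI: "G \<subseteq> I" using M.R.genideal_self[OF G(1)] G(3) by simp
  obtain gs where gs: "set gs = G" using finite_list[OF G(2)] by blast
  let ?ps = "map (\<lambda>r. (r, \<phi> r)) gs"
  have "\<forall>(r, v)\<in>set ?ps. r \<in> R \<and> v \<in> N" using gs GI G(1) \<phi>N by auto
  then obtain t where t: "snd (ev t) = ?ps" using terms by blast
  define y' where "y' = sol ?ps"
  have y'N: "y' \<in> N" using NI[of "Solve t"] unfolding ev t y'_def by simp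
  have y'Q: "y' \<in> ?Q" unfolding y'_def by (rule sol)
  have "\<forall>(r, v)\<in>set ?ps. v = r \<odot>\<^sub>?Q y"
  proof
   fix p assume "p \<in> set ?ps"
   then obtain r where "r \<in> G" "p = (r, \<phi> r)" using gs by auto
   then show "case p of (r, v) => v = r \<odot>\<^sub>?Q y" using y(2) GI by (simp del: char_module_simps add: subset_iff)
  qed
  then have ex: "\<exists>y\<in>?Q. \<forall>(r, v)\<in>set ?ps. v = r \<odot>\<^sub>?Q y" using y(1) by blast
  have y'G: "\<phi> r = r \<odot>\<^sub>?Q y'" if "r \<in> G" for r
   unfolding y'_def by (rule sol_eq[OF ex]) (use that gs in auto)
  \<comment> \<open>The element y' solves the equations for generators of I only. The elements
    annihilating y - y' form an ideal containing these generators, so y' agrees with y on all of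
    I.\<close>
  have "submodule {\<zero>\<^sub>?Q} R ?Q"
   by (rule Q.submoduleI) (simp_all only: Q.zero_closed Q.a_inv_zero Q.smult_r_null Q.r_zero Q.l_zero singleton_iff empty_subsetI insert_subset simp_thms)
  then have J: "ideal (colon R ?Q {\<zero>\<^sub>?Q} (y \<ominus>\<^sub>?Q y')) R"
   using colon_ideal[OF Q] Q.minus_closed[OF y(1) y'Q] by blast
  have dist: "r \<odot>\<^sub>?Q (y \<ominus>\<^sub>?Q y') = r \<odot>\<^sub>?Q y \<ominus>\<^sub>?Q r \<odot>\<^sub>?Q y'" if "r \<in> R" for r
   by (rule mod_hom_minus[OF Q Q scale_hom[OF Q that] y(1) y'Q])
  have "G \<subseteq> colon R ?Q {\<zero>\<^sub>?Q} (y \<ominus>\<^sub>?Q y')"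
  proof
   fix r assume r: "r \<in> G"
   have rR: "r \<in> R" using r G(1) by auto
   have "r \<odot>\<^sub>?Q y = r \<odot>\<^sub>?Q y'" using y'G[OF r] y(2)[of r] r GI by auto
   then have "r \<odot>\<^sub>?Q (y \<ominus>\<^sub>?Q y') = \<zero>\<^sub>?Q"
    unfolding dist[OF rR] using Q.a_minus_self[OF Q.smult_closed[OF rR y'Q]] by (simp only:)
   then show "r \<in> colon R ?Q {\<zero>\<^sub>?Q} (y \<ominus>\<^sub>?Q y')" unfolding colon_def using rR by blast
  qed
  then have IJ: "I \<subseteq> colon R ?Q {\<zero>\<^sub>?Q} (y \<ominus>\<^sub>?Q y')" unfolding G(3) by (rule M.R.genideal_minimal[OF J])
  have "\<phi> r = r \<odot>\<^sub>?N y'" if r: "r \<in> I" for r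
  proof -
   have rR: "r \<in> R" by (rule ideal.Icarr[OF I r])
   have "r \<odot>\<^sub>?Q y \<ominus>\<^sub>?Q r \<odot>\<^sub>?Q y' = \<zero>\<^sub>?Q"
    using IJ r dist[OF rR] unfolding colon_def by (metis (no_types, lifting) mem_Collect_eq singletonD subsetD)
   then have "r \<odot>\<^sub>?Q y = r \<odot>\<^sub>?Q y'"
    using Q.a_minus_eq_zero_iff[OF Q.smult_closed[OF rR y(1)] Q.smult_closed[OF rR y'Q]] by blast
   then show ?thesis using y(2)[OF r] by simp
  qed
  then show "\<exists>y\<in>?N. \<forall>r\<in>I. \<phi> r = r \<odot>\<^sub>?N y" using y'N by (intro bexI[of _ y']) simp_all
 qed
 have eN: "e \<in> mod_hom R M ?N"
 proof (rule mod_hom_into[OF e(1)])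
  show "e x \<in> N" if "x \<in> M" for x using NI[of "Base (k x)"] basek[OF that] unfolding ev by simp
 qed
 obtain c :: "'t sol_term => 't" where c: "inj c" using sol_term_inj[OF inf] by blast
 define J where "J v = c (SOME t. fst (ev t) = v)" for v
 have J: "inj_on J N"
 proof (rule inj_onI)
  fix v w assume v: "v \<in> N" and w: "w \<in> N" and eq: "J v = J w"
  have "\<exists>t. fst (ev t) = v" "\<exists>t. fst (ev t) = w" using v w by (auto simp: N_def)
  from someI_ex[OF this(1)] someI_ex[OF this(2)] show "v = w"
   using eq inj_eq[OF c] unfolding J_def by metis
 qed
 have JN: "inj_on J (carrier ?N)" using J by simp
 note t = transport_module[OF NM JN]
 have "f (inv_into (carrier ?N) f y) = y" if "y \<in> transport f ?N" for f :: "_ => 't" and y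
  using that f_inv_into_f[of y f "carrier ?N"] by (simp del: char_module_simps)
 then have bE: "baer R (transport J ?N)" by (rule baer_iso[OF NM t(2,3) _ bN])
 have "inj_on (\<lambda>x. J (e x)) (carrier M)"
 proof (rule inj_onI)
  fix x y assume x: "x \<in> M" and y: "y \<in> M" and eq: "J (e x) = J (e y)"
  have "e x \<in> N" "e y \<in> N" using mod_hom_closed[OF eN] x y by simp_all
  then have "e x = e y" using J eq by (auto dest: inj_onD)
  then show "x = y" using e(2) x y by (auto dest: inj_onD)
 qed
 then show ?thesis using that[OF t(1) bE mod_hom_comp[OF eN t(2)]] by blast
qed

section \<open>Existence of injective hulls\<close>

text \<open>Essentiality is stated elementwise, every nonzero x having a nonzero multiple in I, and
  this form passes to unions of chains.\<close>

lemma essential_maximal: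
 assumes N: "module R N" and I: "submodule I R N"
 defines "ess \<equiv> \<lambda>H. submodule H R N \<and> I \<subseteq> H \<and>
  (\<forall>x\<in>H. x \<noteq> \<zero>\<^sub>N --> (\<exists>r\<in>carrier R. r \<odot>\<^sub>N x \<in> I \<and> r \<odot>\<^sub>N x \<noteq> \<zero>\<^sub>N))"
 obtains H where "ess H" "!!H'. ess H' ==> H \<subseteq> H' ==> H' = H"
proof -
 interpret N: module R N by fact
 have Iess: "ess I"
  unfolding ess_def
 proof (intro conjI ballI impI)
  fix x assume x: "x \<in> I" "x \<noteq> \<zero>\<^sub>N"
  then show "\<exists>r\<in>R. r \<odot>\<^sub>N x \<in> I \<and> r \<odot>\<^sub>N x \<noteq> \<zero>\<^sub>N"
   using N.submodule_carrier[OF I x(1)] by (intro bexI[of _ "\<one>\<^sub>R"]) auto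
 qed (use I in auto)
 have "\<exists>H\<in>Collect ess. \<forall>X\<in>Collect ess. H \<subseteq> X --> X = H"
 proof (rule subset_Zorn_nonempty)
  show "Collect ess \<noteq> {}" using Iess by blast
  fix C assume C: "C \<noteq> {}" "subset.chain (Collect ess) C"
  have CE: "ess X" if "X \<in> C" for X using C(2) that unfolding subset_chain_def by blast
  have CS: "submodule X R N" "I \<subseteq> X" if "X \<in> C" for X using CE[OF that] by (simp_all add: ess_def)
  note XE = N.submoduleE[OF CS(1)]
  have dir: "\<exists>Z\<in>C. a \<in> Z \<and> b \<in> Z" if ab: "a \<in> \<Union>C" "b \<in> \<Union>C" for a b
  proof -
   obtain X Y where XY: "X \<in> C" "a \<in> X" "Y \<in> C" "b \<in> Y" using ab by blast
   have "X \<subseteq> Y \<or> Y \<subseteq> X" using C(2) XY by (simp add: subset_chain_def)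
   then show ?thesis using XY by blast
  qed
  have sub: "submodule (\<Union>C) R N"
  proof (rule N.submoduleI)
   show "\<Union>C \<subseteq> N" using XE(1) by blast
   show "\<zero>\<^sub>N \<in> \<Union>C" using C(1) submodule_zero[OF CS(1)] by blast
   show "\<ominus>\<^sub>N a \<in> \<Union>C" if "a \<in> \<Union>C" for a using that XE(3) by blast
   show "a \<oplus>\<^sub>N b \<in> \<Union>C" if "a \<in> \<Union>C" "b \<in> \<Union>C" for a b
    using dir[OF that] XE(5) by blast
   show "r \<odot>\<^sub>N a \<in> \<Union>C" if "r \<in> R" "a \<in> \<Union>C" for r a using that XE(4) by blast
  qed
  have "I \<subseteq> \<Union>C" using C(1) CS(2) by blast
  moreover have "\<forall>x\<in>\<Union>C. x \<noteq> \<zero>\<^sub>N --> (\<exists>r\<in>R. r \<odot>\<^sub>N x \<in> I \<and> r \<odot>\<^sub>N x \<noteq> \<zero>\<^sub>N)"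
   using CE unfolding ess_def by blast
  ultimately show "\<Union>C \<in> Collect ess" using sub unfolding ess_def by blast
 qed
 then show ?thesis using that by blast
qed

text \<open>A maximal essential extension H of M inside an injective module is a direct summand. The
  identity of H is extended to a map f into H on a maximal domain L; once L = N is shown, f is a
  retraction and H inherits Baer's criterion.\<close>

lemma injective_hull_in_injective:
 assumes M: "module R M" and N: "module R N" and bN: "baer R N"
  and \<iota>: "\<iota> \<in> mod_hom R M N" and inj: "inj_on \<iota> (carrier M)"
 obtains H where "submodule H R N" "is_injective_hull R M (N\<lparr>carrier := H\<rparr>) \<iota>"
proof -
 interpret N: module R N by fact
 let ?I = "\<iota> ` M"
 have I: "submodule ?I R N" by (rule submodule_range[OF M N \<iota>])
 define ess where "ess H \<longleftrightarrow> submodule H R N \<and> ?I \<subseteq> H \<and>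
  (\<forall>x\<in>H. x \<noteq> \<zero>\<^sub>N --> (\<exists>r\<in>R. r \<odot>\<^sub>N x \<in> ?I \<and> r \<odot>\<^sub>N x \<noteq> \<zero>\<^sub>N))" for H
 obtain H where H: "ess H" and max: "!!H'. ess H' ==> H \<subseteq> H' ==> H' = H"
  using essential_maximal[OF N I] unfolding ess_def by blast
 have Hs: "submodule H R N" and IH: "?I \<subseteq> H"
  and He: "!!x. x \<in> H ==> x \<noteq> \<zero>\<^sub>N ==> \<exists>r\<in>R. r \<odot>\<^sub>N x \<in> ?I \<and> r \<odot>\<^sub>N x \<noteq> \<zero>\<^sub>N"
  using H unfolding ess_def by blast+
 note HE = N.submoduleE[OF Hs] and Hc = N.submodule_carrier[OF Hs]
 let ?H = "N\<lparr>carrier := H\<rparr>"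
 have HM: "module R ?H" by (rule sub_module[OF N Hs])
 have idH: "(\<lambda>x. x) \<in> mod_hom R ?H ?H" by (rule mod_hom_id)
 obtain L f where L: "submodule L R N" "H \<subseteq> L" and f: "f \<in> mod_hom R (N\<lparr>carrier := L\<rparr>) ?H"
  and fH: "!!x. x \<in> H ==> f x = x"
  and maxL: "!!L' f'. submodule L' R N ==> L \<subseteq> L' ==> f' \<in> mod_hom R (N\<lparr>carrier := L'\<rparr>) ?H ==>
    (!!x. x \<in> L ==> f' x = f x) ==> L' = L"
  using mod_hom_maximal_extension[OF N HM Hs idH] by blast
 have step: "y \<in> L" if y: "y \<in> N" and z: "z \<in> H"
  and ok: "!!r. r \<in> R ==> r \<odot>\<^sub>N y \<in> L ==> f (r \<odot>\<^sub>N y) = r \<odot>\<^sub>N z" for y z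
 proof -
  have z': "z \<in> ?H" and ok': "!!r. r \<in> R ==> r \<odot>\<^sub>N y \<in> L ==> f (r \<odot>\<^sub>N y) = r \<odot>\<^sub>?H z"
   using z ok by simp_all
  obtain L' f' where "submodule L' R N" "L \<subseteq> L'" "y \<in> L'"
   "f' \<in> mod_hom R (N\<lparr>carrier := L'\<rparr>) ?H" "!!x. x \<in> L ==> f' x = f x"
   using mod_hom_extend_one[OF N HM L(1) f y z' ok'] by metis
  then show ?thesis using maxL by blast
 qed
 have fN: "f \<in> mod_hom R (N\<lparr>carrier := L\<rparr>) N" by (rule mod_hom_from_sub[OF f HE(1)])
 \<comment> \<open>By injectivity of N the map f extends to all of N if values outside H are
   allowed; g y is the candidate for the value of f at y.\<close>
 obtain g where g: "g \<in> mod_hom R N N" "!!x. x \<in> L ==> g x = f x"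
  using baer_extend[OF N N bN L(1) fN] by blast
 have gH: "g x = x" if "x \<in> H" for x using g(2) fH L(2) that by auto
 have fLH: "f x \<in> H" if "x \<in> L" for x using mod_hom_closed[OF f] that by simp
 have gs: "g (r \<odot>\<^sub>N x) = r \<odot>\<^sub>N g x" if "r \<in> R" "x \<in> N" for r x
  by (rule mod_hom_smult[OF g(1) that])
 have all: "y \<in> L" if y: "y \<in> N" for y
 proof (cases "g y \<in> H")
  case True
  show ?thesis
   by (rule step[OF y True]) (use g(2)[symmetric] gs[OF _ y] in simp)
 next
  case False
  \<comment> \<open>As z is not in H, maximality says that H + Rz is not essential over M: it
    contains some w = h + r z \<noteq> 0 without nonzero multiples in the image of M, hence without
    nonzero multiples in H. Then g maps y' = h + r y to w, and 0 is an admissible value of f at y'.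
    This puts y' into L and w into H, a contradiction.\<close>
  define z where "z = g y"
  have z: "z \<in> N" unfolding z_def by (rule mod_hom_closed[OF g(1) y])
  have f0: "(zf N) \<in> mod_hom R (N\<lparr>carrier := H\<rparr>) N" by (rule mod_homI) auto
  have ok0: "\<zero>\<^sub>N = r \<odot>\<^sub>N \<zero>\<^sub>N" if "r \<in> R" "r \<odot>\<^sub>N z \<in> H" for r using that by simp
  obtain H' where H': "submodule H' R N" "H \<subseteq> H'" "z \<in> H'"
   and H'e: "!!x. x \<in> H' ==> \<exists>l\<in>H. \<exists>r\<in>R. x = l \<oplus>\<^sub>N r \<odot>\<^sub>N z"
   using mod_hom_extend_one[OF N N Hs f0 z N.zero_closed ok0] by metis
  have "\<not> ess H'" using max[OF _ H'(2)] H'(3) False unfolding z_def by blast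
  then obtain w where w: "w \<in> H'" "w \<noteq> \<zero>\<^sub>N"
   and wI: "!!r. r \<in> R ==> r \<odot>\<^sub>N w \<in> ?I ==> r \<odot>\<^sub>N w = \<zero>\<^sub>N"
   unfolding ess_def using H' IH by blast
  obtain h r where hr: "h \<in> H" "r \<in> R" "w = h \<oplus>\<^sub>N r \<odot>\<^sub>N z" using H'e[OF w(1)] by blast
  have wc: "w \<in> N" using hr Hc z by simp
  have wH: "t \<odot>\<^sub>N w = \<zero>\<^sub>N" if t: "t \<in> R" "t \<odot>\<^sub>N w \<in> H" for t
  proof (rule ccontr)
   assume nz: "t \<odot>\<^sub>N w \<noteq> \<zero>\<^sub>N"
   obtain s where s: "s \<in> R" "s \<odot>\<^sub>N (t \<odot>\<^sub>N w) \<in> ?I" "s \<odot>\<^sub>N (t \<odot>\<^sub>N w) \<noteq> \<zero>\<^sub>N"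
    using He[OF t(2) nz] by blast
   have "(s \<otimes>\<^sub>R t) \<odot>\<^sub>N w = s \<odot>\<^sub>N (t \<odot>\<^sub>N w)" by (rule N.smult_assoc1[OF s(1) t(1) wc])
   then show False using wI[of "s \<otimes>\<^sub>R t"] s t by simp
  qed
  define y' where "y' = h \<oplus>\<^sub>N r \<odot>\<^sub>N y"
  have y': "y' \<in> N" unfolding y'_def using hr Hc y by simp
  have gy': "g y' = w"
   unfolding y'_def hr(3) z_def
   using mod_hom_add[OF g(1), of h "r \<odot>\<^sub>N y"] gs[OF hr(2) y] gH[OF hr(1)] Hc[OF hr(1)] hr(2) y by simp
  have "y' \<in> L"
  proof (rule step[OF y' submodule_zero[OF Hs]])
   fix t assume t: "t \<in> R" "t \<odot>\<^sub>N y' \<in> L"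
   have "f (t \<odot>\<^sub>N y') = t \<odot>\<^sub>N w" using g(2)[OF t(2)] gs[OF t(1) y'] gy' by simp
   then show "f (t \<odot>\<^sub>N y') = t \<odot>\<^sub>N \<zero>\<^sub>N" using wH[OF t(1)] fLH[OF t(2)] t(1) by simp
  qed
  then have "w \<in> H" using g(2) gy' fLH by auto
  then have "\<one>\<^sub>R \<odot>\<^sub>N w = \<zero>\<^sub>N" using wH[of "\<one>\<^sub>R"] wc by simp
  then show ?thesis using w(2) wc by simp
 qed
 have Lc: "L = carrier N" using all N.submoduleE(1)[OF L(1)] by blast
 have fh: "f \<in> mod_hom R N ?H" using f by (simp add: Lc)
 have bH: "baer R ?H"
  unfolding baer_def
 proof (intro allI impI; elim conjE)
  fix J \<phi> assume J: "ideal J R" and \<phi>: "\<phi> \<in> mod_hom R ((reg R)\<lparr>carrier := J\<rparr>) ?H"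
  have \<phi>N: "\<phi> \<in> mod_hom R ((reg R)\<lparr>carrier := J\<rparr>) N" by (rule mod_hom_from_sub[OF \<phi> HE(1)])
  obtain y where y: "y \<in> N" "!!r. r \<in> J ==> \<phi> r = r \<odot>\<^sub>N y"
   using bN[unfolded baer_def, rule_format, OF conjI[OF J \<phi>N]] by (elim bexE) blast
  have "\<phi> r = r \<odot>\<^sub>?H f y" if r: "r \<in> J" for r
  proof -
   have "\<phi> r \<in> H" using mod_hom_closed[OF \<phi>, of r] r by simp
   then have "\<phi> r = f (r \<odot>\<^sub>N y)" using fH y(2)[OF r] by simp
   then show ?thesis using mod_hom_smult[OF fh ideal.Icarr[OF J r] y(1)] by simp
  qed
  then show "\<exists>y\<in>?H. \<forall>r\<in>J. \<phi> r = r \<odot>\<^sub>?H y" using mod_hom_closed[OF fh y(1)] by blast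
 qed
 have "is_injective_hull R M ?H \<iota>"
  unfolding is_injective_hull_def
 proof (intro conjI allI impI)
  show "injective_module R ?H" using injective_module_iff_baer[OF HM] bH by blast
  show "\<iota> \<in> mod_hom R M ?H" by (rule mod_hom_into[OF \<iota>]) (use IH in auto)
  show "inj_on \<iota> (carrier M)" by fact
  fix K assume K: "submodule K R ?H \<and> K \<inter> ?I = {\<zero>\<^sub>?H}"
  interpret HM: module R ?H by (rule HM)
  note KE = HM.submoduleE[OF conjunct1[OF K]]
  have "x = \<zero>\<^sub>N" if x: "x \<in> K" for x
  proof (rule ccontr)
   assume nz: "x \<noteq> \<zero>\<^sub>N"
   have "x \<in> H" using KE(1) x by auto
   then obtain r where r: "r \<in> R" "r \<odot>\<^sub>N x \<in> ?I" "r \<odot>\<^sub>N x \<noteq> \<zero>\<^sub>N" using He nz by blast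
   then have "r \<odot>\<^sub>N x \<in> K \<inter> ?I" using KE(4)[OF r(1) x] by simp
   then show False using K r(3) by simp
  qed
  then have "K \<subseteq> {\<zero>\<^sub>N}" by blast
  moreover have "\<zero>\<^sub>N \<in> K" using submodule_zero[OF conjunct1[OF K]] by simp
  ultimately show "K = {\<zero>\<^sub>?H}" by force
 qed
 then show ?thesis using that[OF Hs] by blast
qed

text \<open>The choice in \<open>injective_hull\<close> ranges over one type. R and M embed into it
  as singletons of one-element lists, so an injective module containing M exists there, and with it
  a hull to be chosen.\<close>

lemma injective_hull_is_injective_hull:
 fixes R :: "('r, 'c) ring_scheme" and M :: "('r, 'm, 'd) module_scheme"
 assumes R: "cring R" and noeth: "noetherian_ring R" and M: "module R M"
 obtains \<iota> where "is_injective_hull R M (injective_hull R M) \<iota>"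
proof -
 let ?t = "\<lambda>x :: 'r + 'm. {[x]}"
 have inf: "infinite (UNIV :: ('r, 'm) big set)"
 proof -
  have "inj (\<lambda>n. {replicate n (undefined :: 'r + 'm)})" by (auto simp: inj_def dest: arg_cong[of _ _ length])
  then show ?thesis using finite_imageD infinite_UNIV_nat by (metis finite_subset top_greatest)
 qed
 have j: "inj (\<lambda>r. ?t (Inl r))" and k: "inj_on (\<lambda>x. ?t (Inr x)) (carrier M)" by (auto simp: inj_def inj_on_def)
 obtain E :: "('r, ('r, 'm) big) module" and \<iota> where E: "module R E" "baer R E" "\<iota> \<in> mod_hom R M E" "inj_on \<iota> (carrier M)"
  by (rule small_injective_module[OF R noeth M inf j k])
 obtain H where "is_injective_hull R M (E\<lparr>carrier := H\<rparr>) \<iota>"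
  by (rule injective_hull_in_injective[OF M E])
 then have "\<exists>E :: ('r, ('r, 'm) big) module. \<exists>\<iota>. is_injective_hull R M E \<iota>" by blast
 from someI_ex[OF this] have "\<exists>\<iota>. is_injective_hull R M (injective_hull R M) \<iota>"
  unfolding injective_hull_def .
 then show ?thesis using that by blast
qed

section \<open>Dimension shifting for Ext\<close>

text \<open>The condition \<open>Ext\<^sup>i\<^sup>+\<^sup>1 = x Ext\<^sup>i\<^sup>+\<^sup>1\<close>, which for \<open>x = 0\<close> is the vanishing of \<open>Ext\<^sup>i\<^sup>+\<^sup>1\<close>.\<close>

definition coh_div :: "('r, 'c) ring_scheme => 'r => ('r, 'm, 'd) module_scheme => (nat => 'b set) =>
  (nat => 'b => 'b => 'r) => nat => bool"
 where "coh_div R x N B A i \<longleftrightarrow>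
  (\<forall>e\<in>dprod N (B (Suc i)). cobd R N B A (Suc i) e = zf N -->
    (\<exists>f\<in>dprod N (B (Suc i)). cobd R N B A (Suc i) f = zf N \<and>
     (\<exists>g\<in>dprod N (B i). \<forall>b. e b = x \<odot>\<^sub>N f b \<oplus>\<^sub>N cobd R N B A i g b)))"

lemma dprod_zero: "module R N ==> (zf N) \<in> dprod N X"
proof -
 assume "module R N"
 then interpret module R N .
 show ?thesis by (rule dprodI) auto
qed

lemma pull_zero:
 assumes "module R N" "rmat R B C A"
 shows "pull R N B A (zf N) = zf N"
proof -
 interpret module R N by fact
 have "pull R N B A (\<lambda>c. \<zero>\<^sub>R \<odot>\<^sub>N \<zero>\<^sub>N) = (\<lambda>b. \<zero>\<^sub>R \<odot>\<^sub>N pull R N B A (zf N) b)"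
  by (rule pull_scale[OF assms]) auto
 then show ?thesis using dprod_val[OF pull_closed[OF assms dprod_zero[OF assms(1)]]] by simp
qed

lemma coh_div_zero:
 assumes N: "module R N" and A: "!!i. rmat R (B (Suc i)) (B i) (A i)"
 shows "coh_div R \<zero>\<^sub>R N B A i \<longleftrightarrow> ext_exact R N B A i"
proof -
 interpret N: module R N by fact
 have *: "(\<forall>b. e b = \<zero>\<^sub>R \<odot>\<^sub>N f b \<oplus>\<^sub>N cobd R N B A i g b) \<longleftrightarrow> e = cobd R N B A i g"
  if "f \<in> dprod N (B (Suc i))" "g \<in> dprod N (B i)" for e f g
  using dprod_val[OF that(1)] dprod_val[OF pull_closed[OF N A that(2)]] by (auto simp: fun_eq_iff)
 show ?thesis
  unfolding coh_div_def ext_exact_def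
 proof (intro ball_cong imp_cong refl iffI)
  fix e assume "\<exists>f\<in>dprod N (B (Suc i)). cobd R N B A (Suc i) f = zf N \<and>
     (\<exists>g\<in>dprod N (B i). \<forall>b. e b = \<zero>\<^sub>R \<odot>\<^sub>N f b \<oplus>\<^sub>N cobd R N B A i g b)"
  then show "\<exists>e'\<in>dprod N (B i). e = cobd R N B A i e'" using * by blast
 next
  fix e assume "\<exists>e'\<in>dprod N (B i). e = cobd R N B A i e'"
  then show "\<exists>f\<in>dprod N (B (Suc i)). cobd R N B A (Suc i) f = zf N \<and>
     (\<exists>g\<in>dprod N (B i). \<forall>b. e b = \<zero>\<^sub>R \<odot>\<^sub>N f b \<oplus>\<^sub>N cobd R N B A i g b)"
   using *[OF dprod_zero[OF N]] dprod_zero[OF N] pull_zero[OF N A] by blast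
 qed
qed

lemma dprod_map:
 assumes "module R M" "module R N" "h \<in> mod_hom R M N" "e \<in> dprod M X"
 shows "(\<lambda>b. h (e b)) \<in> dprod N X"
 using dprodD[OF assms(4)] mod_hom_closed[OF assms(3)] mod_hom_zero[OF assms(1-3)] by (intro dprodI) auto

lemma dprod_lift:
 assumes "module R M" "e \<in> dprod N X" "h \<in> mod_hom R M N" "h \<zero>\<^sub>M = \<zero>\<^sub>N" "!!b. e b \<in> h ` carrier M"
 obtains f where "f \<in> dprod M X" "!!b. h (f b) = e b"
proof -
 interpret M: module R M by fact
 define f where "f b = (if b \<in> X then inv_into (carrier M) h (e b) else \<zero>\<^sub>M)" for b
 have "f \<in> dprod M X" by (rule dprodI) (use inv_into_into[OF assms(5)] in \<open>auto simp: f_def\<close>)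
 moreover have "h (f b) = e b" for b
  using f_inv_into_f[OF assms(5)] dprod_out[OF assms(2)] assms(4) by (simp add: f_def)
 ultimately show ?thesis using that by blast
qed

text \<open>Cocycles are carried back along g and solutions forward along f, so it is enough that N
  is a retract of M. This serves to exchange copies of a module in different types.\<close>

lemma coh_div_iso:
 assumes M: "module R M" and N: "module R N" and f: "f \<in> mod_hom R M N" and g: "g \<in> mod_hom R N M"
  and gf: "!!y. y \<in> N ==> f (g y) = y" and A: "!!i. rmat R (B (Suc i)) (B i) (A i)"
  and x: "x \<in> carrier R" and c: "coh_div R x M B A i"
 shows "coh_div R x N B A i"
 unfolding coh_div_def
proof (intro ballI impI)
 interpret M: module R M by fact
 fix e assume e: "e \<in> dprod N (B (Suc i))" and z: "cobd R N B A (Suc i) e = zf N"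
 have "cobd R M B A (Suc i) (\<lambda>b. g (e b)) = zf M"
  using pull_natural[OF N M g A dprod_val[OF e]] z mod_hom_zero[OF N M g] by simp
 then obtain u v where u: "u \<in> dprod M (B (Suc i))" "cobd R M B A (Suc i) u = zf M"
  and v: "v \<in> dprod M (B i)" and eq: "!!b. g (e b) = x \<odot>\<^sub>M u b \<oplus>\<^sub>M cobd R M B A i v b"
  using c dprod_map[OF N M g e] unfolding coh_div_def by blast
 have "e b = x \<odot>\<^sub>N f (u b) \<oplus>\<^sub>N cobd R N B A i (\<lambda>b. f (v b)) b" for b
 proof -
  have "e b = f (g (e b))" using gf[OF dprod_val[OF e]] by simp
  also have "\<dots> = x \<odot>\<^sub>N f (u b) \<oplus>\<^sub>N f (cobd R M B A i v b)"
   unfolding eq using mod_hom_add[OF f] mod_hom_smult[OF f x] dprod_val[OF u(1)] x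
    dprod_val[OF pull_closed[OF M A v]] by simp
  also have "f (cobd R M B A i v b) = cobd R N B A i (\<lambda>b. f (v b)) b"
   using pull_natural[OF M N f A dprod_val[OF v]] by simp
  finally show ?thesis .
 qed
 moreover have "cobd R N B A (Suc i) (\<lambda>b. f (u b)) = zf N"
  using pull_natural[OF M N f A dprod_val[OF u(1)]] u(2) mod_hom_zero[OF M N f] by simp
 ultimately show "\<exists>f\<in>dprod N (B (Suc i)). cobd R N B A (Suc i) f = zf N \<and>
     (\<exists>g\<in>dprod N (B i). \<forall>b. e b = x \<odot>\<^sub>N f b \<oplus>\<^sub>N cobd R N B A i g b)"
  using dprod_map[OF M N f u(1)] dprod_map[OF M N f v] by blast
qed

section \<open>Cosyzygies and the shift of Ext in the second variable\<close>

locale cosyzygy =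
 M: module R M + I: module R I + M': module R M'
 for R :: "('r, 'c) ring_scheme" and M :: "('r, 'm, 'd) module_scheme"
  and I :: "('r, 'n, 'e) module_scheme" and M' :: "('r, 'k, 'f) module_scheme" +
 fixes \<iota> \<pi>
 assumes inj_I: "baer R I" and \<iota>: "\<iota> \<in> mod_hom R M I" and \<pi>: "\<pi> \<in> mod_hom R I M'"
  and \<iota>_inj: "inj_on \<iota> (carrier M)" and \<pi>_surj: "\<pi> ` carrier I = carrier M'"
  and exact: "\<iota> ` carrier M = a_kernel I M' \<pi>"
begin

lemma mM: "module R M" and mI: "module R I" and mM': "module R M'"
 by (rule M.module_axioms I.module_axioms M'.module_axioms)+

lemma \<pi>\<iota>: "x \<in> carrier M ==> \<pi> (\<iota> x) = \<zero>\<^sub>M'"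
 using exact unfolding a_kernel_def'' by blast

lemma ker\<pi>: "y \<in> carrier I ==> \<pi> y = \<zero>\<^sub>M' ==> y \<in> \<iota> ` carrier M"
 using exact unfolding a_kernel_def'' by blast

lemma \<iota>_eq: "x \<in> carrier M ==> y \<in> carrier M ==> \<iota> x = \<iota> y ==> x = y"
 using \<iota>_inj by (auto dest: inj_onD)

text \<open>The connecting isomorphism of 0 -> M -> I -> M' -> 0 commutes with multiplication by x,
  so surjectivity of x moves along with it. The chase works on cocycles and uses that cocycles over
  I are coboundaries.\<close>

lemma coh_div_shift:
 assumes res: "free_resolution R Q B A \<mu>" and x: "x \<in> carrier R"
 shows "coh_div R x M B A (Suc i) \<longleftrightarrow> coh_div R x M' B A i"
proof
 note R = M.is_cring
 note A = res_rmat[OF R res]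
 let ?d = "\<lambda>N j. cobd R N B A j"
 note zM = mod_hom_zero[OF mM mI \<iota>] and zI = mod_hom_zero[OF mI mM' \<pi>]
 have dd: "?d I (Suc j) (?d I j e) = zf I" if e: "e \<in> dprod I (B j)" for j e
 proof (rule pull_comp_zero[OF mI A A _ dprod_val[OF e]])
  fix b assume b: "b \<in> B (Suc (Suc j))"
  note Rg = reg_module[OF R]
  have "A (Suc j) b = bd (reg R) B A (Suc j) (sing (reg R) b \<one>\<^sub>R)"
   using push_sing[OF Rg A b, of "\<one>\<^sub>R"] rmat_entry[OF A b] by simp
  then have "bd (reg R) B A j (A (Suc j) b) = zf R"
   using res_comp[OF R res, of "sing (reg R) b \<one>\<^sub>R" j] sing_closed[OF Rg b] by simp
  then show "lin_ext R (free_module R (B j)) (A j) (A (Suc j) b) = zf R"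
   using lin_ext_free[OF R A rmat_row[OF A b]] by simp
 qed
 have nat\<iota>: "?d I j (\<lambda>b. \<iota> (e b)) = (\<lambda>b. \<iota> (?d M j e b))" if "e \<in> dprod M (B j)" for j e
  by (rule pull_natural[OF mM mI \<iota> A dprod_val[OF that]])
 have nat\<pi>: "?d M' j (\<lambda>b. \<pi> (e b)) = (\<lambda>b. \<pi> (?d I j e b))" if "e \<in> dprod I (B j)" for j e
  by (rule pull_natural[OF mI mM' \<pi> A dprod_val[OF that]])
 have cl: "?d I j e \<in> dprod I (B (Suc j))" if "e \<in> dprod I (B j)" for j e by (rule pull_closed[OF mI A that])
 have clM: "?d M j e \<in> dprod M (B (Suc j))" if "e \<in> dprod M (B j)" for j e by (rule pull_closed[OF mM A that])
 have exI: "\<exists>e'\<in>dprod I (B j). e = ?d I j e'" if "e \<in> dprod I (B (Suc j))" "?d I (Suc j) e = zf I" for j e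
  using ext_exact_injective[OF mI inj_I res, of j] that unfolding ext_exact_def by blast
 have lift\<pi>: "\<exists>H\<in>dprod I X. \<forall>b. \<pi> (H b) = h b" if h: "h \<in> dprod M' X" for h :: "'g => 'k" and X
  using dprod_lift[OF mI h \<pi> zI] dprod_val[OF h] \<pi>_surj by metis
 have lift\<iota>: "\<exists>F\<in>dprod M X. \<forall>b. \<iota> (F b) = e b" if e: "e \<in> dprod I X" "!!b. \<pi> (e b) = \<zero>\<^sub>M'" for e :: "'g => 'n" and X
  using dprod_lift[OF mM e(1) \<iota> zM ker\<pi>[OF dprod_val[OF e(1)] e(2)]] by metis
 have cocycle\<iota>: "?d M j F = zf M" if F: "F \<in> dprod M (B j)" and z: "?d I j (\<lambda>b. \<iota> (F b)) = zf I" for j F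
 proof
  fix b
  have "\<iota> (?d M j F b) = \<iota> \<zero>\<^sub>M" using z nat\<iota>[OF F] zM by (simp add: fun_eq_iff)
  then show "?d M j F b = \<zero>\<^sub>M" using \<iota>_eq[OF dprod_val[OF clM[OF F]] M.zero_closed] by simp
 qed
 have comb: "(\<lambda>b. H b \<ominus>\<^sub>I (x \<odot>\<^sub>I H1 b \<oplus>\<^sub>I G b)) \<in> dprod I (B j)"
  "?d I j (\<lambda>b. H b \<ominus>\<^sub>I (x \<odot>\<^sub>I H1 b \<oplus>\<^sub>I G b)) =
    (\<lambda>b. ?d I j H b \<ominus>\<^sub>I (x \<odot>\<^sub>I ?d I j H1 b \<oplus>\<^sub>I ?d I j G b))"
  if "H \<in> dprod I (B j)" "H1 \<in> dprod I (B j)" "G \<in> dprod I (B j)" for H H1 G j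
 proof -
  note v = dprod_val[OF that(1)] dprod_val[OF that(2)] dprod_val[OF that(3)]
  show "(\<lambda>b. H b \<ominus>\<^sub>I (x \<odot>\<^sub>I H1 b \<oplus>\<^sub>I G b)) \<in> dprod I (B j)"
   by (rule dprodI) (use v x dprod_out[OF that(1)] dprod_out[OF that(2)] dprod_out[OF that(3)] in auto)
  have "?d I j (\<lambda>b. H b \<ominus>\<^sub>I (x \<odot>\<^sub>I H1 b \<oplus>\<^sub>I G b)) =
    (\<lambda>b. ?d I j H b \<ominus>\<^sub>I ?d I j (\<lambda>b. x \<odot>\<^sub>I H1 b \<oplus>\<^sub>I G b) b)"
   by (rule pull_minus[OF mI A]) (use v x in auto)
  also have "?d I j (\<lambda>b. x \<odot>\<^sub>I H1 b \<oplus>\<^sub>I G b) = (\<lambda>b. ?d I j (\<lambda>b. x \<odot>\<^sub>I H1 b) b \<oplus>\<^sub>I ?d I j G b)"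
   by (rule pull_add[OF mI A]) (use v x in auto)
  also have "?d I j (\<lambda>b. x \<odot>\<^sub>I H1 b) = (\<lambda>b. x \<odot>\<^sub>I ?d I j H1 b)"
   by (rule pull_scale[OF mI A v(2) x])
  finally show "?d I j (\<lambda>b. H b \<ominus>\<^sub>I (x \<odot>\<^sub>I H1 b \<oplus>\<^sub>I G b)) =
    (\<lambda>b. ?d I j H b \<ominus>\<^sub>I (x \<odot>\<^sub>I ?d I j H1 b \<oplus>\<^sub>I ?d I j G b))" .
 qed
 have cancel: "p \<oplus>\<^sub>I (h \<ominus>\<^sub>I p) = h" if "p \<in> I" "h \<in> I" for p h
  using that by (simp add: a_minus_def I.a_lcomm[of p] I.r_neg)
 have solve: "h = u \<oplus>\<^sub>I v" if h: "h \<in> I" "u \<in> I" "w \<in> I" "v = w \<oplus>\<^sub>I (h \<ominus>\<^sub>I (u \<oplus>\<^sub>I w))" for h u v w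
  using cancel[of "u \<oplus>\<^sub>I w" h] h by (simp add: I.a_assoc)
 {
  assume c: "coh_div R x M B A (Suc i)"
  show "coh_div R x M' B A i"
   unfolding coh_div_def
  proof (intro ballI impI)
   fix h assume h: "h \<in> dprod M' (B (Suc i))" and hz: "?d M' (Suc i) h = zf M'"
   obtain H where H: "H \<in> dprod I (B (Suc i))" "!!b. \<pi> (H b) = h b" using lift\<pi>[OF h] by blast
   have "(\<lambda>b. \<pi> (H b)) = h" using H(2) by auto
   then have "\<pi> (?d I (Suc i) H b) = \<zero>\<^sub>M'" for b
    using nat\<pi>[OF H(1)] hz by (auto simp: fun_eq_iff)
   then obtain F where F: "F \<in> dprod M (B (Suc (Suc i)))" "!!b. \<iota> (F b) = ?d I (Suc i) H b"
    using lift\<iota>[OF cl[OF H(1)]] by blast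
   have \<iota>F: "(\<lambda>b. \<iota> (F b)) = ?d I (Suc i) H" using F(2) by auto
   have "?d M (Suc (Suc i)) F = zf M" by (rule cocycle\<iota>[OF F(1)]) (simp add: \<iota>F dd[OF H(1)])
   then obtain F' g where F': "F' \<in> dprod M (B (Suc (Suc i)))" "?d M (Suc (Suc i)) F' = zf M"
    and g: "g \<in> dprod M (B (Suc i))" and Fe: "!!b. F b = x \<odot>\<^sub>M F' b \<oplus>\<^sub>M ?d M (Suc i) g b"
    using c F(1) unfolding coh_div_def by blast
   have "?d I (Suc (Suc i)) (\<lambda>b. \<iota> (F' b)) = zf I" using nat\<iota>[OF F'(1)] F'(2) zM by simp
   then obtain H' where H': "H' \<in> dprod I (B (Suc i))" "(\<lambda>b. \<iota> (F' b)) = ?d I (Suc i) H'"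
    using exI[OF dprod_map[OF mM mI \<iota> F'(1)]] by blast
   have \<iota>g: "(\<lambda>b. \<iota> (g b)) \<in> dprod I (B (Suc i))" by (rule dprod_map[OF mM mI \<iota> g])
   \<comment> \<open>The coboundary of K is \<iota> applied to F - x F' - d g = 0. So K is a
     coboundary d w over I, and under \<pi> the term \<iota> g disappears from the decomposition of
     H.\<close>
   define K where "K = (\<lambda>b. H b \<ominus>\<^sub>I (x \<odot>\<^sub>I H' b \<oplus>\<^sub>I \<iota> (g b)))"
   have K: "K \<in> dprod I (B (Suc i))" unfolding K_def by (rule comb(1)[OF H(1) H'(1) \<iota>g])
   have "?d I (Suc i) K b = \<zero>\<^sub>I" for b
   proof -
    have "?d I (Suc i) H b = \<iota> (F b)" by (rule F(2)[symmetric])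
    also have "\<dots> = x \<odot>\<^sub>I \<iota> (F' b) \<oplus>\<^sub>I \<iota> (?d M (Suc i) g b)"
     unfolding Fe using mod_hom_add[OF \<iota>] mod_hom_smult[OF \<iota> x] x dprod_val[OF F'(1)] dprod_val[OF clM[OF g]] by simp
    also have "\<iota> (F' b) = ?d I (Suc i) H' b" using H'(2) by (simp add: fun_eq_iff)
    also have "\<iota> (?d M (Suc i) g b) = ?d I (Suc i) (\<lambda>b. \<iota> (g b)) b" using nat\<iota>[OF g] by simp
    finally show ?thesis
     unfolding K_def comb(2)[OF H(1) H'(1) \<iota>g]
     using dprod_val[OF cl[OF H'(1)], of b] dprod_val[OF cl[OF \<iota>g], of b] x by simp
   qed
   then obtain w where w: "w \<in> dprod I (B i)" "K = ?d I i w" using exI[OF K] by blast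
   have "h b = x \<odot>\<^sub>M' \<pi> (H' b) \<oplus>\<^sub>M' ?d M' i (\<lambda>b. \<pi> (w b)) b" for b
   proof -
    note v = dprod_val[OF H(1), of b] dprod_val[OF H'(1), of b] dprod_val[OF \<iota>g, of b] dprod_val[OF K, of b]
    have "H b = x \<odot>\<^sub>I H' b \<oplus>\<^sub>I (\<iota> (g b) \<oplus>\<^sub>I K b)"
     by (rule solve[OF _ _ v(3)]) (use v x in \<open>auto simp: K_def\<close>)
    then have "h b = x \<odot>\<^sub>M' \<pi> (H' b) \<oplus>\<^sub>M' (\<pi> (\<iota> (g b)) \<oplus>\<^sub>M' \<pi> (K b))"
     using H(2)[of b] mod_hom_add[OF \<pi>] mod_hom_smult[OF \<pi> x] v x by simp
    also have "\<pi> (\<iota> (g b)) = \<zero>\<^sub>M'" by (rule \<pi>\<iota>[OF dprod_val[OF g]])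
    also have "\<pi> (K b) = ?d M' i (\<lambda>b. \<pi> (w b)) b" using nat\<pi>[OF w(1)] w(2) by simp
    finally show ?thesis using dprod_val[OF pull_closed[OF mM' A dprod_map[OF mI mM' \<pi> w(1)]]] by simp
   qed
   moreover have "?d M' (Suc i) (\<lambda>b. \<pi> (H' b)) = zf M'"
   proof
    fix b
    have "?d M' (Suc i) (\<lambda>b. \<pi> (H' b)) b = \<pi> (\<iota> (F' b))"
     using nat\<pi>[OF H'(1)] H'(2)[symmetric] by simp
    then show "?d M' (Suc i) (\<lambda>b. \<pi> (H' b)) b = \<zero>\<^sub>M'" using \<pi>\<iota>[OF dprod_val[OF F'(1)]] by simp
   qed
   ultimately show "\<exists>f\<in>dprod M' (B (Suc i)). ?d M' (Suc i) f = zf M' \<and>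
     (\<exists>g\<in>dprod M' (B i). \<forall>b. h b = x \<odot>\<^sub>M' f b \<oplus>\<^sub>M' ?d M' i g b)"
    using dprod_map[OF mI mM' \<pi> H'(1)] dprod_map[OF mI mM' \<pi> w(1)] by blast
  qed
 next
  assume c: "coh_div R x M' B A i"
  show "coh_div R x M B A (Suc i)"
   unfolding coh_div_def
  proof (intro ballI impI)
   fix F assume F: "F \<in> dprod M (B (Suc (Suc i)))" and Fz: "?d M (Suc (Suc i)) F = zf M"
   have "?d I (Suc (Suc i)) (\<lambda>b. \<iota> (F b)) = zf I" using nat\<iota>[OF F] Fz zM by simp
   then obtain H where H: "H \<in> dprod I (B (Suc i))" "(\<lambda>b. \<iota> (F b)) = ?d I (Suc i) H"
    using exI[OF dprod_map[OF mM mI \<iota> F]] by blast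
   have "?d M' (Suc i) (\<lambda>b. \<pi> (H b)) b = \<zero>\<^sub>M'" for b
   proof -
    have "?d M' (Suc i) (\<lambda>b. \<pi> (H b)) b = \<pi> (\<iota> (F b))" using nat\<pi>[OF H(1)] H(2)[symmetric] by simp
    then show ?thesis using \<pi>\<iota>[OF dprod_val[OF F]] by simp
   qed
   then obtain h1 g1 where h1: "h1 \<in> dprod M' (B (Suc i))" "?d M' (Suc i) h1 = zf M'"
    and g1: "g1 \<in> dprod M' (B i)" and he: "!!b. \<pi> (H b) = x \<odot>\<^sub>M' h1 b \<oplus>\<^sub>M' ?d M' i g1 b"
    using c dprod_map[OF mI mM' \<pi> H(1)] unfolding coh_div_def by blast
   obtain H1 where H1: "H1 \<in> dprod I (B (Suc i))" "!!b. \<pi> (H1 b) = h1 b" using lift\<pi>[OF h1(1)] by blast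
   obtain G1 where G1: "G1 \<in> dprod I (B i)" "!!b. \<pi> (G1 b) = g1 b" using lift\<pi>[OF g1] by blast
   have e1: "(\<lambda>b. \<pi> (H1 b)) = h1" "(\<lambda>b. \<pi> (G1 b)) = g1" using H1(2) G1(2) by auto
   have "\<pi> (?d I (Suc i) H1 b) = \<zero>\<^sub>M'" for b
    using nat\<pi>[OF H1(1)] h1(2) unfolding e1 by (auto simp: fun_eq_iff)
   then obtain F' where F': "F' \<in> dprod M (B (Suc (Suc i)))" "!!b. \<iota> (F' b) = ?d I (Suc i) H1 b"
    using lift\<iota>[OF cl[OF H1(1)]] by blast
   have \<iota>F': "(\<lambda>b. \<iota> (F' b)) = ?d I (Suc i) H1" using F'(2) by auto
   have F'z: "?d M (Suc (Suc i)) F' = zf M" by (rule cocycle\<iota>[OF F'(1)]) (simp add: \<iota>F' dd[OF H1(1)])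
   note dG1 = cl[OF G1(1)]
   \<comment> \<open>The decomposition of \<pi> H makes \<pi> K vanish, so K = \<iota> g. Applying
     the coboundary map, which kills the last term of K, gives F = x F' + d g.\<close>
   define K where "K = (\<lambda>b. H b \<ominus>\<^sub>I (x \<odot>\<^sub>I H1 b \<oplus>\<^sub>I ?d I i G1 b))"
   have K: "K \<in> dprod I (B (Suc i))" unfolding K_def by (rule comb(1)[OF H(1) H1(1) dG1])
   have "\<pi> (K b) = \<zero>\<^sub>M'" for b
   proof -
    note v = dprod_val[OF H(1), of b] dprod_val[OF H1(1), of b] dprod_val[OF dG1, of b]
    have "\<pi> (K b) = \<pi> (H b) \<ominus>\<^sub>M' \<pi> (x \<odot>\<^sub>I H1 b \<oplus>\<^sub>I ?d I i G1 b)"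
     unfolding K_def by (rule mod_hom_minus[OF mI mM' \<pi>]) (use v x in auto)
    also have "\<pi> (x \<odot>\<^sub>I H1 b \<oplus>\<^sub>I ?d I i G1 b) = x \<odot>\<^sub>M' \<pi> (H1 b) \<oplus>\<^sub>M' \<pi> (?d I i G1 b)"
     using mod_hom_add[OF \<pi>] mod_hom_smult[OF \<pi> x] v x by simp
    also have "\<pi> (?d I i G1 b) = ?d M' i g1 b" using nat\<pi>[OF G1(1)] unfolding e1 by simp
    finally show ?thesis
     using he[of b] H1(2)[of b] x mod_hom_closed[OF \<pi> v(1)] by simp
   qed
   then obtain g where g: "g \<in> dprod M (B (Suc i))" "!!b. \<iota> (g b) = K b" using lift\<iota>[OF K] by blast
   have \<iota>g: "(\<lambda>b. \<iota> (g b)) = K" using g(2) by auto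
   have "F b = x \<odot>\<^sub>M F' b \<oplus>\<^sub>M ?d M (Suc i) g b" for b
   proof (rule \<iota>_eq)
    note v = dprod_val[OF cl[OF H(1)], of b] dprod_val[OF cl[OF H1(1)], of b] dprod_val[OF F'(1), of b] dprod_val[OF clM[OF g(1)], of b]
    show "F b \<in> M" by (rule dprod_val[OF F])
    show "x \<odot>\<^sub>M F' b \<oplus>\<^sub>M ?d M (Suc i) g b \<in> M" using v x by simp
    have "\<iota> (x \<odot>\<^sub>M F' b \<oplus>\<^sub>M ?d M (Suc i) g b) = x \<odot>\<^sub>I ?d I (Suc i) H1 b \<oplus>\<^sub>I ?d I (Suc i) K b"
     using mod_hom_add[OF \<iota>] mod_hom_smult[OF \<iota> x] v x F'(2) nat\<iota>[OF g(1)] unfolding \<iota>g by simp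
    also have "?d I (Suc i) K b = ?d I (Suc i) H b \<ominus>\<^sub>I (x \<odot>\<^sub>I ?d I (Suc i) H1 b \<oplus>\<^sub>I \<zero>\<^sub>I)"
     unfolding K_def comb(2)[OF H(1) H1(1) dG1] dd[OF G1(1)] ..
    also have "x \<odot>\<^sub>I ?d I (Suc i) H1 b \<oplus>\<^sub>I \<dots> = ?d I (Suc i) H b"
     using cancel[OF _ v(1), of "x \<odot>\<^sub>I ?d I (Suc i) H1 b"] v x by simp
    also have "\<dots> = \<iota> (F b)" using H(2) by (simp add: fun_eq_iff)
    finally show "\<iota> (F b) = \<iota> (x \<odot>\<^sub>M F' b \<oplus>\<^sub>M ?d M (Suc i) g b)" by simp
   qed
   then show "\<exists>f\<in>dprod M (B (Suc (Suc i))). ?d M (Suc (Suc i)) f = zf M \<and>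
     (\<exists>g\<in>dprod M (B (Suc i)). \<forall>b. F b = x \<odot>\<^sub>M f b \<oplus>\<^sub>M ?d M (Suc i) g b)"
    using F'(1) F'z g(1) by blast
  qed
 }
qed

end

text \<open>The quotient of I by the image of M consists of cosets; choosing a representative of
  each brings it back into the type of M, so that the construction can be iterated.\<close>

lemma cosyzygy_exists:
 fixes R :: "('r, 'c) ring_scheme" and M :: "('r, 't) module"
 assumes R: "cring R" and noeth: "noetherian_ring R" and M: "module R M"
  and inf: "infinite (UNIV :: 't set)" and j: "inj (j :: 'r => 't)"
 obtains I M' :: "('r, 't) module" and \<iota> \<pi> where "cosyzygy R M I M' \<iota> \<pi>"
proof -
 have k: "inj_on (\<lambda>x. x) (carrier M)" by simp
 obtain I :: "('r, 't) module" and \<iota> where I: "module R I" "baer R I" "\<iota> \<in> mod_hom R M I" "inj_on \<iota> (carrier M)"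
  by (rule small_injective_module[OF R noeth M inf j k])
 let ?H = "\<iota> ` M"
 have H: "submodule ?H R I" by (rule submodule_range[OF M I(1,3)])
 let ?Q = "quotient_module I ?H"
 have Q: "module R ?Q" by (rule quotient_module_module[OF I(1) H])
 define r where "r X = (SOME x. x \<in> X)" for X :: "'t set"
 have rX: "?H +>\<^sub>I r X = X \<and> r X \<in> I" if X: "X \<in> ?Q" for X
 proof -
  obtain x where x: "x \<in> I" "X = ?H +>\<^sub>I x" using X unfolding quotient_module_carrier by auto
  have "x \<in> X" using coset_self[OF I(1) H x(1)] x(2) by simp
  then have "r X \<in> X" unfolding r_def by (rule someI)
  then show ?thesis using coset_memD[OF I(1) H x(1), of "r X"] x(2) by simp
 qed
 have rinj: "inj_on r (carrier ?Q)" by (rule inj_onI) (metis rX)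
 let ?M' = "transport r ?Q"
 note t = transport_module[OF Q rinj]
 define \<pi> where "\<pi> x = r (?H +>\<^sub>I x)" for x
 have \<pi>: "\<pi> \<in> mod_hom R I ?M'" unfolding \<pi>_def by (rule mod_hom_comp[OF quotient_map_hom[OF I(1) H] t(2)])
 have "\<pi> ` I = carrier ?M'" unfolding \<pi>_def by (simp add: quotient_module_carrier image_image)
 moreover have "?H = a_kernel I ?M' \<pi>"
 proof -
  have "\<pi> x = \<zero>\<^sub>?M' \<longleftrightarrow> x \<in> ?H" if x: "x \<in> I" for x
  proof -
   have z: "\<zero>\<^sub>?M' = r ?H" using mod_hom_zero[OF Q t(1,2)] by (simp add: quotient_module_zero)
   have "?H \<in> ?Q" using abelian_monoid.zero_closed[OF abelian_group.axioms(1)[OF module.axioms(2)[OF Q]]]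
    by (simp add: quotient_module_zero)
   moreover have "?H +>\<^sub>I x \<in> ?Q" using x by (auto simp: quotient_module_carrier)
   ultimately have "\<pi> x = \<zero>\<^sub>?M' \<longleftrightarrow> ?H +>\<^sub>I x = ?H" unfolding \<pi>_def z using rinj by (auto dest: inj_onD)
   then show ?thesis using coset_zero_iff[OF I(1) H x] by simp
  qed
  then show ?thesis using module.submodule_carrier[OF I(1) H] unfolding a_kernel_def'' by blast
 qed
 ultimately have "cosyzygy R M I ?M' \<iota> \<pi>"
  by (intro cosyzygy.intro cosyzygy_axioms.intro M I t(1) \<pi>) auto
 then show ?thesis by (rule that)
qed

text \<open>Ext^1(R/I, N) is Hom(I, N) modulo the maps r -> r m; the condition says that x acts
  surjectively on this quotient.\<close>

definition ext1_div :: "('r, 'c) ring_scheme => 'r => ('r, 'm, 'd) module_scheme => 'r set => bool"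
 where "ext1_div R x N I \<longleftrightarrow> (\<forall>\<phi>\<in>mod_hom R ((reg R)\<lparr>carrier := I\<rparr>) N.
  \<exists>\<phi>'\<in>mod_hom R ((reg R)\<lparr>carrier := I\<rparr>) N. \<exists>m\<in>carrier N. \<forall>r\<in>I. \<phi> r = x \<odot>\<^sub>N \<phi>' r \<oplus>\<^sub>N r \<odot>\<^sub>N m)"

lemma ext1_div_zero:
 assumes N: "module R N" and I: "I \<subseteq> carrier R"
 shows "ext1_div R \<zero>\<^sub>R N I \<longleftrightarrow>
  (\<forall>\<phi>\<in>mod_hom R ((reg R)\<lparr>carrier := I\<rparr>) N. (\<exists>m\<in>N. \<forall>r\<in>I. \<phi> r = r \<odot>\<^sub>N m))"
proof -
 interpret N: module R N by fact
 have *: "(\<forall>r\<in>I. \<phi> r = \<zero>\<^sub>R \<odot>\<^sub>N \<phi>' r \<oplus>\<^sub>N r \<odot>\<^sub>N m) \<longleftrightarrow> (\<forall>r\<in>I. \<phi> r = r \<odot>\<^sub>N m)"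
  if "m \<in> N" "\<phi>' \<in> mod_hom R ((reg R)\<lparr>carrier := I\<rparr>) N" for \<phi> \<phi>' m
 proof (rule ball_cong[OF refl])
  fix r assume r: "r \<in> I"
  then have "\<phi>' r \<in> N" using mod_hom_closed[OF that(2), of r] by simp
  moreover have "r \<odot>\<^sub>N m \<in> N" using r I \<open>m \<in> N\<close> by auto
  ultimately show "(\<phi> r = \<zero>\<^sub>R \<odot>\<^sub>N \<phi>' r \<oplus>\<^sub>N r \<odot>\<^sub>N m) \<longleftrightarrow> (\<phi> r = r \<odot>\<^sub>N m)" by simp
 qed
 show ?thesis unfolding ext1_div_def using * by (simp cong: bex_cong) blast
qed

text \<open>In a resolution of R/I the first syzygy is I: the map \<open>p\<close> from the first
  free module onto I has the next image as its kernel. So 1-cocycles are the maps out of I composed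
  with \<open>p\<close>, and 0-cochains give the multiplications.\<close>

lemma coh_div_0_iff:
 assumes R: "cring R" and res: "ideal_resolution R I B A" and N: "module R N"
  and I: "ideal I R" and x: "x \<in> R"
 shows "coh_div R x N B A 0 \<longleftrightarrow> ext1_div R x N I"
proof -
 interpret N: module R N by fact
 note Rg = reg_module[OF R]
 let ?I = "(reg R)\<lparr>carrier := I\<rparr>"
 have sI: "submodule I R (reg R)" using I ideal_submodule[OF R] by blast
 have IR: "r \<in> R" if "r \<in> I" for r using module.submodule_carrier[OF Rg sI that] by simp
 have mI: "module R ?I" by (rule sub_module[OF Rg sI])
 have B0: "B 0 = {0}" and rm: "!!i. rmat R (B (Suc i)) (B i) (A i)"
  and im0: "bd (reg R) B A 0 ` fmod R (B (Suc 0)) = {f \<in> fmod R (B 0). f 0 \<in> I}"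
  and im1: "bd (reg R) B A (Suc 0) ` fmod R (B (Suc (Suc 0))) =
   {f \<in> fmod R (B (Suc 0)). bd (reg R) B A 0 f = zf R}"
  using res unfolding ideal_resolution_def by blast+
 let ?F = "fmod R (B (Suc 0))"
 let ?a = "\<lambda>b. A 0 b 0"
 define p where "p f = bd (reg R) B A 0 f 0" for f
 have push0: "bd (reg R) B A 0 f \<in> fmod R (B 0)" if "f \<in> ?F" for f
  by (rule mod_hom_closed[OF push_hom[OF Rg rm] that])
 have pI: "p f \<in> I" if "f \<in> ?F" for f using im0 that unfolding p_def by blast
 have p: "p \<in> mod_hom R ?F (reg R)"
  unfolding p_def by (rule mod_hom_comp[OF push_hom[OF Rg rm] dsum_eval_hom[OF Rg]])
 have p': "p \<in> mod_hom R ?F ?I" by (rule mod_hom_into[OF p pI])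
 have aI: "?a b \<in> I" if b: "b \<in> B (Suc 0)" for b
 proof -
  have "p (sing (reg R) b \<one>\<^sub>R) = ?a b"
   using push_sing[OF Rg rm b, of "\<one>\<^sub>R"] rmat_entry[OF rm b] unfolding p_def by simp
  then show ?thesis using pI[OF sing_closed[OF Rg b, of "\<one>\<^sub>R"]] by simp
 qed
 have p_onto: "\<exists>f\<in>?F. p f = r" if r: "r \<in> I" for r
 proof -
  have "sing (reg R) (0::nat) r \<in> {f \<in> fmod R (B 0). f 0 \<in> I}"
   using sing_closed[OF Rg, of "0::nat" "B 0" r] IR[OF r] r B0 by (simp add: sing_def)
  then obtain f where f: "f \<in> ?F" "sing (reg R) 0 r = bd (reg R) B A 0 f" using im0 by blast
  have "p f = r" unfolding p_def f(2)[symmetric] by (simp add: sing_def)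
  then show ?thesis using f(1) by blast
 qed
 have p_ker: "f \<in> bd (reg R) B A (Suc 0) ` fmod R (B (Suc (Suc 0)))"
  if f: "f \<in> ?F" "p f = \<zero>\<^sub>R" for f
 proof -
  have "bd (reg R) B A 0 f b = \<zero>\<^sub>R" for b
   using f(2) dsum_out[OF push0[OF f(1)], of b] B0 unfolding p_def by (cases "b = 0") auto
  then show ?thesis using im1 f(1) by blast
 qed
 have p_sing: "p (sing (reg R) b r) = r \<otimes>\<^sub>R ?a b" if "b \<in> B (Suc 0)" "r \<in> R" for b r
  using push_sing[OF Rg rm that(1), of r] that IR[OF aI] N.R.m_comm unfolding p_def by simp
 have hp: "h (p f) = lin_ext R N e f"
  if h: "h \<in> mod_hom R ?I N" and e: "!!b. b \<in> B (Suc 0) ==> e b = h (?a b)" and f: "f \<in> ?F" for h e f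
 proof -
  have ec: "e b \<in> N" if b: "b \<in> B (Suc 0)" for b using e[OF b] mod_hom_closed[OF h, of "?a b"] aI[OF b] by simp
  show ?thesis
  proof (rule dsum_hom_eq[OF Rg N mod_hom_comp[OF p' h] lin_ext_hom[OF N ec, unfolded free_eq_dsum] _ f])
   fix b r assume b: "b \<in> B (Suc 0)" and r: "r \<in> reg R"
   have "h (p (sing (reg R) b r)) = h (r \<odot>\<^sub>?I ?a b)" using p_sing[OF b] r by simp
   also have "\<dots> = r \<odot>\<^sub>N h (?a b)" using mod_hom_smult[OF h, of r "?a b"] r aI[OF b] by simp
   also have "\<dots> = lin_ext R N e (sing (reg R) b r)"
    using lin_ext_sing[where \<mu> = e and b = b, OF N ec[OF b], of r] r e[OF b] by simp
   finally show "h (p (sing (reg R) b r)) = lin_ext R N e (sing (reg R) b r)" .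
  qed
 qed
 \<comment> \<open>The cocycle of a map h out of I, given by its values at the images ?a b of the
   basis elements; \<open>ext\<close> is the converse passage.\<close>
 define res where "res h = (\<lambda>b. if b \<in> B (Suc 0) then h (?a b) else \<zero>\<^sub>N)" for h
 have res: "res h \<in> dprod N (B (Suc 0))" "cobd R N B A (Suc 0) (res h) = zf N"
  if h: "h \<in> mod_hom R ?I N" for h
 proof -
  show "res h \<in> dprod N (B (Suc 0))"
  proof (rule dprodI)
   show "res h b \<in> N" for b using mod_hom_closed[OF h, of "?a b"] aI by (simp add: res_def)
  qed (simp add: res_def)
  have "lin_ext R N (res h) (A (Suc 0) b) = \<zero>\<^sub>N" if b: "b \<in> B (Suc (Suc 0))" for b
  proof -
   have "A (Suc 0) b = bd (reg R) B A (Suc 0) (sing (reg R) b \<one>\<^sub>R)"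
    using push_sing[OF Rg rm b, of "\<one>\<^sub>R"] rmat_entry[OF rm b] by simp
   then have "A (Suc 0) b \<in> bd (reg R) B A (Suc 0) ` fmod R (B (Suc (Suc 0)))"
    using sing_closed[OF Rg b, of "\<one>\<^sub>R"] by simp
   then have Ab: "A (Suc 0) b \<in> ?F" "p (A (Suc 0) b) = \<zero>\<^sub>R" unfolding im1 p_def by auto
   have "lin_ext R N (res h) (A (Suc 0) b) = h (p (A (Suc 0) b))"
    by (rule hp[OF h _ Ab(1), symmetric]) (simp add: res_def)
   then show ?thesis using Ab(2) mod_hom_zero[OF mI N h] by simp
  qed
  then show "cobd R N B A (Suc 0) (res h) = zf N" by (auto simp: pull_def)
 qed
 have ext: "\<exists>h\<in>mod_hom R ?I N. \<forall>b\<in>B (Suc 0). e b = h (?a b)"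
  if e: "e \<in> dprod N (B (Suc 0))" and z: "cobd R N B A (Suc 0) e = zf N" for e
 proof -
  note ec = dprod_val[OF e]
  have L: "lin_ext R N e \<in> mod_hom R ?F N" by (rule lin_ext_hom[OF N ec, unfolded free_eq_dsum])
  have Lker: "lin_ext R N e f = \<zero>\<^sub>N" if f: "f \<in> ?F" "p f = \<zero>\<^sub>R" for f
  proof -
   obtain g where g: "g \<in> fmod R (B (Suc (Suc 0)))" "f = bd (reg R) B A (Suc 0) g"
    using p_ker[OF f] by blast
   have g': "g \<in> free_module R (B (Suc (Suc 0)))" using g(1) by (simp add: free_eq_dsum)
   have "lin_ext R N e f = lin_ext R N e (lin_ext R (free_module R (B (Suc 0))) (A (Suc 0)) g)"
    using g(2) lin_ext_free[OF R rm g'] by simp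
   also have "\<dots> = lin_ext R N (\<lambda>b. lin_ext R N e (A (Suc 0) b)) g" by (rule lin_ext_comp[OF N rm ec g'])
   also have "\<dots> = lin_ext R N (zf N) g"
    by (rule lin_ext_cong[OF g' N]) (use z in \<open>auto simp: pull_def fun_eq_iff split: if_splits\<close>)
   also have "\<dots> = \<zero>\<^sub>N"
    using lin_ext_natural[OF N N scale_hom[OF N N.R.zero_closed] g', of "\<lambda>_. \<zero>\<^sub>N"]
     mod_hom_closed[OF lin_ext_hom[OF N, of "B (Suc (Suc 0))" "\<lambda>_. \<zero>\<^sub>N"] g'] by simp
   finally show ?thesis .
  qed
  have Leq: "lin_ext R N e f = lin_ext R N e g" if fg: "f \<in> ?F" "g \<in> ?F" "p f = p g" for f g
  proof -
   interpret F: module R ?F by (rule dsum_module[OF Rg])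
   have "p (f \<ominus>\<^sub>?F g) = \<zero>\<^sub>R"
    using mod_hom_minus[OF F.module_axioms Rg p fg(1,2)] fg(3) IR[OF pI[OF fg(2)]] by simp
   then have "lin_ext R N e f \<ominus>\<^sub>N lin_ext R N e g = \<zero>\<^sub>N"
    using Lker[of "f \<ominus>\<^sub>?F g"] mod_hom_minus[OF F.module_axioms N L fg(1,2)] fg(1,2) by simp
   then show ?thesis using N.a_minus_eq_zero_iff[OF mod_hom_closed[OF L fg(1)] mod_hom_closed[OF L fg(2)]] by simp
  qed
  define k where "k r = (SOME f. f \<in> ?F \<and> p f = r)" for r
  have k: "k r \<in> ?F" "p (k r) = r" if "r \<in> I" for r
   using someI_ex[of "\<lambda>f. f \<in> ?F \<and> p f = r"] p_onto[OF that] unfolding k_def by auto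
  define h where "h r = lin_ext R N e (k r)" for r
  have hL: "h r = lin_ext R N e f" if "f \<in> ?F" "p f = r" "r \<in> I" for f r
   unfolding h_def by (rule Leq) (use k that in auto)
  have "h \<in> mod_hom R ?I N"
  proof (rule mod_homI)
   interpret F: module R ?F by (rule dsum_module[OF Rg])
   show "h r \<in> N" if "r \<in> ?I" for r
    unfolding h_def by (rule mod_hom_closed[OF L]) (use k that in auto)
   show "h (r \<oplus>\<^sub>?I s) = h r \<oplus>\<^sub>N h s" if "r \<in> ?I" "s \<in> ?I" for r s
   proof -
    have rs: "r \<in> I" "s \<in> I" using that by auto
    have "h (r \<oplus>\<^sub>R s) = lin_ext R N e (k r \<oplus>\<^sub>?F k s)"
     by (rule hL[OF F.a_closed[OF k(1)[OF rs(1)] k(1)[OF rs(2)]]])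
      (use mod_hom_add[OF p k(1)[OF rs(1)] k(1)[OF rs(2)]] k(2)[OF rs(1)] k(2)[OF rs(2)]
       module.submoduleE(5)[OF Rg sI rs] in auto)
    then show ?thesis using mod_hom_add[OF L k(1)[OF rs(1)] k(1)[OF rs(2)]] by (simp add: h_def)
   qed
   show "h (r \<odot>\<^sub>?I s) = r \<odot>\<^sub>N h s" if r: "r \<in> R" and "s \<in> ?I" for r s
   proof -
    have s: "s \<in> I" using that by auto
    have "h (r \<otimes>\<^sub>R s) = lin_ext R N e (r \<odot>\<^sub>?F k s)"
     by (rule hL[OF F.smult_closed[OF r k(1)[OF s]]])
      (use mod_hom_smult[OF p r k(1)[OF s]] k(2)[OF s] module.submoduleE(4)[OF Rg sI r s] in auto)
    then show ?thesis using mod_hom_smult[OF L r k(1)[OF s]] by (simp add: h_def)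
   qed
  qed
  moreover have "e b = h (?a b)" if b: "b \<in> B (Suc 0)" for b
  proof -
   have "h (?a b) = lin_ext R N e (sing (reg R) b \<one>\<^sub>R)"
    by (rule hL[OF sing_closed[OF Rg b] _ aI[OF b]]) (use p_sing[OF b] IR[OF aI[OF b]] in auto)
   then show ?thesis using lin_ext_sing[where \<mu> = e and b = b, OF N ec, of "\<one>\<^sub>R"] ec by simp
  qed
  ultimately show ?thesis by blast
 qed
 have pull0: "cobd R N B A 0 g b = ?a b \<odot>\<^sub>N g 0" if g: "g \<in> dprod N (B 0)" and b: "b \<in> B (Suc 0)" for g b
 proof -
  have "sing (reg R) 0 (?a b) = A 0 b"
   using dsum_out[OF rmat_row[OF rm b, unfolded free_eq_dsum]] B0 by (auto simp: sing_def fun_eq_iff)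
  then show ?thesis
   using lin_ext_sing[where \<mu> = g and b = "0::nat", OF N dprod_val[OF g] IR[OF aI[OF b]]] b by (simp add: pull_def)
 qed
 show ?thesis
 proof
  assume c: "coh_div R x N B A 0"
  show "ext1_div R x N I"
   unfolding ext1_div_def
  proof
   fix h assume h: "h \<in> mod_hom R ?I N"
   obtain f g where f: "f \<in> dprod N (B (Suc 0))" "cobd R N B A (Suc 0) f = zf N"
    and g: "g \<in> dprod N (B 0)" and eq: "!!b. res h b = x \<odot>\<^sub>N f b \<oplus>\<^sub>N cobd R N B A 0 g b"
    using c res[OF h] unfolding coh_div_def by blast
   obtain h' where h': "h' \<in> mod_hom R ?I N" "!!b. b \<in> B (Suc 0) ==> f b = h' (?a b)" using ext[OF f] by blast
   note g0 = dprod_val[OF g, of 0]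
   define h2 where "h2 = (\<lambda>r. x \<odot>\<^sub>N h' r \<oplus>\<^sub>N r \<odot>\<^sub>N g 0)"
   have "(\<lambda>r. r \<odot>\<^sub>N g 0) \<in> mod_hom R ?I N"
    by (rule mod_homI) (use g0 IR in \<open>auto simp: N.smult_l_distr N.smult_assoc1\<close>)
   then have h2: "h2 \<in> mod_hom R ?I N"
    unfolding h2_def by (intro mod_hom_sum[OF N mod_hom_scale[OF N h'(1) x]])
   have e2: "res h b = h2 (?a b)" if b: "b \<in> B (Suc 0)" for b
    using eq[of b] h'(2)[OF b] pull0[OF g b] by (simp add: h2_def)
   have "h r = h2 r" if r: "r \<in> I" for r
   proof -
    obtain f where f: "f \<in> ?F" "p f = r" using p_onto[OF r] by blast
    have "h (p f) = lin_ext R N (res h) f" by (rule hp[OF h _ f(1)]) (simp add: res_def)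
    also have "\<dots> = h2 (p f)" by (rule hp[OF h2 e2 f(1), symmetric])
    finally show ?thesis using f(2) by simp
   qed
   then show "\<exists>\<phi>'\<in>mod_hom R ?I N. \<exists>m\<in>N. \<forall>r\<in>I. h r = x \<odot>\<^sub>N \<phi>' r \<oplus>\<^sub>N r \<odot>\<^sub>N m"
    using h'(1) g0 unfolding h2_def by blast
  qed
 next
  assume c: "ext1_div R x N I"
  show "coh_div R x N B A 0"
   unfolding coh_div_def
  proof (intro ballI impI)
   fix e assume e: "e \<in> dprod N (B (Suc 0))" "cobd R N B A (Suc 0) e = zf N"
   obtain h where h: "h \<in> mod_hom R ?I N" "!!b. b \<in> B (Suc 0) ==> e b = h (?a b)" using ext[OF e] by blast
   obtain h' m where h': "h' \<in> mod_hom R ?I N" and m: "m \<in> N"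
    and eq: "!!r. r \<in> I ==> h r = x \<odot>\<^sub>N h' r \<oplus>\<^sub>N r \<odot>\<^sub>N m"
    using c h(1) unfolding ext1_div_def by blast
   have g: "sing N 0 m \<in> dprod N (B 0)" by (rule dprodI) (use m B0 in \<open>auto simp: sing_def\<close>)
   have "e b = x \<odot>\<^sub>N res h' b \<oplus>\<^sub>N cobd R N B A 0 (sing N 0 m) b" for b
   proof (cases "b \<in> B (Suc 0)")
    case True
    then show ?thesis using h(2)[OF True] eq[OF aI[OF True]] pull0[OF g True] by (simp add: res_def sing_def)
   next
    case False
    then show ?thesis using dprod_out[OF e(1) False] x by (simp add: res_def pull_def)
   qed
   then show "\<exists>f\<in>dprod N (B (Suc 0)). cobd R N B A (Suc 0) f = zf N \<and>
     (\<exists>g\<in>dprod N (B 0). \<forall>b. e b = x \<odot>\<^sub>N f b \<oplus>\<^sub>N cobd R N B A 0 g b)"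
    using res[OF h'] g by blast
  qed
 qed
qed

text \<open>The condition on Ext^(i+1)(R/I, M), imposed on all resolutions by finite free modules at
  once so that none has to be singled out.\<close>

definition ext_div :: "('r, 'c) ring_scheme => 'r => ('r, 'm, 'd) module_scheme => 'r set => nat => bool"
 where "ext_div R x M I i \<longleftrightarrow> (\<forall>B A. ideal_resolution R I B A --> coh_div R x M B A i)"

text \<open>The type \<open>'t\<close> is large enough to be closed under cosyzygies.\<close>

locale large_type =
 fixes R :: "('r, 'c) ring_scheme" and j :: "'r => 't"
 assumes R: "cring R" and noeth: "noetherian_ring R" and inf: "infinite (UNIV :: 't set)" and j: "inj j"
begin

sublocale R: cring R by (rule R)

lemma Rg: "module R (reg R)" by (rule reg_module[OF R])

lemma cosyzygy:
 fixes M :: "('r, 't) module"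
 assumes "module R M"
 obtains I M' :: "('r, 't) module" and \<iota> \<pi> where "cosyzygy R M I M' \<iota> \<pi>"
 by (rule cosyzygy_exists[OF R noeth assms inf j])

lemma quotient_resolution:
 assumes I: "ideal I R" and res: "ideal_resolution R I B A"
 shows "free_resolution R (quotient_module (reg R) I) B A (\<lambda>_. I +>\<^bsub>reg R\<^esub> \<one>\<^sub>R)"
proof (rule ideal_resolution_free_resolution[OF R res])
 have sI: "submodule I R (reg R)" using I ideal_submodule[OF R] by blast
 note q = quotient_map_hom[OF Rg sI]
 have r: "r \<odot>\<^bsub>quotient_module (reg R) I\<^esub> (I +>\<^bsub>reg R\<^esub> \<one>\<^sub>R) = I +>\<^bsub>reg R\<^esub> r" if "r \<in> R" for r
  using mod_hom_smult[OF q that, of "\<one>\<^sub>R"] that by simp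
 show "module R (quotient_module (reg R) I)" by (rule quotient_module_module[OF Rg sI])
 show "I +>\<^bsub>reg R\<^esub> \<one>\<^sub>R \<in> quotient_module (reg R) I" using mod_hom_closed[OF q, of "\<one>\<^sub>R"] by simp
 show "\<exists>r\<in>R. X = r \<odot>\<^bsub>quotient_module (reg R) I\<^esub> (I +>\<^bsub>reg R\<^esub> \<one>\<^sub>R)"
  if "X \<in> quotient_module (reg R) I" for X
  using that r unfolding quotient_module_carrier by auto
 show "r \<odot>\<^bsub>quotient_module (reg R) I\<^esub> (I +>\<^bsub>reg R\<^esub> \<one>\<^sub>R) = \<zero>\<^bsub>quotient_module (reg R) I\<^esub> \<longleftrightarrow> r \<in> I"
  if "r \<in> R" for r
  using coset_zero_iff[OF Rg sI] r[OF that] that by (simp add: quotient_module_zero)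
qed

lemma ext_div_0:
 assumes "module R M" "ideal I R" "x \<in> carrier R"
 shows "ext_div R x M I 0 \<longleftrightarrow> ext1_div R x M I"
 using coh_div_0_iff[OF R _ assms] ideal_resolution_exists[OF R noeth assms(2)] unfolding ext_div_def by metis

lemma ext_div_Suc:
 assumes "cosyzygy R M I' M' \<iota> \<pi>" "ideal I R" "x \<in> carrier R"
 shows "ext_div R x M I (Suc i) \<longleftrightarrow> ext_div R x M' I i"
 unfolding ext_div_def using cosyzygy.coh_div_shift[OF assms(1) quotient_resolution[OF assms(2)] assms(3)] by blast

text \<open>Independence of the resolution by dimension shifting: passing to cosyzygies of M lowers
  the degree to 1, where only the ideal I enters.\<close>

lemma coh_div_iff_ext_div:
 fixes M :: "('r, 't) module"
 assumes "module R M" and I: "ideal I R" and x: "x \<in> carrier R" and res: "ideal_resolution R I B A"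
 shows "coh_div R x M B A i \<longleftrightarrow> ext_div R x M I i"
 using assms(1)
proof (induction i arbitrary: M)
 case 0
 show ?case using coh_div_0_iff[OF R res 0 I x] ext_div_0[OF 0 I x] by simp
next
 case (Suc i)
 obtain I' M' :: "('r, 't) module" and \<iota> \<pi> where c: "cosyzygy R M I' M' \<iota> \<pi>" by (rule cosyzygy[OF Suc.prems])
 have M': "module R M'" using c by (rule cosyzygy.axioms(3))
 show ?case
  using Suc.IH[OF M'] ext_div_Suc[OF c I x] cosyzygy.coh_div_shift[OF c quotient_resolution[OF I res] x] by simp
qed

lemma extend_to:
 assumes N: "module R N" and I: "ideal I R" and J: "ideal J R" "I \<subseteq> J" "x \<in> J"
  and IJ: "!!s. s \<in> J ==> \<exists>b\<in>I. \<exists>r\<in>carrier R. s = b \<oplus>\<^sub>R r \<otimes>\<^sub>R x"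
  and f: "f \<in> mod_hom R ((reg R)\<lparr>carrier := I\<rparr>) N" and z: "z \<in> N"
  and ok: "!!r. r \<in> R ==> r \<otimes>\<^sub>R x \<in> I ==> f (r \<otimes>\<^sub>R x) = r \<odot>\<^sub>N z"
 obtains f' where "f' \<in> mod_hom R ((reg R)\<lparr>carrier := J\<rparr>) N" "!!b. b \<in> I ==> f' b = f b" "f' x = z"
proof -
 have sI: "submodule I R (reg R)" and sJ: "submodule J R (reg R)" using I J ideal_submodule[OF R] by blast+
 have x: "x \<in> R" using module.submodule_carrier[OF Rg sJ J(3)] by simp
 then have x': "x \<in> reg R" by simp
 have ok': "f (r \<odot>\<^bsub>reg R\<^esub> x) = r \<odot>\<^sub>N z" if "r \<in> R" "r \<odot>\<^bsub>reg R\<^esub> x \<in> I" for r using ok that by simp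
 obtain L f' where L: "submodule L R (reg R)" "I \<subseteq> L" "x \<in> L"
  and f': "f' \<in> mod_hom R ((reg R)\<lparr>carrier := L\<rparr>) N" "!!b. b \<in> I ==> f' b = f b" "f' x = z"
  using mod_hom_extend_one[OF Rg N sI f x' z ok'] by metis
 have "s \<in> L" if "s \<in> J" for s
  using IJ[OF that] module.submoduleE(5)[OF Rg L(1)] module.submoduleE(4)[OF Rg L(1) _ L(3)] L(2) by fastforce
 then have "f' \<in> mod_hom R ((reg R)\<lparr>carrier := J\<rparr>) N"
  using mod_hom_restrict[OF f'(1), of J] by auto
 then show ?thesis using f'(2,3) by (rule that)
qed

text \<open>The middle term of 0 -> R/(I : x) -> R/I -> R/J -> 0. In degree 1 a map on I is extended
  to J, the value at x being supplied by the hypothesis on (I : x), and is then a multiplication by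
  the hypothesis on J. Cosyzygies reduce higher degrees to this one.\<close>

lemma ext_div_add_colon:
 fixes M :: "('r, 't) module"
 assumes "module R M" and I: "ideal I R" and J: "ideal J R" "I \<subseteq> J" "x \<in> J"
  and IJ: "!!s. s \<in> J ==> \<exists>b\<in>I. \<exists>r\<in>carrier R. s = b \<oplus>\<^sub>R r \<otimes>\<^sub>R x"
  and eJ: "ext_div R \<zero>\<^sub>R M J i" and eC: "ext_div R \<zero>\<^sub>R M (colon R (reg R) I x) i"
 shows "ext_div R \<zero>\<^sub>R M I i"
 using assms(1) eJ eC
proof (induction i arbitrary: M)
 case 0
 interpret M: module R M by fact
 note M = M.module_axioms
 have sI: "submodule I R (reg R)" using I ideal_submodule[OF R] by blast
 have x: "x \<in> R" using J by (meson ideal.Icarr)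
 let ?C = "colon R (reg R) I x"
 have C: "ideal ?C R" by (rule colon_ideal[OF Rg sI]) (use x in simp)
 note sub = additive_subgroup.a_subset[OF ideal.axioms(1)]
 note z = R.zero_closed
 have eJ: "\<exists>m\<in>M. \<forall>r\<in>J. \<phi> r = r \<odot>\<^sub>M m" if "\<phi> \<in> mod_hom R ((reg R)\<lparr>carrier := J\<rparr>) M" for \<phi>
  using 0(2) that unfolding ext_div_0[OF M J(1) z] ext1_div_zero[OF M sub[OF J(1)]] by blast
 have eC: "\<exists>m\<in>M. \<forall>r\<in>?C. \<phi> r = r \<odot>\<^sub>M m" if "\<phi> \<in> mod_hom R ((reg R)\<lparr>carrier := ?C\<rparr>) M" for \<phi>
  using 0(3) that unfolding ext_div_0[OF M C z] ext1_div_zero[OF M sub[OF C]] by blast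
 show ?case
  unfolding ext_div_0[OF M I z] ext1_div_zero[OF M sub[OF I]]
 proof
  fix \<phi> assume \<phi>: "\<phi> \<in> mod_hom R ((reg R)\<lparr>carrier := I\<rparr>) M"
  have C': "r \<in> R" "r \<otimes>\<^sub>R x \<in> I" if "r \<in> ?C" for r using that unfolding colon_def by auto
  have "(\<lambda>r. \<phi> (r \<otimes>\<^sub>R x)) \<in> mod_hom R ((reg R)\<lparr>carrier := ?C\<rparr>) M"
  proof (rule mod_homI)
   show "\<phi> (r \<otimes>\<^sub>R x) \<in> M" if "r \<in> ((reg R)\<lparr>carrier := ?C\<rparr>)" for r
    using mod_hom_closed[OF \<phi>] C'(2) that by simp
   show "\<phi> ((r \<oplus>\<^bsub>(reg R)\<lparr>carrier := ?C\<rparr>\<^esub> s) \<otimes>\<^sub>R x) = \<phi> (r \<otimes>\<^sub>R x) \<oplus>\<^sub>M \<phi> (s \<otimes>\<^sub>R x)"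
    if "r \<in> ((reg R)\<lparr>carrier := ?C\<rparr>)" "s \<in> ((reg R)\<lparr>carrier := ?C\<rparr>)" for r s
    using mod_hom_add[OF \<phi>, of "r \<otimes>\<^sub>R x" "s \<otimes>\<^sub>R x"] C'[of r] C'[of s] that x by (simp add: R.l_distr)
   show "\<phi> ((r \<odot>\<^bsub>(reg R)\<lparr>carrier := ?C\<rparr>\<^esub> s) \<otimes>\<^sub>R x) = r \<odot>\<^sub>M \<phi> (s \<otimes>\<^sub>R x)"
    if "r \<in> R" "s \<in> ((reg R)\<lparr>carrier := ?C\<rparr>)" for r s
    using mod_hom_smult[OF \<phi>, of r "s \<otimes>\<^sub>R x"] C'[of s] that x by (simp add: R.m_assoc)
  qed
  then obtain z where z: "z \<in> M" "!!r. r \<in> ?C ==> \<phi> (r \<otimes>\<^sub>R x) = r \<odot>\<^sub>M z" using eC by blast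
  have ok: "\<phi> (r \<otimes>\<^sub>R x) = r \<odot>\<^sub>M z" if "r \<in> R" "r \<otimes>\<^sub>R x \<in> I" for r
   by (rule z(2)) (use that in \<open>simp add: colon_def\<close>)
  obtain f' where f': "f' \<in> mod_hom R ((reg R)\<lparr>carrier := J\<rparr>) M" "!!b. b \<in> I ==> f' b = \<phi> b" "f' x = z"
   using extend_to[OF M I J IJ \<phi> z(1) ok] by blast
  show "\<exists>m\<in>M. \<forall>r\<in>I. \<phi> r = r \<odot>\<^sub>M m" using eJ[OF f'(1)] f'(2) J(2) by (metis subsetD)
 qed
next
 case (Suc i)
 obtain I' M' :: "('r, 't) module" and \<iota> \<pi> where c: "cosyzygy R M I' M' \<iota> \<pi>" by (rule cosyzygy[OF Suc.prems(1)])
 have M': "module R M'" using c by (rule cosyzygy.axioms(3))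
 have sI: "submodule I R (reg R)" using I ideal_submodule[OF R] by blast
 have x: "x \<in> reg R" using J by (auto dest: ideal.Icarr)
 note z = R.zero_closed
 show ?case
  using Suc.IH[OF M'] Suc.prems(2,3)
  unfolding ext_div_Suc[OF c I z] ext_div_Suc[OF c J(1) z] ext_div_Suc[OF c colon_ideal[OF Rg sI x] z] by blast
qed

text \<open>The part of the long exact sequence of \<open>0 \<rightarrow> R/I \<rightarrow> R/I \<rightarrow> R/(I + xR) \<rightarrow> 0\<close> saying that
 \<open>x\<close> acts surjectively on \<open>Ext\<^sup>i\<^sup>+\<^sup>1(R/I, M)\<close> if \<open>Ext\<^sup>i\<^sup>+\<^sup>2(R/(I + xR), M) = 0\<close>.\<close>

lemma ext_div_regular:
 fixes M :: "('r, 't) module"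
 assumes "module R M" and I: "ideal I R" and J: "ideal J R" "I \<subseteq> J" "x \<in> J"
  and IJ: "!!s. s \<in> J ==> \<exists>b\<in>I. \<exists>r\<in>carrier R. s = b \<oplus>\<^sub>R r \<otimes>\<^sub>R x"
  and reg: "!!r. r \<in> R ==> r \<otimes>\<^sub>R x \<in> I ==> r \<in> I"
  and e: "ext_div R \<zero>\<^sub>R M J (Suc i)"
 shows "ext_div R x M I i"
 using assms(1) e
proof (induction i arbitrary: M)
 case 0
 obtain I' M' :: "('r, 't) module" and \<iota> \<pi> where "cosyzygy R M I' M' \<iota> \<pi>" by (rule cosyzygy[OF 0(1)])
 then interpret c: cosyzygy R M I' M' \<iota> \<pi> .
 note z = R.zero_closed and sub = additive_subgroup.a_subset[OF ideal.axioms(1)]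
 have x: "x \<in> R" using J by (meson ideal.Icarr)
 have sI: "submodule I R (reg R)" using I ideal_submodule[OF R] by blast
 have IR: "r \<in> R" if "r \<in> I" for r using I that by (meson ideal.Icarr)
 have e': "\<exists>m\<in>M'. \<forall>r\<in>J. \<phi> r = r \<odot>\<^sub>M' m" if "\<phi> \<in> mod_hom R ((reg R)\<lparr>carrier := J\<rparr>) M'" for \<phi>
  using 0(2) that
  unfolding ext_div_Suc[OF c.cosyzygy_axioms J(1) z] ext_div_0[OF c.mM' J(1) z] ext1_div_zero[OF c.mM' sub[OF J(1)]] by blast
 show ?case
  unfolding ext_div_0[OF c.mM I x] ext1_div_def
 proof
  fix \<phi> assume \<phi>: "\<phi> \<in> mod_hom R ((reg R)\<lparr>carrier := I\<rparr>) M"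
  have \<iota>\<phi>: "(\<lambda>r. \<iota> (\<phi> r)) \<in> mod_hom R ((reg R)\<lparr>carrier := I\<rparr>) I'" by (rule mod_hom_comp[OF \<phi> c.\<iota>])
  \<comment> \<open>Injectivity turns \<iota> \<phi> into multiplication by w; as \<pi> \<iota> = 0,
    the element \<pi> w is killed by I.\<close>
  obtain w where w: "w \<in> I'" "!!r. r \<in> I ==> \<iota> (\<phi> r) = r \<odot>\<^sub>I' w"
   using c.inj_I[unfolded baer_def, rule_format, OF conjI[OF I \<iota>\<phi>]] by (elim bexE) blast
  have ry: "r \<odot>\<^sub>M' \<pi> w = \<zero>\<^sub>M'" if r: "r \<in> I" for r
   using mod_hom_smult[OF c.\<pi> IR[OF r] w(1)] w(2)[OF r] c.\<pi>\<iota>[of "\<phi> r"] mod_hom_closed[OF \<phi>, of r] r by simp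
  note y = mod_hom_closed[OF c.\<pi> w(1)]
  \<comment> \<open>Since r x \<in> I forces r \<in> I, the map b + r x -> r (\<pi> w) on J is well
    defined. The hypothesis on J makes it multiplication by some m', so \<pi> w = x m'.\<close>
  have "(zf M') \<in> mod_hom R ((reg R)\<lparr>carrier := I\<rparr>) M'" by (rule mod_homI) auto
  then obtain \<psi> where \<psi>: "\<psi> \<in> mod_hom R ((reg R)\<lparr>carrier := J\<rparr>) M'" "!!b. b \<in> I ==> \<psi> b = \<zero>\<^sub>M'" "\<psi> x = \<pi> w"
   using extend_to[OF c.mM' I J IJ _ y] ry reg by metis
  obtain m' where m': "m' \<in> M'" "!!r. r \<in> J ==> \<psi> r = r \<odot>\<^sub>M' m'" using e'[OF \<psi>(1)] by (elim bexE) simp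
  obtain v where v: "v \<in> I'" "\<pi> v = m'" using m'(1) unfolding c.\<pi>_surj[symmetric] by (elim imageE) simp
  have "b \<odot>\<^sub>I' v \<in> \<iota> ` M" if b: "b \<in> I" for b
   by (rule c.ker\<pi>) (use m'(2)[of b] \<psi>(2)[OF b] b J(2) v mod_hom_smult[OF c.\<pi> IR[OF b] v(1)] IR[OF b] in auto)
  then have iv: "\<exists>m\<in>M. \<iota> m = b \<odot>\<^sub>I' v" if "b \<in> I" for b using that by force
  \<comment> \<open>The lift v of m' is carried by I into the image of M, and this defines \<phi>'.
    The remainder w - x v lies in that image as well and supplies m.\<close>
  define \<phi>' where "\<phi>' b = inv_into (carrier M) \<iota> (b \<odot>\<^sub>I' v)" for b
  have \<phi>': "\<phi>' b \<in> M" "\<iota> (\<phi>' b) = b \<odot>\<^sub>I' v" if "b \<in> I" for b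
   using iv[OF that] inv_into_into[of "b \<odot>\<^sub>I' v" \<iota> "carrier M"] f_inv_into_f[of "b \<odot>\<^sub>I' v" \<iota> "carrier M"]
   unfolding \<phi>'_def by force+
  have h\<phi>': "\<phi>' \<in> mod_hom R ((reg R)\<lparr>carrier := I\<rparr>) M"
  proof (rule mod_homI)
   show "\<phi>' (r \<oplus>\<^bsub>(reg R)\<lparr>carrier := I\<rparr>\<^esub> s) = \<phi>' r \<oplus>\<^sub>M \<phi>' s"
    if "r \<in> ((reg R)\<lparr>carrier := I\<rparr>)" "s \<in> ((reg R)\<lparr>carrier := I\<rparr>)" for r s
   proof (rule c.\<iota>_eq)
    have rs: "r \<in> I" "s \<in> I" "r \<oplus>\<^sub>R s \<in> I" using that module.submoduleE(5)[OF Rg sI, of r s] by auto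
    show "\<phi>' (r \<oplus>\<^bsub>(reg R)\<lparr>carrier := I\<rparr>\<^esub> s) \<in> M" "\<phi>' r \<oplus>\<^sub>M \<phi>' s \<in> M"
     using \<phi>'(1)[OF rs(1)] \<phi>'(1)[OF rs(2)] \<phi>'(1)[OF rs(3)] by auto
    show "\<iota> (\<phi>' (r \<oplus>\<^bsub>(reg R)\<lparr>carrier := I\<rparr>\<^esub> s)) = \<iota> (\<phi>' r \<oplus>\<^sub>M \<phi>' s)"
     using mod_hom_add[OF c.\<iota> \<phi>'(1)[OF rs(1)] \<phi>'(1)[OF rs(2)]] \<phi>'(2)[OF rs(1)] \<phi>'(2)[OF rs(2)] \<phi>'(2)[OF rs(3)]
      c.I.smult_l_distr[OF IR[OF rs(1)] IR[OF rs(2)] v(1)] by simp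
   qed
   show "\<phi>' (r \<odot>\<^bsub>(reg R)\<lparr>carrier := I\<rparr>\<^esub> s) = r \<odot>\<^sub>M \<phi>' s"
    if r: "r \<in> R" and "s \<in> ((reg R)\<lparr>carrier := I\<rparr>)" for r s
   proof (rule c.\<iota>_eq)
    have rs: "s \<in> I" "r \<otimes>\<^sub>R s \<in> I" using that module.submoduleE(4)[OF Rg sI r, of s] by auto
    show "\<phi>' (r \<odot>\<^bsub>(reg R)\<lparr>carrier := I\<rparr>\<^esub> s) \<in> M" "r \<odot>\<^sub>M \<phi>' s \<in> M"
     using \<phi>'(1)[OF rs(1)] \<phi>'(1)[OF rs(2)] r by auto
    show "\<iota> (\<phi>' (r \<odot>\<^bsub>(reg R)\<lparr>carrier := I\<rparr>\<^esub> s)) = \<iota> (r \<odot>\<^sub>M \<phi>' s)"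
     using mod_hom_smult[OF c.\<iota> r \<phi>'(1)[OF rs(1)]] \<phi>'(2)[OF rs(1)] \<phi>'(2)[OF rs(2)]
      c.I.smult_assoc1[OF r IR[OF rs(1)] v(1)] by simp
   qed
  qed (use \<phi>' in auto)
  have "\<pi> (w \<ominus>\<^sub>I' x \<odot>\<^sub>I' v) = \<zero>\<^sub>M'"
   using mod_hom_minus[OF c.mI c.mM' c.\<pi> w(1), of "x \<odot>\<^sub>I' v"] mod_hom_smult[OF c.\<pi> x v(1)] v x y m'(2)[OF J(3)] \<psi>(3) by simp
  then have "w \<ominus>\<^sub>I' x \<odot>\<^sub>I' v \<in> \<iota> ` M" using c.ker\<pi> w(1) v(1) x by simp
  then obtain m where m: "m \<in> M" "w \<ominus>\<^sub>I' x \<odot>\<^sub>I' v = \<iota> m" by blast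
  note \<iota>m = mod_hom_closed[OF c.\<iota> m(1)]
  have weq: "w = x \<odot>\<^sub>I' v \<oplus>\<^sub>I' \<iota> m"
   unfolding m(2)[symmetric] using w(1) v(1) x
   by (simp add: a_minus_def c.I.a_lcomm[of "x \<odot>\<^sub>I' v"] c.I.r_neg)
  have "\<phi> r = x \<odot>\<^sub>M \<phi>' r \<oplus>\<^sub>M r \<odot>\<^sub>M m" if r: "r \<in> I" for r
  proof (rule c.\<iota>_eq)
   show "\<phi> r \<in> M" using mod_hom_closed[OF \<phi>, of r] r by simp
   note p = \<phi>'(1)[OF r]
   show "x \<odot>\<^sub>M \<phi>' r \<oplus>\<^sub>M r \<odot>\<^sub>M m \<in> M" using p m(1) IR[OF r] x by simp
   have "\<iota> (\<phi> r) = r \<odot>\<^sub>I' (x \<odot>\<^sub>I' v) \<oplus>\<^sub>I' r \<odot>\<^sub>I' \<iota> m"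
    using w(2)[OF r] weq c.I.smult_r_distr[OF IR[OF r], of "x \<odot>\<^sub>I' v" "\<iota> m"] x v(1) \<iota>m by simp
   also have "r \<odot>\<^sub>I' (x \<odot>\<^sub>I' v) = x \<odot>\<^sub>I' \<iota> (\<phi>' r)"
    using \<phi>'(2)[OF r] c.I.smult_assoc1[OF x IR[OF r] v(1)] c.I.smult_assoc1[OF IR[OF r] x v(1)]
     R.m_comm[OF x IR[OF r]] by simp
   also have "\<dots> \<oplus>\<^sub>I' r \<odot>\<^sub>I' \<iota> m = \<iota> (x \<odot>\<^sub>M \<phi>' r \<oplus>\<^sub>M r \<odot>\<^sub>M m)"
    using mod_hom_add[OF c.\<iota>] mod_hom_smult[OF c.\<iota>] x p m(1) IR[OF r] by simp
   finally show "\<iota> (\<phi> r) = \<iota> (x \<odot>\<^sub>M \<phi>' r \<oplus>\<^sub>M r \<odot>\<^sub>M m)" .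
  qed
  then show "\<exists>\<phi>'\<in>mod_hom R ((reg R)\<lparr>carrier := I\<rparr>) M. \<exists>m\<in>M. \<forall>r\<in>I. \<phi> r = x \<odot>\<^sub>M \<phi>' r \<oplus>\<^sub>M r \<odot>\<^sub>M m"
   using h\<phi>' m(1) by blast
 qed
next
 case (Suc i)
 obtain I' M' :: "('r, 't) module" and \<iota> \<pi> where c: "cosyzygy R M I' M' \<iota> \<pi>" by (rule cosyzygy[OF Suc.prems(1)])
 have M': "module R M'" using c by (rule cosyzygy.axioms(3))
 have x: "x \<in> R" using J by (meson ideal.Icarr)
 show ?case
  using Suc.IH[OF M'] Suc.prems(2)
  unfolding ext_div_Suc[OF c I x] ext_div_Suc[OF c J(1) R.zero_closed] by blast
qed

text \<open>Here R/I = 0; in degree 1 a map out of R is multiplication by the image of 1.\<close>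

lemma ext_div_top:
 fixes M :: "('r, 't) module"
 assumes "module R M"
 shows "ext_div R \<zero>\<^sub>R M (carrier R) i"
 using assms
proof (induction i arbitrary: M)
 case 0
 interpret M: module R M by fact
 show ?case
  unfolding ext_div_0[OF 0 R.oneideal R.zero_closed] ext1_div_zero[OF 0 subset_refl]
 proof
  fix \<phi> assume "\<phi> \<in> mod_hom R ((reg R)\<lparr>carrier := carrier R\<rparr>) M"
  then have \<phi>: "\<phi> \<in> mod_hom R (reg R) M" using mod_hom_from_sub by (simp add: mod_hom_def)
  show "\<exists>m\<in>M. \<forall>r\<in>R. \<phi> r = r \<odot>\<^sub>M m"
  proof (intro bexI ballI)
   show "\<phi> \<one>\<^sub>R \<in> M" using mod_hom_closed[OF \<phi>, of "\<one>\<^sub>R"] by simp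
   show "\<phi> r = r \<odot>\<^sub>M \<phi> \<one>\<^sub>R" if "r \<in> R" for r
    using mod_hom_smult[OF \<phi> that, of "\<one>\<^sub>R"] that by simp
  qed
 qed
next
 case (Suc i)
 obtain I' M' :: "('r, 't) module" and \<iota> \<pi> where c: "cosyzygy R M I' M' \<iota> \<pi>" by (rule cosyzygy[OF Suc.prems])
 show ?case unfolding ext_div_Suc[OF c R.oneideal R.zero_closed] by (rule Suc.IH[OF cosyzygy.axioms(3)[OF c]])
qed

end

text \<open>The sum H + Ry, obtained as the domain of an extension of the zero map.\<close>

lemma adjoin_element:
 assumes M: "module R M" and H: "submodule H R M" and y: "y \<in> M"
 obtains L where "submodule L R M" "H \<subseteq> L" "y \<in> L" "!!x. x \<in> L ==> \<exists>l\<in>H. \<exists>r\<in>carrier R. x = l \<oplus>\<^sub>M r \<odot>\<^sub>M y"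
proof -
 interpret module R M by fact
 have h: "(zf M) \<in> mod_hom R (M\<lparr>carrier := H\<rparr>) M" by (rule mod_homI) auto
 show ?thesis
 proof (rule mod_hom_extend_one[OF M M H h y zero_closed])
  fix L and f' :: "'c => 'c" assume L: "submodule L R M" "H \<subseteq> L" "y \<in> L"
   "!!x. x \<in> L ==> \<exists>l\<in>H. \<exists>r\<in>R. x = l \<oplus>\<^sub>M r \<odot>\<^sub>M y \<and> f' x = \<zero>\<^sub>M \<oplus>\<^sub>M r \<odot>\<^sub>M \<zero>\<^sub>M"
  show ?thesis using L(4) by (intro that[OF L(1,2,3)]) blast
 qed simp
qed

text \<open>Generators are removed one at a time: if Z lies in K + Rg, then g = x (l + r g) + h with
  l in K and h in H, so (1 - x r) g lies in K and the unit can be cancelled.\<close>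

lemma nakayama:
 assumes F: "module R F" and Z: "submodule Z R F" and H: "submodule H R F" and fg: "fin_gen R F Z"
  and x: "x \<in> carrier R" and unit: "!!r. r \<in> carrier R ==> \<one>\<^sub>R \<ominus>\<^sub>R x \<otimes>\<^sub>R r \<in> Units R"
  and ZxZ: "!!z. z \<in> Z ==> \<exists>f\<in>Z. \<exists>h\<in>H. z = x \<odot>\<^sub>F f \<oplus>\<^sub>F h"
 shows "Z \<subseteq> H"
proof -
 interpret F: module R F by fact
 obtain G where G: "G \<subseteq> Z" "finite G" "!!K. submodule K R F ==> G \<subseteq> K ==> Z \<subseteq> K"
  using fg unfolding fin_gen_def by blast
 have claim: "Z \<subseteq> H" if "finite G" "G \<subseteq> Z" "!!K. submodule K R F ==> H \<subseteq> K ==> G \<subseteq> K ==> Z \<subseteq> K" for G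
  using that
 proof (induction G)
  case empty
  show ?case by (rule empty(2)) (use H in auto)
 next
  case (insert g G)
  have g: "g \<in> F" using insert.prems(1) F.submodule_carrier[OF Z] by blast
  show ?case
  proof (rule insert.IH)
   fix K assume K: "submodule K R F" "H \<subseteq> K" "G \<subseteq> K"
   obtain L where L: "submodule L R F" "K \<subseteq> L" "g \<in> L"
    and LK: "!!x. x \<in> L ==> \<exists>l\<in>K. \<exists>r\<in>R. x = l \<oplus>\<^sub>F r \<odot>\<^sub>F g"
    by (rule adjoin_element[OF F K(1) g]) blast
   have ZL: "Z \<subseteq> L" by (rule insert.prems(2)) (use L K in auto)
   obtain f h where f: "f \<in> Z" and h: "h \<in> H" and gf: "g = x \<odot>\<^sub>F f \<oplus>\<^sub>F h" using ZxZ insert.prems(1) by blast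
   obtain l r where l: "l \<in> K" and r: "r \<in> R" and fl: "f = l \<oplus>\<^sub>F r \<odot>\<^sub>F g" using LK f ZL by blast
   note c = F.submodule_carrier[OF K(1) l] F.submodule_carrier[OF H h]
   let ?u = "\<one>\<^sub>R \<ominus>\<^sub>R x \<otimes>\<^sub>R r"
   have u: "?u \<in> Units R" by (rule unit[OF r])
   then have uc: "?u \<in> R" "inv\<^bsub>R\<^esub> ?u \<in> R" "inv\<^bsub>R\<^esub> ?u \<otimes>\<^sub>R ?u = \<one>\<^sub>R" by auto
   have xl: "x \<odot>\<^sub>F l \<oplus>\<^sub>F h \<in> K" using F.submoduleE(5)[OF K(1) F.submoduleE(4)[OF K(1) x l]] K(2) h by blast
   have "g = (x \<odot>\<^sub>F l \<oplus>\<^sub>F h) \<oplus>\<^sub>F (x \<otimes>\<^sub>R r) \<odot>\<^sub>F g"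
    using gf fl c r x g by (simp add: F.smult_r_distr F.smult_assoc1 F.a_ac)
   moreover have "?u \<odot>\<^sub>F g = g \<ominus>\<^sub>F (x \<otimes>\<^sub>R r) \<odot>\<^sub>F g"
    using x r g by (simp add: a_minus_def F.smult_l_distr F.smult_l_minus)
   moreover have "(p \<oplus>\<^sub>F q) \<ominus>\<^sub>F q = p" if "p \<in> F" "q \<in> F" for p q
    using that by (simp add: a_minus_def F.a_assoc F.r_neg)
   ultimately have "?u \<odot>\<^sub>F g = x \<odot>\<^sub>F l \<oplus>\<^sub>F h"
    using x r g c by (metis F.smult_closed F.a_closed F.R.m_closed)
   then have "inv\<^bsub>R\<^esub> ?u \<odot>\<^sub>F (?u \<odot>\<^sub>F g) \<in> K" using F.submoduleE(4)[OF K(1) uc(2) xl] by simp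
   then have "g \<in> K" using F.smult_assoc1[OF uc(2,1) g] uc(3) g by simp
   then show "Z \<subseteq> K" by (intro insert.prems(2)) (use K in auto)
  qed (use insert.prems(1) in simp)
 qed
 show ?thesis by (rule claim[OF G(2,1,3)])
qed

context large_type
begin

text \<open>A copy of R inside the large type, where its cosyzygies are formed.\<close>

abbreviation V :: "('r, 't) module" where "V \<equiv> transport j (reg R)"

lemma V_inj: "inj_on j (carrier (reg R))" using j by (rule inj_on_subset) simp

lemmas mV = transport_module[OF Rg V_inj]

text \<open>Over R itself the cocycles form a submodule of a finite free module, hence are finitely
  generated, and Nakayama's lemma applies to them modulo the coboundaries.\<close>

lemma coh_div_nakayama:
 assumes res: "ideal_resolution R a B A" and x: "x \<in> carrier R"
  and unit: "!!r. r \<in> carrier R ==> \<one>\<^sub>R \<ominus>\<^sub>R x \<otimes>\<^sub>R r \<in> Units R"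
  and c: "coh_div R x V B A i"
 shows "coh_div R \<zero>\<^sub>R V B A i"
proof -
 note rm = ideal_res_rmat[OF res] and fin = ideal_res_finite[OF res]
 have "coh_div R x (reg R) B A i"
  by (rule coh_div_iso[OF mV(1) Rg mV(3,2) inv_into_f_f[OF V_inj] rm x c])
 note c = this[unfolded coh_div_def, rule_format]
 let ?F = "fmod R (B (Suc i))"
 note d = pull_hom[OF Rg rm fin fin]
 have F: "module R (fmod R X)" for X :: "nat set" by (rule dsum_module[OF Rg])
 let ?Z = "a_kernel ?F (fmod R (B (Suc (Suc i)))) (cobd (R) (reg R) B A (Suc i))"
 let ?H = "cobd R (reg R) B A i ` fmod R (B i)"
 have Z: "submodule ?Z R ?F" by (rule submodule_kernel[OF F F d])
 have ZD: "e \<in> ?Z \<longleftrightarrow> e \<in> dprod (reg R) (B (Suc i)) \<and> cobd R (reg R) B A (Suc i) e = zf (reg R)" for e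
  unfolding a_kernel_def'' using dsum_finite[OF fin, of "reg R" "Suc i"] by simp
 have ZH: "?Z \<subseteq> ?H"
 proof (rule nakayama[OF F Z submodule_range[OF F F d] submodule_free_fin_gen[OF R noeth fin Z] x unit])
  fix e assume "e \<in> ?Z"
  then obtain f g where fg: "f \<in> dprod (reg R) (B (Suc i))"
   "cobd R (reg R) B A (Suc i) f = zf (reg R)" "g \<in> dprod (reg R) (B i)"
   "!!b. e b = x \<odot>\<^bsub>reg R\<^esub> f b \<oplus>\<^bsub>reg R\<^esub> cobd R (reg R) B A i g b"
   using c[of e] unfolding ZD by blast
  then have "f \<in> ?Z" "cobd R (reg R) B A i g \<in> ?H" unfolding ZD using dsum_finite[OF fin, of "reg R"] by auto
  moreover have "e = x \<odot>\<^sub>?F f \<oplus>\<^sub>?F cobd R (reg R) B A i g" using fg(4) by (simp add: fun_eq_iff)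
  ultimately show "\<exists>f\<in>?Z. \<exists>h\<in>?H. e = x \<odot>\<^sub>?F f \<oplus>\<^sub>?F h" by blast
 qed
 have "ext_exact R (reg R) B A i"
  unfolding ext_exact_def using ZH dsum_finite[OF fin, of "reg R" i] unfolding subset_iff ZD by (auto simp del: regular_module_simps)
 then have "coh_div R \<zero>\<^sub>R (reg R) B A i" unfolding coh_div_zero[where R = R and N = "reg R" and B = B and A = A, OF Rg rm] .
 then show ?thesis
  by (intro coh_div_iso[where A = A and B = B, OF Rg mV(1) mV(2,3) _ rm R.zero_closed]) (auto simp: f_inv_into_f)
qed

text \<open>An ideal maximal among those with non-vanishing Ext is prime; a nonzero element
 of the maximal ideal then acts surjectively on Ext, against Nakayama.\<close>

lemma ext_div_all_ideals:
 assumes m: "ideal m R" "\<one>\<^sub>R \<notin> m" and unit: "!!r. r \<in> R ==> r \<notin> m ==> r \<in> Units R"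
  and base: "!!i. n \<le> i ==> ext_div R \<zero>\<^sub>R V m i"
  and a: "ideal a R" and i: "n \<le> i"
 shows "ext_div R \<zero>\<^sub>R V a i"
proof (rule ccontr)
 assume bad: "\<not> ext_div R \<zero>\<^sub>R V a i"
 \<comment> \<open>All degrees are treated together because the prime case for b in degree i uses
   the larger ideal in degree i + 1.\<close>
 define good where "good a \<longleftrightarrow> (\<forall>i\<ge>n. ext_div R \<zero>\<^sub>R V a i)" for a
 let ?\<F> = "{a. ideal a R \<and> \<not> good a}"
 obtain b where b: "b \<in> ?\<F>" and max: "!!J. J \<in> ?\<F> ==> b \<subseteq> J ==> J = b"
  using noetherian_maximal_ideal[OF noeth, of ?\<F>] a bad i unfolding good_def by blast
 have I: "ideal b R" and ng: "\<not> good b" using b by auto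
 have sub: "r \<in> R" if "ideal c R" "r \<in> c" for r c using that by (rule ideal.Icarr)
 have larger: "good J" if "ideal J R" "b \<subseteq> J" "y \<in> J" "y \<notin> b" for J y
  using max[of J] that by blast
 have adjoin: "\<exists>J. ideal J R \<and> b \<subseteq> J \<and> x \<in> J \<and> (\<forall>s\<in>J. \<exists>l\<in>b. \<exists>r\<in>R. s = l \<oplus>\<^sub>R r \<otimes>\<^sub>R x)"
  if "x \<in> R" for x
  using adjoin_element[OF Rg, of b x] that I unfolding ideal_submodule[OF R] by (metis regular_module_simps)
 show False
 proof (cases "\<exists>x\<in>R. \<exists>y\<in>R. x \<notin> b \<and> y \<notin> b \<and> y \<otimes>\<^sub>R x \<in> b")
  \<comment> \<open>The maximal counterexample b is not prime here. Both b + Rx and (b : x) are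
    strictly larger, hence good, and b is controlled by the two.\<close>
  case True
  then obtain x y where xy: "x \<in> R" "y \<in> R" "x \<notin> b" "y \<notin> b" "y \<otimes>\<^sub>R x \<in> b" by blast
  obtain J where J: "ideal J R" "b \<subseteq> J" "x \<in> J" "!!s. s \<in> J ==> \<exists>l\<in>b. \<exists>r\<in>R. s = l \<oplus>\<^sub>R r \<otimes>\<^sub>R x"
   using adjoin[OF xy(1)] by blast
  let ?C = "colon R (reg R) b x"
  have C: "ideal ?C R" using colon_ideal[OF Rg, of b x] I xy(1) ideal_submodule[OF R] by simp
  have "b \<subseteq> ?C" using sub[OF I] ideal.I_r_closed[OF I _ xy(1)] unfolding colon_def by auto
  moreover have "y \<in> ?C" using xy unfolding colon_def by simp
  ultimately have "good ?C" using larger[OF C] xy(4) by blast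
  then have "good b"
   using ext_div_add_colon[OF mV(1) I J] larger[OF J(1,2,3) xy(3)] unfolding good_def by blast
  then show False using ng by blast
 next
  case False
  have "b \<noteq> carrier R" using ext_div_top[OF mV(1)] ng unfolding good_def by auto
  then have one: "\<one>\<^sub>R \<notin> b" using ideal.one_imp_carrier[OF I] by blast
  have bm: "b \<subseteq> m"
  proof
   fix r assume r: "r \<in> b"
   show "r \<in> m"
   proof (rule ccontr)
    assume "r \<notin> m"
    then have "r \<in> Units R" using unit sub[OF I r] by blast
    then show False using ideal.I_l_closed[OF I r R.Units_inv_closed] R.Units_l_inv one by metis
   qed
  qed
  \<comment> \<open>As m is good by hypothesis, some x lies in m but not in b. It is regular modulo
    b, and 1 - x r is a unit for every r.\<close>
  have "b \<noteq> m" using base ng unfolding good_def by auto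
  then obtain x where x: "x \<in> m" "x \<notin> b" using bm by blast
  note xR = sub[OF m(1) x(1)]
  obtain J where J: "ideal J R" "b \<subseteq> J" "x \<in> J" "!!s. s \<in> J ==> \<exists>l\<in>b. \<exists>r\<in>R. s = l \<oplus>\<^sub>R r \<otimes>\<^sub>R x"
   using adjoin[OF xR] by blast
  have reg: "r \<in> b" if "r \<in> R" "r \<otimes>\<^sub>R x \<in> b" for r using False that x(2) xR by blast
  have gJ: "good J" by (rule larger[OF J(1,2,3) x(2)])
  have u: "\<one>\<^sub>R \<ominus>\<^sub>R x \<otimes>\<^sub>R r \<in> Units R" if r: "r \<in> R" for r
  proof (rule unit)
   have xr: "x \<otimes>\<^sub>R r \<in> m" by (rule ideal.I_r_closed[OF m(1) x(1) r])
   show "\<one>\<^sub>R \<ominus>\<^sub>R x \<otimes>\<^sub>R r \<notin> m"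
   proof
    assume "\<one>\<^sub>R \<ominus>\<^sub>R x \<otimes>\<^sub>R r \<in> m"
    then have "(\<one>\<^sub>R \<ominus>\<^sub>R x \<otimes>\<^sub>R r) \<oplus>\<^sub>R x \<otimes>\<^sub>R r \<in> m"
     using additive_subgroup.a_closed[OF ideal.axioms(1)[OF m(1)] _ xr] by blast
    then show False using m(2) xR r by (simp add: a_minus_def R.a_assoc R.l_neg)
   qed
  qed (use xR r in simp)
  have "ext_div R \<zero>\<^sub>R V b i" if "n \<le> i" for i
  proof -
   have "ext_div R x V b i"
    using ext_div_regular[OF mV(1) I J reg] gJ that unfolding good_def by simp
   then show ?thesis unfolding ext_div_def using coh_div_nakayama[OF _ xR u] by blast
  qed
  then show False using ng unfolding good_def by blast
 qed
qed

end

section \<open>Finite injective dimension\<close>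

lemma injective_resolutionD:
 assumes "injective_resolution R M I \<eta> \<delta>"
 shows injres_inj: "injective_module R (I i)" and injres_eta: "\<eta> \<in> mod_hom R M (I 0)" "inj_on \<eta> (carrier M)"
  and injres_delta: "\<delta> i \<in> mod_hom R (I i) (I (Suc i))"
  and injres_exact0: "\<eta> ` carrier M = a_kernel (I 0) (I (Suc 0)) (\<delta> 0)"
  and injres_exact: "\<delta> i ` carrier (I i) = a_kernel (I (Suc i)) (I (Suc (Suc i))) (\<delta> (Suc i))"
 using assms unfolding injective_resolution_def by auto

lemma injres_module: "injective_resolution R M I \<eta> \<delta> ==> module R (I i)"
 using injres_inj[of R M I \<eta> \<delta> i] by (simp add: injective_module_def)

lemma injres_baer: "injective_resolution R M I \<eta> \<delta> ==> baer R (I i)"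
 using injres_inj[of R M I \<eta> \<delta> i] injective_module_iff_baer[OF injres_module[of R M I \<eta> \<delta> i]] by simp

text \<open>Induction on the length: the image of \<delta> 0 is a cosyzygy of K and is resolved by
  the shifted sequence. Coefficients are taken as a submodule K of I 0 because the cosyzygies arise
  in this form, as submodules of terms of the resolution.\<close>

lemma sub_resolution_ext_exact:
 assumes "module R M" and res: "free_resolution R M B A \<mu>"
  and "injective_resolution R ((I 0)\<lparr>carrier := K\<rparr>) I (\<lambda>x. x) \<delta>"
  and "!!i. n < i ==> is_zero_module (I i)" and "n \<le> i"
 shows "ext_exact R ((I 0)\<lparr>carrier := K\<rparr>) B A i"
 using assms(3-)
proof (induction n arbitrary: I K \<delta> i)
 case 0
 note r = 0(1) and m = injres_module[OF 0(1)]
 have "carrier (I (Suc 0)) = {\<zero>\<^bsub>I (Suc 0)\<^esub>}" using 0(2)[of "Suc 0"] by (simp add: is_zero_module_def)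
 then have "a_kernel (I 0) (I (Suc 0)) (\<delta> 0) = carrier (I 0)"
  using mod_hom_closed[OF injres_delta[OF r], of _ 0] unfolding a_kernel_def'' by auto
 then have "(I 0)\<lparr>carrier := K\<rparr> = I 0" using injres_exact0[OF r] by simp
 then show ?case using ext_exact_injective[OF m injres_baer[OF r] res] by metis
next
 case (Suc n)
 note r = Suc.prems(1) and m = injres_module[OF Suc.prems(1)] and d = injres_delta[OF Suc.prems(1)]
 interpret M: module R M by fact
 have K: "K = a_kernel (I 0) (I (Suc 0)) (\<delta> 0)" using injres_exact0[OF r] by simp
 have sK: "submodule K R (I 0)" unfolding K by (rule submodule_kernel[OF m m d])
 obtain i' where i': "i = Suc i'" using Suc.prems(3) by (cases i) auto
 let ?L = "\<delta> 0 ` I 0"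
 let ?M' = "(I (Suc 0))\<lparr>carrier := ?L\<rparr>"
 have sL: "submodule ?L R (I (Suc 0))" by (rule submodule_range[OF m m d])
 interpret c: cosyzygy R "(I 0)\<lparr>carrier := K\<rparr>" "I 0" ?M' "\<lambda>x. x" "\<delta> 0"
 proof (intro cosyzygy.intro cosyzygy_axioms.intro)
  show "\<delta> 0 \<in> mod_hom R (I 0) ?M'" by (rule mod_hom_into[OF d]) simp
  show "(\<lambda>x. x) ` ((I 0)\<lparr>carrier := K\<rparr>) = a_kernel (I 0) ?M' (\<delta> 0)" unfolding a_kernel_def'' K by simp
 qed (auto intro: sub_module[OF m] sK sL m injres_baer[OF r] injres_eta(1)[OF r])
 have "injective_resolution R ?M' (\<lambda>i. I (Suc i)) (\<lambda>x. x) (\<lambda>i. \<delta> (Suc i))"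
  unfolding injective_resolution_def One_nat_def
 proof (intro conjI allI)
  show "(\<lambda>x. x) \<in> mod_hom R ?M' (I (Suc 0))"
   by (rule mod_hom_restrict[OF mod_hom_id]) (use module.submodule_carrier[OF m sL] in blast)
  show "(\<lambda>x. x) ` ?M' = a_kernel (I (Suc 0)) (I (Suc (Suc 0))) (\<delta> (Suc 0))" using injres_exact[OF r, of 0] by simp
 qed (use injres_inj[OF r] d injres_exact[OF r] in auto)
 then have "ext_exact R ?M' B A i'" by (rule Suc.IH) (use Suc.prems i' in auto)
 then show ?case
  using c.coh_div_shift[OF res M.R.zero_closed, of i'] coh_div_zero[OF c.mM, of B A] coh_div_zero[OF c.mM', of B A]
   res_rmat[OF M.is_cring res] unfolding i' by blast
qed

lemma injective_resolution_ext_exact: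
 assumes M: "module R M" and Q: "module R Q" and res: "free_resolution R Q B A \<mu>"
  and r: "injective_resolution R M I \<eta> \<delta>" and z: "!!i. n < i ==> is_zero_module (I i)" and i: "n \<le> i"
 shows "ext_exact R M B A i"
proof -
 interpret M: module R M by fact
 let ?K = "\<eta> ` M"
 let ?M = "(I 0)\<lparr>carrier := ?K\<rparr>"
 note m = injres_module[OF r] and \<eta> = injres_eta[OF r]
 have sK: "submodule ?K R (I 0)" by (rule submodule_range[OF M m \<eta>(1)])
 have mM: "module R ?M" by (rule sub_module[OF m sK])
 have \<eta>': "\<eta> \<in> mod_hom R M ?M" by (rule mod_hom_into[OF \<eta>(1)]) simp
 have "injective_resolution R ?M I (\<lambda>x. x) \<delta>"
  unfolding injective_resolution_def One_nat_def
 proof (intro conjI allI)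
  show "(\<lambda>x. x) \<in> mod_hom R ?M (I 0)"
   by (rule mod_hom_restrict[OF mod_hom_id]) (use module.submodule_carrier[OF m sK] in blast)
 qed (use injres_inj[OF r] injres_delta[OF r] injres_exact[OF r] injres_exact0[OF r] in auto)
 then have "ext_exact R ?M B A i" by (rule sub_resolution_ext_exact[OF Q res]) (use z i in auto)
 then have "coh_div R \<zero>\<^sub>R ?M B A i" using coh_div_zero[OF mM, of B A] res_rmat[OF M.is_cring res] by blast
 then have "coh_div R \<zero>\<^sub>R M B A i"
  by (intro coh_div_iso[where A = A and B = B, OF mM M mod_hom_inv[OF M \<eta>' \<eta>(2)] \<eta>' inv_into_f_f[OF \<eta>(2)]
     res_rmat[OF M.is_cring res] M.R.zero_closed]) auto
 then show ?thesis using coh_div_zero[OF M, of B A] res_rmat[OF M.is_cring res] by blast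
qed

context large_type
begin

lemma baer_of_ext_div:
 assumes M: "module R M" and e: "!!a. ideal a R ==> ext_div R \<zero>\<^sub>R M a 0"
 shows "baer R M"
 unfolding baer_def
proof (intro allI impI, elim conjE)
 fix a \<phi> assume a: "ideal a R" and \<phi>: "\<phi> \<in> mod_hom R ((reg R)\<lparr>carrier := a\<rparr>) M"
 show "\<exists>y\<in>M. \<forall>r\<in>a. \<phi> r = r \<odot>\<^sub>M y"
  using e[OF a] \<phi> additive_subgroup.a_subset[OF ideal.axioms(1)[OF a]]
  unfolding ext_div_0[OF M a R.zero_closed] by (simp add: ext1_div_zero[OF M])
qed

text \<open>When Ext^1(R/a, M) vanishes for every ideal a, the module M is injective by Baer's
  criterion. After n cosyzygies this is the case, so the resolution can stop there and continue by
  zero modules.\<close>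

lemma injective_resolution_exists:
 fixes M :: "('r, 't) module"
 assumes "module R M" and "!!a i. ideal a R ==> n \<le> i ==> ext_div R \<zero>\<^sub>R M a i"
 shows "\<exists>(I :: nat => ('r, 't) module) \<eta> \<delta>. injective_resolution R M I \<eta> \<delta> \<and> (\<forall>i>n. is_zero_module (I i))"
 using assms
proof (induction n arbitrary: M)
 case 0
 note M = 0(1)
 interpret M: module R M by fact
 have bM: "baer R M" by (rule baer_of_ext_div[OF M]) (simp add: 0)
 let ?Z = "M\<lparr>carrier := {\<zero>\<^sub>M}\<rparr>"
 have zs: "submodule {\<zero>\<^sub>M} R M" by (rule M.submoduleI) auto
 have mZ: "module R ?Z" by (rule sub_module[OF M zs])
 have bZ: "baer R ?Z"
  unfolding baer_def
 proof (intro allI impI, elim conjE)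
  fix a \<phi> assume a: "ideal a R" and \<phi>: "\<phi> \<in> mod_hom R ((reg R)\<lparr>carrier := a\<rparr>) ?Z"
  show "\<exists>y\<in>?Z. \<forall>r\<in>a. \<phi> r = r \<odot>\<^sub>?Z y"
   using mod_hom_closed[OF \<phi>] ideal.Icarr[OF a] by simp
 qed
 define I where "I i = (if i = 0 then M else ?Z)" for i :: nat
 have "injective_resolution R M I (\<lambda>x. x) (\<lambda>_ _. \<zero>\<^sub>M)"
  unfolding injective_resolution_def
 proof (intro conjI allI)
  show "injective_module R (I i)" for i
   using injective_module_iff_baer[OF M] injective_module_iff_baer[OF mZ] bM bZ by (simp add: I_def)
  show "(zf M) \<in> mod_hom R (I i) (I (Suc i))" for i by (rule mod_homI) (auto simp: I_def)
  show "(zf M) ` I i = a_kernel (I (Suc i)) (I (Suc (Suc i))) (zf M)" for i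
   unfolding a_kernel_def'' by (auto simp: I_def)
 qed (auto simp: I_def mod_hom_id a_kernel_def'')
 moreover have "\<forall>i>0. is_zero_module (I i)" by (simp add: I_def is_zero_module_def)
 ultimately show ?case by blast
next
 case (Suc n)
 obtain I0 M' :: "('r, 't) module" and \<iota> \<pi> where "cosyzygy R M I0 M' \<iota> \<pi>" by (rule cosyzygy[OF Suc.prems(1)])
 then interpret c: cosyzygy R M I0 M' \<iota> \<pi> .
 have "ext_div R \<zero>\<^sub>R M' a i" if "ideal a R" "n \<le> i" for a i
  using Suc.prems(2)[OF that(1), of "Suc i"] that ext_div_Suc[OF c.cosyzygy_axioms that(1) R.zero_closed] by simp
 then obtain I' :: "nat => ('r, 't) module" and \<eta>' \<delta>' where r: "injective_resolution R M' I' \<eta>' \<delta>'"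
  and z: "\<forall>i>n. is_zero_module (I' i)" using Suc.IH[OF c.mM'] by blast
 define I where "I i = (case i of 0 => I0 | Suc i => I' i)" for i
 define \<delta> where "\<delta> i = (case i of 0 => (\<lambda>x. \<eta>' (\<pi> x)) | Suc i => \<delta>' i)" for i
 note \<eta>' = injres_eta[OF r]
 have ker: "\<eta>' (\<pi> x) = \<zero>\<^bsub>I' 0\<^esub> \<longleftrightarrow> \<pi> x = \<zero>\<^sub>M'" if "x \<in> I0" for x
  using mod_hom_zero[OF c.mM' injres_module[OF r] \<eta>'(1)] \<eta>'(2) mod_hom_closed[OF c.\<pi> that] by (metis inj_onD c.M'.zero_closed)
 have "injective_resolution R M I \<iota> \<delta>"
  unfolding injective_resolution_def
 proof (intro conjI allI)
  show "injective_module R (I i)" for i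
   using injective_module_iff_baer[OF c.mI] c.inj_I injres_inj[OF r] by (cases i) (simp_all add: I_def)
  show "\<iota> \<in> mod_hom R M (I 0)" using c.\<iota> by (simp add: I_def)
  show "inj_on \<iota> (carrier M)" by (rule c.\<iota>_inj)
  show "\<delta> i \<in> mod_hom R (I i) (I (Suc i))" for i
   using mod_hom_comp[OF c.\<pi> \<eta>'(1)] injres_delta[OF r] by (cases i) (simp_all add: I_def \<delta>_def)
  show "\<iota> ` M = a_kernel (I 0) (I 1) (\<delta> 0)"
   unfolding c.exact unfolding a_kernel_def'' using ker by (auto simp: I_def \<delta>_def)
  show "\<delta> i ` I i = a_kernel (I (Suc i)) (I (Suc (Suc i))) (\<delta> (Suc i))" for i
  proof (cases i)
   case 0
   have "(\<lambda>x. \<eta>' (\<pi> x)) ` I0 = \<eta>' ` M'" unfolding c.\<pi>_surj[symmetric] by (simp add: image_image)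
   then show ?thesis using 0 injres_exact0[OF r] by (simp add: I_def \<delta>_def)
  next
   case (Suc k)
   then show ?thesis using injres_exact[OF r, of k] by (simp add: I_def \<delta>_def)
  qed
 qed
 moreover have "\<forall>i>Suc n. is_zero_module (I i)" using z by (auto simp: I_def split: nat.split)
 ultimately show ?case by blast
qed

lemma ext_div_V:
 assumes "ideal a R" "ideal_resolution R a B A"
 shows "ext_div R \<zero>\<^sub>R V a i \<longleftrightarrow> ext_exact R (reg R) B A i"
proof -
 note rm = ideal_res_rmat[OF assms(2)]
 have "ext_div R \<zero>\<^sub>R V a i \<longleftrightarrow> coh_div R \<zero>\<^sub>R V B A i"
  by (rule coh_div_iff_ext_div[OF mV(1) assms(1) R.zero_closed assms(2), symmetric])
 also have "\<dots> \<longleftrightarrow> coh_div R \<zero>\<^sub>R (reg R) B A i"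
 proof
  show "coh_div R \<zero>\<^sub>R (reg R) B A i" if "coh_div R \<zero>\<^sub>R V B A i"
   by (rule coh_div_iso[where A = A and B = B, OF mV(1) Rg mV(3,2) inv_into_f_f[OF V_inj] rm R.zero_closed that])
  show "coh_div R \<zero>\<^sub>R V B A i" if "coh_div R \<zero>\<^sub>R (reg R) B A i"
   by (rule coh_div_iso[where A = A and B = B, OF Rg mV(1) mV(2,3) _ rm R.zero_closed that]) (auto simp: f_inv_into_f)
 qed
 also have "\<dots> \<longleftrightarrow> ext_exact R (reg R) B A i" by (rule coh_div_zero[where A = A and B = B, OF Rg rm])
 finally show ?thesis .
qed

end

text \<open>\<open>big\<close> is the type in which \<open>finite_injective_dimension\<close> looks
  for resolutions, so those built in the locale are of the kind that the definition asks
  for.\<close>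

lemma large_type_big:
 assumes "cring R" "noetherian_ring R"
 shows "large_type (R :: ('r, 'c) ring_scheme) (\<lambda>r. {[Inl r]} :: ('r, 'r) big)"
proof (rule large_type.intro[OF assms])
 show "infinite (UNIV :: ('r, 'r) big set)" by (simp add: Finite_Set.finite_set infinite_UNIV_listI)
qed (auto simp: inj_def)

text \<open>One n serves all ideals. The resolution is built for the copy V of R and then
  precomposed with the copying map.\<close>

lemma finite_injective_dimension_if_ext_vanish:
 fixes R :: "('r, 'c) ring_scheme"
 assumes R: "cring R" "noetherian_ring R"
  and e: "!!a. ideal a R ==> \<exists>B A. ideal_resolution R a B A \<and> (\<forall>i\<ge>n. ext_exact R (reg R) B A i)"
 shows "finite_injective_dimension R (reg R)"
proof -
 interpret large_type R "\<lambda>r. {[Inl r]} :: ('r, 'r) big" by (rule large_type_big[OF R])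
 have "ext_div R \<zero>\<^sub>R V a i" if "ideal a R" "n \<le> i" for a i using e[OF that(1)] ext_div_V[OF that(1)] that(2) by blast
 then obtain I :: "nat => ('r, ('r, 'r) big) module" and \<eta> \<delta> where r: "injective_resolution R V I \<eta> \<delta>"
  and z: "\<forall>i>n. is_zero_module (I i)" using injective_resolution_exists[OF mV(1)] by blast
 have "injective_resolution R (reg R) I (\<lambda>r. \<eta> {[Inl r]}) \<delta>"
  unfolding injective_resolution_def One_nat_def
 proof (intro conjI allI)
  show "(\<lambda>r. \<eta> {[Inl r]}) \<in> mod_hom R (reg R) (I 0)" by (rule mod_hom_comp[OF mV(2) injres_eta(1)[OF r]])
  show "inj_on (\<lambda>r. \<eta> {[Inl r]}) (carrier (reg R))"
   using comp_inj_on[OF V_inj, of \<eta>] injres_eta(2)[OF r] by (simp add: comp_def)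
  show "(\<lambda>r. \<eta> {[Inl r]}) ` reg R = a_kernel (I 0) (I (Suc 0)) (\<delta> 0)"
   unfolding injres_exact0[OF r, symmetric] by (simp add: image_image)
 qed (use injres_inj[OF r] injres_delta[OF r] injres_exact[OF r] in auto)
 then show ?thesis unfolding finite_injective_dimension_def using z by blast
qed

lemma ext_vanish_if_finite_injective_dimension:
 assumes R: "cring R" "noetherian_ring R" and f: "finite_injective_dimension R (reg R)"
 obtains n where "!!a B A i. ideal a R ==> ideal_resolution R a B A ==> n \<le> i ==> ext_exact R (reg R) B A i"
proof -
 interpret large_type R "\<lambda>r. {[Inl r]} :: ('a, 'a) big" by (rule large_type_big[OF R])
 obtain n and I :: "nat => ('a, ('a, 'a) big) module" and \<eta> \<delta> where r: "injective_resolution R (reg R) I \<eta> \<delta>"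
  and z: "\<forall>i>n. is_zero_module (I i)" using f unfolding finite_injective_dimension_def by blast
 have "ext_exact R (reg R) B A i" if "ideal a R" "ideal_resolution R a B A" "n \<le> i" for a B A i
  by (rule injective_resolution_ext_exact[OF Rg _ quotient_resolution[OF that(1,2)] r _ that(3)])
   (use z that(1) ideal_submodule[OF R(1)] quotient_module_module[OF Rg] in auto)
 then show ?thesis by (rule that)
qed

lemma local_ext_vanish:
 assumes R: "cring R" "noetherian_ring R"
  and m: "ideal m R" "\<one>\<^sub>R \<notin> m" and unit: "!!r. r \<in> R ==> r \<notin> m ==> r \<in> Units R"
  and res: "ideal_resolution R m B A" and base: "!!i. n \<le> i ==> ext_exact R (reg R) B A i"
  and a: "ideal a R" and res': "ideal_resolution R a B' A'" and i: "n \<le> i"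
 shows "ext_exact R (reg R) B' A' i"
proof -
 interpret large_type R "\<lambda>r. {[Inl r]} :: ('a, 'a) big" by (rule large_type_big[OF R])
 show ?thesis
  using ext_div_all_ideals[OF m unit _ a i] base ext_div_V[OF m(1) res] ext_div_V[OF a res'] by blast
qed

section \<open>Restriction of scalars\<close>

lemma restrict_scalars_simps [simp]:
 "carrier (restrict_scalars V \<phi>) = carrier V" "add (restrict_scalars V \<phi>) = add V"
 "zero (restrict_scalars V \<phi>) = zero V" "smult (restrict_scalars V \<phi>) = (\<lambda>r x. \<phi> r \<otimes>\<^sub>V x)"
 by (simp_all add: restrict_scalars_def)

lemma restrict_scalars_finsum [simp]: "finsum (restrict_scalars V \<phi>) f X = finsum V f X"
 unfolding finsum_def finprod_def by simp

lemma restrict_scalars_module: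
 assumes R: "cring R" and V: "cring V" and \<phi>: "\<phi> \<in> ring_hom R V"
 shows "module R (restrict_scalars V \<phi>)"
proof -
 interpret R: cring R by fact
 interpret V: cring V by fact
 note c = ring_hom_closed[OF \<phi>]
 show ?thesis
  by (rule moduleI[OF R])
   (auto intro!: abelian_groupI simp: V.a_ac V.m_assoc V.l_distr V.r_distr c ring_hom_add[OF \<phi>] ring_hom_mult[OF \<phi>] ring_hom_one[OF \<phi>]
    intro: V.l_neg dest: V.add.l_inv_ex)
qed

text \<open>Scalars of R enter \<open>push\<close> only through the entries of A, which act via
  \<phi>; so a change of scalars is a change of entries.\<close>

lemma push_restrict: "push (restrict_scalars V \<phi>) C A = push (reg V) C (\<lambda>b c. \<phi> (A b c))"
proof
 have "finsum (dsum (restrict_scalars V \<phi>) C) g X = finsum (fmod V C) g X" for g :: "'x => _" and X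
  unfolding finsum_def finprod_def by (simp add: dsum_def)
 then show "push (restrict_scalars V \<phi>) C A f = push (reg V) C (\<lambda>b c. \<phi> (A b c)) f" for f
  unfolding push_def lext_def by simp
qed

lemma dsum_restrict: "carrier (dsum (restrict_scalars V \<phi>) B) = carrier (fmod V B)"
 by (simp add: dsum_def)

lemma dprod_restrict: "dprod (restrict_scalars V \<phi>) B = dprod (reg V) B"
 by (simp add: dprod_def)

lemma tor_exact_restrict: "tor_exact S (restrict_scalars V \<phi>) B A i \<longleftrightarrow> tor_exact (\<phi> ` S) (reg V) B (\<lambda>i b c. \<phi> (A i b c)) i"
 unfolding tor_exact_def dsum_restrict push_restrict by simp

lemma rmat_map:
 assumes "cring R" "cring V" and \<phi>: "\<phi> \<in> ring_hom R V" and A: "rmat R B C A"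
 shows "rmat V B C (\<lambda>b c. \<phi> (A b c))"
 unfolding rmat_def
proof
 fix b assume b: "b \<in> B"
 have z: "\<phi> \<zero>\<^sub>R = \<zero>\<^sub>V" by (rule ring_hom_zero[OF \<phi> cring.axioms(1)[OF assms(1)] cring.axioms(1)[OF assms(2)]])
 note a = rmat_row[OF A b, unfolded free_eq_dsum]
 show "(\<lambda>c. \<phi> (A b c)) \<in> free_module V C"
  unfolding free_eq_dsum
 proof (rule dsumI)
  show "finite {c. \<phi> (A b c) \<noteq> \<zero>\<^bsub>reg V\<^esub>}"
   by (rule finite_subset[OF _ dsum_fin[OF a]]) (use z in auto)
 qed (use dsumD[OF a] ring_hom_closed[OF \<phi>] z in auto)
qed

lemma pull_restrict:
 assumes R: "cring R" and V: "cring V" and \<phi>: "\<phi> \<in> ring_hom R V" and A: "rmat R B C A" and e: "e \<in> dprod (reg V) C"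
 shows "pull R (restrict_scalars V \<phi>) B A e = pull V (reg V) B (\<lambda>b c. \<phi> (A b c)) e"
proof
 fix b
 have "lin_ext R (restrict_scalars V \<phi>) e (A b) = lin_ext V (reg V) e (\<lambda>c. \<phi> (A b c))" if b: "b \<in> B"
 proof -
  have z: "\<phi> \<zero>\<^sub>R = \<zero>\<^sub>V" by (rule ring_hom_zero[OF \<phi> cring.axioms(1)[OF R] cring.axioms(1)[OF V]])
  note a = rmat_row[OF A b] and a' = rmat_row[OF rmat_map[OF R V \<phi> A] b]
  have "lin_ext V (reg V) e (\<lambda>c. \<phi> (A b c)) = (\<Oplus>\<^bsub>reg V\<^esub>c\<in>{c. A b c \<noteq> \<zero>\<^sub>R}. \<phi> (A b c) \<odot>\<^bsub>reg V\<^esub> e c)"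
   by (rule lin_ext_superset[OF reg_module[OF V] a'])
    (use dprod_val[OF e] z dsumD[OF a[unfolded free_eq_dsum]] in auto)
  then show ?thesis unfolding lin_ext_def[of R] by simp
 qed
 then show "pull R (restrict_scalars V \<phi>) B A e b = pull V (reg V) B (\<lambda>b c. \<phi> (A b c)) e b"
  by (simp add: pull_def)
qed

lemma coh_exact_restrict:
 assumes R: "cring R" and V: "cring V" and \<phi>: "\<phi> \<in> ring_hom R V" and A: "!!i. rmat R (B (Suc i)) (B i) (A i)"
 shows "coh_exact R S (restrict_scalars V \<phi>) B A i \<longleftrightarrow> coh_exact V (\<phi> ` S) (reg V) B (\<lambda>i b c. \<phi> (A i b c)) i"
 unfolding coh_exact_def dprod_restrict using pull_restrict[OF R V \<phi> A] by (simp cong: ball_cong bex_cong)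

section \<open>Localization\<close>

locale mult_closed = cring R for R :: "('a, 'c) ring_scheme" (structure) +
 fixes S :: "'a set"
 assumes S: "S \<subseteq> carrier R" and S_one: "\<one> \<in> S" and S_mult: "s \<in> S ==> t \<in> S ==> s \<otimes> t \<in> S"
begin

abbreviation F where "F \<equiv> fraction R S"
abbreviation L where "L \<equiv> localization R S"

lemma S_carrier: "s \<in> S ==> s \<in> carrier R" using S by blast

lemma fraction_mem: "a \<in> carrier R ==> s \<in> S ==>
  (b, t) \<in> F a s \<longleftrightarrow> b \<in> carrier R \<and> t \<in> S \<and> (\<exists>u\<in>S. u \<otimes> (t \<otimes> a) = u \<otimes> (s \<otimes> b))"
proof -
 assume a: "a \<in> R" "s \<in> S"
 have "u \<otimes> (t \<otimes> a \<ominus> s \<otimes> b) = \<zero> \<longleftrightarrow> u \<otimes> (t \<otimes> a) = u \<otimes> (s \<otimes> b)" if "u \<in> S" "t \<in> S" "b \<in> R" for u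
 proof -
  have "u \<otimes> (t \<otimes> a \<ominus> s \<otimes> b) = u \<otimes> (t \<otimes> a) \<ominus> u \<otimes> (s \<otimes> b)"
   using that a S_carrier by (simp add: a_minus_def r_distr r_minus)
  then show ?thesis using that a S_carrier by (simp add: a_minus_eq_zero_iff)
 qed
 then show ?thesis unfolding fraction_def by auto
qed

lemma fraction_sub:
 assumes "(b, t) \<in> F a s" "a \<in> carrier R" "s \<in> S"
 shows "F b t \<subseteq> F a s"
proof
 fix x assume x: "x \<in> F b t"
 obtain c v where xv: "x = (c, v)" by force
 obtain u where b: "b \<in> R" "t \<in> S" and u: "u \<in> S" "u \<otimes> (t \<otimes> a) = u \<otimes> (s \<otimes> b)"
  using assms fraction_mem by blast
 obtain w where c: "c \<in> R" "v \<in> S" and w: "w \<in> S" "w \<otimes> (v \<otimes> b) = w \<otimes> (t \<otimes> c)"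
  using x b fraction_mem[OF b] unfolding xv by blast
 note [simp] = S_carrier[OF assms(3)] S_carrier[OF b(2)] S_carrier[OF u(1)] S_carrier[OF c(2)] S_carrier[OF w(1)] assms(2) b(1) c(1)
 have "(w \<otimes> u \<otimes> t) \<otimes> (v \<otimes> a) = (w \<otimes> v) \<otimes> (u \<otimes> (t \<otimes> a))" by (simp add: m_ac)
 also have "\<dots> = (u \<otimes> s) \<otimes> (w \<otimes> (v \<otimes> b))" unfolding u(2) by (simp add: m_ac)
 also have "\<dots> = (w \<otimes> u \<otimes> t) \<otimes> (s \<otimes> c)" unfolding w(2) by (simp add: m_ac)
 finally show "x \<in> F a s" unfolding xv fraction_mem[OF assms(2,3)] using c S_mult u(1) w(1) b(2) by blast
qed

lemma fraction_eq_iff: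
 assumes "a \<in> carrier R" "s \<in> S" "b \<in> carrier R" "t \<in> S"
 shows "F a s = F b t \<longleftrightarrow> (\<exists>u\<in>S. u \<otimes> (t \<otimes> a) = u \<otimes> (s \<otimes> b))"
proof
 have "(b, t) \<in> F b t" unfolding fraction_mem[OF assms(3,4)] using assms S_one by blast
 then show "\<exists>u\<in>S. u \<otimes> (t \<otimes> a) = u \<otimes> (s \<otimes> b)" if "F a s = F b t"
  using that fraction_mem[OF assms(1,2)] by blast
 assume u: "\<exists>u\<in>S. u \<otimes> (t \<otimes> a) = u \<otimes> (s \<otimes> b)"
 then have "(b, t) \<in> F a s" "(a, s) \<in> F b t"
  unfolding fraction_mem[OF assms(1,2)] fraction_mem[OF assms(3,4)] using assms by (blast, metis)
 then show "F a s = F b t" using fraction_sub assms by blast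
qed

lemma fraction_eqI:
 assumes "a \<in> carrier R" "s \<in> S" "b \<in> carrier R" "t \<in> S" "t \<otimes> a = s \<otimes> b"
 shows "F a s = F b t"
 using fraction_eq_iff[OF assms(1-4)] assms(5) S_one by metis

lemma fraction_rep:
 assumes "(b, t) \<in> F a s" "a \<in> carrier R" "s \<in> S"
 shows "b \<in> carrier R" "t \<in> S" "\<exists>u\<in>S. u \<otimes> (t \<otimes> a) = u \<otimes> (s \<otimes> b)"
 using assms fraction_mem by blast+

lemma fraction_self: "a \<in> carrier R ==> s \<in> S ==> (a, s) \<in> F a s"
 using fraction_mem S_one by blast

lemma L_carrier: "carrier L = {F a s | a s. a \<in> carrier R \<and> s \<in> S}"
 and L_one: "\<one>\<^sub>L = F \<one> \<one>" and L_zero: "\<zero>\<^sub>L = F \<zero> \<one>"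
 by (simp_all add: localization_def)

lemma L_closed: "a \<in> carrier R ==> s \<in> S ==> F a s \<in> carrier L"
 unfolding L_carrier by blast

lemma L_cases:
 assumes "x \<in> carrier L"
 obtains a s where "a \<in> carrier R" "s \<in> S" "x = F a s"
 using assms unfolding L_carrier by blast

text \<open>The product is defined as a union over all pairs of representatives; it is a single
  fraction because all pairs give the same one.\<close>

lemma L_mult:
 assumes a: "a \<in> carrier R" "s \<in> S" and b: "b \<in> carrier R" "t \<in> S"
 shows "F a s \<otimes>\<^sub>L F b t = F (a \<otimes> b) (s \<otimes> t)"
proof -
 have *: "F (a' \<otimes> b') (s' \<otimes> t') = F (a \<otimes> b) (s \<otimes> t)" if a': "(a', s') \<in> F a s" and b': "(b', t') \<in> F b t" for a' s' b' t'
 proof -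
  obtain u where u: "u \<in> S" "u \<otimes> (s' \<otimes> a) = u \<otimes> (s \<otimes> a')" using fraction_rep(3)[OF a' a] by blast
  obtain v where v: "v \<in> S" "v \<otimes> (t' \<otimes> b) = v \<otimes> (t \<otimes> b')" using fraction_rep(3)[OF b' b] by blast
  note ra = fraction_rep(1,2)[OF a' a] and rb = fraction_rep(1,2)[OF b' b]
  note [simp] = a(1) b(1) ra(1) rb(1) a(2)[THEN S_carrier] b(2)[THEN S_carrier] ra(2)[THEN S_carrier] rb(2)[THEN S_carrier]
   u(1)[THEN S_carrier] v(1)[THEN S_carrier]
  have "(u \<otimes> v) \<otimes> ((s \<otimes> t) \<otimes> (a' \<otimes> b')) = (u \<otimes> (s \<otimes> a')) \<otimes> (v \<otimes> (t \<otimes> b'))" by (simp add: m_ac)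
  also have "\<dots> = (u \<otimes> v) \<otimes> ((s' \<otimes> t') \<otimes> (a \<otimes> b))" unfolding u(2)[symmetric] v(2)[symmetric] by (simp add: m_ac)
  finally show ?thesis
   by (subst fraction_eq_iff) (use S_mult[OF u(1) v(1)] S_mult[OF a(2) b(2)] S_mult[OF ra(2) rb(2)] in auto)
 qed
 have "F a s \<otimes>\<^sub>L F b t = (\<Union>(a', s')\<in>F a s. \<Union>(b', t')\<in>F b t. F (a' \<otimes> b') (s' \<otimes> t'))"
  by (simp add: localization_def)
 also have "\<dots> = F (a \<otimes> b) (s \<otimes> t)"
  by (rule UN_eq_const[OF fraction_self[OF a]], clarify, rule UN_eq_const[OF fraction_self[OF b]], clarify, rule *)
 finally show ?thesis .
qed

lemma L_add:
 assumes a: "a \<in> carrier R" "s \<in> S" and b: "b \<in> carrier R" "t \<in> S"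
 shows "F a s \<oplus>\<^sub>L F b t = F (t \<otimes> a \<oplus> s \<otimes> b) (s \<otimes> t)"
proof -
 have *: "F (t' \<otimes> a' \<oplus> s' \<otimes> b') (s' \<otimes> t') = F (t \<otimes> a \<oplus> s \<otimes> b) (s \<otimes> t)" if a': "(a', s') \<in> F a s" and b': "(b', t') \<in> F b t" for a' s' b' t'
 proof -
  obtain u where u: "u \<in> S" "u \<otimes> (s' \<otimes> a) = u \<otimes> (s \<otimes> a')" using fraction_rep(3)[OF a' a] by blast
  obtain v where v: "v \<in> S" "v \<otimes> (t' \<otimes> b) = v \<otimes> (t \<otimes> b')" using fraction_rep(3)[OF b' b] by blast
  note ra = fraction_rep(1,2)[OF a' a] and rb = fraction_rep(1,2)[OF b' b]
  note [simp] = a(1) b(1) ra(1) rb(1) a(2)[THEN S_carrier] b(2)[THEN S_carrier] ra(2)[THEN S_carrier] rb(2)[THEN S_carrier]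
   u(1)[THEN S_carrier] v(1)[THEN S_carrier]
  have "(u \<otimes> v) \<otimes> ((s \<otimes> t) \<otimes> (t' \<otimes> a' \<oplus> s' \<otimes> b')) =
    (v \<otimes> t \<otimes> t') \<otimes> (u \<otimes> (s \<otimes> a')) \<oplus> (u \<otimes> s \<otimes> s') \<otimes> (v \<otimes> (t \<otimes> b'))" by (simp add: r_distr m_ac)
  also have "\<dots> = (u \<otimes> v) \<otimes> ((s' \<otimes> t') \<otimes> (t \<otimes> a \<oplus> s \<otimes> b))"
   unfolding u(2)[symmetric] v(2)[symmetric] by (simp add: r_distr m_ac)
  finally show ?thesis
   by (subst fraction_eq_iff) (use S_mult[OF u(1) v(1)] S_mult[OF a(2) b(2)] S_mult[OF ra(2) rb(2)] in auto)
 qed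
 have "F a s \<oplus>\<^sub>L F b t = (\<Union>(a', s')\<in>F a s. \<Union>(b', t')\<in>F b t. F (t' \<otimes> a' \<oplus> s' \<otimes> b') (s' \<otimes> t'))"
  by (simp add: localization_def)
 also have "\<dots> = F (t \<otimes> a \<oplus> s \<otimes> b) (s \<otimes> t)"
  by (rule UN_eq_const[OF fraction_self[OF a]], clarify, rule UN_eq_const[OF fraction_self[OF b]], clarify, rule *)
 finally show ?thesis .
qed

lemma L_neg:
 assumes "a \<in> carrier R" "s \<in> S"
 shows "F (\<ominus> a) s \<oplus>\<^sub>L F a s = \<zero>\<^sub>L"
proof -
 have "F (\<ominus> a) s \<oplus>\<^sub>L F a s = F \<zero> (s \<otimes> s)" using assms S_carrier by (simp add: L_add r_minus l_neg)
 also have "\<dots> = F \<zero> \<one>" by (rule fraction_eqI) (use assms S_carrier S_mult S_one in auto)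
 finally show ?thesis by (simp add: L_zero)
qed

lemma L_cring: "cring L"
proof (rule cringI)
 note c = S_carrier S_mult S_one
 show "abelian_group L"
 proof (rule abelian_groupI)
  fix x assume "x \<in> L"
  then obtain a s where x: "a \<in> R" "s \<in> S" "x = F a s" by (rule L_cases)
  then show "\<exists>y\<in>L. y \<oplus>\<^sub>L x = \<zero>\<^sub>L" using L_neg[of a s] L_closed[of "\<ominus> a" s] by auto
 qed (auto elim!: L_cases intro!: L_closed simp: L_add L_zero c m_ac r_distr a_ac)
 show "comm_monoid L"
  by (rule comm_monoidI) (auto elim!: L_cases intro!: L_closed simp: L_mult L_one c m_ac)
 show "(x \<oplus>\<^sub>L y) \<otimes>\<^sub>L z = x \<otimes>\<^sub>L z \<oplus>\<^sub>L y \<otimes>\<^sub>L z" if xyz: "x \<in> L" "y \<in> L" "z \<in> L" for x y z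
 proof -
  obtain a r where a: "a \<in> R" "r \<in> S" "x = F a r" by (rule L_cases[OF xyz(1)])
  obtain b s where b: "b \<in> R" "s \<in> S" "y = F b s" by (rule L_cases[OF xyz(2)])
  obtain d t where d: "d \<in> R" "t \<in> S" "z = F d t" by (rule L_cases[OF xyz(3)])
  have "F ((s \<otimes> a \<oplus> r \<otimes> b) \<otimes> d) (r \<otimes> s \<otimes> t) =
    F (s \<otimes> t \<otimes> (a \<otimes> d) \<oplus> r \<otimes> t \<otimes> (b \<otimes> d)) (r \<otimes> t \<otimes> (s \<otimes> t))"
   by (rule fraction_eqI) (use a b d c in \<open>simp_all add: m_ac r_distr l_distr\<close>)
  then show ?thesis using a b d c by (simp add: L_mult L_add)
 qed
qed

sublocale L: cring L by (rule L_cring)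

abbreviation \<phi> where "\<phi> r \<equiv> F r \<one>"

lemma \<phi>_hom: "\<phi> \<in> ring_hom R L"
 by (rule ring_hom_memI) (auto simp: L_closed L_mult L_add L_one S_one)

lemmas \<phi>_closed = ring_hom_closed[OF \<phi>_hom]

lemma \<phi>_zero: "r \<in> carrier R ==> \<phi> r = \<zero>\<^sub>L \<longleftrightarrow> (\<exists>u\<in>S. u \<otimes> r = \<zero>)"
 unfolding L_zero using fraction_eq_iff[of r \<one> \<zero> \<one>] S_one S_carrier by auto

lemma fraction_eq_mult: "a \<in> carrier R ==> s \<in> S ==> F a s = F \<one> s \<otimes>\<^sub>L \<phi> a"
 using S_one S_carrier by (simp add: L_mult)

lemma \<phi>_cancel: "a \<in> carrier R ==> s \<in> S ==> \<phi> s \<otimes>\<^sub>L F a s = \<phi> a"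
 using fraction_eqI[of "s \<otimes> a" s a \<one>] S_one S_carrier by (simp add: L_mult)

lemma \<phi>_unit: "s \<in> S ==> F \<one> s \<otimes>\<^sub>L \<phi> s = \<one>\<^sub>L"
 using fraction_eqI[of s s \<one> \<one>] S_one S_carrier by (simp add: L_mult L_one)

section \<open>Ideals of the localization\<close>

definition ext_ideal :: "'a set => ('a \<times> 'a) set set" where "ext_ideal a = {F x s | x s. x \<in> a \<and> s \<in> S}"

lemma ext_ideal:
 assumes a: "ideal a R"
 shows "ideal (ext_ideal a) L"
proof -
 interpret a: ideal a R by fact
 interpret M: module L "reg L" by (rule reg_module[OF L_cring])
 note c = S_carrier S_mult S_one L_closed L_mult L_add
 have "submodule (ext_ideal a) L (reg L)"
 proof (rule M.submoduleI)
  have "\<zero>\<^sub>L \<in> ext_ideal a" unfolding ext_ideal_def L_zero using S_one a.zero_closed by blast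
  then show "\<zero>\<^bsub>reg L\<^esub> \<in> ext_ideal a" by simp
  show "\<ominus>\<^bsub>reg L\<^esub> x \<in> ext_ideal a" if x: "x \<in> ext_ideal a" for x
  proof -
   obtain r s where r: "r \<in> a" "s \<in> S" "x = F r s" using x unfolding ext_ideal_def by blast
   have rc: "r \<in> R" by (rule a.Icarr[OF r(1)])
   have "\<ominus>\<^sub>L x = F (\<ominus> r) s" using L.minus_equality[OF L_neg[OF rc r(2)]] r rc L_closed by simp
   then show ?thesis using r a.a_inv_closed[OF r(1)] unfolding ext_ideal_def by auto
  qed
  show "x \<oplus>\<^bsub>reg L\<^esub> y \<in> ext_ideal a" if x: "x \<in> ext_ideal a" and y: "y \<in> ext_ideal a" for x y
  proof -
   obtain r s where r: "r \<in> a" "s \<in> S" "x = F r s" using x unfolding ext_ideal_def by blast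
   obtain q t where q: "q \<in> a" "t \<in> S" "y = F q t" using y unfolding ext_ideal_def by blast
   have "x \<oplus>\<^sub>L y = F (t \<otimes> r \<oplus> s \<otimes> q) (s \<otimes> t)" using r q a.Icarr by (simp add: L_add)
   moreover have "t \<otimes> r \<oplus> s \<otimes> q \<in> a" using a.I_l_closed r q S_carrier by auto
   ultimately show ?thesis unfolding ext_ideal_def using S_mult[OF r(2) q(2)] by auto
  qed
  show "x \<odot>\<^bsub>reg L\<^esub> y \<in> ext_ideal a" if x: "x \<in> L" and y: "y \<in> ext_ideal a" for x y
  proof -
   obtain r s where r: "r \<in> R" "s \<in> S" "x = F r s" by (rule L_cases[OF x])
   obtain q t where q: "q \<in> a" "t \<in> S" "y = F q t" using y unfolding ext_ideal_def by blast
   have "x \<otimes>\<^sub>L y = F (r \<otimes> q) (s \<otimes> t)" using r q a.Icarr by (simp add: L_mult)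
   then show ?thesis unfolding ext_ideal_def using a.I_l_closed[OF q(1) r(1)] S_mult[OF r(2) q(2)] by auto
  qed
 qed (use a.Icarr L_closed in \<open>auto simp: ext_ideal_def\<close>)
 then show ?thesis using ideal_submodule[OF L_cring] by blast
qed

lemma fraction_in_ideal:
 assumes J: "ideal J L" and a: "a \<in> carrier R" "s \<in> S"
 shows "F a s \<in> J \<longleftrightarrow> \<phi> a \<in> J"
 using ideal.I_l_closed[OF J, of "\<phi> a" "F \<one> s"] ideal.I_l_closed[OF J, of "F a s" "\<phi> s"]
  fraction_eq_mult[OF a] \<phi>_cancel[OF a] \<phi>_closed L_closed[OF one_closed a(2)] S_carrier[OF a(2)] by metis

text \<open>This is what allows an ideal of the localization to be resolved by localizing a
  resolution of its preimage in R.\<close>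

lemma ideal_extended:
 assumes J: "ideal J L"
 shows "ideal {r \<in> carrier R. \<phi> r \<in> J} R" "J = ext_ideal {r \<in> carrier R. \<phi> r \<in> J}"
proof -
 show "ideal {r \<in> R. \<phi> r \<in> J} R" by (rule ring_hom_ring.ideal_vimage[OF ring_hom_ringI2[OF ring_axioms L.ring_axioms \<phi>_hom] J])
 show "J = ext_ideal {r \<in> R. \<phi> r \<in> J}"
 proof
  show "J \<subseteq> ext_ideal {r \<in> R. \<phi> r \<in> J}"
  proof
   fix x assume x: "x \<in> J"
   obtain a s where a: "a \<in> R" "s \<in> S" "x = F a s" by (rule L_cases[OF ideal.Icarr[OF J x]])
   then show "x \<in> ext_ideal {r \<in> R. \<phi> r \<in> J}" using x fraction_in_ideal[OF J a(1,2)] unfolding ext_ideal_def by auto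
  qed
  show "ext_ideal {r \<in> R. \<phi> r \<in> J} \<subseteq> J" using fraction_in_ideal[OF J] unfolding ext_ideal_def by auto
 qed
qed

text \<open>Relates the explicit set of fractions x/s to the form of \<open>loc_ideal\<close>, which
  is given by generators; finite generation passes to the localization the same way.\<close>

lemma ext_ideal_eq_genideal:
 assumes a: "ideal a R" and A: "A \<subseteq> carrier R" "a = Idl A"
 shows "ext_ideal a = Idl\<^bsub>L\<^esub> (\<phi> ` A)"
proof
 have sub: "\<phi> ` A \<subseteq> L" using A(1) \<phi>_closed by blast
 note J = L.genideal_ideal[OF sub]
 note pre = ideal_extended[OF J]
 have "A \<subseteq> {r \<in> R. \<phi> r \<in> Idl\<^bsub>L\<^esub> (\<phi> ` A)}" using A(1) L.genideal_self[OF sub] by blast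
 then have "a \<subseteq> {r \<in> R. \<phi> r \<in> Idl\<^bsub>L\<^esub> (\<phi> ` A)}" unfolding A(2) by (rule genideal_minimal[OF pre(1)])
 then show "ext_ideal a \<subseteq> Idl\<^bsub>L\<^esub> (\<phi> ` A)" using fraction_in_ideal[OF J] unfolding ext_ideal_def by blast
 have "\<phi> ` A \<subseteq> ext_ideal a" using genideal_self[OF A(1)] S_one unfolding ext_ideal_def A(2) by blast
 then show "Idl\<^bsub>L\<^esub> (\<phi> ` A) \<subseteq> ext_ideal a" by (rule L.genideal_minimal[OF ext_ideal[OF a]])
qed

lemma L_noetherian:
 assumes "noetherian_ring R"
 shows "noetherian_ring L"
proof (rule noetherian_ring.intro[OF L.ring_axioms noetherian_ring_axioms.intro])
 fix J assume J: "ideal J L"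
 note pre = ideal_extended[OF J]
 obtain A where A: "A \<subseteq> R" "finite A" "{r \<in> R. \<phi> r \<in> J} = Idl A"
  using noetherian_ring.finetely_gen[OF assms pre(1)] by blast
 have "J = Idl\<^bsub>L\<^esub> (\<phi> ` A)" using pre(2) ext_ideal_eq_genideal[OF pre(1) A(1,3)] by simp
 moreover have "\<phi> ` A \<subseteq> L" "finite (\<phi> ` A)" using A \<phi>_closed by auto
 ultimately show "\<exists>A\<subseteq>carrier L. finite A \<and> J = Idl\<^bsub>L\<^esub> A" by blast
qed

end

section \<open>Localizing complexes and resolutions by finite free modules\<close>

context mult_closed
begin

abbreviation VR where "VR \<equiv> restrict_scalars L \<phi>"

lemma VR: "module R VR" by (rule restrict_scalars_module[OF is_cring L_cring \<phi>_hom])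

lemma VR_inj: "s \<in> S ==> x \<in> carrier VR ==> s \<odot>\<^sub>VR x = \<zero>\<^sub>VR ==> x = \<zero>\<^sub>VR"
 using L.m_assoc[of "F \<one> s" "\<phi> s" x] \<phi>_unit[of s] L_closed[of \<one> s] \<phi>_closed[OF S_carrier, of s] by simp

lemma VR_surj: "s \<in> S ==> x \<in> carrier VR ==> \<exists>y\<in>carrier VR. s \<odot>\<^sub>VR y = x"
 using L.m_assoc[of "\<phi> s" "F \<one> s" x] L.m_comm[of "\<phi> s" "F \<one> s"] \<phi>_unit[of s] L_closed[of \<one> s] \<phi>_closed[OF S_carrier, of s]
 by (intro bexI[of _ "F \<one> s \<otimes>\<^sub>L x"]) auto

lemma \<phi>_mod_hom: "\<phi> \<in> mod_hom R (reg R) VR"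
 by (rule mod_homI) (use \<phi>_closed ring_hom_add[OF \<phi>_hom] ring_hom_mult[OF \<phi>_hom] in auto)

lemma \<phi>_hs: "y \<in> carrier VR ==> \<exists>s\<in>S. \<exists>x\<in>carrier (reg R). s \<odot>\<^sub>VR y = \<phi> x"
 by (auto elim!: L_cases) (metis \<phi>_cancel)

lemma \<phi>_hi: "x \<in> carrier (reg R) ==> \<phi> x = \<zero>\<^sub>VR ==> \<exists>s\<in>S. s \<odot>\<^bsub>reg R\<^esub> x = \<zero>\<^bsub>reg R\<^esub>"
 using \<phi>_zero by simp

text \<open>With finite bases a cochain over the localization comes from R after multiplication by
  one common denominator. Over the localization itself, a coboundary up to S is a
  coboundary.\<close>

lemma ext_exact_localize:
 assumes A: "!!i. rmat R (B (Suc i)) (B i) (A i)" and fin: "!!i. finite (B i)"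
 shows "ext_exact L (reg L) B (\<lambda>i b c. \<phi> (A i b c)) i \<longleftrightarrow> coh_exact R S (reg R) B A i"
proof -
 have "ext_exact L (reg L) B (\<lambda>i b c. \<phi> (A i b c)) i \<longleftrightarrow> coh_exact R {\<one>} VR B A i"
  unfolding coh_exact_restrict[where A = A and B = B, OF is_cring L_cring \<phi>_hom A]
   ext_exact_iff_coh_exact[OF reg_module[OF L_cring]] by (simp add: L_one)
 also have "\<dots> \<longleftrightarrow> coh_exact R S VR B A i"
 proof
  show "coh_exact R S VR B A i" if "coh_exact R {\<one>} VR B A i" using that S_one unfolding coh_exact_def by blast
  assume c: "coh_exact R S VR B A i"
  show "coh_exact R {\<one>} VR B A i"
   unfolding coh_exact_def
  proof (intro ballI impI)
   fix e assume e: "e \<in> dprod VR (B (Suc i))" "cobd R VR B A (Suc i) e = zf VR"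
   then obtain s e' where s: "s \<in> S" and e': "e' \<in> dprod VR (B i)"
    and eq: "(\<lambda>b. s \<odot>\<^sub>VR e b) = cobd R VR B A i e'" using c unfolding coh_exact_def by blast
   have F: "F \<one> s \<in> L" by (rule L_closed[OF one_closed s])
   have hom: "(\<lambda>x. F \<one> s \<otimes>\<^sub>L x) \<in> mod_hom R VR VR"
    by (rule mod_homI) (use F \<phi>_closed L.m_lcomm L.r_distr in auto)
   have "e b = cobd R VR B A i (\<lambda>b. F \<one> s \<otimes>\<^sub>L e' b) b" for b
   proof -
    have v: "e b \<in> L" using dprod_val[OF e(1), of b] by simp
    have "e b = F \<one> s \<otimes>\<^sub>L (\<phi> s \<otimes>\<^sub>L e b)"
     using L.m_assoc[OF F \<phi>_closed[OF S_carrier[OF s]] v] \<phi>_unit[OF s] v by simp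
    also have "\<phi> s \<otimes>\<^sub>L e b = cobd R VR B A i e' b" using fun_cong[OF eq, of b] by simp
    also have "F \<one> s \<otimes>\<^sub>L \<dots> = cobd R VR B A i (\<lambda>b. F \<one> s \<otimes>\<^sub>L e' b) b"
     using pull_natural[OF VR VR hom A dprod_val[OF e']] by simp
    finally show ?thesis .
   qed
   then have "(\<lambda>b. \<one> \<odot>\<^sub>VR e b) = cobd R VR B A i (\<lambda>b. F \<one> s \<otimes>\<^sub>L e' b)"
    using module.smult_one[OF VR dprod_val[OF e(1)]] by (simp only: fun_eq_iff) simp
   then show "\<exists>s\<in>{\<one>}. \<exists>e'\<in>dprod VR (B i). (\<lambda>b. s \<odot>\<^sub>VR e b) = cobd R VR B A i e'"
    using dprod_map[OF VR VR hom e'] by blast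
  qed
 qed
 also have "\<dots> \<longleftrightarrow> coh_exact R S (reg R) B A i"
  by (rule coh_exact_S_iso[where A = A and B = B, symmetric,
     OF reg_module[OF is_cring] VR \<phi>_mod_hom S S_one S_mult \<phi>_hs \<phi>_hi A fin])
 finally show ?thesis .
qed

text \<open>Exactness of localization in the language of \<open>tor_exact\<close>: the map from R to
  its localization is an isomorphism up to S, and over the localization exactness up to S is
  exactness.\<close>

lemma ideal_resolution_localize:
 assumes a: "ideal a R" and res: "ideal_resolution R a B A"
 shows "ideal_resolution L (ext_ideal a) B (\<lambda>i b c. \<phi> (A i b c))"
proof -
 have B0: "B 0 = {0}" and fin: "!!i. finite (B i)" and A: "!!i. rmat R (B (Suc i)) (B i) (A i)"
  and im0: "bd (reg R) B A 0 ` fmod R (B (Suc 0)) = {f \<in> fmod R (B 0). f 0 \<in> a}"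
  and im: "!!i. bd (reg R) B A (Suc i) ` fmod R (B (Suc (Suc i))) =
   {f \<in> fmod R (B (Suc i)). bd (reg R) B A i f = (\<lambda>_. \<zero>)}"
  using res unfolding ideal_resolution_def by blast+
 note Rg = reg_module[OF is_cring] and Lg = reg_module[OF L_cring]
 let ?A = "\<lambda>i b c. \<phi> (A i b c)"
 have A': "!!i. rmat L (B (Suc i)) (B i) (?A i)" by (rule rmat_map[OF is_cring L_cring \<phi>_hom A])
 interpret J: ideal "ext_ideal a" L by (rule ext_ideal[OF a])
 have entry: "?A 0 b 0 \<in> ext_ideal a" if b: "b \<in> B (Suc 0)" for b
 proof -
  have "bd (reg R) B A 0 (sing (reg R) b \<one>) = A 0 b"
   using push_sing[OF Rg A b, of \<one>] rmat_entry[OF A b] by simp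
  then have "A 0 b \<in> bd (reg R) B A 0 ` fmod R (B (Suc 0))"
   using sing_closed[OF Rg b, of \<one>] by force
  then show ?thesis unfolding im0 ext_ideal_def using S_one by auto
 qed
 show ?thesis
  unfolding ideal_resolution_def
 proof (intro conjI allI B0 fin A')
  \<comment> \<open>This image is compared with an ideal and not with a kernel, so it is computed by
    hand: the numerator is lifted over R, and the lift is divided by s.\<close>
  show "bd (reg L) B ?A 0 ` fmod L (B (Suc 0)) = {f \<in> fmod L (B 0). f 0 \<in> ext_ideal a}"
  proof (intro equalityI subsetI)
   fix f assume "f \<in> bd (reg L) B ?A 0 ` fmod L (B (Suc 0))"
   then obtain g where g: "g \<in> fmod L (B (Suc 0))" "f = bd (reg L) B ?A 0 g" by blast
   note h = push_hom[OF Lg A', of 0]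
   have "bd (reg L) B ?A 0 g 0 \<in> ext_ideal a"
    using Lg g(1)
   proof (induction g rule: dsum_induct)
    case zero
    then show ?case using mod_hom_zero[OF dsum_module[OF Lg] dsum_module[OF Lg] h] by simp
   next
    case (add b y f)
    note s = sing_closed[OF Lg add(1,2)]
    have "bd (reg L) B ?A 0 (\<lambda>c. sing (reg L) b y c \<oplus>\<^bsub>reg L\<^esub> f c) 0 = ?A 0 b 0 \<otimes>\<^sub>L y \<oplus>\<^sub>L bd (reg L) B ?A 0 f 0"
     using mod_hom_add[OF h s add(3)] push_sing[OF Lg A' add(1,2)] by simp
    then show ?case using J.a_closed[OF J.I_r_closed[OF entry[OF add(1)]] add(4), of y] add(2) by simp
   qed
   then show "f \<in> {f \<in> fmod L (B 0). f 0 \<in> ext_ideal a}" using g mod_hom_closed[OF h g(1)] by simp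
  next
   fix f assume "f \<in> {f \<in> fmod L (B 0). f 0 \<in> ext_ideal a}"
   then have f: "f \<in> fmod L (B 0)" and "f 0 \<in> ext_ideal a" by auto
   then obtain r s where r: "r \<in> a" "s \<in> S" "f 0 = F r s" unfolding ext_ideal_def by blast
   note rc = ideal.Icarr[OF a r(1)]
   have "sing (reg R) (0::nat) r \<in> {f \<in> fmod R (B 0). f 0 \<in> a}"
    using sing_closed[OF Rg, of "0::nat" "B 0" r] rc r B0 by (simp add: sing_def)
   then obtain g where g: "g \<in> fmod R (B (Suc 0))" "sing (reg R) 0 r = bd (reg R) B A 0 g"
    unfolding im0[symmetric] by blast
   note F = L_closed[OF one_closed r(2)]
   have \<phi>g: "(\<lambda>b. \<phi> (g b)) \<in> fmod L (B (Suc 0))"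
    using mod_hom_closed[OF dsum_map_hom[OF Rg VR \<phi>_mod_hom] g(1)] unfolding dsum_restrict .
   have "bd (reg L) B ?A 0 (\<lambda>b. \<phi> (g b)) = (\<lambda>c. \<phi> (sing (reg R) 0 r c))"
    using push_natural[OF Rg VR \<phi>_mod_hom A g(1)] unfolding push_restrict g(2) .
   then have p: "bd (reg L) B ?A 0 (\<lambda>b. \<phi> (g b)) = sing (reg L) 0 (\<phi> r)"
    by (auto simp: sing_def L_zero fun_eq_iff)
   have "bd (reg L) B ?A 0 (F \<one> s \<odot>\<^bsub>fmod L (B (Suc 0))\<^esub> (\<lambda>b. \<phi> (g b))) = (\<lambda>c. F \<one> s \<otimes>\<^sub>L sing (reg L) 0 (\<phi> r) c)"
    using mod_hom_smult[OF push_hom[OF Lg A', of 0] F \<phi>g] unfolding p by simp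
   also have "\<dots> = f"
    using fraction_eq_mult[OF rc r(2)] r(3) dsum_out[OF f] B0 F by (auto simp: sing_def fun_eq_iff)
   finally have e: "bd (reg L) B ?A 0 (F \<one> s \<odot>\<^bsub>fmod L (B (Suc 0))\<^esub> (\<lambda>b. \<phi> (g b))) = f" .
   show "f \<in> bd (reg L) B ?A 0 ` fmod L (B (Suc 0))"
    by (rule image_eqI) (rule e[symmetric], rule module.smult_closed[OF dsum_module[OF Lg] F \<phi>g])
  qed
 next
  fix i
  have "tor_exact S (reg R) B A i"
   unfolding tor_exact_def
  proof (intro ballI impI)
   fix z assume z: "z \<in> fmod R (B (Suc i))" "bd (reg R) B A i z = zf (reg R)"
   then have "z \<in> bd (reg R) B A (Suc i) ` fmod R (B (Suc (Suc i)))" unfolding im by simp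
   then obtain w where w: "w \<in> fmod R (B (Suc (Suc i)))" "z = bd (reg R) B A (Suc i) w" by (rule imageE)
   have "(\<lambda>b. \<one> \<odot>\<^bsub>reg R\<^esub> z b) = z" using dsum_val[OF z(1)] by (simp add: fun_eq_iff)
   then have "(\<lambda>b. \<one> \<odot>\<^bsub>reg R\<^esub> z b) = bd (reg R) B A (Suc i) w" using w(2) by (rule trans)
   then show "\<exists>s\<in>S. \<exists>w\<in>fmod R (B (Suc (Suc i))). (\<lambda>b. s \<odot>\<^bsub>reg R\<^esub> z b) = bd (reg R) B A (Suc i) w"
    using S_one w(1) by blast
  qed
  then have "tor_exact S VR B A i"
   using tor_exact_S_iso[where A = A and B = B, OF Rg VR \<phi>_mod_hom S S_one S_mult \<phi>_hs \<phi>_hi A] by blast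
  then have "tor_exact {\<one>} VR B A i" 
   by (subst (asm) tor_exact_S_local[where A = A and B = B, OF VR A S S_one]) (erule (2) VR_inj, erule (1) VR_surj)
  then have t: "tor_exact {\<one>\<^sub>L} (reg L) B ?A i" unfolding tor_exact_restrict by (simp add: L_one)
  show "bd (reg L) B ?A (Suc i) ` fmod L (B (Suc (Suc i))) =
   {f \<in> fmod L (B (Suc i)). bd (reg L) B ?A i f = zf L}"
  proof (intro equalityI subsetI)
   fix f assume "f \<in> bd (reg L) B ?A (Suc i) ` fmod L (B (Suc (Suc i)))"
   then obtain g where g: "g \<in> fmod L (B (Suc (Suc i)))" "f = bd (reg L) B ?A (Suc i) g" by blast
   have z: "bd (reg R) B A i (A (Suc i) b) = (\<lambda>_. \<zero>)" if b: "b \<in> B (Suc (Suc i))" for b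
   proof -
    have "bd (reg R) B A (Suc i) (sing (reg R) b \<one>) = A (Suc i) b"
     using push_sing[OF Rg A b, of \<one>] rmat_entry[OF A b] by simp
    then have "A (Suc i) b \<in> bd (reg R) B A (Suc i) ` fmod R (B (Suc (Suc i)))"
     using sing_closed[OF Rg b, of \<one>] by force
    then show ?thesis unfolding im by simp
   qed
   have "bd VR B A i (bd VR B A (Suc i) g) = zf VR"
    by (rule push_comp_zero[OF VR A A z]) (use g(1) in \<open>simp_all add: dsum_restrict\<close>)
   then show "f \<in> {f \<in> fmod L (B (Suc i)). bd (reg L) B ?A i f = zf L}"
    using g mod_hom_closed[OF push_hom[OF Lg A'] g(1)] unfolding push_restrict by simp
  next
   fix f assume "f \<in> {f \<in> fmod L (B (Suc i)). bd (reg L) B ?A i f = zf L}"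
   then have f: "f \<in> fmod L (B (Suc i))" "bd (reg L) B ?A i f = zf (reg L)" by auto
   have "(\<lambda>b. \<one>\<^sub>L \<odot>\<^bsub>reg L\<^esub> f b) = f" using dsum_val[OF f(1)] by (simp add: fun_eq_iff)
   then show "f \<in> bd (reg L) B ?A (Suc i) ` fmod L (B (Suc (Suc i)))"
    using t[unfolded tor_exact_def, rule_format, OF f] by (elim bexE) (simp only: singleton_iff, rule image_eqI, rule refl)
  qed
 qed
qed

end

section \<open>The residue field and the injective hull at a prime\<close>

locale prime_localization = primeideal P R for P and R :: "('a, 'c) ring_scheme" (structure)
begin

sublocale mult_closed R "carrier R - P"
proof unfold_locales
 show "\<one> \<in> carrier R - P" using I_notcarr one_imp_carrier by auto
qed (use I_prime in auto)

abbreviation S where "S \<equiv> carrier R - P"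
abbreviation M where "M \<equiv> ext_ideal P"

lemma ideal_P: "ideal P R" by (rule ideal_axioms)

lemma L_def: "localization_at R P = L" by (simp add: localization_at_def)

lemma loc_map: "loc_map R P = \<phi>" by (simp add: loc_map_def fun_eq_iff)

lemma M_def: "loc_ideal R P = M"
proof -
 have "P = Idl P" using genideal_self[OF a_subset] genideal_minimal[OF ideal_P subset_refl] by blast
 then show ?thesis unfolding loc_ideal_def L_def loc_map by (rule ext_ideal_eq_genideal[OF ideal_P a_subset, symmetric])
qed

lemma ideal_M: "ideal M L" by (rule ext_ideal[OF ideal_P])

lemma fraction_in_M:
 assumes a: "a \<in> carrier R" "s \<in> S"
 shows "F a s \<in> M \<longleftrightarrow> a \<in> P"
proof
 assume "F a s \<in> M"
 then obtain b t where b: "b \<in> P" "t \<in> S" "F a s = F b t" unfolding ext_ideal_def by blast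
 have bR: "b \<in> R" by (rule Icarr[OF b(1)])
 then obtain u where u: "u \<in> S" "u \<otimes> (t \<otimes> a) = u \<otimes> (s \<otimes> b)" using b fraction_eq_iff[OF a bR b(2)] by blast
 have "u \<otimes> (s \<otimes> b) \<in> P" using I_l_closed b(1) u(1) a(2) by auto
 then have "(u \<otimes> t) \<otimes> a \<in> P" using u a b(2) by (simp add: m_assoc)
 then show "a \<in> P" using I_prime[of "u \<otimes> t" a] S_mult[OF u(1) b(2)] a(1) by auto
qed (use a in \<open>auto simp: ext_ideal_def\<close>)

lemma one_notin_M: "\<one>\<^sub>L \<notin> M"
 unfolding L_one using fraction_in_M[of \<one> \<one>] S_one by auto

lemma unit_L:
 assumes "x \<in> carrier L" "x \<notin> M"
 shows "x \<in> Units L"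
proof -
 obtain a s where x: "a \<in> R" "s \<in> S" "x = F a s" by (rule L_cases[OF assms(1)])
 have aS: "a \<in> S" using x assms(2) fraction_in_M by auto
 have "F a s \<otimes>\<^sub>L F s a = \<one>\<^sub>L"
  unfolding L_mult[OF x(1,2) S_carrier[OF x(2)] aS] L_one
  by (rule fraction_eqI) (use x aS S_mult[OF x(2) aS] S_one m_comm[of a s] in auto)
 then show ?thesis
  unfolding Units_def using L.m_comm[OF assms(1), of "F s a"] L_closed[of s a] assms(1) x(2,3) aS
  by (auto intro!: bexI[of _ "F s a"] S_carrier)
qed

lemma proper_ideal_L:
 assumes J: "ideal J L" "J \<noteq> carrier L"
 shows "J \<subseteq> M"
proof
 fix x assume x: "x \<in> J"
 show "x \<in> M"
 proof (rule ccontr)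
  assume "x \<notin> M"
  then have u: "x \<in> Units L" using unit_L ideal.Icarr[OF J(1) x] by blast
  have "\<one>\<^sub>L \<in> J" using ideal.I_l_closed[OF J(1) x L.Units_inv_closed[OF u]] L.Units_l_inv[OF u] by simp
  then show False using ideal.one_imp_carrier[OF J(1)] J(2) by simp
 qed
qed

lemma maximal_M: "maximalideal M L"
proof (rule maximalidealI[OF ideal_M])
 show "carrier L \<noteq> M" using one_notin_M L.one_closed by auto
 show "J = M \<or> J = carrier L" if "ideal J L" "M \<subseteq> J" "J \<subseteq> L" for J
  using proper_ideal_L[OF that(1)] that(2) by blast
qed

lemma maximal_L_unique:
 assumes "maximalideal J L"
 shows "J = M"
proof -
 interpret J: maximalideal J L by fact
 have "J \<subseteq> M" by (rule proper_ideal_L[OF J.ideal_axioms]) (use J.I_notcarr in simp)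
 moreover have "M \<noteq> carrier L" using one_notin_M L.one_closed by auto
 moreover have "M \<subseteq> L" using ideal.Icarr[OF ideal_M] by blast
 ultimately show ?thesis using J.I_maximal[OF ideal_M] by blast
qed

abbreviation K where "K \<equiv> L Quot M"
abbreviation \<psi> where "\<psi> r \<equiv> M +>\<^sub>L \<phi> r"
abbreviation k where "k \<equiv> residue_field_module R P"
abbreviation Q where "Q \<equiv> quot_ring_module R P"
abbreviation q where "q r \<equiv> P +> r"

lemma k_def: "k = restrict_scalars K \<psi>"
 by (simp add: residue_field_module_def residue_field_def L_def M_def loc_map)

lemma K_field: "field K" by (rule maximalideal.quotient_is_field[OF maximal_M L_cring])

sublocale K: field K by (rule K_field)

lemma \<psi>_hom: "\<psi> \<in> ring_hom R K"
 using ring_hom_trans[OF \<phi>_hom ideal.rcos_ring_hom[OF ideal_M]] by (simp add: comp_def)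

lemma mk: "module R k" unfolding k_def by (rule restrict_scalars_module[OF is_cring K.is_cring \<psi>_hom])

lemma q_hom: "q \<in> ring_hom R (R Quot P)" by (rule rcos_ring_hom)

lemma mQ: "module R Q"
 unfolding quot_ring_module_def by (rule restrict_scalars_module[OF is_cring quotient_is_cring[OF is_cring] q_hom])

lemma \<psi>_zero: "r \<in> carrier R ==> \<psi> r = \<zero>\<^sub>K \<longleftrightarrow> r \<in> P"
proof -
 assume r: "r \<in> R"
 have "\<psi> r = M \<longleftrightarrow> \<phi> r \<in> M"
  using coset_zero_iff[OF reg_module[OF L_cring], of M "\<phi> r"] ideal_M \<phi>_closed[OF r]
  unfolding ideal_submodule[OF L_cring] by (simp add: a_r_coset_def r_coset_def)
 then show ?thesis using fraction_in_M[OF r S_one] by (simp add: FactRing_def)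
qed

lemma q_zero: "r \<in> carrier R ==> q r = \<zero>\<^sub>Q \<longleftrightarrow> r \<in> P"
 using coset_zero_iff[OF reg_module[OF is_cring], of P r] ideal_P
 unfolding ideal_submodule[OF is_cring] by (simp add: a_r_coset_def r_coset_def quot_ring_module_def FactRing_def)

lemma Q_carrier: "carrier Q = q ` carrier R"
 by (auto simp: quot_ring_module_def FactRing_def A_RCOSETS_def')

lemma q_mod_hom: "q \<in> mod_hom R (reg R) Q"
 unfolding quot_ring_module_def
 by (rule mod_homI) (use ring_hom_closed[OF q_hom] ring_hom_add[OF q_hom] ring_hom_mult[OF q_hom] in auto)

lemma Q_gen: "r \<in> carrier R ==> r \<odot>\<^sub>Q q \<one> = q r"
 using mod_hom_smult[OF q_mod_hom, of r \<one>] by simp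

lemma Q_resolution: "ideal_resolution R P B A ==> free_resolution R Q B A (\<lambda>_. q \<one>)"
 by (rule ideal_resolution_free_resolution[OF is_cring _ mQ])
  (auto simp: Q_carrier Q_gen q_zero)

lemma \<psi>_nonzero: "s \<in> S ==> \<psi> s \<in> carrier K - {\<zero>\<^sub>K}"
 using \<psi>_zero[of s] ring_hom_closed[OF \<psi>_hom] by auto

lemma k_inj: "s \<in> S ==> x \<in> carrier k ==> s \<odot>\<^sub>k x = \<zero>\<^sub>k ==> x = \<zero>\<^sub>k"
 unfolding k_def using K.integral[of "\<psi> s" x] \<psi>_nonzero by auto

lemma k_surj: "s \<in> S ==> x \<in> carrier k ==> \<exists>y\<in>carrier k. s \<odot>\<^sub>k y = x"
proof -
 assume s: "s \<in> S" and x: "x \<in> k"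
 have u: "\<psi> s \<in> Units K" using \<psi>_nonzero[OF s] K.field_Units by simp
 then have "\<psi> s \<otimes>\<^sub>K (inv\<^bsub>K\<^esub> \<psi> s \<otimes>\<^sub>K x) = x"
  using x K.m_assoc[of "\<psi> s" "inv\<^bsub>K\<^esub> \<psi> s" x] by (simp add: k_def K.Units_closed)
 then show ?thesis using u x by (intro bexI[of _ "inv\<^bsub>K\<^esub> \<psi> s \<otimes>\<^sub>K x"]) (auto simp: k_def)
qed

text \<open>The map R/P -> k(P) is injective, and its cokernel is S-torsion because s (a/s) comes
  from a.\<close>

lemma tor_exact_k_iff_Q:
 assumes A: "!!i. rmat R (B (Suc i)) (B i) (A i)"
 shows "tor_exact S k B A i \<longleftrightarrow> tor_exact S Q B A i"
proof -
 interpret Q: module R Q by (rule mQ)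
 \<comment> \<open>Defined on a coset through a chosen representative; the choice is immaterial
   because \<psi> vanishes on P.\<close>
 define h where "h X = \<psi> (SOME r. r \<in> R \<and> q r = X)" for X
 have h: "h (q r) = \<psi> r" if r: "r \<in> R" for r
 proof -
  obtain r' where r': "r' \<in> R" "q r' = q r" "h (q r) = \<psi> r'"
   using someI[of "\<lambda>r'. r' \<in> R \<and> q r' = q r" r] r unfolding h_def by blast
  have "q (r' \<ominus> r) = \<zero>\<^sub>Q"
   using mod_hom_minus[OF reg_module[OF is_cring] mQ q_mod_hom, of r' r] r r' mod_hom_closed[OF q_mod_hom] by simp
  then have "\<psi> (r' \<ominus> r) = \<zero>\<^sub>k" using q_zero[of "r' \<ominus> r"] \<psi>_zero[of "r' \<ominus> r"] r r' by (simp add: k_def)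
  interpret k: module R k by (rule mk)
  have "\<psi> \<in> mod_hom R (reg R) k" unfolding k_def
   by (rule mod_homI) (use ring_hom_closed[OF \<psi>_hom] ring_hom_add[OF \<psi>_hom] ring_hom_mult[OF \<psi>_hom] in auto)
  note m = mod_hom_minus[OF reg_module[OF is_cring] mk this, of r' r] mod_hom_closed[OF this]
  show ?thesis using m(1) \<open>\<psi> (r' \<ominus> r) = \<zero>\<^sub>k\<close> m(2)[of r] m(2)[of r'] r r' k.a_minus_eq_zero_iff[of "\<psi> r'" "\<psi> r"] by simp
 qed
 have hom: "h \<in> mod_hom R Q k"
 proof (rule mod_homI)
  show "h X \<in> k" if "X \<in> Q" for X
   using that h ring_hom_closed[OF \<psi>_hom] unfolding Q_carrier by (auto simp: k_def)
  show "h (X \<oplus>\<^sub>Q Y) = h X \<oplus>\<^sub>k h Y" if XY: "X \<in> Q" "Y \<in> Q" for X Y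
  proof -
   obtain r s where r: "r \<in> R" "X = q r" "s \<in> R" "Y = q s" using XY unfolding Q_carrier by blast
   have "X \<oplus>\<^sub>Q Y = q (r \<oplus> s)" using mod_hom_add[OF q_mod_hom, of r s] r by simp
   then show ?thesis using r h ring_hom_add[OF \<psi>_hom, of r s] by (simp add: k_def)
  qed
  show "h (r \<odot>\<^sub>Q X) = r \<odot>\<^sub>k h X" if r: "r \<in> R" and X: "X \<in> Q" for r X
  proof -
   obtain s where s: "s \<in> R" "X = q s" using X unfolding Q_carrier by blast
   have "r \<odot>\<^sub>Q X = q (r \<otimes> s)" using mod_hom_smult[OF q_mod_hom, of r s] r s by simp
   then show ?thesis using r s h ring_hom_mult[OF \<psi>_hom, of r s] by (simp add: k_def)
  qed
 qed
 have hs: "\<exists>s\<in>S. \<exists>x\<in>Q. s \<odot>\<^sub>k y = h x" if y: "y \<in> k" for y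
 proof -
  obtain v where v: "v \<in> L" "y = M +>\<^sub>L v" using y by (auto simp: k_def FactRing_def A_RCOSETS_def')
  obtain a s where a: "a \<in> R" "s \<in> S" "v = F a s" by (rule L_cases[OF v(1)])
  have "s \<odot>\<^sub>k y = M +>\<^sub>L (\<phi> s \<otimes>\<^sub>L v)"
   using ring_hom_mult[OF ideal.rcos_ring_hom[OF ideal_M], of "\<phi> s" v] v a \<phi>_closed[of s] by (simp add: k_def)
  also have "\<dots> = h (q a)" using \<phi>_cancel[OF a(1,2)] a(3) h[OF a(1)] by simp
  finally show ?thesis using a unfolding Q_carrier by blast
 qed
 have hi: "\<exists>s\<in>S. s \<odot>\<^sub>Q x = \<zero>\<^sub>Q" if x: "x \<in> Q" "h x = \<zero>\<^sub>k" for x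
 proof -
  obtain r where r: "r \<in> R" "x = q r" using x unfolding Q_carrier by blast
  then have "x = \<zero>\<^sub>Q" using x(2) h \<psi>_zero q_zero by (simp add: k_def)
  then show ?thesis using S_one by (intro bexI[of _ \<one>]) auto
 qed
 show ?thesis
  by (rule tor_exact_S_iso[where A = A and B = B, symmetric, OF mQ mk hom S S_one S_mult hs hi A])
qed

end

section \<open>The hull E(R/P) and its Tor and Ext with k(P)\<close>

locale noetherian_prime = prime_localization + assumes noeth: "noetherian_ring R"
begin

abbreviation E where "E \<equiv> injective_hull R Q"

text \<open>The kernel of s on E meets R/P trivially because P is prime, so it is zero by
  essentiality. Then s is also onto: the assignment r s -> r x is well defined, and injectivity of E
  provides an element y with s y = x. The element e0 is the image of 1, with annihilator P.\<close>

lemma E_facts: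
 obtains e0 where "module R E" "baer R E" "e0 \<in> E" "!!r. r \<in> carrier R ==> r \<odot>\<^sub>E e0 = \<zero>\<^sub>E \<longleftrightarrow> r \<notin> S"
  "!!s x. s \<in> S ==> x \<in> E ==> s \<odot>\<^sub>E x = \<zero>\<^sub>E ==> x = \<zero>\<^sub>E"
  "!!s x. s \<in> S ==> x \<in> E ==> \<exists>y\<in>E. s \<odot>\<^sub>E y = x"
proof -
 obtain \<iota> where hull: "is_injective_hull R Q E \<iota>" by (rule injective_hull_is_injective_hull[OF is_cring noeth mQ])
 have \<iota>: "\<iota> \<in> mod_hom R Q E" "inj_on \<iota> (carrier Q)"
  and ess: "!!H. submodule H R E ==> H \<inter> \<iota> ` Q = {\<zero>\<^sub>E} ==> H = {\<zero>\<^sub>E}"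
  and iE: "injective_module R E" using hull unfolding is_injective_hull_def by blast+
 have mE: "module R E" using iE unfolding injective_module_def by blast
 have bE: "baer R E" using injective_module_iff_baer[OF mE] iE by blast
 interpret E: module R E by (rule mE)
 interpret Q: module R Q by (rule mQ)
 have q1: "q r \<in> Q" if "r \<in> R" for r using that unfolding Q_carrier by blast
 have z: "\<iota> x = \<zero>\<^sub>E \<longleftrightarrow> x = \<zero>\<^sub>Q" if "x \<in> Q" for x
  using mod_hom_zero[OF mQ mE \<iota>(1)] inj_onD[OF \<iota>(2) _ that Q.zero_closed] by auto
 have ann: "r \<odot>\<^sub>E \<iota> (q \<one>) = \<zero>\<^sub>E \<longleftrightarrow> r \<notin> S" if "r \<in> R" for r
  using mod_hom_smult[OF \<iota>(1) that q1[OF one_closed]] z[OF q1[OF that]] q_zero[OF that] that by (simp add: Q_gen)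
 have inj: "x = \<zero>\<^sub>E" if s: "s \<in> S" and x: "x \<in> E" "s \<odot>\<^sub>E x = \<zero>\<^sub>E" for s x
 proof -
  let ?H = "a_kernel E E (\<lambda>y. s \<odot>\<^sub>E y)"
  have sR: "s \<in> R" using s by simp
  have H: "submodule ?H R E" by (rule submodule_kernel[OF mE mE scale_hom[OF mE sR]])
  have "?H \<inter> \<iota> ` Q \<subseteq> {\<zero>\<^sub>E}"
  proof
   fix y assume y: "y \<in> ?H \<inter> \<iota> ` Q"
   then obtain r where r: "r \<in> R" "y = \<iota> (q r)" "s \<odot>\<^sub>E y = \<zero>\<^sub>E" unfolding Q_carrier a_kernel_def'' by blast
   have "s \<odot>\<^sub>Q q r = q (s \<otimes> r)" using mod_hom_smult[OF q_mod_hom sR, of r] r by simp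
   then have "\<iota> (q (s \<otimes> r)) = \<zero>\<^sub>E" using mod_hom_smult[OF \<iota>(1) sR q1[OF r(1)]] r by simp
   then have "s \<otimes> r \<in> P" using z[OF q1, of "s \<otimes> r"] q_zero[of "s \<otimes> r"] r(1) sR by simp
   then have "r \<in> P" using I_prime[OF sR r(1)] s by simp
   then show "y \<in> {\<zero>\<^sub>E}" using r q_zero[OF r(1)] z[OF q1[OF r(1)]] by simp
  qed
  moreover have "\<zero>\<^sub>E \<in> ?H \<inter> \<iota> ` Q"
   using submodule_zero[OF H] submodule_zero[OF submodule_range[OF mQ mE \<iota>(1)]] by blast
  ultimately have "?H = {\<zero>\<^sub>E}" by (intro ess[OF H]) blast
  then show ?thesis using x unfolding a_kernel_def'' by blast
 qed
 have surj: "\<exists>y\<in>E. s \<odot>\<^sub>E y = x" if s: "s \<in> S" and x: "x \<in> E" for s x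
 proof -
  note Rg = reg_module[OF is_cring]
  interpret Rg: module R "reg R" by (rule Rg)
  have sR: "s \<in> reg R" using s by simp
  have Z: "submodule {\<zero>\<^bsub>reg R\<^esub>} R (reg R)" by (rule Rg.submoduleI) auto
  have f: "(zf E) \<in> mod_hom R ((reg R)\<lparr>carrier := {\<zero>\<^bsub>reg R\<^esub>}\<rparr>) E" by (rule mod_homI) auto
  have ok: "\<zero>\<^sub>E = r \<odot>\<^sub>E x" if r: "r \<in> R" "r \<odot>\<^bsub>reg R\<^esub> s \<in> {\<zero>\<^bsub>reg R\<^esub>}" for r
  proof -
   have "s \<odot>\<^sub>E (r \<odot>\<^sub>E x) = (r \<otimes> s) \<odot>\<^sub>E x" using sR r(1) x m_comm[of r s] by (simp add: E.smult_assoc1)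
   then have "s \<odot>\<^sub>E (r \<odot>\<^sub>E x) = \<zero>\<^sub>E" using r x by simp
   then show ?thesis using inj[OF s, of "r \<odot>\<^sub>E x"] r(1) x by simp
  qed
  show ?thesis
  proof (rule mod_hom_extend_one[OF Rg mE Z f sR x ok])
   fix J g assume J: "submodule J R (reg R)" "s \<in> J" and g: "g \<in> mod_hom R ((reg R)\<lparr>carrier := J\<rparr>) E" "g s = x"
   have "ideal J R" using J(1) ideal_submodule[OF is_cring] by blast
   from bE[unfolded baer_def, rule_format, OF conjI[OF this g(1)]]
   obtain y where "y \<in> E" "\<forall>r\<in>J. g r = r \<odot>\<^sub>E y" by (elim bexE)
   then show ?thesis using J(2) g(2) by (intro bexI[of _ y]) auto
  qed
 qed
 show ?thesis
  by (rule that[OF mE bE mod_hom_closed[OF \<iota>(1) q1[OF one_closed]] ann inj surj])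
qed

context
 fixes B :: "nat => nat set" and A
 assumes res: "ideal_resolution R P B A"
begin

text \<open>The infinite bases disappear here: after the change of coefficients, balancing is
  applied to R/P, which has a resolution by finite free modules, whereas k(P) in general has none
  over R.\<close>

lemma tor_res_E_iff: "tor_exact S k (res_basis R E) (\<lambda>_. of_cell R) i \<longleftrightarrow> coh_exact R S (reg R) B A i"
proof -
 obtain e0 where mE: "module R E" and bE: "baer R E" and e0: "e0 \<in> E"
  and ann: "!!r. r \<in> R ==> r \<odot>\<^sub>E e0 = \<zero>\<^sub>E \<longleftrightarrow> r \<notin> S"
  and E_inj: "!!s x. s \<in> S ==> x \<in> E ==> s \<odot>\<^sub>E x = \<zero>\<^sub>E ==> x = \<zero>\<^sub>E"
  and E_surj: "!!s x. s \<in> S ==> x \<in> E ==> \<exists>y\<in>E. s \<odot>\<^sub>E y = x"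
  by (rule E_facts) blast
 note A = ideal_res_rmat[OF res] and fin = ideal_res_finite[OF res]
 note std = standard_resolution[OF mE]
 have "tor_exact S k (res_basis R E) (\<lambda>_. of_cell R) i \<longleftrightarrow> tor_exact S Q (res_basis R E) (\<lambda>_. of_cell R) i"
  by (rule tor_exact_k_iff_Q[where A = "\<lambda>_. of_cell R" and B = "res_basis R E", OF res_rmat[OF is_cring std]])
 also have "\<dots> \<longleftrightarrow> tor_exact S E B A i" by (rule tor_balanced[OF mE mQ std Q_resolution[OF res] S])
 also have "\<dots> \<longleftrightarrow> tor_exact {\<one>} E B A i" by (rule tor_exact_S_local[where A = A and B = B, OF mE A S S_one E_inj E_surj])
 also have "\<dots> \<longleftrightarrow> coh_exact R S (reg R) B A i"
  by (rule tor_exact_dual[where A = A and B = B, OF mE bE A fin S S_one E_inj e0 ann])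
 finally show ?thesis .
qed

text \<open>S is brought in through E, on which it acts bijectively; then Tor can be balanced into
  the form with coefficients k(P).\<close>

lemma Tor_zero_iff: "is_zero_module (Tor R (Suc i) k E) \<longleftrightarrow> coh_exact R S (reg R) B A i"
proof -
 obtain e0 where mE: "module R E" 
  and E_inj: "!!s x. s \<in> S ==> x \<in> E ==> s \<odot>\<^sub>E x = \<zero>\<^sub>E ==> x = \<zero>\<^sub>E"
  and E_surj: "!!s x. s \<in> S ==> x \<in> E ==> \<exists>y\<in>E. s \<odot>\<^sub>E y = x"
  by (rule E_facts) blast
 note std = standard_resolution[OF mk]
 have "is_zero_module (Tor R (Suc i) k E) \<longleftrightarrow> tor_exact {\<one>} E (res_basis R k) (\<lambda>_. of_cell R) i"
  by (rule is_zero_Tor[OF mk mE])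
 also have "\<dots> \<longleftrightarrow> tor_exact S E (res_basis R k) (\<lambda>_. of_cell R) i"
  by (rule tor_exact_S_local[where A = "\<lambda>_. of_cell R" and B = "res_basis R k", symmetric, OF mE res_rmat[OF is_cring std] S S_one E_inj E_surj])
 also have "\<dots> \<longleftrightarrow> tor_exact S k (res_basis R E) (\<lambda>_. of_cell R) i"
  by (rule tor_balanced[OF mk mE std standard_resolution[OF mE] S])
 finally show ?thesis unfolding tor_res_E_iff .
qed

text \<open>Coefficients in k(P) turn the complex into one of vector spaces, where cohomology of the
  dual vanishes exactly when homology does. S can be inserted afterwards because its elements act
  invertibly on k(P).\<close>

lemma Ext_zero_iff: "is_zero_module (Ext R (Suc i) E k) \<longleftrightarrow> coh_exact R S (reg R) B A i"
proof -
 obtain e0 where mE: "module R E" by (rule E_facts) blast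
 let ?C = "res_basis R E" and ?T = "\<lambda>_ :: nat. of_cell R"
 have T: "!!i. rmat R (?C (Suc i)) (?C i) (?T i)" by (rule res_rmat[OF is_cring standard_resolution[OF mE]])
 have one: "\<psi> ` {\<one>} = {\<one>\<^sub>K}" using ring_hom_one[OF \<psi>_hom] by simp
 have "is_zero_module (Ext R (Suc i) E k) \<longleftrightarrow> ext_exact R k ?C ?T i" by (rule is_zero_Ext[OF mE mk])
 also have "\<dots> \<longleftrightarrow> coh_exact R {\<one>} k ?C ?T i" by (rule ext_exact_iff_coh_exact[OF mk])
 also have "\<dots> \<longleftrightarrow> ext_exact K (reg K) ?C (\<lambda>i b c. \<psi> (?T i b c)) i"
  unfolding k_def coh_exact_restrict[where A = ?T and B = ?C, OF is_cring K.is_cring \<psi>_hom T] one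
  by (rule ext_exact_iff_coh_exact[symmetric, OF reg_module[OF K.is_cring]])
 also have "\<dots> \<longleftrightarrow> tor_exact {\<one>\<^sub>K} (reg K) ?C (\<lambda>i b c. \<psi> (?T i b c)) i"
  by (rule exact_field_dual[where B = ?C and A = "\<lambda>i b c. \<psi> (?T i b c)", symmetric, OF K_field rmat_map[OF is_cring K.is_cring \<psi>_hom T]])
 also have "\<dots> \<longleftrightarrow> tor_exact {\<one>} k ?C ?T i" unfolding k_def tor_exact_restrict one ..
 also have "\<dots> \<longleftrightarrow> tor_exact S k ?C ?T i"
  by (rule tor_exact_S_local[where A = ?T and B = ?C, symmetric, OF mk T S S_one k_inj k_surj])
 finally show ?thesis unfolding tor_res_E_iff .
qed

end

end

section \<open>From one prime to all ideals and to smaller primes\<close>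

lemma coh_exact_mono: "coh_exact R S N B A i ==> S \<subseteq> S' ==> coh_exact R S' N B A i"
 unfolding coh_exact_def by blast

lemma noetherian_primeI: "primeideal P R ==> noetherian_ring R ==> noetherian_prime P R"
 by (simp add: noetherian_prime_def prime_localization_def noetherian_prime_axioms_def)

lemma maximal_ideal_above:
 assumes R: "cring R" "noetherian_ring R" and P: "primeideal P R"
 obtains m where "maximalideal m R" "P \<subseteq> m"
proof -
 interpret primeideal P R by fact
 let ?\<F> = "{I. ideal I R \<and> \<one>\<^sub>R \<notin> I \<and> P \<subseteq> I}"
 have "P \<in> ?\<F>" using is_ideal I_notcarr one_imp_carrier by auto
 then obtain m where m: "m \<in> ?\<F>" and max: "!!J. J \<in> ?\<F> ==> m \<subseteq> J ==> J = m"
  using noetherian_maximal_ideal[OF R(2), of ?\<F>] by blast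
 have "maximalideal m R"
 proof (rule maximalidealI)
  show "ideal m R" using m by simp
  show "carrier R \<noteq> m" using m one_closed by auto
  show "J = m \<or> J = carrier R" if "ideal J R" "m \<subseteq> J" "J \<subseteq> R" for J
   using max[of J] m that ideal.one_imp_carrier[OF that(1)] by blast
 qed
 then show ?thesis using m that by blast
qed

text \<open>Finite injective dimension bounds Ext against every ideal of the local ring; it is
  applied to the maximal ideal, with the resolution of P localized from R.\<close>

lemma gorenstein_imp_coh_exact:
 assumes "noetherian_ring R" and P: "primeideal P R" and g: "gorenstein_local_ring (localization_at R P)"
  and res: "ideal_resolution R P B A"
 obtains n where "!!i. n \<le> i ==> coh_exact R (carrier R - P) (reg R) B A i"
proof -
 interpret noetherian_prime P R using P assms(1) by (rule noetherian_primeI)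
 note A = ideal_res_rmat[OF res] and fin = ideal_res_finite[OF res]
 have "finite_injective_dimension L (reg L)" using g unfolding gorenstein_local_ring_def L_def by blast
 from ext_vanish_if_finite_injective_dimension[OF L_cring L_noetherian[OF noeth] this]
 obtain n where n: "!!a B A i. ideal a L ==> ideal_resolution L a B A ==> n \<le> i ==> ext_exact L (reg L) B A i" by metis
 have "coh_exact R S (reg R) B A i" if "n \<le> i" for i
  using n[OF ideal_M ideal_resolution_localize[OF ideal_P res] that] unfolding ext_exact_localize[where A = A and B = B, OF A fin] .
 then show ?thesis by (rule that)
qed

text \<open>Hypothesis and conclusion are moved to the local ring, where the elements outside the
  maximal ideal are units; the bound n is unchanged.\<close>

lemma coh_exact_all_ideals:
 assumes R: "noetherian_ring R" and P: "primeideal P R" and res: "ideal_resolution R P B A"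
  and base: "!!i. n \<le> i ==> coh_exact R (carrier R - P) (reg R) B A i"
  and a: "ideal a R" and res': "ideal_resolution R a B' A'" and i: "n \<le> i"
 shows "coh_exact R (carrier R - P) (reg R) B' A' i"
proof -
 interpret noetherian_prime P R using P R by (rule noetherian_primeI)
 note A = ideal_res_rmat[OF res] and fin = ideal_res_finite[OF res]
 note A' = ideal_res_rmat[OF res'] and fin' = ideal_res_finite[OF res']
 have "ext_exact L (reg L) B' (\<lambda>i b c. \<phi> (A' i b c)) i"
  by (rule local_ext_vanish[OF L_cring L_noetherian[OF noeth] ideal_M one_notin_M unit_L
     ideal_resolution_localize[OF ideal_P res] _ ext_ideal[OF a] ideal_resolution_localize[OF a res'] i])
   (use base ext_exact_localize[where A = A and B = B, OF A fin] in auto)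
 then show ?thesis using ext_exact_localize[where A = A' and B = B', OF A' fin'] by blast
qed

text \<open>Every ideal of the local ring is extended from R, so the bound n for ideals of R is a
  bound for those of the local ring.\<close>

lemma gorenstein_if_coh_exact:
 assumes R: "noetherian_ring R" and P: "primeideal P R"
  and c: "!!a B A i. ideal a R ==> ideal_resolution R a B A ==> n \<le> i ==> coh_exact R (carrier R - P) (reg R) B A i"
 shows "gorenstein_local_ring (localization_at R P)"
proof -
 interpret noetherian_prime P R using P R by (rule noetherian_primeI)
 have "finite_injective_dimension L (reg L)"
 proof (rule finite_injective_dimension_if_ext_vanish[OF L_cring L_noetherian[OF noeth]])
  fix J assume J: "ideal J L"
  let ?a = "{r \<in> R. \<phi> r \<in> J}"
  note a = ideal_extended[OF J]
  obtain B A where res: "ideal_resolution R ?a B A" by (rule ideal_resolution_exists[OF is_cring noeth a(1)])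
  note A = ideal_res_rmat[OF res] and fin = ideal_res_finite[OF res]
  have "ideal_resolution L J B (\<lambda>i b c. \<phi> (A i b c))"
   using ideal_resolution_localize[OF a(1) res] a(2)[symmetric] by simp
  moreover have "ext_exact L (reg L) B (\<lambda>i b c. \<phi> (A i b c)) i" if "n \<le> i" for i
   unfolding ext_exact_localize[where A = A and B = B, OF A fin] by (rule c[OF a(1) res that])
  ultimately show "\<exists>B A. ideal_resolution L J B A \<and> (\<forall>i\<ge>n. ext_exact L (reg L) B A i)" by blast
 qed
 moreover have "\<exists>!\<mm>. maximalideal \<mm> L" using maximal_M maximal_L_unique by blast
 ultimately show ?thesis
  unfolding gorenstein_local_ring_def L_def using L_cring L_noetherian[OF noeth] by blast
qed

text \<open>Degrees > n correspond to indices i \<ge> n, since the index i stands for degree i +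
  1.\<close>

lemma Tor_eventually_zero_iff:
 assumes R: "noetherian_ring R" and P: "primeideal P R" and res: "ideal_resolution R P B A"
 shows "(\<exists>n. \<forall>i>n. is_zero_module (Tor R i (residue_field_module R P) (injective_hull R (quot_ring_module R P)))) \<longleftrightarrow>
   (\<exists>n. \<forall>i\<ge>n. coh_exact R (carrier R - P) (reg R) B A i)"
  and "(\<exists>n. \<forall>i>n. is_zero_module (Ext R i (injective_hull R (quot_ring_module R P)) (residue_field_module R P))) \<longleftrightarrow>
   (\<exists>n. \<forall>i\<ge>n. coh_exact R (carrier R - P) (reg R) B A i)"
proof -
 interpret noetherian_prime P R using P R by (rule noetherian_primeI)
 have *: "(\<exists>n::nat. \<forall>i>n. T i) \<longleftrightarrow> (\<exists>n. \<forall>i\<ge>n. T (Suc i))" for T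
 proof -
  have "(\<forall>i>n. T i) \<longleftrightarrow> (\<forall>i\<ge>n. T (Suc i))" for n by (metis Suc_le_D Suc_le_eq Suc_le_mono)
  then show ?thesis by simp
 qed
 show "(\<exists>n. \<forall>i>n. is_zero_module (Tor R i k E)) \<longleftrightarrow> (\<exists>n. \<forall>i\<ge>n. coh_exact R S (reg R) B A i)"
  unfolding *[of "\<lambda>i. is_zero_module (Tor R i k E)"] Tor_zero_iff[OF res] ..
 show "(\<exists>n. \<forall>i>n. is_zero_module (Ext R i E k)) \<longleftrightarrow> (\<exists>n. \<forall>i\<ge>n. coh_exact R S (reg R) B A i)"
  unfolding *[of "\<lambda>i. is_zero_module (Ext R i E k)"] Ext_zero_iff[OF res] ..
qed

theorem theorem4p16:
  fixes R :: "('a, 'b) ring_scheme"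
  assumes "cring R" and "noetherian_ring R"
  shows "let
      G1 = (\<forall>P. primeideal P R \<longrightarrow> gorenstein_local_ring (localization_at R P));
      G2 = (\<forall>P. primeideal P R \<longrightarrow> (\<exists>n. \<forall>i>n. is_zero_module
             (Tor R i (residue_field_module R P) (injective_hull R (quot_ring_module R P)))));
      G3 = (\<forall>P. maximalideal P R \<longrightarrow> (\<exists>n. \<forall>i>n. is_zero_module
             (Tor R i (residue_field_module R P) (injective_hull R (quot_ring_module R P)))));
      G4 = (\<forall>P. primeideal P R \<longrightarrow> (\<exists>n. \<forall>i>n. is_zero_module
             (Ext R i (injective_hull R (quot_ring_module R P)) (residue_field_module R P))));
      G5 = (\<forall>P. maximalideal P R \<longrightarrow> (\<exists>n. \<forall>i>n. is_zero_module
             (Ext R i (injective_hull R (quot_ring_module R P)) (residue_field_module R P))))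
    in (G1 \<longleftrightarrow> G2) \<and> (G2 \<longleftrightarrow> G3) \<and> (G3 \<longleftrightarrow> G4) \<and> (G4 \<longleftrightarrow> G5)"
proof -
  interpret R: cring R by fact
  note noeth = assms(2)
  define T where "T P \<longleftrightarrow> (\<exists>n. \<forall>i>n. is_zero_module
      (Tor R i (residue_field_module R P) (injective_hull R (quot_ring_module R P))))" for P
  define X where "X P \<longleftrightarrow> (\<exists>n. \<forall>i>n. is_zero_module
      (Ext R i (injective_hull R (quot_ring_module R P)) (residue_field_module R P)))" for P
  define G where "G P \<longleftrightarrow> gorenstein_local_ring (localization_at R P)" for P
  have prime: "primeideal P R" if "maximalideal P R" for P using that R.maximalideal_prime by blast
  have TX: "T P \<longleftrightarrow> X P" if P: "primeideal P R" for P
  proof -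
    obtain B A where "ideal_resolution R P B A"
      by (rule ideal_resolution_exists[OF assms primeideal.axioms(1)[OF P]])
    then show ?thesis unfolding T_def X_def using Tor_eventually_zero_iff[OF noeth P] by blast
  qed
  have GT: "T P" if P: "primeideal P R" "G P" for P
  proof -
    obtain B A where res: "ideal_resolution R P B A"
      by (rule ideal_resolution_exists[OF assms primeideal.axioms(1)[OF P(1)]])
    obtain n where "\<And>i. n \<le> i \<Longrightarrow> coh_exact R (carrier R - P) (reg R) B A i"
      by (rule gorenstein_imp_coh_exact[OF noeth P(1) P(2)[unfolded G_def] res]) blast
    then show ?thesis unfolding T_def Tor_eventually_zero_iff[OF noeth P(1) res] by blast
  qed
  have TG: "G P" if P: "primeideal P R" and T: "\<And>m. maximalideal m R \<Longrightarrow> T m" for P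
  proof -
    obtain m where m: "maximalideal m R" "P \<subseteq> m" by (rule maximal_ideal_above[OF assms P])
    note pm = prime[OF m(1)]
    obtain B A where res: "ideal_resolution R m B A"
      by (rule ideal_resolution_exists[OF assms primeideal.axioms(1)[OF pm]])
    obtain n where n: "\<And>i. n \<le> i \<Longrightarrow> coh_exact R (carrier R - m) (reg R) B A i"
      using T[OF m(1)] unfolding T_def Tor_eventually_zero_iff[OF noeth pm res] by blast
    show ?thesis
      unfolding G_def
      \<comment> \<open>As P lies in m, the complement of m lies in that of P, and exactness up to
        the smaller set is the stronger condition. It is available for all ideals of R with the
        bound n found at m.\<close>
      by (rule gorenstein_if_coh_exact[OF noeth P coh_exact_mono[OF coh_exact_all_ideals[OF noeth pm res n]]])
        (use m(2) in auto)
  qed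
  have "(\<forall>P. primeideal P R \<longrightarrow> G P) \<longleftrightarrow> (\<forall>P. primeideal P R \<longrightarrow> T P)"
    "(\<forall>P. primeideal P R \<longrightarrow> T P) \<longleftrightarrow> (\<forall>P. maximalideal P R \<longrightarrow> T P)"
    "(\<forall>P. maximalideal P R \<longrightarrow> T P) \<longleftrightarrow> (\<forall>P. primeideal P R \<longrightarrow> X P)"
    "(\<forall>P. primeideal P R \<longrightarrow> X P) \<longleftrightarrow> (\<forall>P. maximalideal P R \<longrightarrow> X P)"
    using prime TX GT TG by blast+
  then show ?thesis unfolding Let_def T_def X_def G_def by blast
qed

end
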